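(* Let $n\ge3$ and define $p_n^+:=2+\frac{8}{3n-2}$. Then for all sufficiently large $R$ there exist nonzero functions $f_R\in\mathcal S(\mathbb R^n)$ with $\operatorname{supp}\widehat{f_R}\subset B_1^n\setminus B_{1/2}^n$ such that for every $2<p<p_n^+$ there is a constant $c_{n,p}>0$ with $$\left\|e^{it\sqrt{-\Delta}}f_R\right\|_{L^p(B_R^{n+1})}\gtrsim R^{(n-1)\left(\frac12-\frac1p\right)+c_{n,p}}\,\|f_R\|_{L^2(\mathbb R^n)}^{\frac2p}\,\mathcal W(f_R,B_R^{n+1})^{1-\frac2p},$$ where $\mathcal W$ is the (Euclidean) wave packet density, and $c_{n,p}$ and the implicit constant do not depend on $R$.
   Context: Notation. $B_r^m$ is the ball of radius $r$ centered at the origin in $\mathbb R^m$; points of $\mathbb R^{n+1}$ are $(x,t)\in\mathbb R^n\times\mathbb R$. The half-wave propagator is $e^{it\sqrt{-\Delta}}f(x)=(2\pi)^{-n}\int_{\mathbb R^n} e^{i(x\cdot\xi+t|\xi|)}\hat f(\xi)\,d\xi$. Caps. For $R^{-1/2}\le s\le1$, $\Theta_s$ is a finitely overlapping cover of the annulus $B_1^n\setminus B_{1/2}^n$ by $s$-caps $\tau$: the intersections of the annulus with sectors $\{\xi:|\xi/|\xi|-\omega|\lesssim s\}$, with $\omega$ in an $s$-net of $S^{n-1}$. Such a $\tau$ is essentially a box of dimensions $1\times s\times\cdots\times s$ with long side in the direction $\omega$. Its dual box $\tau^*$ is centered at the origin, with side $1$ in the direction $\omega$ and sides $s^{-1}$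 in the orthogonal directions. Set $V_{\tau,R}:=(Rs^2)\tau^*$, a box of dimensions $Rs^2\times Rs\times\cdots\times Rs$; $V\parallel V_{\tau,R}$ means that $V$ is a translate of $V_{\tau,R}$. Wave packets. For each $\theta\in\Theta_{R^{-1/2}}$ tile $\mathbb R^n$ by translates $T^\flat$ of $\theta^*$ (dimensions $1\times R^{1/2}\times\cdots\times R^{1/2}$). Let $\{\psi_\theta\}$ be a smooth partition of unity adapted to $\Theta_{R^{-1/2}}$, and for each $\theta$ let $\{\chi_{T^\flat}\}$ be a smooth partition of unity on $\mathbb R^n$ adapted to the tiles, rapidly decaying off $T^\flat$, with $\hat\chi_{T^\flat}$ supported in a fixed dilate of the box dual to $\theta^*-\theta^*$. Put $g_T:=\chi_{T^\flat}\cdot(\psi_\theta\hat g)^\vee$, so $g=\sum_\theta\sum_T g_T$. With $\omega_\theta$ the central direction of $\theta$ and $\delta>0$ a fixed small parameter, the spacetime plank associated with $T^\flat$ is $T=\{(x,t):x+t\omega_\theta\in R^\delta T^\flat,\ |t|\le R\}$, where $R^\delta T^\flat$ is the concentric dilate; $T^\flat$ is the base box of $T$. Let $\mathbb T_\theta$ be the set of such planks meeting $B_R^{n+1}$. Wave packet density: for $g\in\mathcal S(\mathbb R^n)$ with $\operatorname{supp}\hat g\subset B_1^n\setminus B_{1/2}^n$, $$\mathcal W(g,B_R^{n+1}):=\sup_{R^{-1/2}\le s\le1}\ \sup_{\tau\in\Theta_s}\ \sup_{V\parallel V_{\tau,R}}\left(\frac1{|V|}\sum_{\substack{\theta\in\Theta_{R^{-1/2}}\\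 \theta\subset\tau}}\ \sum_{\substack{T\in\mathbb T_\theta\\ T^\flat\subset V}}\|g_T\|_{L^2(\mathbb R^n)}^2\right)^{1/2}.$$ *)

theory Defs
  imports "HOL-Analysis.Analysis"
begin

section \<open>Schwartz functions and the Fourier transform\<close>

fun iter_deriv :: "'a::euclidean_space list \<Rightarrow> ('a \<Rightarrow> 'b::real_normed_vector) \<Rightarrow> 'a \<Rightarrow> 'b" where
  "iter_deriv [] f = f"
| "iter_deriv (v # vs) f = (\<lambda>x. frechet_derivative (iter_deriv vs f) (at x) v)"

text \<open>Differentiability of every iterated directional derivative makes all of them
  continuous, so this is the class of infinitely differentiable functions.\<close>

definition smooth :: "('a::euclidean_space \<Rightarrow> 'b::real_normed_vector) \<Rightarrow> bool" where
  "smooth f \<longleftrightarrow> (\<forall>vs x. iter_deriv vs f differentiable (at x))"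

definition schwartz :: "('a::euclidean_space \<Rightarrow> complex) \<Rightarrow> bool" where
  "schwartz f \<longleftrightarrow>
     smooth f \<and> (\<forall>vs k. \<exists>C. \<forall>x. norm x ^ k * norm (iter_deriv vs f x) \<le> C)"

definition fourier :: "('a::euclidean_space \<Rightarrow> complex) \<Rightarrow> 'a \<Rightarrow> complex" where
  "fourier f \<xi> = (LINT x|lborel. cis (- (x \<bullet> \<xi>)) * f x)"

definition inv_fourier :: "('a::euclidean_space \<Rightarrow> complex) \<Rightarrow> 'a \<Rightarrow> complex" where
  "inv_fourier h x =
     complex_of_real (1 / (2 * pi) ^ DIM('a)) * (LINT \<xi>|lborel. cis (x \<bullet> \<xi>) * h \<xi>)"

definition half_wave :: "('a::euclidean_space \<Rightarrow> complex) \<Rightarrow> 'a \<times> real \<Rightarrow> complex" where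
  "half_wave f = (\<lambda>(x, t). complex_of_real (1 / (2 * pi) ^ DIM('a)) *
     (LINT \<xi>|lborel. cis (x \<bullet> \<xi> + t * norm \<xi>) * fourier f \<xi>))"

definition Lp_norm :: "real \<Rightarrow> 'a::euclidean_space set \<Rightarrow> ('a \<Rightarrow> complex) \<Rightarrow> real" where
  "Lp_norm p S u = (LINT x:S|lborel. norm (u x) powr p) powr (1 / p)"

definition annulus :: "'a::euclidean_space set" where
  "annulus = ball 0 1 - ball 0 (1 / 2)"

section \<open>Caps and dual boxes\<close>

text \<open>A cap of \<open>\<Theta>\<^sub>s\<close> is represented by its direction \<open>\<omega>\<close>; the number \<open>A\<close> is the constant
  implicit in the angular condition \<open>|\<xi>/|\<xi>| - \<omega>| \<lesssim> s\<close>.\<close>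

definition cap :: "real \<Rightarrow> real \<Rightarrow> 'a::euclidean_space \<Rightarrow> 'a set" where
  "cap A s \<omega> = {\<xi> \<in> annulus. norm (\<xi> /\<^sub>R norm \<xi> - \<omega>) \<le> A * s}"

text \<open>The annulus is relaxed to a comparable one here, because no smooth function on the whole
  space is equal to 1 on the annulus and vanishes off it.\<close>

definition fat_cap :: "real \<Rightarrow> real \<Rightarrow> 'a::euclidean_space \<Rightarrow> 'a set" where
  "fat_cap K s \<omega> =
     {\<xi>. 1 / K \<le> norm \<xi> \<and> norm \<xi> \<le> K \<and> norm (\<xi> /\<^sub>R norm \<xi> - \<omega>) \<le> K * s}"

text \<open>The orthogonal sides of a box are only determined by an orthonormal frame containing its
  direction.\<close>

definition is_frame :: "'a::euclidean_space set \<Rightarrow> 'a \<Rightarrow> bool" where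
  "is_frame B \<omega> \<longleftrightarrow>
     \<omega> \<in> B \<and> pairwise orthogonal B \<and> (\<forall>e\<in>B. norm e = 1) \<and> span B = UNIV"

text \<open>Box centered at the origin with side \<open>a\<close> along \<open>\<omega>\<close> and sides \<open>b\<close> along the other frame
  vectors.\<close>

definition obox :: "'a::euclidean_space set \<Rightarrow> 'a \<Rightarrow> real \<Rightarrow> real \<Rightarrow> 'a set" where
  "obox B \<omega> a b = {x. \<bar>x \<bullet> \<omega>\<bar> \<le> a / 2 \<and> (\<forall>e\<in>B - {\<omega>}. \<bar>x \<bullet> e\<bar> \<le> b / 2)}"

definition dual_box :: "'a::euclidean_space set \<Rightarrow> 'a \<Rightarrow> real \<Rightarrow> 'a set" where
  "dual_box B \<omega> s = obox B \<omega> 1 (1 / s)"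

definition V_box :: "'a::euclidean_space set \<Rightarrow> 'a \<Rightarrow> real \<Rightarrow> real \<Rightarrow> 'a set" where
  "V_box B \<omega> s R = (\<lambda>x. (R * s\<^sup>2) *\<^sub>R x) ` dual_box B \<omega> s"

section \<open>Wave packet systems\<close>

text \<open>The choices entering the wave packet decomposition at a fixed \<open>R\<close>:
  \<open>dirs s\<close> are the directions of the caps of \<open>\<Theta>\<^sub>s\<close>, and \<open>frame s \<omega>\<close> is the frame of the box dual to
  such a cap. The remaining fields concern the finest scale \<open>s = R\<^sup>-\<^sup>1\<^sup>/\<^sup>2\<close> only: \<open>centers \<omega>\<close> are the
  centers of the tiles \<open>T\<^sup>\<flat>\<close> belonging to \<open>\<theta>\<close>, \<open>psi \<omega>\<close> is \<open>\<psi>\<^sub>\<theta>\<close>, and \<open>chi \<omega> c\<close> is the cutoff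
  to the tile with center \<open>c\<close>.\<close>

record ('n::finite) wp_system =
  dirs :: "real \<Rightarrow> (real ^ 'n) set"
  frame :: "real \<Rightarrow> real ^ 'n \<Rightarrow> (real ^ 'n) set"
  centers :: "real ^ 'n \<Rightarrow> (real ^ 'n) set"
  psi :: "real ^ 'n \<Rightarrow> real ^ 'n \<Rightarrow> real"
  chi :: "real ^ 'n \<Rightarrow> real ^ 'n \<Rightarrow> real ^ 'n \<Rightarrow> real"

definition cap_cover :: "real \<Rightarrow> nat \<Rightarrow> real \<Rightarrow> (real ^ 'n::finite) set \<Rightarrow> bool" where
  "cap_cover A N s D \<longleftrightarrow>
     finite D \<and> D \<subseteq> sphere 0 1 \<and>
     (\<forall>v\<in>sphere 0 1. \<exists>\<omega>\<in>D. dist v \<omega> \<le> s) \<and>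
     annulus \<subseteq> (\<Union>\<omega>\<in>D. cap A s \<omega>) \<and>
     (\<forall>\<xi>. card {\<omega> \<in> D. \<xi> \<in> cap A s \<omega>} \<le> N)"

text \<open>The derivative bounds express that \<open>\<psi>\<^sub>\<theta>\<close> is adapted to the box \<open>1 \<times> s \<times> \<dots> \<times> s\<close>: each
  derivative costs a factor 1 along \<open>\<omega>\<close> and a factor \<open>s\<^sup>-\<^sup>1\<close> along the other frame vectors.\<close>

definition cap_partition ::
  "real \<Rightarrow> (nat \<Rightarrow> real) \<Rightarrow> real \<Rightarrow> (real ^ 'n::finite) set \<Rightarrow> (real ^ 'n \<Rightarrow> (real ^ 'n) set) \<Rightarrow>
   (real ^ 'n \<Rightarrow> real ^ 'n \<Rightarrow> real) \<Rightarrow> bool" where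
  "cap_partition K C s D F \<psi> \<longleftrightarrow>
     (\<forall>\<omega>\<in>D. smooth (\<psi> \<omega>) \<and> (\<forall>\<xi>. 0 \<le> \<psi> \<omega> \<xi>) \<and>
        closure {\<xi>. \<psi> \<omega> \<xi> \<noteq> 0} \<subseteq> fat_cap K s \<omega> \<and>
        (\<forall>vs \<xi>. set vs \<subseteq> F \<omega> \<longrightarrow>
           \<bar>iter_deriv vs (\<psi> \<omega>) \<xi>\<bar> \<le> C (length vs) * (1 / s) ^ length (filter (\<lambda>v. v \<noteq> \<omega>) vs))) \<and>
     (\<forall>\<xi>\<in>annulus. (\<Sum>\<omega>\<in>D. \<psi> \<omega> \<xi>) = 1)"

definition tiling :: "'a::euclidean_space set \<Rightarrow> 'a set \<Rightarrow> bool" where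
  "tiling Q Z \<longleftrightarrow>
     (\<Union>c\<in>Z. (+) c ` Q) = UNIV \<and>
     (\<forall>c\<in>Z. \<forall>c'\<in>Z. c \<noteq> c' \<longrightarrow> interior ((+) c ` Q) \<inter> interior ((+) c' ` Q) = {})"

text \<open>Rapid decay off a tile is decay faster than any power of the dilation factor \<open>l\<close> needed
  to reach the point. The difference set of a dual box has sides \<open>2, 2/s, \<dots>, 2/s\<close>, hence its own
  dual box is \<open>obox B \<omega> (1/2) (s/2)\<close>.\<close>

definition tile_partition ::
  "real \<Rightarrow> (nat \<Rightarrow> real) \<Rightarrow> real \<Rightarrow> (real ^ 'n::finite) set \<Rightarrow> real ^ 'n \<Rightarrow> (real ^ 'n) set \<Rightarrow>
   (real ^ 'n \<Rightarrow> real ^ 'n \<Rightarrow> real) \<Rightarrow> bool" where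
  "tile_partition K C s B \<omega> Z \<eta> \<longleftrightarrow>
     tiling (dual_box B \<omega> s) Z \<and>
     (\<forall>c\<in>Z. smooth (\<eta> c) \<and> (\<forall>x. 0 \<le> \<eta> c x) \<and>
        (\<forall>M l x. 1 \<le> l \<longrightarrow> x - c \<notin> (\<lambda>y. l *\<^sub>R y) ` dual_box B \<omega> s \<longrightarrow> \<eta> c x \<le> C M / l ^ M) \<and>
        closure {\<xi>. fourier (\<lambda>x. complex_of_real (\<eta> c x)) \<xi> \<noteq> 0}
          \<subseteq> (\<lambda>y. K *\<^sub>R y) ` obox B \<omega> (1 / 2) (s / 2)) \<and>
     (\<forall>x. ((\<lambda>c. \<eta> c x) has_sum 1) Z)"

definition is_wp_system ::
  "real \<Rightarrow> nat \<Rightarrow> real \<Rightarrow> (nat \<Rightarrow> real) \<Rightarrow> (nat \<Rightarrow> real) \<Rightarrow> real \<Rightarrow> ('n::finite) wp_system \<Rightarrow> bool" where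
  "is_wp_system A N K C C' R S \<longleftrightarrow>
     (\<forall>s\<in>{R powr (-1/2)..1}.
        cap_cover A N s (dirs S s) \<and> (\<forall>\<omega>\<in>dirs S s. is_frame (frame S s \<omega>) \<omega>)) \<and>
     (let r = R powr (-1/2) in
        cap_partition K C r (dirs S r) (frame S r) (psi S) \<and>
        (\<forall>\<omega>\<in>dirs S r. tile_partition K C' r (frame S r \<omega>) \<omega> (centers S \<omega>) (chi S \<omega>)))"

text \<open>One system for each \<open>R\<close>, with all implicit constants independent of \<open>R\<close>.\<close>

definition wp_family :: "real \<Rightarrow> (real \<Rightarrow> ('n::finite) wp_system) \<Rightarrow> bool" where
  "wp_family A S \<longleftrightarrow> 0 < A \<and> (\<exists>N K C C'. 0 < K \<and> (\<forall>R\<ge>1. is_wp_system A N K C C' R (S R)))"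

section \<open>Wave packets and wave packet density\<close>

definition base_box :: "('n::finite) wp_system \<Rightarrow> real \<Rightarrow> real ^ 'n \<Rightarrow> real ^ 'n \<Rightarrow> (real ^ 'n) set" where
  "base_box S R \<omega> c = (+) c ` dual_box (frame S (R powr (-1/2)) \<omega>) \<omega> (R powr (-1/2))"

definition plank ::
  "real \<Rightarrow> ('n::finite) wp_system \<Rightarrow> real \<Rightarrow> real ^ 'n \<Rightarrow> real ^ 'n \<Rightarrow> ((real ^ 'n) \<times> real) set" where
  "plank \<delta> S R \<omega> c =
     {(x, t). x + t *\<^sub>R \<omega> \<in> (\<lambda>y. c + (R powr \<delta>) *\<^sub>R y) `
                dual_box (frame S (R powr (-1/2)) \<omega>) \<omega> (R powr (-1/2)) \<and> \<bar>t\<bar> \<le> R}"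

definition packet ::
  "('n::finite) wp_system \<Rightarrow> (real ^ 'n \<Rightarrow> complex) \<Rightarrow> real ^ 'n \<Rightarrow> real ^ 'n \<Rightarrow> real ^ 'n \<Rightarrow> complex" where
  "packet S g \<omega> c x =
     complex_of_real (chi S \<omega> c x) * inv_fourier (\<lambda>\<xi>. complex_of_real (psi S \<omega> \<xi>) * fourier g \<xi>) x"

text \<open>Here \<open>\<tau>\<close> is the cap at scale \<open>s\<close> with direction \<open>\<omega>\<close>, and \<open>V = a + V\<^bsub>\<tau>,R\<^esub>\<close>. Planks are indexed by
  the centers of their base boxes. Both sums are finite: the tiles inside \<open>V\<close> have a common volume
  and disjoint interiors.\<close>

definition local_density ::
  "real \<Rightarrow> real \<Rightarrow> ('n::finite) wp_system \<Rightarrow> real \<Rightarrow> (real ^ 'n \<Rightarrow> complex) \<Rightarrow>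
   real \<Rightarrow> real ^ 'n \<Rightarrow> real ^ 'n \<Rightarrow> real" where
  "local_density A \<delta> S R g s \<omega> a =
     (let r = R powr (-1/2); V = (+) a ` V_box (frame S s \<omega>) \<omega> s R in
      sqrt (1 / measure lborel V *
        (\<Sum>\<omega>' \<in> {\<omega>' \<in> dirs S r. cap A r \<omega>' \<subseteq> cap A s \<omega>}.
         \<Sum>c \<in> {c \<in> centers S \<omega>'. plank \<delta> S R \<omega>' c \<inter> ball 0 R \<noteq> {} \<and> base_box S R \<omega>' c \<subseteq> V}.
           (Lp_norm 2 UNIV (packet S g \<omega>' c))\<^sup>2)))"

text \<open>For fixed \<open>R\<close> the volumes \<open>|V|\<close> are bounded below and the packets are square summable, so all
  suprema are over nonempty sets of reals that are bounded above.\<close>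

definition wp_density ::
  "real \<Rightarrow> real \<Rightarrow> ('n::finite) wp_system \<Rightarrow> real \<Rightarrow> (real ^ 'n \<Rightarrow> complex) \<Rightarrow> real" where
  "wp_density A \<delta> S R g =
     (SUP s\<in>{R powr (-1/2)..1}. SUP \<omega>\<in>dirs S s. SUP a. local_density A \<delta> S R g s \<omega> a)"

definition p_plus :: "nat \<Rightarrow> real" where
  "p_plus n = 2 + 8 / (3 * real n - 2)"

end

theory Submission
  imports Defs "HOL-Probability.Probability" "HOL-Computational_Algebra.Polynomial"
begin

text \<open>Let \<open>k\<close> be \<open>n / 2\<close> rounded up, and let \<open>u\<close> have as its Fourier transform a bump in the
  \<open>R\<^sup>-\<^sup>1\<^sup>/\<^sup>2\<close>-neighbourhood of a \<open>k\<close>-dimensional coordinate subspace. In the remaining directions the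
  group velocity on this support is at most of order \<open>R\<^sup>-\<^sup>1\<^sup>/\<^sup>2\<close>, so for times of order \<open>R\<close> the half
  wave of \<open>u\<close> stays within distance of order \<open>R\<^sup>1\<^sup>/\<^sup>2\<close> of the subspace. The example \<open>f\<close> is a sum, with
  signs, of the translates of \<open>u\<close> by the lattice points of the subspace at distance at most of order
  \<open>R\<close>. A fixed fraction of its energy remains in a spacetime box with \<open>k + 1\<close> sides of length \<open>R\<close> and
  \<open>n - k\<close> sides of length \<open>R\<^sup>1\<^sup>/\<^sup>2\<close>, so that Hoelder's inequality on the box bounds the \<open>L\<^sup>p\<close> norm from
  below. For random signs the masses of the translates add up in every unit slab; an exponential
  moment bound gives one choice of signs for which this holds for all wave packets at once up to a
  factor \<open>R\<^sup>\<epsilon>\<close>, which bounds the wave packet density. Comparing the two bounds gains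
  \<open>(1 - (p / 2 - 1) * (2 * n - k - 1) / 2) / p\<close> in the exponent, which is positive for
  \<open>p < p_plus n\<close>.\<close>

section \<open>Fourier inversion and the Plancherel identity\<close>

text \<open>The bound for the squared density at angular scale \<open>s\<close> carries
  \<open>s\<close> to the power \<open>2 * k - n - 1\<close>. Hence \<open>2 * k \<le> n + 1\<close>
  makes the finest scale the worst one; beyond it the coarse scales would dominate. Subject to this,
  the loss \<open>(p / 2 - 1) * (2 * n - k - 1) / 2\<close> decreases in \<open>k\<close>, which
  fixes the choice, and \<open>n \<le> 2 * k\<close> lets \<open>p < p_plus n\<close> keep the loss
  below 1.

  One function must serve all \<open>p\<close>, so the signs are fixed before \<open>p\<close> and
  \<epsilon>. Therefore the moment bound has a normalisation free of both and is only asked to be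
  polynomial in \<open>R\<close>: a threshold \<open>L\<close> that is a multiple of
  \<open>ln R\<close> makes the tail beat that power, while the dilation \<open>l\<close> of the
  tiles and the decay order \<open>M\<close> are chosen afterwards.

  On the Fourier side the signs form a trigonometric polynomial. It commutes with all multipliers,
  so the part of the example in each cap, and its half wave at each time, are the same signed
  lattice sum of different profiles. This is why one sign pattern controls all of them.\<close>

lemma
  fixes f :: "'a::euclidean_space \<Rightarrow> real \<Rightarrow> 'b::{real_normed_field,banach,second_countable_topology}"
  assumes "\<And>b. b \<in> Basis \<Longrightarrow> integrable lborel (f b)"
  shows lborel_integrable_prod: "integrable lborel (\<lambda>x::'a. \<Prod>b\<in>Basis. f b (x \<bullet> b))"
    and lborel_integral_prod:
      "(LINT x|lborel. (\<Prod>b\<in>Basis. f b (x \<bullet> b))) = (\<Prod>b\<in>Basis. LINT y|lborel. f b y)"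
proof -
  interpret product_sigma_finite "\<lambda>_::'a. lborel :: real measure" ..
  have m: "f b \<in> borel_measurable borel" if "b \<in> Basis" for b
    using borel_measurable_integrable[OF assms[OF that]] by simp
  have meas: "(\<lambda>x::'a. \<Prod>b\<in>Basis. f b (x \<bullet> b)) \<in> borel_measurable borel"
  proof (rule borel_measurable_prod)
    fix b :: 'a assume "b \<in> Basis"
    from m[OF this] show "(\<lambda>x. f b (x \<bullet> b)) \<in> borel_measurable borel"
      by (rule measurable_compose_rev) simp
  qed
  have T: "(\<lambda>g. \<Sum>b\<in>Basis. g b *\<^sub>R b) \<in> measurable (\<Pi>\<^sub>M b\<in>Basis. lborel) (borel :: 'a measure)"
    by measurable
  have eq: "(\<Prod>b\<in>Basis. f b ((\<Sum>i\<in>Basis. g i *\<^sub>R i) \<bullet> b)) = (\<Prod>b\<in>Basis. f b (g b))" for g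
    by (rule prod.cong) simp_all
  show "integrable lborel (\<lambda>x::'a. \<Prod>b\<in>Basis. f b (x \<bullet> b))"
    unfolding lborel_eq[where 'a='a] integrable_distr_eq[OF T meas] eq
    by (intro product_integrable_prod assms) auto
  show "(LINT x|lborel. (\<Prod>b\<in>Basis. f b (x \<bullet> b))) = (\<Prod>b\<in>Basis. LINT y|lborel. f b y)"
    unfolding lborel_eq[where 'a='a] integral_distr[OF T meas] eq
    by (intro product_integral_prod assms) auto
qed

text \<open>The integral of \<open>inv_fourier\<close> without its constant. This keeps the powers
  of 2 pi out of Fubini, differentiation and integration by parts.\<close>

definition osc :: "('a::euclidean_space \<Rightarrow> complex) \<Rightarrow> 'a \<Rightarrow> complex" where
  "osc h x = (LINT \<xi>|lborel. cis (x \<bullet> \<xi>) * h \<xi>)"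

section \<open>Gaussians and their Fourier integrals\<close>

definition gauss :: "'a::euclidean_space \<Rightarrow> real" where
  "gauss x = exp (- (norm x)\<^sup>2 / 2)"

lemma gauss_pos [simp]: "0 < gauss x" and gauss_le_1 [simp]: "gauss x \<le> 1"
  and gauss_nonneg [simp]: "0 \<le> gauss x" and gauss_0 [simp]: "gauss 0 = 1"
  and gauss_minus [simp]: "gauss (- x) = gauss x"
  by (simp_all add: gauss_def)

lemma measurable_gauss [measurable]: "gauss \<in> borel_measurable borel"
  unfolding gauss_def by (intro borel_measurable_continuous_onI continuous_intros) auto

lemma continuous_gauss [continuous_intros]:
  "continuous_on S f \<Longrightarrow> continuous_on S (\<lambda>x. gauss (f x))"
  unfolding gauss_def by (intro continuous_intros) auto

lemma borel_measurable_cis [measurable]: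
  "f \<in> borel_measurable M \<Longrightarrow> (\<lambda>x. cis (f x)) \<in> borel_measurable M"
  by (rule borel_measurable_continuous_on[of cis]) (intro continuous_intros)

lemma gauss_prod: "gauss x = (\<Prod>b\<in>Basis. exp (- (x \<bullet> b)\<^sup>2 / 2))"
proof -
  have "(norm x)\<^sup>2 = (\<Sum>b\<in>Basis. (x \<bullet> b)\<^sup>2)"
    unfolding norm_eq_sqrt_inner by (simp add: euclidean_inner[of x x] power2_eq_square sum_nonneg)
  then show ?thesis
    by (simp add: gauss_def exp_sum[symmetric] sum_negf sum_divide_distrib)
qed

lemma cis_sum: "finite A \<Longrightarrow> cis (\<Sum>a\<in>A. f a) = (\<Prod>a\<in>A. cis (f a))"
  by (induction A rule: finite_induct) (simp_all add: cis_mult[symmetric])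

text \<open>The characteristic function of the standard normal distribution, with the normalisation
  of its density removed.\<close>

lemma
  shows integrable_cis_gauss_real:
    "integrable lborel (\<lambda>y. cis (t * y) * complex_of_real (exp (- y\<^sup>2 / 2)))"
    and integral_cis_gauss_real:
    "(LINT y|lborel. cis (t * y) * complex_of_real (exp (- y\<^sup>2 / 2)))
       = complex_of_real (sqrt (2 * pi) * exp (- t\<^sup>2 / 2))"
proof -
  have d: "std_normal_density y *\<^sub>R iexp (t * y) =
      complex_of_real (1 / sqrt (2 * pi)) * (cis (t * y) * complex_of_real (exp (- y\<^sup>2 / 2)))" for y
    by (simp add: std_normal_density_def scaleR_conv_of_real cis_conv_exp)
  have "integrable lborel (\<lambda>y. complex_of_real (exp (- y\<^sup>2 / 2)))"
    unfolding complex_of_real_integrable_eq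
    using integrable_mult_right[of "sqrt (2 * pi)" lborel std_normal_density]
      integrable_std_normal_moment[of 0]
    by (simp add: std_normal_density_def)
  then show i: "integrable lborel (\<lambda>y. cis (t * y) * complex_of_real (exp (- y\<^sup>2 / 2)))"
    by (rule Bochner_Integration.integrable_bound)
       (measurable, simp add: norm_mult)
  let ?I = "LINT y|lborel. cis (t * y) * complex_of_real (exp (- y\<^sup>2 / 2))"
  have "complex_of_real (exp (- t\<^sup>2 / 2)) = (LINT y|lborel. std_normal_density y *\<^sub>R iexp (t * y))"
    using char_std_normal_distribution unfolding fun_eq_iff char_def
    by (subst (asm) integral_density) (simp_all add: normal_density_nonneg)
  also have "\<dots> = complex_of_real (1 / sqrt (2 * pi)) * ?I"
    unfolding d by (rule Bochner_Integration.integral_mult_right) (rule i)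
  finally have "complex_of_real (sqrt (2 * pi)) * complex_of_real (exp (- t\<^sup>2 / 2))
      = complex_of_real (sqrt (2 * pi)) * (complex_of_real (1 / sqrt (2 * pi)) * ?I)"
    by (rule arg_cong)
  also have "\<dots> = complex_of_real (sqrt (2 * pi) * (1 / sqrt (2 * pi))) * ?I"
    by (simp only: of_real_mult mult.assoc)
  also have "sqrt (2 * pi) * (1 / sqrt (2 * pi)) = 1"
    unfolding times_divide_eq_right mult_1_right by (rule divide_self) (simp del: real_sqrt_mult)
  finally show "?I = complex_of_real (sqrt (2 * pi) * exp (- t\<^sup>2 / 2))"
    by (simp only: of_real_mult of_real_1 mult_1)
qed

text \<open>Both the Gaussian and the character factor over the coordinates, so the one-dimensional
  formula is multiplied up. Its value at 0 is the total integral.\<close>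

lemma osc_gauss: "osc (\<lambda>x. complex_of_real (gauss x)) \<xi> =
    complex_of_real (sqrt (2 * pi) ^ DIM('a) * gauss (\<xi> :: 'a::euclidean_space))"
  and integrable_gauss: "integrable lborel (\<lambda>x::'a. gauss x)"
  and integral_gauss: "(LINT x|lborel. gauss (x::'a)) = sqrt (2 * pi) ^ DIM('a)"
proof -
  have e: "cis (\<xi> \<bullet> x) * complex_of_real (gauss x) =
     (\<Prod>b\<in>Basis. cis ((\<xi> \<bullet> b) * (x \<bullet> b)) * complex_of_real (exp (- (x \<bullet> b)\<^sup>2 / 2)))" for \<xi> x :: 'a
    unfolding gauss_prod euclidean_inner[of \<xi> x] prod.distrib
    by (simp add: cis_sum of_real_prod)
  show *: "osc (\<lambda>x. complex_of_real (gauss x)) \<xi> =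
    complex_of_real (sqrt (2 * pi) ^ DIM('a) * gauss (\<xi> :: 'a))" for \<xi> :: 'a
    unfolding osc_def e
    by (subst lborel_integral_prod)
       (simp_all only: integrable_cis_gauss_real integral_cis_gauss_real gauss_prod prod.distrib
          of_real_prod of_real_mult of_real_power prod_constant)
  have "integrable lborel (\<lambda>x::'a. cis (0 \<bullet> x) * complex_of_real (gauss x))"
    unfolding e by (rule lborel_integrable_prod[OF integrable_cis_gauss_real])
  then show i: "integrable lborel (\<lambda>x::'a. gauss x)"
    by (simp add: complex_of_real_integrable_eq)
  have "complex_of_real (LINT x|lborel. gauss (x::'a)) = complex_of_real (sqrt (2 * pi) ^ DIM('a))"
    using *[of 0] by (simp add: osc_def del: of_real_power)
  then show "(LINT x|lborel. gauss (x::'a)) = sqrt (2 * pi) ^ DIM('a)"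
    by (simp only: of_real_eq_iff)
qed

lemma nn_integral_lborel_affine:
  fixes f :: "'a::euclidean_space \<Rightarrow> ennreal"
  assumes [measurable]: "f \<in> borel_measurable borel" and "c \<noteq> 0"
  shows "(\<integral>\<^sup>+x. f x \<partial>lborel) = ennreal (\<bar>c\<bar> ^ DIM('a)) * (\<integral>\<^sup>+x. f (t + c *\<^sub>R x) \<partial>lborel)"
  by (subst lborel_affine[OF \<open>c \<noteq> 0\<close>, of t])
     (simp add: nn_integral_density nn_integral_distr nn_integral_cmult ennreal_power)

lemma
  fixes f :: "'a::euclidean_space \<Rightarrow> 'b::{banach, second_countable_topology}"
  assumes f: "integrable lborel f" and c: "c \<noteq> 0"
  shows lborel_integrable_affine: "integrable lborel (\<lambda>x. f (t + c *\<^sub>R x))"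
    and lborel_integral_affine:
      "(LINT x|lborel. f x) = (\<bar>c\<bar> ^ DIM('a)) *\<^sub>R (LINT x|lborel. f (t + c *\<^sub>R x))"
proof -
  have [measurable]: "f \<in> borel_measurable borel"
    using borel_measurable_integrable[OF f] by simp
  show i: "integrable lborel (\<lambda>x. f (t + c *\<^sub>R x))"
    using f c unfolding integrable_iff_bounded
    by (subst (asm) nn_integral_lborel_affine[where c=c and t=t]) (auto simp: ennreal_mult_less_top)
  show "(LINT x|lborel. f x) = (\<bar>c\<bar> ^ DIM('a)) *\<^sub>R (LINT x|lborel. f (t + c *\<^sub>R x))"
    using c i by (subst lborel_affine[OF c, of t]) (simp add: integral_density integral_distr)
qed

lemma measurable_osc [measurable (raw)]:
  assumes [measurable]: "h \<in> borel_measurable borel"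
  shows "osc h \<in> borel_measurable borel"
  unfolding osc_def[abs_def] by measurable

lemma borel_measurable_cnj [measurable]:
  "f \<in> borel_measurable M \<Longrightarrow> (\<lambda>x. cnj (f x)) \<in> borel_measurable M"
  by (rule borel_measurable_continuous_on[of cnj]) (intro continuous_intros)

lemma integrable_cis_mult:
  assumes "integrable M h" and [measurable]: "u \<in> borel_measurable M"
  shows "integrable M (\<lambda>\<xi>. cis (u \<xi>) * h \<xi>)"
  by (rule Bochner_Integration.integrable_bound[OF assms(1)])
     (use borel_measurable_integrable[OF assms(1)] in measurable, simp add: norm_mult)

lemma norm_osc_le:
  "norm (osc h x) \<le> (LINT \<xi>|lborel. norm (h \<xi>))"
proof -
  have "norm (osc h x) \<le> (LINT \<xi>|lborel. norm (cis (x \<bullet> \<xi>) * h \<xi>))"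
    unfolding osc_def by (rule integral_norm_bound)
  then show ?thesis by (simp add: norm_mult)
qed

text \<open>Fubini, since the kernel is symmetric in \<open>x\<close> and \<xi>. With a Gaussian
  weight for \<open>w\<close> this regularises both inversion and Plancherel.\<close>

lemma osc_mult_formula:
  fixes h w :: "'a::euclidean_space \<Rightarrow> complex"
  assumes h: "integrable lborel h" and w: "integrable lborel w"
  shows "(LINT x|lborel. osc h x * w x) = (LINT \<xi>|lborel. h \<xi> * osc w \<xi>)"
proof -
  have [measurable]: "h \<in> borel_measurable borel" "w \<in> borel_measurable borel"
    using h w borel_measurable_integrable by force+
  have "integrable (lborel \<Otimes>\<^sub>M lborel) (\<lambda>(x, \<xi>). w x * h \<xi>)"
    by (rule lborel_pair.Fubini_integrable) (auto simp: h w norm_mult integrable_norm)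
  then have i: "integrable (lborel \<Otimes>\<^sub>M lborel) (\<lambda>(x, \<xi>). cis (x \<bullet> \<xi>) * h \<xi> * w x)"
    by (rule Bochner_Integration.integrable_bound) (auto simp: norm_mult)
  have "(LINT x|lborel. osc h x * w x) = (LINT x|lborel. (LINT \<xi>|lborel. cis (x \<bullet> \<xi>) * h \<xi> * w x))"
    unfolding osc_def by simp
  also have "\<dots> = (LINT \<xi>|lborel. (LINT x|lborel. cis (x \<bullet> \<xi>) * h \<xi> * w x))"
    by (rule lborel_pair.Fubini_integral[OF i, symmetric])
  also have "\<dots> = (LINT \<xi>|lborel. (LINT x|lborel. h \<xi> * (cis (\<xi> \<bullet> x) * w x)))"
    by (simp add: inner_commute mult_ac)
  also have "\<dots> = (LINT \<xi>|lborel. h \<xi> * osc w \<xi>)"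
    unfolding osc_def by simp
  finally show ?thesis .
qed

text \<open>This is \<open>(2 * pi) ^ DIM('a)\<close> times the Gaussian average of \<open>h\<close>
  at distance \<epsilon> around \<eta>: half of the constant is the prefactor and half the integral
  of \<open>gauss\<close>.\<close>

definition smear :: "('a::euclidean_space \<Rightarrow> complex) \<Rightarrow> real \<Rightarrow> 'a \<Rightarrow> complex" where
  "smear h \<epsilon> \<eta> = complex_of_real (sqrt (2 * pi) ^ DIM('a)) *
     (LINT y|lborel. h (\<eta> + \<epsilon> *\<^sub>R y) * complex_of_real (gauss y))"

lemma measurable_smear [measurable (raw)]:
  assumes [measurable]: "h \<in> borel_measurable borel"
  shows "smear h \<epsilon> \<in> borel_measurable borel"
  unfolding smear_def[abs_def] by measurable

lemma integrable_gauss_scaled: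
  "\<epsilon> \<noteq> 0 \<Longrightarrow> integrable lborel (\<lambda>x::'a::euclidean_space. gauss (\<epsilon> *\<^sub>R x))"
  using lborel_integrable_affine[OF integrable_gauss, of \<epsilon> 0] by simp

lemma osc_gauss_scaled:
  fixes \<zeta> :: "'a::euclidean_space"
  assumes e: "\<epsilon> > 0"
  shows "osc (\<lambda>x. complex_of_real (gauss (\<epsilon> *\<^sub>R x))) \<zeta> =
    complex_of_real ((sqrt (2 * pi) / \<epsilon>) ^ DIM('a) * gauss (\<zeta> /\<^sub>R \<epsilon>))"
proof -
  let ?F = "\<lambda>x. cis ((\<zeta> /\<^sub>R \<epsilon>) \<bullet> x) * complex_of_real (gauss x)"
  have i: "integrable lborel ?F"
    by (intro integrable_cis_mult) (simp_all add: integrable_gauss complex_of_real_integrable_eq)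
  have "osc (\<lambda>x. complex_of_real (gauss x)) (\<zeta> /\<^sub>R \<epsilon>) = (\<epsilon> ^ DIM('a)) *\<^sub>R (LINT x|lborel. ?F (0 + \<epsilon> *\<^sub>R x))"
    unfolding osc_def using lborel_integral_affine[OF i, of \<epsilon> 0] e by simp
  also have "(LINT x|lborel. ?F (0 + \<epsilon> *\<^sub>R x)) = osc (\<lambda>x. complex_of_real (gauss (\<epsilon> *\<^sub>R x))) \<zeta>"
    unfolding osc_def using e by (simp add: mult.assoc[symmetric])
  finally show ?thesis
    unfolding osc_gauss using e
    by (simp add: scaleR_conv_of_real field_simps power_divide)
qed

text \<open>The Gaussian factor makes the inversion integral absolutely convergent for every
  integrable \<open>h\<close>; the multiplication formula then moves the transform to the Gaussian,
  where it is explicit.\<close>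

lemma osc_gauss_smear:
  fixes h :: "'a::euclidean_space \<Rightarrow> complex"
  assumes h: "integrable lborel h" and e: "\<epsilon> > 0"
  shows "(LINT x|lborel. cis (- (\<eta> \<bullet> x)) * complex_of_real (gauss (\<epsilon> *\<^sub>R x)) * osc h x) = smear h \<epsilon> \<eta>"
proof -
  have [measurable]: "h \<in> borel_measurable borel"
    using h borel_measurable_integrable by force
  let ?w = "\<lambda>x. cis (- (\<eta> \<bullet> x)) * complex_of_real (gauss (\<epsilon> *\<^sub>R x))"
  have w: "integrable lborel ?w"
    using e by (intro integrable_cis_mult) (simp_all add: integrable_gauss_scaled complex_of_real_integrable_eq)
  have ow: "osc ?w \<xi> = complex_of_real ((sqrt (2 * pi) / \<epsilon>) ^ DIM('a) * gauss ((\<xi> - \<eta>) /\<^sub>R \<epsilon>))" for \<xi>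
  proof -
    have "osc ?w \<xi> = osc (\<lambda>x. complex_of_real (gauss (\<epsilon> *\<^sub>R x))) (\<xi> - \<eta>)"
      unfolding osc_def by (simp add: mult.assoc[symmetric] cis_mult inner_diff_left)
    then show ?thesis by (simp only: osc_gauss_scaled[OF e])
  qed
  let ?G = "\<lambda>\<xi>. h \<xi> * complex_of_real (gauss ((\<xi> - \<eta>) /\<^sub>R \<epsilon>))"
  have iG: "integrable lborel ?G"
    by (rule Bochner_Integration.integrable_bound[OF h]) (auto simp: norm_mult mult_left_le)
  have "(LINT x|lborel. ?w x * osc h x) = (LINT x|lborel. osc h x * ?w x)"
    by (simp add: mult_ac)
  also have "\<dots> = (LINT \<xi>|lborel. h \<xi> * osc ?w \<xi>)"
    by (rule osc_mult_formula[OF h w])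
  also have "\<dots> = (LINT \<xi>|lborel. complex_of_real ((sqrt (2 * pi) / \<epsilon>) ^ DIM('a)) * ?G \<xi>)"
    unfolding ow by (simp only: of_real_mult mult_ac)
  also have "\<dots> = complex_of_real ((sqrt (2 * pi) / \<epsilon>) ^ DIM('a)) * (LINT \<xi>|lborel. ?G \<xi>)"
    by (rule integral_mult_right_zero)
  also have "(LINT \<xi>|lborel. ?G \<xi>) = (\<epsilon> ^ DIM('a)) *\<^sub>R (LINT y|lborel. ?G (\<eta> + \<epsilon> *\<^sub>R y))"
    using lborel_integral_affine[OF iG, of \<epsilon> \<eta>] e by simp
  also have "(LINT y|lborel. ?G (\<eta> + \<epsilon> *\<^sub>R y)) = (LINT y|lborel. h (\<eta> + \<epsilon> *\<^sub>R y) * complex_of_real (gauss y))"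
    using e by simp
  also have "complex_of_real ((sqrt (2 * pi) / \<epsilon>) ^ DIM('a)) * (\<epsilon> ^ DIM('a) *\<^sub>R \<dots>) = smear h \<epsilon> \<eta>"
    using e unfolding smear_def by (simp add: scaleR_conv_of_real power_divide)
  finally show ?thesis .
qed

lemma norm_smear_le:
  fixes h :: "'a::euclidean_space \<Rightarrow> complex"
  assumes "\<And>\<xi>. norm (h \<xi>) \<le> B" and [measurable]: "h \<in> borel_measurable borel"
  shows "norm (smear h \<epsilon> \<eta>) \<le> (2 * pi) ^ DIM('a) * B"
proof -
  have i: "integrable lborel (\<lambda>y::'a. B * gauss y)"
    by (intro integrable_mult_right integrable_gauss)
  have "norm (LINT y|lborel. h (\<eta> + \<epsilon> *\<^sub>R y) * complex_of_real (gauss y)) \<le> (LINT y|lborel. B * gauss (y::'a))"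
  proof (rule order_trans[OF integral_norm_bound], rule integral_mono[OF _ i])
    show "integrable lborel (\<lambda>y. norm (h (\<eta> + \<epsilon> *\<^sub>R y) * complex_of_real (gauss y)))"
      by (intro integrable_norm Bochner_Integration.integrable_bound[OF i])
         (auto simp: norm_mult abs_mult intro!: mult_right_mono order_trans[OF assms(1)])
  qed (auto simp: norm_mult intro!: mult_right_mono assms(1))
  also have "\<dots> = B * sqrt (2 * pi) ^ DIM('a)"
    by (simp add: integral_gauss)
  finally have "norm (smear h \<epsilon> \<eta>) \<le> sqrt (2 * pi) ^ DIM('a) * (B * sqrt (2 * pi) ^ DIM('a))"
    unfolding smear_def by (simp add: norm_mult norm_power mult_left_mono)
  also have "\<dots> = (sqrt (2 * pi) * sqrt (2 * pi)) ^ DIM('a) * B"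
    by (simp only: power_mult_distrib mult_ac)
  also have "sqrt (2 * pi) * sqrt (2 * pi) = 2 * pi"
    by (simp add: real_sqrt_mult_self del: real_sqrt_mult)
  finally show ?thesis .
qed

lemma smear_tendsto:
  fixes h :: "'a::euclidean_space \<Rightarrow> complex"
  assumes B: "\<And>\<xi>. norm (h \<xi>) \<le> B" and [measurable]: "h \<in> borel_measurable borel"
    and c: "isCont h \<eta>" and e: "\<epsilon> \<longlonglongrightarrow> 0"
  shows "(\<lambda>k. smear h (\<epsilon> k) \<eta>) \<longlonglongrightarrow> complex_of_real ((2 * pi) ^ DIM('a)) * h \<eta>"
proof -
  have "(\<lambda>k. LINT y|lborel. h (\<eta> + \<epsilon> k *\<^sub>R y) * complex_of_real (gauss y))
      \<longlonglongrightarrow> (LINT y|lborel. h \<eta> * complex_of_real (gauss (y::'a)))"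
  proof (rule integral_dominated_convergence)
    show "integrable lborel (\<lambda>y::'a. B * gauss y)"
      by (intro integrable_mult_right integrable_gauss)
    show "AE y in lborel. (\<lambda>k. h (\<eta> + \<epsilon> k *\<^sub>R y) * complex_of_real (gauss y)) \<longlonglongrightarrow> h \<eta>
        * complex_of_real (gauss (y::'a))"
    proof (rule AE_I2)
      fix y :: 'a
      have "(\<lambda>k. \<eta> + \<epsilon> k *\<^sub>R y) \<longlonglongrightarrow> \<eta> + 0 *\<^sub>R y"
        by (intro tendsto_intros e)
      then have "(\<lambda>k. h (\<eta> + \<epsilon> k *\<^sub>R y)) \<longlonglongrightarrow> h \<eta>"
        by (intro isCont_tendsto_compose[OF c]) simp
      then show "(\<lambda>k. h (\<eta> + \<epsilon> k *\<^sub>R y) * complex_of_real (gauss y)) \<longlonglongrightarrow> h \<eta> * complex_of_real (gauss y)"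
        by (intro tendsto_intros)
    qed
  qed (auto simp: norm_mult intro!: mult_right_mono B)
  also have "(LINT y|lborel. h \<eta> * complex_of_real (gauss (y::'a)))
      = h \<eta> * complex_of_real (sqrt (2 * pi) ^ DIM('a))"
    by (simp only: integral_mult_right_zero integral_complex_of_real integral_gauss)
  finally have "(\<lambda>k. smear h (\<epsilon> k) \<eta>) \<longlonglongrightarrow> complex_of_real (sqrt (2 * pi) ^ DIM('a))
      * (h \<eta> * complex_of_real (sqrt (2 * pi) ^ DIM('a)))"
    unfolding smear_def by (intro tendsto_intros)
  also have "complex_of_real (sqrt (2 * pi) ^ DIM('a)) * (h \<eta> * complex_of_real (sqrt (2 * pi) ^ DIM('a)))
     = complex_of_real ((sqrt (2 * pi) * sqrt (2 * pi)) ^ DIM('a)) * h \<eta>"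
    by (simp only: power_mult_distrib of_real_mult mult_ac)
  also have "sqrt (2 * pi) * sqrt (2 * pi) = 2 * pi"
    by (simp add: real_sqrt_mult_self del: real_sqrt_mult)
  finally show ?thesis .
qed

lemma gauss_scaled_tendsto:
  fixes x :: "'a::euclidean_space"
  shows "(\<lambda>k. gauss (inverse (real (Suc k)) *\<^sub>R x)) \<longlonglongrightarrow> 1"
proof -
  have "(\<lambda>k. inverse (real (Suc k)) *\<^sub>R x) \<longlonglongrightarrow> 0 *\<^sub>R x"
    by (intro tendsto_intros LIMSEQ_inverse_real_of_nat)
  then have "(\<lambda>k. gauss (inverse (real (Suc k)) *\<^sub>R x)) \<longlonglongrightarrow> gauss (0 *\<^sub>R x)"
    by (rule isCont_tendsto_compose[rotated])
       (use continuous_gauss[of UNIV "\<lambda>x::'a. x"] in \<open>simp add: continuous_on_eq_continuous_at\<close>)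
  then show ?thesis by simp
qed

text \<open>Both sides of \<open>osc_gauss_smear\<close> converge as the Gaussian weight tends to 1:
  the left side is dominated by \<open>norm (osc h x)\<close>, the right side is an average of
  \<open>h\<close> that shrinks to the point of continuity \<eta>.\<close>

theorem osc_inversion:
  fixes h :: "'a::euclidean_space \<Rightarrow> complex"
  assumes h: "integrable lborel h" and B: "\<And>\<xi>. norm (h \<xi>) \<le> B" and c: "isCont h \<eta>"
    and H: "integrable lborel (osc h)"
  shows "(LINT x|lborel. cis (- (\<eta> \<bullet> x)) * osc h x) = complex_of_real ((2 * pi) ^ DIM('a)) * h \<eta>"
proof -
  have [measurable]: "h \<in> borel_measurable borel"
    using h borel_measurable_integrable by force
  let ?e = "\<lambda>k. inverse (real (Suc k))"
  have "(\<lambda>k. LINT x|lborel. cis (- (\<eta> \<bullet> x)) * complex_of_real (gauss (?e k *\<^sub>R x)) * osc h x)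
      \<longlonglongrightarrow> (LINT x|lborel. cis (- (\<eta> \<bullet> x)) * complex_of_real 1 * osc h x)"
  proof (rule integral_dominated_convergence)
    show "integrable lborel (\<lambda>x. norm (osc h x))" using H by (rule integrable_norm)
    show "AE x in lborel. (\<lambda>k. cis (- (\<eta> \<bullet> x)) * complex_of_real (gauss (?e k *\<^sub>R x)) * osc h x)
        \<longlonglongrightarrow> cis (- (\<eta> \<bullet> x)) * complex_of_real 1 * osc h x"
      by (intro AE_I2 tendsto_intros gauss_scaled_tendsto)
  qed (auto simp: norm_mult mult_left_le_one_le)
  moreover have "(\<lambda>k. LINT x|lborel. cis (- (\<eta> \<bullet> x)) * complex_of_real (gauss (?e k *\<^sub>R x)) * osc h x)
      = (\<lambda>k. smear h (?e k) \<eta>)"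
    by (intro ext osc_gauss_smear h) simp
  moreover have "(\<lambda>k. smear h (?e k) \<eta>) \<longlonglongrightarrow> complex_of_real ((2 * pi) ^ DIM('a)) * h \<eta>"
    by (rule smear_tendsto[OF B _ c LIMSEQ_inverse_real_of_nat]) measurable
  ultimately show ?thesis
    using LIMSEQ_unique by fastforce
qed

theorem osc_plancherel:
  fixes h :: "'a::euclidean_space \<Rightarrow> complex"
  assumes h: "integrable lborel h" and B: "\<And>\<xi>. norm (h \<xi>) \<le> B" and c: "continuous_on UNIV h"
  shows "integrable lborel (\<lambda>x. (norm (osc h x))\<^sup>2)"
    and "(LINT x|lborel. (norm (osc h x))\<^sup>2) = (2 * pi) ^ DIM('a) * (LINT \<xi>|lborel. (norm (h \<xi>))\<^sup>2)"
proof -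
  have [measurable]: "h \<in> borel_measurable borel"
    using h borel_measurable_integrable by force
  let ?e = "\<lambda>k. inverse (real (Suc k))"
  define w where "w k x = complex_of_real (gauss (?e k *\<^sub>R x)) * cnj (osc h x)" for k x
  have [measurable]: "w k \<in> borel_measurable borel" for k
    unfolding w_def[abs_def] by measurable
  define L where "L = (LINT \<xi>|lborel. norm (h \<xi>))"
  have iw: "integrable lborel (w k)" for k
  proof (rule Bochner_Integration.integrable_bound)
    show "integrable lborel (\<lambda>x::'a. L * gauss (?e k *\<^sub>R x))"
      by (intro integrable_mult_right integrable_gauss_scaled) simp
    have "0 \<le> L" unfolding L_def by simp
    then show "AE x in lborel. norm (w k x) \<le> norm (L * gauss (?e k *\<^sub>R x))"
      by (auto simp: w_def norm_mult L_def mult.commute[of _ "gauss _"] norm_osc_le intro!: mult_left_mono)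
  qed simp
  have ow: "osc (w k) \<xi> = cnj (smear h (?e k) \<xi>)" for k \<xi>
  proof -
    have "osc (w k) \<xi> = (LINT x|lborel. cnj (cis (- (\<xi> \<bullet> x)) * complex_of_real (gauss (?e k *\<^sub>R x)) * osc h x))"
      unfolding osc_def[of "w k"] w_def by (simp add: cis_cnj mult.assoc)
    also have "\<dots> = cnj (LINT x|lborel. cis (- (\<xi> \<bullet> x)) * complex_of_real (gauss (?e k *\<^sub>R x)) * osc h x)"
      by (rule Bochner_Integration.integral_cnj)
    also have "\<dots> = cnj (smear h (?e k) \<xi>)"
      by (subst osc_gauss_smear[OF h]) auto
    finally show ?thesis .
  qed
  have "(\<lambda>k. LINT \<xi>|lborel. h \<xi> * cnj (smear h (?e k) \<xi>)) \<longlonglongrightarrow>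
      (LINT \<xi>|lborel. h \<xi> * cnj (complex_of_real ((2 * pi) ^ DIM('a)) * h \<xi>))"
  proof (rule integral_dominated_convergence)
    show "integrable lborel (\<lambda>\<xi>. norm (h \<xi>) * ((2 * pi) ^ DIM('a) * B))"
      using h by (intro integrable_mult_left integrable_norm)
    show "AE \<xi> in lborel. (\<lambda>k. h \<xi> * cnj (smear h (?e k) \<xi>)) \<longlonglongrightarrow> h \<xi> * cnj (complex_of_real ((2 * pi) ^ DIM('a))
        * h \<xi>)"
      using c by (intro AE_I2 tendsto_intros tendsto_cnj smear_tendsto[OF B _ _ LIMSEQ_inverse_real_of_nat])
        (auto simp: continuous_on_eq_continuous_at)
    show "AE \<xi> in lborel. norm (h \<xi> * cnj (smear h (?e k) \<xi>)) \<le> norm (h \<xi>) * ((2 * pi) ^ DIM('a) * B)" for k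
      unfolding norm_mult complex_mod_cnj by (intro AE_I2 mult_left_mono norm_smear_le B) auto
  qed auto
  also have "(\<lambda>k. LINT \<xi>|lborel. h \<xi> * cnj (smear h (?e k) \<xi>)) = (\<lambda>k. LINT x|lborel. osc h x * w k x)"
    unfolding osc_mult_formula[OF h iw] ow ..
  also have "\<dots> = (\<lambda>k. complex_of_real (LINT x|lborel. gauss (?e k *\<^sub>R x) * (norm (osc h x))\<^sup>2))"
    unfolding w_def integral_complex_of_real[symmetric]
    by (simp only: of_real_mult complex_norm_square mult_ac)
  also have "(\<lambda>\<xi>. h \<xi> * cnj (complex_of_real ((2 * pi) ^ DIM('a)) * h \<xi>))
     = (\<lambda>\<xi>. complex_of_real ((2 * pi) ^ DIM('a) * (norm (h \<xi>))\<^sup>2))"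
    by (simp only: complex_cnj_mult complex_cnj_complex_of_real of_real_mult complex_norm_square mult_ac)
  also have "(LINT \<xi>|lborel. complex_of_real ((2 * pi) ^ DIM('a) * (norm (h \<xi>))\<^sup>2))
     = complex_of_real ((2 * pi) ^ DIM('a) * (LINT \<xi>|lborel. (norm (h \<xi>))\<^sup>2))"
    by (simp only: integral_complex_of_real integral_mult_right_zero)
  finally have lim: "(\<lambda>k. LINT x|lborel. gauss (?e k *\<^sub>R x) * (norm (osc h x))\<^sup>2)
     \<longlonglongrightarrow> (2 * pi) ^ DIM('a) * (LINT \<xi>|lborel. (norm (h \<xi>))\<^sup>2)"
    by (simp only: tendsto_of_real_iff)
  have i: "integrable lborel (\<lambda>x. gauss (?e k *\<^sub>R x) * (norm (osc h x))\<^sup>2)" for k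
  proof (rule Bochner_Integration.integrable_bound)
    show "integrable lborel (\<lambda>x::'a. gauss (?e k *\<^sub>R x) * L\<^sup>2)"
      by (intro integrable_mult_left integrable_gauss_scaled) simp
    have "(norm (osc h x))\<^sup>2 \<le> L\<^sup>2" for x
      unfolding L_def by (intro power_mono norm_osc_le) simp
    then show "AE x in lborel. norm (gauss (?e k *\<^sub>R x) * (norm (osc h x))\<^sup>2) \<le> norm (gauss (?e k *\<^sub>R x) * L\<^sup>2)"
      by (auto simp: norm_mult intro!: mult_left_mono)
  qed simp
  \<comment> \<open>The damping increases to 1 in \<open>k\<close>, so monotone convergence yields
    the square integrability together with the value of the integral.\<close>
  have mono: "gauss (?e k *\<^sub>R x) \<le> gauss (?e l *\<^sub>R x)" if "k \<le> l" for k l and x :: 'a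
    using that by (auto simp: gauss_def intro!: power_mono mult_right_mono)
  have m: "AE x in lborel. mono (\<lambda>k. gauss (?e k *\<^sub>R x) * (norm (osc h x))\<^sup>2)"
    by (intro AE_I2 monoI mult_right_mono mono) auto
  have l: "AE x in lborel. (\<lambda>k. gauss (?e k *\<^sub>R x) * (norm (osc h x))\<^sup>2) \<longlonglongrightarrow> (norm (osc h x))\<^sup>2"
    using tendsto_mult_right[OF gauss_scaled_tendsto] by (intro AE_I2) fastforce
  show "integrable lborel (\<lambda>x. (norm (osc h x))\<^sup>2)"
    by (rule integral_monotone_convergence_nonneg(1)[OF i m _ l lim]) auto
  show "(LINT x|lborel. (norm (osc h x))\<^sup>2) = (2 * pi) ^ DIM('a) * (LINT \<xi>|lborel. (norm (h \<xi>))\<^sup>2)"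
    by (rule integral_monotone_convergence_nonneg(2)[OF i m _ l lim]) auto
qed

section \<open>Smooth amplitudes of compact support\<close>

text \<open>Differentiating \<open>exp (- (1 / x))\<close> produces polynomials in
  \<open>1 / x\<close>; with the polynomial as a parameter the family is closed under
  derivatives.\<close>

definition flat :: "real poly \<Rightarrow> real \<Rightarrow> real" where
  "flat P x = (if x \<le> 0 then 0 else poly P (1 / x) * exp (- (1 / x)))"

lemma poly_exp_tendsto_0: "((\<lambda>y::real. poly P y * exp (- y)) \<longlongrightarrow> 0) at_top"
proof -
  have "((\<lambda>y. \<Sum>i\<le>degree P. coeff P i * (y ^ i / exp y)) \<longlongrightarrow> (\<Sum>i\<le>degree P. coeff P i * 0)) at_top"
    by (intro tendsto_intros tendsto_power_div_exp_0)
  then show ?thesis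
    by (simp add: poly_altdef sum_distrib_right exp_minus divide_inverse mult.assoc)
qed

text \<open>With \<open>y = 1 / x\<close> one has \<open>dy/dx = - y\<^sup>2\<close>, so the
  derivative of \<open>P(y) * exp (- y)\<close> is
  \<open>y\<^sup>2 * (P(y) - P'(y)) * exp (- y)\<close>; \<open>[:0, 0, 1:]\<close> is the
  square.\<close>

lemma flat_has_derivative:
  "(flat P has_real_derivative flat ([:0, 0, 1:] * (P - pderiv P)) x) (at x)"
proof -
  consider "x < 0" | "x > 0" | "x = 0" by linarith
  then show ?thesis
  proof cases
    case 1
    have "((\<lambda>_. 0) has_real_derivative 0) (at x)" by simp
    then have "(flat P has_real_derivative 0) (at x)"
      by (rule has_field_derivative_transform_within_open[where S="{..<0}"])
         (use 1 in \<open>auto simp: flat_def\<close>)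
    then show ?thesis using 1 by (simp add: flat_def)
  next
    case 2
    have "((\<lambda>x. poly P (1 / x) * exp (- (1 / x))) has_real_derivative
        poly ([:0, 0, 1:] * (P - pderiv P)) (1 / x) * exp (- (1 / x))) (at x)"
      using 2 by (auto intro!: derivative_eq_intros DERIV_chain2[OF poly_DERIV]
          simp: field_simps power2_eq_square)
    then have "(flat P has_real_derivative
        poly ([:0, 0, 1:] * (P - pderiv P)) (1 / x) * exp (- (1 / x))) (at x)"
      by (rule has_field_derivative_transform_within_open[where S="{0<..}"])
         (use 2 in \<open>auto simp: flat_def\<close>)
    then show ?thesis using 2 by (simp add: flat_def)
  next
    \<comment> \<open>From the right the difference quotient at 0 is
      \<open>y * P(y) * exp (- y)\<close> with \<open>y = 1 / h\<close> tending to infinity; from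
      the left it is 0.\<close>
    case 3
    have "((\<lambda>h. flat P h / h) \<longlongrightarrow> 0) (at_left 0)"
      by (rule tendsto_eventually)
         (auto simp: flat_def eventually_at_filter)
    moreover have "((\<lambda>h. flat P h / h) \<longlongrightarrow> 0) (at_right 0)"
    proof -
      have "((\<lambda>h::real. poly ([:0, 1:] * P) (inverse h) * exp (- inverse h)) \<longlongrightarrow> 0) (at_right 0)"
        by (rule filterlim_compose[OF poly_exp_tendsto_0 filterlim_inverse_at_top_right])
      then show ?thesis
        by (rule Lim_transform_eventually)
           (auto simp: flat_def eventually_at_filter field_simps)
    qed
    ultimately have "((\<lambda>h. flat P h / h) \<longlongrightarrow> 0) (at 0)"
      by (rule filterlim_split_at)
    then show ?thesis
      using 3 by (simp add: DERIV_def flat_def)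
  qed
qed

lemma cis_has_derivative:
  fixes v :: "'a::euclidean_space"
  shows "((\<lambda>x. cis (v \<bullet> x)) has_derivative (\<lambda>w. \<i> * complex_of_real (v \<bullet> w) * cis (v \<bullet> x))) (at x)"
proof -
  have "((\<lambda>x. \<i> * complex_of_real (v \<bullet> x)) has_derivative (\<lambda>w. \<i> * complex_of_real (v \<bullet> w))) (at x)"
    by (auto intro!: derivative_eq_intros)
  from has_derivative_compose[OF this has_field_derivative_imp_has_derivative[OF DERIV_exp]]
  show ?thesis by (simp add: cis_conv_exp mult.commute)
qed

text \<open>This class contains the Fourier transform of the example and is closed under directional
  derivatives, so the regularity of iterated derivatives comes from membership.\<close>

inductive_set elem :: "('a::euclidean_space \<Rightarrow> complex) set" where
  elem_const: "(\<lambda>x. c) \<in> elem"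
| elem_linear: "(\<lambda>x. complex_of_real (v \<bullet> x)) \<in> elem"
| elem_cis: "(\<lambda>x. cis (v \<bullet> x)) \<in> elem"
| elem_flat: "(\<lambda>x. complex_of_real (flat P (v \<bullet> x + b))) \<in> elem"
| elem_add: "f \<in> elem \<Longrightarrow> g \<in> elem \<Longrightarrow> (\<lambda>x. f x + g x) \<in> elem"
| elem_mult: "f \<in> elem \<Longrightarrow> g \<in> elem \<Longrightarrow> (\<lambda>x. f x * g x) \<in> elem"

lemma elem_sum: "(\<And>i. i \<in> I \<Longrightarrow> f i \<in> elem) \<Longrightarrow> (\<lambda>x. \<Sum>i\<in>I. f i x) \<in> elem"
  by (induction I rule: infinite_finite_induct) (auto intro: elem_const elem_add)

lemma elem_prod: "(\<And>i. i \<in> I \<Longrightarrow> f i \<in> elem) \<Longrightarrow> (\<lambda>x. \<Prod>i\<in>I. f i x) \<in> elem"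
  by (induction I rule: infinite_finite_induct) (auto intro: elem_const elem_mult)

lemma elem_derivative:
  "f \<in> elem \<Longrightarrow> \<exists>f'. (\<forall>x. (f has_derivative f' x) (at x)) \<and> (\<forall>v. (\<lambda>x. f' x v) \<in> elem)"
proof (induction rule: elem.induct)
  case (elem_const c)
  show ?case by (rule exI[of _ "\<lambda>x v. 0"]) (auto intro: elem.elem_const)
next
  case (elem_linear v)
  show ?case
    by (rule exI[of _ "\<lambda>x w. complex_of_real (v \<bullet> w)"])
       (auto intro!: derivative_eq_intros elem.elem_const)
next
  case (elem_cis v)
  show ?case
    by (intro exI[of _ "\<lambda>x w. \<i> * complex_of_real (v \<bullet> w) * cis (v \<bullet> x)"])
       (auto intro!: cis_has_derivative elem.elem_const elem.elem_cis elem.elem_mult)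
next
  case (elem_flat P v b)
  have "((\<lambda>x. complex_of_real (flat P (v \<bullet> x + b))) has_derivative
      (\<lambda>w. complex_of_real (v \<bullet> w) * complex_of_real (flat ([:0, 0, 1:] * (P - pderiv P)) (v \<bullet> x
        + b)))) (at x)" for x
  proof -
    have "((\<lambda>x. v \<bullet> x + b) has_derivative (\<lambda>w. v \<bullet> w)) (at x)"
      by (auto intro!: derivative_eq_intros)
    from has_derivative_of_real[OF DERIV_compose_FDERIV[OF flat_has_derivative this], where 'a=complex]
    show ?thesis by (simp only: of_real_mult)
  qed
  then show ?case
    by (intro exI[of _ "\<lambda>x w. complex_of_real (v \<bullet> w)
        * complex_of_real (flat ([:0, 0, 1:] * (P - pderiv P)) (v \<bullet> x + b))"])
       (auto intro!: elem.elem_const elem.elem_flat elem.elem_mult)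
next
  case (elem_add f g)
  then obtain f' g' where "\<forall>x. (f has_derivative f' x) (at x)" "\<forall>v. (\<lambda>x. f' x v) \<in> elem"
    "\<forall>x. (g has_derivative g' x) (at x)" "\<forall>v. (\<lambda>x. g' x v) \<in> elem"
    by metis
  then show ?case
    by (intro exI[of _ "\<lambda>x v. f' x v + g' x v"])
       (auto intro!: derivative_intros elem.elem_add)
next
  case (elem_mult f g)
  then obtain f' g' where "\<forall>x. (f has_derivative f' x) (at x)" "\<forall>v. (\<lambda>x. f' x v) \<in> elem"
    "\<forall>x. (g has_derivative g' x) (at x)" "\<forall>v. (\<lambda>x. g' x v) \<in> elem"
    by metis
  with elem_mult.hyps show ?case
    by (intro exI[of _ "\<lambda>x v. f x * g' x v + f' x v * g x"])
       (auto intro!: derivative_intros elem.elem_add elem.elem_mult)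
qed

lemma elem_has_derivative:
  assumes "f \<in> elem"
  shows "(f has_derivative frechet_derivative f (at x)) (at x)"
proof -
  have "f differentiable at x"
    using elem_derivative[OF assms] unfolding differentiable_def by blast
  then show ?thesis by (simp add: frechet_derivative_works)
qed

lemma elem_frechet_derivative:
  assumes "f \<in> elem"
  shows "(\<lambda>x. frechet_derivative f (at x) v) \<in> elem"
proof -
  obtain f' where f': "\<forall>x. (f has_derivative f' x) (at x)" "\<forall>v. (\<lambda>x. f' x v) \<in> elem"
    using elem_derivative[OF assms] by blast
  then have "frechet_derivative f (at x) = f' x" for x
    using frechet_derivative_at[of f "f' x" x] by simp
  with f' show ?thesis by simp
qed

lemma elem_continuous: "f \<in> elem \<Longrightarrow> continuous_on UNIV f"
  by (rule has_derivative_continuous_on[OF has_derivative_at_withinI[OF elem_has_derivative]])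

definition test :: "('a::euclidean_space \<Rightarrow> complex) set" where
  "test = {f \<in> elem. \<exists>\<rho>. \<forall>x. \<rho> < norm x \<longrightarrow> f x = 0}"

lemma test_elem: "f \<in> test \<Longrightarrow> f \<in> elem"
  by (simp add: test_def)

lemma test_mult: "f \<in> elem \<Longrightarrow> g \<in> test \<Longrightarrow> (\<lambda>x. f x * g x) \<in> test"
  unfolding test_def by (auto intro: elem_mult)

lemma has_derivative_zero_outside:
  fixes f :: "'a::euclidean_space \<Rightarrow> 'b::real_normed_vector"
  assumes "\<And>x. \<rho> < norm x \<Longrightarrow> f x = 0" "(f has_derivative f') (at x)" "\<rho> < norm x"
  shows "f' = (\<lambda>_. 0)"
proof -
  have "((\<lambda>_. 0) has_derivative (\<lambda>_. 0 :: 'b)) (at x)" by simp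
  then have "(f has_derivative (\<lambda>_. 0)) (at x)"
    by (rule has_derivative_transform_within_open[where s="- cball 0 \<rho>"])
       (use assms in auto)
  with assms(2) show ?thesis by (rule has_derivative_unique)
qed

lemma test_frechet_derivative:
  assumes "f \<in> test"
  shows "(\<lambda>x. frechet_derivative f (at x) v) \<in> test"
proof -
  obtain \<rho> where r: "\<And>x. \<rho> < norm x \<Longrightarrow> f x = 0" and f: "f \<in> elem"
    using assms unfolding test_def by blast
  have "frechet_derivative f (at x) v = 0" if "\<rho> < norm x" for x
    using has_derivative_zero_outside[OF r elem_has_derivative[OF f] that] by simp
  then show ?thesis
    unfolding test_def using elem_frechet_derivative[OF f] by blast
qed

section \<open>Integration by parts and decay of Fourier integrals\<close>

lemma bounded_compact_support:
  fixes f :: "'a::euclidean_space \<Rightarrow> 'b::real_normed_vector"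
  assumes "continuous_on UNIV f" "\<And>x. \<rho> < norm x \<Longrightarrow> f x = 0"
  obtains B where "0 \<le> B" "\<And>x. norm (f x) \<le> B"
proof -
  have "compact (f ` cball 0 \<rho>)"
    by (intro compact_continuous_image continuous_on_subset[OF assms(1)]) auto
  then obtain B where B: "\<forall>y\<in>f ` cball 0 \<rho>. norm y \<le> B"
    using compact_imp_bounded bounded_iff by metis
  have "norm (f x) \<le> max B 0" for x
    using B assms(2)[of x] by (cases "norm x \<le> \<rho>") (auto simp: le_max_iff_disj)
  then show ?thesis by (intro that[of "max B 0"]) auto
qed

lemma integrable_compact_support:
  fixes f :: "'a::euclidean_space \<Rightarrow> 'b::{banach, second_countable_topology}"
  assumes "continuous_on UNIV f" "\<And>x. \<rho> < norm x \<Longrightarrow> f x = 0"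
  shows "integrable lborel f"
proof -
  have "integrable lborel (\<lambda>x. indicator (cball 0 \<rho>) x *\<^sub>R f x)"
    by (rule borel_integrable_compact) (auto intro: continuous_on_subset[OF assms(1)])
  also have "(\<lambda>x. indicator (cball 0 \<rho>) x *\<^sub>R f x) = f"
    using assms(2) by (auto simp: fun_eq_iff indicator_def)
  finally show ?thesis .
qed

lemma
  assumes "f \<in> test"
  shows test_integrable: "integrable lborel f"
    and test_bounded: "\<exists>B\<ge>0. \<forall>x. norm (f x) \<le> B"
proof -
  obtain \<rho> where r: "\<And>x. \<rho> < norm x \<Longrightarrow> f x = 0" and f: "f \<in> elem"
    using assms unfolding test_def by blast
  show "integrable lborel f"
    by (rule integrable_compact_support[OF elem_continuous[OF f] r])
  obtain B where "0 \<le> B" "\<And>x. norm (f x) \<le> B"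
    using bounded_compact_support[OF elem_continuous[OF f] r] by metis
  then show "\<exists>B\<ge>0. \<forall>x. norm (f x) \<le> B" by blast
qed

text \<open>By translation invariance every difference quotient of \<open>F\<close> in the direction
  \<open>e\<close> has integral 0, and dominated convergence passes to the derivative.\<close>

lemma integral_directional_derivative:
  fixes F :: "'a::euclidean_space \<Rightarrow> complex"
  assumes d: "\<And>x. (F has_derivative F' x) (at x)"
    and c: "continuous_on UNIV (\<lambda>x. F' x e)"
    and s: "\<And>x. \<rho> < norm x \<Longrightarrow> F x = 0"
  shows "(LINT x|lborel. F' x e) = 0"
proof -
  have cF: "continuous_on UNIV F"
    by (rule has_derivative_continuous_on[OF has_derivative_at_withinI[OF d]])
  have s': "F' x e = 0" if "\<rho> < norm x" for x
    using has_derivative_zero_outside[OF s d that] by simp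
  obtain B where B: "0 \<le> B" "\<And>x. norm (F' x e) \<le> B"
    using bounded_compact_support[OF c s'] by metis
  have [measurable]: "F \<in> borel_measurable borel" "(\<lambda>x. F' x e) \<in> borel_measurable borel"
    using cF c by (auto intro: borel_measurable_continuous_onI)
  have iF: "integrable lborel F" by (rule integrable_compact_support[OF cF s])
  let ?h = "\<lambda>k. inverse (real (Suc k))"
  let ?D = "\<lambda>k x. (F (x + ?h k *\<^sub>R e) - F x) /\<^sub>R ?h k"
  \<comment> \<open>The mean value inequality bounds all difference quotients by \<open>B\<close>,
    uniformly in the step.\<close>
  have mv: "norm (F (x + t *\<^sub>R e) - F x) \<le> B * t" if "0 \<le> t" for x t
  proof -
    have "norm (F (x + t *\<^sub>R e) - F (x + 0 *\<^sub>R e)) \<le> B * norm (t - 0)"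
    proof (rule differentiable_bound[where S="{0..t}"])
      fix u :: real
      show "((\<lambda>u. F (x + u *\<^sub>R e)) has_derivative (\<lambda>y. F' (x + u *\<^sub>R e) (y *\<^sub>R e))) (at u within {0..t})"
        by (rule has_derivative_compose[OF _ d]) (auto intro!: derivative_eq_intros)
      show "onorm (\<lambda>y. F' (x + u *\<^sub>R e) (y *\<^sub>R e)) \<le> B"
      proof (rule onorm_le)
        fix y
        have "F' (x + u *\<^sub>R e) (y *\<^sub>R e) = y *\<^sub>R F' (x + u *\<^sub>R e) e"
          using d has_derivative_linear linear_scale by blast
        then show "norm (F' (x + u *\<^sub>R e) (y *\<^sub>R e)) \<le> B * norm y"
          using mult_left_mono[OF B(2), of "\<bar>y\<bar>"] by (simp add: mult.commute)
      qed
    qed (use that in auto)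
    then show ?thesis using that by simp
  qed
  have "(\<lambda>k. LINT x|lborel. ?D k x) \<longlonglongrightarrow> (LINT x|lborel. F' x e)"
  proof (rule integral_dominated_convergence)
    \<comment> \<open>The steps are at most 1, so every quotient vanishes beyond this
      radius.\<close>
    let ?r = "\<rho> + norm e"
    show "integrable lborel (\<lambda>x. B * indicator (cball 0 ?r) x :: real)"
      by (intro integrable_mult_right integrable_real_indicator) (auto intro: emeasure_compact_finite[unfolded infinity_ennreal_def])
    show "AE x in lborel. (\<lambda>k. ?D k x) \<longlonglongrightarrow> F' x e"
    proof (rule AE_I2)
      fix x
      have "((\<lambda>u. F (x + u *\<^sub>R e)) has_derivative (\<lambda>y. F' x (y *\<^sub>R e))) (at 0)"
        by (rule has_derivative_compose[of _ "\<lambda>y. y *\<^sub>R e" _ _ F "F' x"])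
           (use d[of x] in \<open>auto intro!: derivative_eq_intros\<close>)
      also have "(\<lambda>y. F' x (y *\<^sub>R e)) = (\<lambda>y. y *\<^sub>R F' x e)"
        using d has_derivative_linear linear_scale by blast
      finally have "((\<lambda>u. norm (F (x + u *\<^sub>R e) - F x - u *\<^sub>R F' x e) / norm u) \<longlongrightarrow> 0) (at 0)"
        by (simp add: has_derivative_at)
      then have "((\<lambda>u. norm ((F (x + u *\<^sub>R e) - F x) /\<^sub>R u - F' x e)) \<longlongrightarrow> 0) (at 0)"
      proof (rule Lim_transform_eventually)
        have "norm (F (x + u *\<^sub>R e) - F x - u *\<^sub>R F' x e) / norm u
            = norm ((F (x + u *\<^sub>R e) - F x) /\<^sub>R u - F' x e)"
          if "u \<noteq> 0" for u
        proof -
          have "(F (x + u *\<^sub>R e) - F x) /\<^sub>R u - F' x e = (F (x + u *\<^sub>R e) - F x - u *\<^sub>R F' x e) /\<^sub>R u"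
            using that by (simp add: scaleR_diff_right)
          then show ?thesis by (simp add: divide_inverse mult.commute)
        qed
        then show "\<forall>\<^sub>F u in at 0. norm (F (x + u *\<^sub>R e) - F x - u *\<^sub>R F' x e) / norm u
            = norm ((F (x + u *\<^sub>R e) - F x) /\<^sub>R u - F' x e)"
          by (simp add: eventually_at_filter)
      qed
      then have "((\<lambda>u. (F (x + u *\<^sub>R e) - F x) /\<^sub>R u) \<longlongrightarrow> F' x e) (at 0)"
        by (simp add: tendsto_norm_zero_iff LIM_zero_iff)
      then show "(\<lambda>k. ?D k x) \<longlonglongrightarrow> F' x e"
        by (rule filterlim_compose)
           (use LIMSEQ_inverse_real_of_nat in \<open>auto simp: filterlim_at\<close>)
    qed
    show "AE x in lborel. norm (?D k x) \<le> B * indicator (cball 0 ?r) x" for k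
    proof (rule AE_I2)
      fix x
      have h: "0 < ?h k" "?h k \<le> 1" by (auto simp: divide_simps)
      show "norm (?D k x) \<le> B * indicator (cball 0 ?r) x"
      proof (cases "norm x \<le> ?r")
        case True
        have "norm (?D k x) \<le> (B * ?h k) / ?h k"
          using mv[of "?h k" x] h by (simp add: divide_inverse mult.commute mult_left_mono)
        with True h show ?thesis by simp
      next
        case False
        have "norm x \<le> norm (x + ?h k *\<^sub>R e) + norm (?h k *\<^sub>R e)"
          using norm_triangle_ineq4[of "x + ?h k *\<^sub>R e" "?h k *\<^sub>R e"] by simp
        also have "norm (?h k *\<^sub>R e) \<le> norm e"
          using h mult_right_mono[OF h(2), of "norm e"] by simp
        finally have "\<rho> < norm (x + ?h k *\<^sub>R e)" using False by linarith
        moreover have "\<rho> < norm x" using False norm_ge_zero[of e] by linarith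
        ultimately show ?thesis using s False by simp
      qed
    qed
  qed auto
  moreover have "(LINT x|lborel. ?D k x) = 0" for k
  proof -
    have i2: "integrable lborel (\<lambda>x. F (x + ?h k *\<^sub>R e))"
      using lborel_integrable_affine[OF iF, of 1 "?h k *\<^sub>R e"] by (simp add: add.commute)
    have "(LINT x|lborel. F (x + ?h k *\<^sub>R e)) = (LINT x|lborel. F x)"
      using lborel_integral_affine[OF iF, of 1 "?h k *\<^sub>R e"] by (simp add: add.commute)
    then show ?thesis
      using Bochner_Integration.integral_diff[OF i2 iF] by simp
  qed
  ultimately have "(\<lambda>k::nat. 0) \<longlonglongrightarrow> (LINT x|lborel. F' x e)"
    by (simp only:)
  then show ?thesis
    by (simp add: LIMSEQ_const_iff)
qed

text \<open>Integration by parts: the derivative of the product of the character with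
  \<open>g\<close> has integral 0.\<close>

lemma osc_derivative:
  fixes g :: "'a::euclidean_space \<Rightarrow> complex"
  assumes d: "\<And>x. (g has_derivative g' x) (at x)"
    and c: "continuous_on UNIV (\<lambda>x. g' x e)"
    and s: "\<And>x. \<rho> < norm x \<Longrightarrow> g x = 0"
  shows "osc (\<lambda>\<xi>. g' \<xi> e) x = - \<i> * complex_of_real (x \<bullet> e) * osc g x"
proof -
  have cg: "continuous_on UNIV g"
    by (rule has_derivative_continuous_on[OF has_derivative_at_withinI[OF d]])
  have s': "g' x e = 0" if "\<rho> < norm x" for x
    using has_derivative_zero_outside[OF s d that] by simp
  have i: "integrable lborel (\<lambda>\<xi>. cis (x \<bullet> \<xi>) * g \<xi>)" "integrable lborel (\<lambda>\<xi>. cis (x \<bullet> \<xi>) * g' \<xi> e)"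
    by (intro integrable_cis_mult integrable_compact_support[of _ \<rho>] cg c s s'; measurable)+
  define F' where "F' \<xi> w = cis (x \<bullet> \<xi>) * g' \<xi> w + \<i> * complex_of_real (x \<bullet> w) * cis (x \<bullet> \<xi>) * g \<xi>" for \<xi> w
  have "(LINT \<xi>|lborel. F' \<xi> e) = 0"
  proof (rule integral_directional_derivative)
    fix \<xi>
    from has_derivative_mult[OF cis_has_derivative d]
    show "((\<lambda>\<xi>. cis (x \<bullet> \<xi>) * g \<xi>) has_derivative F' \<xi>) (at \<xi>)"
      unfolding F'_def by simp
  next
    show "continuous_on UNIV (\<lambda>\<xi>. F' \<xi> e)"
      unfolding F'_def by (intro continuous_intros cg c)
    show "cis (x \<bullet> \<xi>) * g \<xi> = 0" if "\<rho> < norm \<xi>" for \<xi>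
      using s[OF that] by simp
  qed
  also have "(\<lambda>\<xi>. F' \<xi> e) = (\<lambda>\<xi>. cis (x \<bullet> \<xi>) * g' \<xi> e + (\<i> * complex_of_real (x \<bullet> e)) * (cis (x \<bullet> \<xi>) * g \<xi>))"
    by (simp add: F'_def mult_ac)
  also have "(LINT \<xi>|lborel. cis (x \<bullet> \<xi>) * g' \<xi> e + (\<i> * complex_of_real (x \<bullet> e)) * (cis (x \<bullet> \<xi>) * g \<xi>))
     = osc (\<lambda>\<xi>. g' \<xi> e) x + (\<i> * complex_of_real (x \<bullet> e)) * osc g x"
    unfolding osc_def
    by (subst Bochner_Integration.integral_add) (use i in \<open>auto intro!: integrable_mult_right\<close>)
  finally show ?thesis
    by (simp add: eq_neg_iff_add_eq_0)
qed

text \<open>The second order Taylor bound for the character leaves an error of at most the second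
  moment \<open>M\<close> of the amplitude times \<open>(norm v)\<^sup>2\<close>; the moment is
  finite by compact support.\<close>

lemma osc_has_derivative:
  fixes h :: "'a::euclidean_space \<Rightarrow> complex"
  assumes "h \<in> test"
  shows "(osc h has_derivative (\<lambda>v. osc (\<lambda>\<xi>. (\<i> * complex_of_real (v \<bullet> \<xi>)) * h \<xi>) x)) (at x)"
proof -
  have t: "(\<lambda>\<xi>. (\<i> * complex_of_real (v \<bullet> \<xi>)) * h \<xi>) \<in> test" for v
    by (intro test_mult elem.intros assms)
  obtain \<rho> where r: "\<And>x. \<rho> < norm x \<Longrightarrow> h x = 0" and c: "continuous_on UNIV h"
    using assms elem_continuous unfolding test_def by blast
  define M where "M = (LINT \<xi>|lborel. (norm \<xi>)\<^sup>2 * norm (h \<xi>))"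
  have iM: "integrable lborel (\<lambda>\<xi>. (norm \<xi>)\<^sup>2 * norm (h \<xi>))"
    by (rule integrable_compact_support[of _ \<rho>]) (auto intro!: continuous_intros c r)
  have i: "integrable lborel (\<lambda>\<xi>. cis (y \<bullet> \<xi>) * h \<xi>)" for y
    by (intro integrable_cis_mult test_integrable assms) simp
  have i': "integrable lborel (\<lambda>\<xi>. cis (y \<bullet> \<xi>) * ((\<i> * complex_of_real (v \<bullet> \<xi>)) * h \<xi>))" for y v
    by (intro integrable_cis_mult test_integrable t) simp
  let ?L = "\<lambda>v. osc (\<lambda>\<xi>. (\<i> * complex_of_real (v \<bullet> \<xi>)) * h \<xi>) x"
  have lin: "linear ?L"
  proof (rule linearI)
    fix v w :: 'a
    show "?L (v + w) = ?L v + ?L w"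
      unfolding osc_def by (subst Bochner_Integration.integral_add[OF i' i', symmetric]) (simp add: algebra_simps inner_add_left)
  next
    fix k :: real and v :: 'a
    have "?L (k *\<^sub>R v) = (LINT \<xi>|lborel. complex_of_real k
        * (cis (x \<bullet> \<xi>) * ((\<i> * complex_of_real (v \<bullet> \<xi>)) * h \<xi>)))"
      unfolding osc_def by (simp add: mult_ac)
    then show "?L (k *\<^sub>R v) = k *\<^sub>R ?L v"
      unfolding osc_def by (simp add: scaleR_conv_of_real)
  qed
  have bd: "norm (osc h (x + v) - osc h x - ?L v) \<le> M * (norm v)\<^sup>2" for v
  proof -
    have "osc h (x + v) - osc h x - ?L v =
      (LINT \<xi>|lborel. cis ((x + v) \<bullet> \<xi>) * h \<xi> - cis (x \<bullet> \<xi>) * h \<xi> - cis (x \<bullet> \<xi>)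
        * ((\<i> * complex_of_real (v \<bullet> \<xi>)) * h \<xi>))"
      unfolding osc_def by (subst Bochner_Integration.integral_diff | use i i' in simp)+
    also have "norm \<dots> \<le> (LINT \<xi>|lborel. (norm v)\<^sup>2 * ((norm \<xi>)\<^sup>2 * norm (h \<xi>)))"
    proof (rule Bochner_Integration.integral_norm_bound_integral)
      fix \<xi> :: 'a
      have "cmod (iexp (v \<bullet> \<xi>) - (\<Sum>k\<le>1. (\<i> * complex_of_real (v \<bullet> \<xi>)) ^ k / fact k))
          \<le> \<bar>v \<bullet> \<xi>\<bar> ^ Suc 1 / fact (Suc 1)"
        by (rule iexp_approx1)
      then have "cmod (cis (v \<bullet> \<xi>) - 1 - \<i> * complex_of_real (v \<bullet> \<xi>)) \<le> \<bar>v \<bullet> \<xi>\<bar>\<^sup>2 / 2"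
        by (simp add: cis_conv_exp power2_eq_square diff_diff_eq)
      also have "\<dots> \<le> \<bar>v \<bullet> \<xi>\<bar>\<^sup>2" by simp
      also have "\<dots> \<le> (norm v * norm \<xi>)\<^sup>2"
        by (intro power_mono Cauchy_Schwarz_ineq2) simp
      finally have *: "cmod (cis (v \<bullet> \<xi>) - 1 - \<i> * complex_of_real (v \<bullet> \<xi>)) \<le> (norm v)\<^sup>2 * (norm \<xi>)\<^sup>2"
        by (simp add: power_mult_distrib)
      have "cis ((x + v) \<bullet> \<xi>) * h \<xi> - cis (x \<bullet> \<xi>) * h \<xi> - cis (x \<bullet> \<xi>) * ((\<i> * complex_of_real (v \<bullet> \<xi>)) * h \<xi>)
         = cis (x \<bullet> \<xi>) * (cis (v \<bullet> \<xi>) - 1 - \<i> * complex_of_real (v \<bullet> \<xi>)) * h \<xi>"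
        by (simp add: inner_add_left cis_mult[symmetric] algebra_simps)
      then show "norm (cis ((x + v) \<bullet> \<xi>) * h \<xi> - cis (x \<bullet> \<xi>) * h \<xi> - cis (x \<bullet> \<xi>)
          * ((\<i> * complex_of_real (v \<bullet> \<xi>)) * h \<xi>))
         \<le> (norm v)\<^sup>2 * ((norm \<xi>)\<^sup>2 * norm (h \<xi>))"
        using mult_right_mono[OF *, of "norm (h \<xi>)"] by (simp add: norm_mult mult.assoc)
    qed (use i i' iM in auto)
    also have "\<dots> = M * (norm v)\<^sup>2"
      by (simp add: M_def)
    finally show ?thesis .
  qed
  have "((\<lambda>v. norm (osc h (x + v) - osc h x - ?L v) / norm v) \<longlongrightarrow> 0) (at 0)"
  proof (rule Lim_null_comparison)
    show "\<forall>\<^sub>F v in at 0. norm (norm (osc h (x + v) - osc h x - ?L v) / norm v) \<le> M * norm v"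
      using bd by (auto simp: eventually_at_filter divide_simps power2_eq_square mult.assoc intro!: always_eventually)
    show "((\<lambda>v. M * norm v) \<longlongrightarrow> 0) (at (0::'a))"
      by (auto intro!: tendsto_eq_intros)
  qed
  then show ?thesis
    using lin by (simp add: has_derivative_at linear_conv_bounded_linear)
qed

text \<open>Each derivative multiplies the amplitude by a linear factor, which stays in
  \<open>test\<close>. Smoothness and decay of all derivatives thus reduce to the same facts about
  \<open>osc h\<close> for arbitrary \<open>h\<close> in \<open>test\<close>.\<close>

lemma iter_deriv_osc:
  assumes "h \<in> test"
  shows "\<exists>h'\<in>test. iter_deriv vs (\<lambda>x. c * osc h x) = (\<lambda>x. c * osc h' x)"
proof (induction vs)
  case Nil
  show ?case using assms by auto
next
  case (Cons v vs)
  then obtain h' where h': "h' \<in> test" "iter_deriv vs (\<lambda>x. c * osc h x) = (\<lambda>x. c * osc h' x)" by blast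
  have "frechet_derivative (\<lambda>x. c * osc h' x) (at x)
      = (\<lambda>v. c * osc (\<lambda>\<xi>. (\<i> * complex_of_real (v \<bullet> \<xi>)) * h' \<xi>) x)" for x
    by (rule sym, rule frechet_derivative_at, rule has_derivative_mult_right, rule osc_has_derivative[OF h'(1)])
  then show ?case
    using h' by (intro bexI[of _ "\<lambda>\<xi>. (\<i> * complex_of_real (v \<bullet> \<xi>)) * h' \<xi>"])
      (auto intro!: test_mult elem.intros)
qed

lemma osc_frechet_derivative:
  assumes "h \<in> test"
  shows "osc (\<lambda>\<xi>. frechet_derivative h (at \<xi>) e) x = - \<i> * complex_of_real (x \<bullet> e) * osc h x"
proof -
  obtain \<rho> where "\<And>x. \<rho> < norm x \<Longrightarrow> h x = 0"
    using assms unfolding test_def by blast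
  then show ?thesis
    by (intro osc_derivative[OF elem_has_derivative] test_elem assms elem_continuous elem_frechet_derivative)
qed

text \<open>Each factor \<open>norm x\<close> is at most the sum of the coordinates, and a
  coordinate is traded for a derivative of the amplitude.\<close>

lemma osc_rapid_decay:
  fixes h :: "'a::euclidean_space \<Rightarrow> complex"
  assumes "h \<in> test"
  shows "\<exists>C. \<forall>x. norm x ^ k * norm (osc h x) \<le> C"
  using assms
proof (induction k arbitrary: h)
  case 0
  then show ?case using norm_osc_le by auto
next
  case (Suc k)
  have "\<forall>b. \<exists>C. \<forall>x. norm x ^ k * norm (osc (\<lambda>\<xi>. frechet_derivative h (at \<xi>) b) x) \<le> C"
    using Suc.IH test_frechet_derivative[OF Suc.prems] by blast
  then obtain C where C: "\<And>b x. norm x ^ k * norm (osc (\<lambda>\<xi>. frechet_derivative h (at \<xi>) b) x) \<le> C b"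
    by metis
  have "norm x ^ Suc k * norm (osc h x) \<le> (\<Sum>b\<in>Basis. C b)" for x
  proof -
    have "norm x ^ Suc k * norm (osc h x) = norm x * (norm x ^ k * norm (osc h x))" by simp
    also have "\<dots> \<le> (\<Sum>b\<in>Basis. \<bar>x \<bullet> b\<bar>) * (norm x ^ k * norm (osc h x))"
      by (intro mult_right_mono norm_le_l1) simp
    also have "\<dots> = (\<Sum>b\<in>Basis. norm x ^ k * norm (osc (\<lambda>\<xi>. frechet_derivative h (at \<xi>) b) x))"
      unfolding osc_frechet_derivative[OF Suc.prems]
        by (simp add: norm_mult sum_distrib_left sum_distrib_right mult_ac)
    also have "\<dots> \<le> (\<Sum>b\<in>Basis. C b)"
      by (intro sum_mono C)
    finally show ?thesis .
  qed
  then show ?case by blast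
qed

lemma schwartz_osc:
  assumes "h \<in> test"
  shows "schwartz (\<lambda>x. c * osc h x)"
  unfolding schwartz_def smooth_def
proof safe
  fix vs :: "'a list" and x
  obtain h' where h': "h' \<in> test" "iter_deriv vs (\<lambda>x. c * osc h x) = (\<lambda>x. c * osc h' x)"
    using iter_deriv_osc[OF assms] by blast
  show "iter_deriv vs (\<lambda>x. c * osc h x) differentiable at x"
    unfolding h' differentiable_def
    using has_derivative_mult_right[OF osc_has_derivative[OF h'(1)]] by blast
next
  fix vs :: "'a list" and k
  obtain h' where h': "h' \<in> test" "iter_deriv vs (\<lambda>x. c * osc h x) = (\<lambda>x. c * osc h' x)"
    using iter_deriv_osc[OF assms] by blast
  obtain C where C: "\<And>x. norm x ^ k * norm (osc h' x) \<le> C"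
    using osc_rapid_decay[OF h'(1)] by blast
  have "norm x ^ k * norm (c * osc h' x) \<le> norm c * C" for x
    using mult_left_mono[OF C, of "norm c" x] by (simp add: norm_mult mult_ac)
  then show "\<exists>C. \<forall>x. norm x ^ k * norm (iter_deriv vs (\<lambda>x. c * osc h x) x) \<le> C"
    unfolding h' by blast
qed

lemma integrable_lborel_inverse_1_plus_square: "integrable lborel (\<lambda>x::real. inverse (1 + x\<^sup>2))"
  using integrable_inverse_1_plus_square by (simp add: set_integrable_def einterval_def)

text \<open>The majorant is a product of one-dimensional functions
  \<open>inverse (1 + y\<^sup>2)\<close>; its reciprocal grows like the power \<open>2 * n\<close>
  of the norm at most, which fixes the order of decay that is used.\<close>

lemma integrable_osc:
  fixes h :: "'a::euclidean_space \<Rightarrow> complex"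
  assumes "h \<in> test"
  shows "integrable lborel (osc h)"
proof -
  have [measurable]: "h \<in> borel_measurable borel"
    using test_integrable[OF assms] borel_measurable_integrable by force
  define n where "n = DIM('a)"
  obtain C0 where C0: "\<And>x. norm (osc h x) \<le> C0"
    using norm_osc_le by blast
  obtain C1 where C1: "\<And>x. norm x ^ (2 * n) * norm (osc h x) \<le> C1"
    using osc_rapid_decay[OF assms] by blast
  let ?W = "\<lambda>x::'a. \<Prod>b\<in>Basis. inverse (1 + (x \<bullet> b)\<^sup>2)"
  have W: "norm (osc h x) \<le> (2 ^ n * (C0 + C1)) * ?W x" for x
  proof -
    have "(\<Prod>b\<in>Basis. 1 + (x \<bullet> b)\<^sup>2) \<le> (\<Prod>b\<in>(Basis::'a set). 1 + (norm x)\<^sup>2)"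
    proof (intro prod_mono conjI add_left_mono)
      fix b :: 'a assume "b \<in> Basis"
      then have "\<bar>x \<bullet> b\<bar>\<^sup>2 \<le> (norm x)\<^sup>2" by (intro power_mono Basis_le_norm) auto
      then show "(x \<bullet> b)\<^sup>2 \<le> (norm x)\<^sup>2" by simp
    qed auto
    also have "\<dots> = (1 + (norm x)\<^sup>2) ^ n" by (simp add: n_def)
    also have "\<dots> \<le> 2 ^ n * (1 + norm x ^ (2 * n))"
    proof (cases "norm x \<le> 1")
      case True
      then have "(1 + (norm x)\<^sup>2) ^ n \<le> 2 ^ n"
        by (intro power_mono) (auto simp: power_le_one)
      then show ?thesis by (simp add: distrib_left add_increasing2)
    next
      case False
      then have "1 \<le> (norm x)\<^sup>2" by (simp add: one_le_power)
      then have "(1 + (norm x)\<^sup>2) ^ n \<le> (2 * (norm x)\<^sup>2) ^ n"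
        by (intro power_mono) auto
      also have "\<dots> = 2 ^ n * norm x ^ (2 * n)"
        by (simp add: power_mult_distrib power_mult)
      finally show ?thesis by (simp add: distrib_left add_increasing)
    qed
    finally have "norm (osc h x) * (\<Prod>b\<in>Basis. 1 + (x \<bullet> b)\<^sup>2)
        \<le> norm (osc h x) * (2 ^ n * (1 + norm x ^ (2 * n)))"
      by (rule mult_left_mono) simp
    also have "\<dots> = 2 ^ n * (norm (osc h x) + norm x ^ (2 * n) * norm (osc h x))"
      by (simp add: algebra_simps)
    also have "\<dots> \<le> 2 ^ n * (C0 + C1)"
      by (intro mult_left_mono add_mono C0 C1) simp
    finally have "norm (osc h x) * (\<Prod>b\<in>Basis. 1 + (x \<bullet> b)\<^sup>2) \<le> 2 ^ n * (C0 + C1)" .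
    moreover have "0 < (\<Prod>b\<in>Basis. 1 + (x \<bullet> b)\<^sup>2)"
      by (intro prod_pos) (auto simp: add_pos_nonneg)
    ultimately show ?thesis
      by (simp add: prod_inversef[unfolded o_def] divide_inverse[symmetric] pos_le_divide_eq)
  qed
  show ?thesis
  proof (rule Bochner_Integration.integrable_bound)
    show "integrable lborel (\<lambda>x. (2 ^ n * (C0 + C1)) * ?W x)"
      by (intro integrable_mult_right lborel_integrable_prod integrable_lborel_inverse_1_plus_square)
    show "AE x in lborel. norm (osc h x) \<le> norm ((2 ^ n * (C0 + C1)) * ?W x)"
      using W by (auto intro: order_trans[OF _ abs_ge_self])
  qed simp
qed

lemma inv_fourier_osc: "inv_fourier h = (\<lambda>x. complex_of_real (1 / (2 * pi) ^ DIM('a))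
    * osc h (x::'a::euclidean_space))"
  by (simp add: fun_eq_iff inv_fourier_def osc_def)

text \<open>It gives the example a Fourier transform that is known exactly, so that its support and
  its wave packets can be read off the amplitude.\<close>

lemma fourier_inv_fourier:
  fixes h :: "'a::euclidean_space \<Rightarrow> complex"
  assumes "h \<in> test"
  shows "fourier (inv_fourier h) = h"
proof
  fix \<eta> :: 'a
  obtain B where B: "\<And>\<xi>. norm (h \<xi>) \<le> B" using test_bounded[OF assms] by blast
  have c: "isCont h \<eta>" using elem_continuous[OF test_elem[OF assms]]
    by (simp add: continuous_on_eq_continuous_at)
  have "fourier (inv_fourier h) \<eta> = (LINT x|lborel. complex_of_real (1 / (2 * pi) ^ DIM('a))
      * (cis (- (\<eta> \<bullet> x)) * osc h x))"
    unfolding fourier_def inv_fourier_osc by (simp only: inner_commute mult_ac)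
  also have "\<dots> = complex_of_real (1 / (2 * pi) ^ DIM('a)) * (LINT x|lborel. cis (- (\<eta> \<bullet> x)) * osc h x)"
    by (rule integral_mult_right_zero)
  also have "\<dots> = h \<eta>"
    unfolding osc_inversion[OF test_integrable[OF assms] B c integrable_osc[OF assms]] by simp
  finally show "fourier (inv_fourier h) \<eta> = h \<eta>" .
qed

lemma schwartz_inv_fourier: "h \<in> test \<Longrightarrow> schwartz (inv_fourier h)"
  unfolding inv_fourier_osc by (rule schwartz_osc)

section \<open>Random signs in a Hilbert space\<close>

lemma cosh_even_sums: "(\<lambda>n. x ^ (2 * n) / fact (2 * n)) sums cosh (x::real)"
proof -
  have "(\<lambda>n. \<Sum>k\<in>{n * 2..<n * 2 + 2}. if even k then x ^ k /\<^sub>R fact k else 0) sums cosh x"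
    by (rule sums_group[OF cosh_converges]) simp
  also have "(\<lambda>n. \<Sum>k\<in>{n * 2..<n * 2 + 2}. if even k then x ^ k /\<^sub>R fact k else 0)
      = (\<lambda>n. x ^ (2 * n) / fact (2 * n))"
  proof
    fix n
    have "{n * 2..<n * 2 + 2} = {2 * n, Suc (2 * n)}" by auto
    then show "(\<Sum>k\<in>{n * 2..<n * 2 + 2}. if even k then x ^ k /\<^sub>R fact k else 0) = x ^ (2 * n) / fact (2 * n)"
      by (simp add: divide_inverse mult.commute del: fact_Suc)
  qed
  finally show ?thesis .
qed

text \<open>Comparison of the power series term by term, by
  \<open>2 ^ n * fact n \<le> fact (2 * n)\<close>.\<close>

lemma cosh_le_exp: "cosh (x::real) \<le> exp (x\<^sup>2 / 2)"
proof (rule sums_le[OF _ cosh_even_sums])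
  show "(\<lambda>n. (x\<^sup>2 / 2) ^ n /\<^sub>R fact n) sums exp (x\<^sup>2 / 2)"
    by (rule exp_converges)
  have f: "2 ^ n * fact n \<le> (fact (2 * n) :: real)" for n
  proof (induction n)
    case (Suc n)
    have "2 ^ Suc n * fact (Suc n) = (2 * real (Suc n)) * (2 ^ n * fact n)"
      by (simp add: algebra_simps)
    also have "\<dots> \<le> (2 * real (Suc n) * real (2 * n + 1)) * fact (2 * n)"
      by (intro mult_mono Suc) auto
    also have "\<dots> = fact (2 * Suc n)"
      by (simp add: algebra_simps)
    finally show ?case .
  qed simp
  fix n
  have "x ^ (2 * n) / fact (2 * n) \<le> x ^ (2 * n) / (2 ^ n * fact n)"
    by (intro divide_left_mono f mult_pos_pos) (auto simp: power_mult)
  also have "\<dots> = (x\<^sup>2 / 2) ^ n /\<^sub>R fact n"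
    by (simp add: power_divide power_mult divide_simps)
  finally show "x ^ (2 * n) / fact (2 * n) \<le> (x\<^sup>2 / 2) ^ n /\<^sub>R fact n" .
qed

text \<open>The pair \<open>(s, t)\<close> majorizes \<open>(p, q)\<close>, and powers are convex on
  the nonnegative numbers.\<close>

lemma power_sum_majorization:
  fixes p q s t :: real
  assumes "p + q = s + t" "0 \<le> p" "0 \<le> q" "0 \<le> t" "p \<le> s" "q \<le> s"
  shows "p ^ n + q ^ n \<le> s ^ n + t ^ n"
proof (induction n)
  case (Suc n)
  have "t \<le> q" using assms by linarith
  \<comment> \<open>The first product is nonnegative by the induction hypothesis, the other two
    because \<open>p \<le> s\<close>, \<open>t \<le> q\<close> and \<open>q \<le> s\<close>.
    Expanded, the sum is the claim for the next exponent.\<close>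
  then have "0 \<le> p * (s ^ n + t ^ n - p ^ n - q ^ n) + (s - p) * (s ^ n - q ^ n) + (s - q) * (q ^ n - t ^ n)"
    using assms Suc by (intro add_nonneg_nonneg mult_nonneg_nonneg) (auto intro: power_mono)
  also have "\<dots> = (s * s ^ n + t * t ^ n - p * p ^ n - q * q ^ n) - (s + t - p - q) * t ^ n"
    by (simp add: algebra_simps)
  also have "s + t - p - q = 0" using assms by simp
  finally show ?case by simp
qed simp

text \<open>As a function of the square of its argument, \<open>cosh\<close> is a power series with
  nonnegative coefficients, so the majorization of \<open>(p, q)\<close> by
  \<open>((a + b)\<^sup>2, (a - b)\<^sup>2)\<close> acts on every term.\<close>

lemma cosh_sqrt_majorization:
  fixes p q a b :: real
  assumes "p + q = 2 * a\<^sup>2 + 2 * b\<^sup>2" "0 \<le> p" "0 \<le> q" "p \<le> (a + b)\<^sup>2" "q \<le> (a + b)\<^sup>2"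
  shows "cosh (sqrt p) + cosh (sqrt q) \<le> 2 * cosh a * cosh b"
proof -
  have "cosh (sqrt p) + cosh (sqrt q) \<le> cosh (a + b) + cosh (a - b)"
  proof (rule sums_le)
    show "(\<lambda>n. sqrt p ^ (2 * n) / fact (2 * n) + sqrt q ^ (2 * n) / fact (2 * n)) sums (cosh (sqrt p)
        + cosh (sqrt q))"
      by (intro sums_add cosh_even_sums)
    show "(\<lambda>n. (a + b) ^ (2 * n) / fact (2 * n) + (a - b) ^ (2 * n) / fact (2 * n)) sums (cosh (a + b)
        + cosh (a - b))"
      by (intro sums_add cosh_even_sums)
    fix n
    have "p ^ n + q ^ n \<le> ((a + b)\<^sup>2) ^ n + ((a - b)\<^sup>2) ^ n"
      by (rule power_sum_majorization) (use assms sum_squares_bound[of a b] in \<open>auto simp: power2_sum power2_diff\<close>)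
    then show "sqrt p ^ (2 * n) / fact (2 * n) + sqrt q ^ (2 * n) / fact (2 * n)
       \<le> (a + b) ^ (2 * n) / fact (2 * n) + (a - b) ^ (2 * n) / fact (2 * n)"
      using assms(2,3) unfolding power_mult
      by (simp add: add_divide_distrib[symmetric] divide_right_mono)
  qed
  also have "\<dots> = 2 * cosh a * cosh b"
    by (simp add: cosh_add cosh_diff)
  finally show ?thesis .
qed

section \<open>Squared L2 norms: parallelogram identity and Minkowski's inequality\<close>

definition sq_integrable :: "'a measure \<Rightarrow> ('a \<Rightarrow> complex) \<Rightarrow> bool" where
  "sq_integrable M u \<longleftrightarrow> u \<in> borel_measurable M \<and> integrable M (\<lambda>x. (cmod (u x))\<^sup>2)"

definition mass :: "'a measure \<Rightarrow> ('a \<Rightarrow> complex) \<Rightarrow> real" where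
  "mass M u = (LINT x|M. (cmod (u x))\<^sup>2)"

lemma mass_nonneg [simp]: "0 \<le> mass M u"
  by (simp add: mass_def)

lemma mass_zero [simp]: "mass M (\<lambda>_. 0) = 0"
  by (simp add: mass_def)

lemma cmod_add_square_le: "(cmod (a + b))\<^sup>2 \<le> (1 + s) * (cmod a)\<^sup>2 + (1 + 1 / s) * (cmod b)\<^sup>2"
  if "0 < s" for s :: real
proof -
  have "0 \<le> (s * cmod a - cmod b)\<^sup>2 / s" using that by simp
  also have "\<dots> = s * (cmod a)\<^sup>2 - 2 * cmod a * cmod b + (cmod b)\<^sup>2 / s"
    using that by (simp add: power2_eq_square field_simps)
  finally have "2 * cmod a * cmod b \<le> s * (cmod a)\<^sup>2 + (cmod b)\<^sup>2 / s" by simp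
  moreover have "(cmod (a + b))\<^sup>2 \<le> (cmod a + cmod b)\<^sup>2"
    by (intro power_mono norm_triangle_ineq) simp
  ultimately show ?thesis
    by (simp add: power2_sum algebra_simps)
qed

lemma sq_integrable_zero [simp, intro]: "sq_integrable M (\<lambda>_. 0)"
  by (simp add: sq_integrable_def)

lemma sq_integrable_add:
  assumes "sq_integrable M u" "sq_integrable M v"
  shows "sq_integrable M (\<lambda>x. u x + v x)"
proof -
  have [measurable]: "u \<in> borel_measurable M" "v \<in> borel_measurable M"
    using assms by (auto simp: sq_integrable_def)
  have "integrable M (\<lambda>x. (cmod (u x + v x))\<^sup>2)"
  proof (rule Bochner_Integration.integrable_bound)
    show "integrable M (\<lambda>x. 2 * (cmod (u x))\<^sup>2 + 2 * (cmod (v x))\<^sup>2)"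
      using assms by (auto simp: sq_integrable_def)
    show "AE x in M. norm ((cmod (u x + v x))\<^sup>2) \<le> norm (2 * (cmod (u x))\<^sup>2 + 2 * (cmod (v x))\<^sup>2)"
      using cmod_add_square_le[of 1] by (auto simp: abs_of_nonneg)
  qed measurable
  then show ?thesis by (simp add: sq_integrable_def)
qed

lemma sq_integrable_cmult:
  assumes "sq_integrable M u"
  shows "sq_integrable M (\<lambda>x. c * u x)"
  using assms by (auto simp: sq_integrable_def norm_mult power_mult_distrib)

lemma mass_cmult: "mass M (\<lambda>x. c * u x) = (cmod c)\<^sup>2 * mass M u"
  by (simp add: mass_def norm_mult power_mult_distrib)

lemma sq_integrable_sum:
  "(\<And>i. i \<in> I \<Longrightarrow> sq_integrable M (u i)) \<Longrightarrow> sq_integrable M (\<lambda>x. \<Sum>i\<in>I. c i * u i x)"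
proof (induction I rule: infinite_finite_induct)
  case (insert i I)
  then have "sq_integrable M (\<lambda>x. c i * u i x + (\<Sum>i\<in>I. c i * u i x))"
    by (intro sq_integrable_add sq_integrable_cmult) auto
  with insert show ?case by simp
qed auto

lemma sq_integrable_diff:
  "sq_integrable M u \<Longrightarrow> sq_integrable M v \<Longrightarrow> sq_integrable M (\<lambda>x. u x - v x)"
  using sq_integrable_add[OF _ sq_integrable_cmult[of M v "-1"]] by simp

lemma mass_parallelogram:
  assumes "sq_integrable M u" "sq_integrable M v"
  shows "mass M (\<lambda>x. u x - v x) + mass M (\<lambda>x. u x + v x) = 2 * mass M u + 2 * mass M v"
proof -
  have p: "(cmod (a - b))\<^sup>2 + (cmod (a + b))\<^sup>2 = 2 * (cmod a)\<^sup>2 + 2 * (cmod b)\<^sup>2" for a b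
    unfolding cmod_power2 by (simp add: power2_eq_square algebra_simps)
  have "mass M (\<lambda>x. u x - v x) + mass M (\<lambda>x. u x + v x)
      = (LINT x|M. (cmod (u x - v x))\<^sup>2 + (cmod (u x + v x))\<^sup>2)"
    unfolding mass_def using sq_integrable_diff[OF assms] sq_integrable_add[OF assms]
    by (simp add: sq_integrable_def)
  also have "\<dots> = 2 * mass M u + 2 * mass M v"
    unfolding p mass_def using assms by (simp add: sq_integrable_def)
  finally show ?thesis .
qed

lemma mass_add_le:
  assumes "sq_integrable M u" "sq_integrable M v" "0 < s"
  shows "mass M (\<lambda>x. u x + v x) \<le> (1 + s) * mass M u + (1 + 1 / s) * mass M v"
proof -
  have "mass M (\<lambda>x. u x + v x) \<le> (LINT x|M. (1 + s) * (cmod (u x))\<^sup>2 + (1 + 1 / s) * (cmod (v x))\<^sup>2)"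
    unfolding mass_def
    by (rule integral_mono)
       (use assms sq_integrable_add[OF assms(1,2)] cmod_add_square_le[OF assms(3)] in \<open>auto simp: sq_integrable_def\<close>)
  also have "\<dots> = (1 + s) * mass M u + (1 + 1 / s) * mass M v"
    unfolding mass_def using assms by (simp add: sq_integrable_def)
  finally show ?thesis .
qed

text \<open>In the weighted inequality \<open>mass_add_le\<close> the best weight is
  \<open>b / a\<close>. Adding \<open>e\<close> to both norms avoids a division by 0, and then
  \<open>e\<close> tends to 0.\<close>

lemma mass_minkowski:
  assumes u: "sq_integrable M u" and v: "sq_integrable M v"
  shows "mass M (\<lambda>x. u x + v x) \<le> (sqrt (mass M u) + sqrt (mass M v))\<^sup>2"
proof -
  define a b where "a = sqrt (mass M u)" and "b = sqrt (mass M v)"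
  have ab: "0 \<le> a" "0 \<le> b" "mass M u = a\<^sup>2" "mass M v = b\<^sup>2"
    by (auto simp: a_def b_def)
  have *: "mass M (\<lambda>x. u x + v x) \<le> (a + b + 2 * e)\<^sup>2" if "0 < e" for e
  proof -
    have "mass M (\<lambda>x. u x + v x) \<le> (1 + (b + e) / (a + e)) * mass M u + (1 + 1 / ((b + e) / (a + e)))
        * mass M v"
      using that ab by (intro mass_add_le u v) auto
    also have "\<dots> \<le> (1 + (b + e) / (a + e)) * (a + e)\<^sup>2 + (1 + 1 / ((b + e) / (a + e))) * (b + e)\<^sup>2"
      using that ab unfolding ab(3,4) by (intro add_mono mult_left_mono power_mono) auto
    also have "\<dots> = (a + b + 2 * e)\<^sup>2"
    proof -
      have *: "(1 + Y / X) * X\<^sup>2 + (1 + 1 / (Y / X)) * Y\<^sup>2 = (X + Y)\<^sup>2" if "X \<noteq> 0" "Y \<noteq> 0" for X Y :: real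
        using that by (simp add: power2_eq_square field_simps)
      have "a + e \<noteq> 0" "b + e \<noteq> 0" using that ab by auto
      from *[OF this] show ?thesis by (simp add: algebra_simps)
    qed
    finally show ?thesis .
  qed
  have "((\<lambda>e. (a + b + 2 * e)\<^sup>2) \<longlongrightarrow> (a + b + 2 * 0)\<^sup>2) (at_right 0)"
    by (intro tendsto_intros)
  then have "mass M (\<lambda>x. u x + v x) \<le> (a + b + 2 * 0)\<^sup>2"
    by (rule tendsto_lowerbound) (auto simp: eventually_at_filter *)
  then show ?thesis by (simp add: a_def b_def)
qed

text \<open>One random sign in a Hilbert space. The squared norms of \<open>u - v\<close> and
  \<open>u + v\<close> have the sum given by the parallelogram identity and are each bounded by
  Minkowski's inequality, which is what the majorization asks for. The outcome is the scalar one, as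
  if \<open>u\<close> and \<open>v\<close> were parallel.\<close>

lemma cosh_mass_step:
  assumes u: "sq_integrable M u" and v: "sq_integrable M v" and l: "0 \<le> \<kappa>"
  shows "cosh (\<kappa> * sqrt (mass M (\<lambda>x. u x - v x))) + cosh (\<kappa> * sqrt (mass M (\<lambda>x. u x + v x)))
    \<le> 2 * cosh (\<kappa> * sqrt (mass M u)) * cosh (\<kappa> * sqrt (mass M v))"
proof -
  have s: "\<kappa> * sqrt t = sqrt (\<kappa>\<^sup>2 * t)" for t using l by (simp add: real_sqrt_mult)
  have "mass M (\<lambda>x. u x - v x) \<le> (sqrt (mass M u) + sqrt (mass M v))\<^sup>2"
    using mass_minkowski[OF u sq_integrable_cmult[OF v, of "-1"]] mass_cmult[of M "-1" v] by simp
  then have "\<kappa>\<^sup>2 * mass M (\<lambda>x. u x - v x) \<le> (\<kappa> * sqrt (mass M u) + \<kappa> * sqrt (mass M v))\<^sup>2"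
    unfolding distrib_left[symmetric] power_mult_distrib by (intro mult_left_mono) auto
  moreover have "\<kappa>\<^sup>2 * mass M (\<lambda>x. u x + v x) \<le> (\<kappa> * sqrt (mass M u) + \<kappa> * sqrt (mass M v))\<^sup>2"
    unfolding distrib_left[symmetric] power_mult_distrib by (intro mult_left_mono mass_minkowski u v) auto
  moreover have "\<kappa>\<^sup>2 * mass M (\<lambda>x. u x - v x) + \<kappa>\<^sup>2 * mass M (\<lambda>x. u x + v x)
      = 2 * (\<kappa> * sqrt (mass M u))\<^sup>2 + 2 * (\<kappa> * sqrt (mass M v))\<^sup>2"
    unfolding distrib_left[symmetric] mass_parallelogram[OF u v] by (simp add: power_mult_distrib algebra_simps)
  ultimately show ?thesis
    unfolding s[of "mass M (\<lambda>x. u x - v x)"] s[of "mass M (\<lambda>x. u x + v x)"]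
    by (intro cosh_sqrt_majorization) auto
qed

text \<open>A sign pattern is encoded by the set of indices with sign +1, so that expectations over
  independent signs become sums over \<open>Pow I\<close> divided by
  \<open>2 ^ card I\<close>.\<close>

definition sgn_of :: "'i set \<Rightarrow> 'i \<Rightarrow> complex" where
  "sgn_of A i = (if i \<in> A then 1 else - 1)"

lemma norm_sgn_of [simp]: "cmod (sgn_of A i) = 1"
  by (simp add: sgn_of_def)

lemma sum_Pow_insert:
  assumes "finite I" "i \<notin> I"
  shows "(\<Sum>A\<in>Pow (insert i I). F (\<lambda>j. sgn_of A j)) =
    (\<Sum>A\<in>Pow I. F ((sgn_of A)(i := - 1)) + F ((sgn_of A)(i := 1)) :: real)"
proof -
  have inj: "inj_on (insert i) (Pow I)"
    using assms(2) by (auto simp: inj_on_def)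
  have "(\<Sum>A\<in>Pow (insert i I). F (sgn_of A)) = (\<Sum>A\<in>Pow I. F (sgn_of A)) + (\<Sum>A\<in>insert i ` Pow I. F (sgn_of A))"
    unfolding Pow_insert using assms by (intro sum.union_disjoint) auto
  also have "(\<Sum>A\<in>insert i ` Pow I. F (sgn_of A)) = (\<Sum>A\<in>Pow I. F ((sgn_of A)(i := 1)))"
    unfolding sum.reindex[OF inj] o_def
    by (intro sum.cong arg_cong[of _ _ F]) (auto simp: sgn_of_def fun_eq_iff)
  also have "(\<Sum>A\<in>Pow I. F (sgn_of A)) = (\<Sum>A\<in>Pow I. F ((sgn_of A)(i := - 1)))"
    using assms(2) by (intro sum.cong arg_cong[of _ _ F]) (auto simp: sgn_of_def fun_eq_iff)
  finally show ?thesis by (simp only: sum.distrib)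
qed

lemma signed_sum_insert:
  fixes v :: "'i \<Rightarrow> 'a \<Rightarrow> complex"
  assumes "finite I" "i \<notin> I"
  shows "(\<lambda>x. \<Sum>j\<in>insert i I. ((sgn_of A)(i := c)) j * v j x) = (\<lambda>x. (\<Sum>j\<in>I. sgn_of A j * v j x) + c * v i x)"
proof -
  have "(\<Sum>j\<in>I. ((sgn_of A)(i := c)) j * v j x) = (\<Sum>j\<in>I. sgn_of A j * v j x)" for x
    using assms by (intro sum.cong) auto
  then show ?thesis unfolding sum.insert[OF assms] by (simp add: fun_eq_iff)
qed

text \<open>Independent signs make the translates orthogonal on average; each further index is one
  use of the parallelogram identity.\<close>

lemma rademacher_mass:
  fixes v :: "'i \<Rightarrow> 'a \<Rightarrow> complex"
  assumes "finite I" "\<And>i. i \<in> I \<Longrightarrow> sq_integrable M (v i)"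
  shows "(\<Sum>A\<in>Pow I. mass M (\<lambda>x. \<Sum>i\<in>I. sgn_of A i * v i x)) = 2 ^ card I * (\<Sum>i\<in>I. mass M (v i))"
  using assms
proof (induction I rule: finite_induct)
  case (insert i I)
  have sq: "sq_integrable M (\<lambda>x. \<Sum>j\<in>I. sgn_of A j * v j x)" for A
    using insert.prems by (intro sq_integrable_sum) auto
  have sv: "sq_integrable M (v i)" using insert.prems by auto
  have "(\<Sum>A\<in>Pow (insert i I). mass M (\<lambda>x. \<Sum>i\<in>insert i I. sgn_of A i * v i x))
      = (\<Sum>A\<in>Pow I. 2 * mass M (\<lambda>x. \<Sum>j\<in>I. sgn_of A j * v j x) + 2 * mass M (v i))"
    unfolding sum_Pow_insert[OF insert.hyps, of "\<lambda>\<sigma>. mass M (\<lambda>x. \<Sum>j\<in>insert i I. \<sigma> j * v j x)"]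
      signed_sum_insert[OF insert.hyps] mass_parallelogram[OF sq sv, symmetric] by simp
  then show ?case
    using insert by (simp add: sum.distrib sum_distrib_left[symmetric] card_Pow algebra_simps)
qed simp

text \<open>A Hoeffding bound for the norm of a vector-valued random sum, with no dependence on the
  dimension. A new index costs the factor \<open>cosh (\<kappa> * norm)\<close>, which
  \<open>cosh_le_exp\<close> turns into a Gaussian one.\<close>

lemma rademacher_cosh:
  fixes v :: "'i \<Rightarrow> 'a \<Rightarrow> complex"
  assumes "finite I" "\<And>i. i \<in> I \<Longrightarrow> sq_integrable M (v i)" and l: "0 \<le> \<kappa>"
  shows "(\<Sum>A\<in>Pow I. cosh (\<kappa> * sqrt (mass M (\<lambda>x. \<Sum>i\<in>I. sgn_of A i * v i x))))
        \<le> 2 ^ card I * exp (\<kappa>\<^sup>2 / 2 * (\<Sum>i\<in>I. mass M (v i)))"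
  using assms(1,2)
proof (induction I rule: finite_induct)
  case (insert i I)
  let ?u = "\<lambda>A x. \<Sum>j\<in>I. sgn_of A j * v j x"
  have sq: "sq_integrable M (?u A)" for A
    using insert.prems by (intro sq_integrable_sum) auto
  have sv: "sq_integrable M (v i)" using insert.prems by auto
  have IH: "(\<Sum>A\<in>Pow I. cosh (\<kappa> * sqrt (mass M (?u A)))) \<le> 2 ^ card I * exp (\<kappa>\<^sup>2 / 2 * (\<Sum>i\<in>I. mass M (v i)))"
    using insert.IH insert.prems by auto
  have "(\<Sum>A\<in>Pow (insert i I). cosh (\<kappa> * sqrt (mass M (\<lambda>x. \<Sum>i\<in>insert i I. sgn_of A i * v i x))))
     = (\<Sum>A\<in>Pow I. cosh (\<kappa> * sqrt (mass M (\<lambda>x. ?u A x - v i x)))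
       + cosh (\<kappa> * sqrt (mass M (\<lambda>x. ?u A x + v i x))))"
    unfolding sum_Pow_insert[OF insert.hyps, of "\<lambda>\<sigma>. cosh (\<kappa> * sqrt (mass M (\<lambda>x. \<Sum>j\<in>insert i I. \<sigma> j * v j x)))"]
      signed_sum_insert[OF insert.hyps] by simp
  also have "\<dots> \<le> (\<Sum>A\<in>Pow I. 2 * cosh (\<kappa> * sqrt (mass M (?u A))) * cosh (\<kappa> * sqrt (mass M (v i))))"
    by (intro sum_mono cosh_mass_step sq sv l)
  also have "\<dots> = 2 * cosh (\<kappa> * sqrt (mass M (v i))) * (\<Sum>A\<in>Pow I. cosh (\<kappa> * sqrt (mass M (?u A))))"
    by (simp add: sum_distrib_left mult_ac)
  also have "\<dots> \<le> 2 * exp (\<kappa>\<^sup>2 / 2 * mass M (v i)) * (2 ^ card I * exp (\<kappa>\<^sup>2 / 2 * (\<Sum>i\<in>I. mass M (v i))))"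
  proof (intro mult_mono IH)
    show "cosh (\<kappa> * sqrt (mass M (v i))) \<le> exp (\<kappa>\<^sup>2 / 2 * mass M (v i))"
      using cosh_le_exp[of "\<kappa> * sqrt (mass M (v i))"] by (simp add: power_mult_distrib)
  qed (auto intro!: sum_nonneg)
  also have "\<dots> = 2 ^ card (insert i I) * exp (\<kappa>\<^sup>2 / 2 * (\<Sum>i\<in>insert i I. mass M (v i)))"
    using insert.hyps by (simp add: exp_add[symmetric] algebra_simps)
  finally show ?case .
qed simp

text \<open>\<open>N\<close> and \<Psi> are compared with \<open>G A\<close> itself and not with
  constants, so that the first moment of \<open>G\<close> from below is all that has to be known
  about it.\<close>

lemma exists_good_signs:
  fixes G N \<Psi> :: "'i set \<Rightarrow> real"
  assumes I: "finite I"
    and G: "(\<Sum>A\<in>Pow I. G A) \<ge> 2 ^ card I * g" and N: "(\<Sum>A\<in>Pow I. N A) \<le> 2 ^ card I * n"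
    and P: "(\<Sum>A\<in>Pow I. \<Psi> A) \<le> 2 ^ card I * \<psi>"
    and pos: "0 < g" "0 < n" "0 < \<psi>" and nn: "\<And>A. 0 \<le> N A" "\<And>A. 0 \<le> \<Psi> A"
  obtains A where "A \<subseteq> I" "g / 2 \<le> G A" "N A \<le> 4 * n / g * G A" "\<Psi> A \<le> 4 * \<psi> / g * G A"
proof -
  \<comment> \<open>The three terms average to at most 1/2, 1/4 and 1/4 of \<open>g\<close>. If
    every \<open>G A\<close> were below its \<open>?F A\<close>, the average of \<open>G\<close>
    would be below \<open>g\<close>.\<close>
  let ?F = "\<lambda>A. g / 2 + g / (4 * n) * N A + g / (4 * \<psi>) * \<Psi> A"
  have "\<exists>A\<in>Pow I. ?F A \<le> G A"
  proof (rule ccontr)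
    assume "\<not> ?thesis"
    then have "G A < ?F A" if "A \<in> Pow I" for A
      using that by (meson not_le)
    then have "(\<Sum>A\<in>Pow I. G A) < (\<Sum>A\<in>Pow I. ?F A)"
      using I by (intro sum_strict_mono) auto
    also have "\<dots> = 2 ^ card I * (g / 2) + g / (4 * n) * (\<Sum>A\<in>Pow I. N A) + g / (4 * \<psi>) * (\<Sum>A\<in>Pow I. \<Psi> A)"
      using I by (simp add: sum.distrib sum_distrib_left card_Pow)
    also have "\<dots> \<le> 2 ^ card I * (g / 2) + g / (4 * n) * (2 ^ card I * n) + g / (4 * \<psi>) * (2 ^ card I * \<psi>)"
      using pos by (intro add_mono mult_left_mono N P) auto
    also have "\<dots> = 2 ^ card I * g"
      using pos by (simp add: field_simps)
    finally show False using G by simp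
  qed
  then obtain A where A: "A \<subseteq> I" "?F A \<le> G A" by auto
  have nn': "0 \<le> g / (4 * n) * N A" "0 \<le> g / (4 * \<psi>) * \<Psi> A"
    using pos nn by auto
  have "g / (4 * n) * N A \<le> G A" "g / (4 * \<psi>) * \<Psi> A \<le> G A" "g / 2 \<le> G A"
    using A(2) nn' pos by linarith+
  then show ?thesis
    using A(1) pos by (intro that[of A]) (auto simp: field_simps)
qed

section \<open>The amplitude of the example\<close>

definition bump :: "real \<Rightarrow> real" where
  "bump y = flat 1 (1 + y) * flat 1 (1 - y)"

lemma flat_1_bounds: "0 \<le> flat 1 x" "flat 1 x \<le> 1"
  by (auto simp: flat_def)

lemma bump_nonneg: "0 \<le> bump y" and bump_le_1: "bump y \<le> 1"
  unfolding bump_def using flat_1_bounds by (auto intro: mult_le_one)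

lemma bump_eq_0: "1 \<le> \<bar>y\<bar> \<Longrightarrow> bump y = 0"
  by (auto simp: bump_def flat_def)

lemma bump_ge:
  assumes "\<bar>y\<bar> \<le> 1 / 2"
  shows "exp (- 4) \<le> bump y"
proof -
  have *: "exp (- 2) \<le> flat 1 x" if "1 / 2 \<le> x" for x
    using that by (auto simp: flat_def divide_simps)
  have "exp (- 2) * exp (- 2) \<le> flat 1 (1 + y) * flat 1 (1 - y)"
    using assms by (intro mult_mono * flat_1_bounds) (auto simp: abs_le_iff)
  then show ?thesis by (simp add: bump_def exp_add[symmetric])
qed

text \<open>The centre has norm 3/4 in the direction \<open>j0\<close>, and the half-widths
  \<open>1 / (8 * n)\<close> add up to 1/8, so the support stays between the radii 5/8 and 7/8 and
  inside the open part of the annulus.\<close>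

definition bump_at :: "'n \<Rightarrow> real ^ 'n::finite \<Rightarrow> complex" where
  "bump_at j0 \<xi> = (\<Prod>j\<in>UNIV. complex_of_real
     (bump ((\<xi> $ j - (if j = j0 then 3 / 4 else 0)) * (8 * real CARD('n)))))"

definition stretch :: "'n set \<Rightarrow> real \<Rightarrow> real ^ 'n \<Rightarrow> real ^ 'n::finite" where
  "stretch J r \<xi> = (\<chi> j. if j \<in> J then \<xi> $ j else \<xi> $ j / r)"

definition amp :: "'n set \<Rightarrow> 'n \<Rightarrow> real \<Rightarrow> real ^ 'n::finite \<Rightarrow> complex" where
  "amp J j0 r \<xi> = bump_at j0 (stretch J r \<xi>)"

definition wid :: "'n::finite set \<Rightarrow> real \<Rightarrow> 'n \<Rightarrow> real" where
  "wid J r j = (if j \<in> J then 1 else r) / (8 * real CARD('n))"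

definition mid :: "'n \<Rightarrow> real ^ 'n::finite" where
  "mid j0 = axis j0 (3 / 4)"

definition amp_box :: "'n set \<Rightarrow> 'n \<Rightarrow> real \<Rightarrow> real \<Rightarrow> (real ^ 'n::finite) set" where
  "amp_box J j0 r d = cbox (mid j0 - (\<chi> j. d * wid J r j)) (mid j0 + (\<chi> j. d * wid J r j))"

lemma mem_amp_box: "\<xi> \<in> amp_box J j0 r d \<longleftrightarrow> (\<forall>j. \<bar>\<xi> $ j - mid j0 $ j\<bar> \<le> d * wid J r j)"
  unfolding amp_box_def mem_box_cart by (auto simp: abs_le_iff algebra_simps)

lemma bump_at_elem: "bump_at j0 \<in> (elem :: (real ^ 'n::finite \<Rightarrow> complex) set)"
proof -
  define N where "N = 8 * real CARD('n)"
  define c where "c j = (if j = j0 then 3 / 4 else 0 :: real)" for j :: 'n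
  have e: "complex_of_real (bump ((\<xi> $ j - c j) * N)) =
     complex_of_real (flat 1 (axis j N \<bullet> \<xi> + (1 - c j * N))) *
     complex_of_real (flat 1 (axis j (- N) \<bullet> \<xi> + (1 + c j * N)))" for \<xi> :: "real ^ 'n" and j
    by (simp add: bump_def inner_axis' algebra_simps)
  have "bump_at j0 = (\<lambda>\<xi>. \<Prod>j\<in>UNIV. complex_of_real (bump ((\<xi> $ j - c j) * N)))"
    by (simp add: fun_eq_iff bump_at_def N_def c_def)
  then show ?thesis
    unfolding e by (simp add: elem_prod elem_mult elem_flat)
qed

lemma elem_compose_linear:
  fixes T :: "'a::euclidean_space \<Rightarrow> 'b::euclidean_space"
  assumes T: "linear T" and f: "f \<in> elem"
  shows "(\<lambda>x. f (T x)) \<in> elem"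
  using f
proof induction
  case (elem_linear v)
  have "v \<bullet> T x = adjoint T v \<bullet> x" for x by (metis T adjoint_works inner_commute)
  then show ?case using elem.elem_linear[of "adjoint T v"] by simp
next
  case (elem_cis v)
  have "v \<bullet> T x = adjoint T v \<bullet> x" for x by (metis T adjoint_works inner_commute)
  then show ?case using elem.elem_cis[of "adjoint T v"] by simp
next
  case (elem_flat P v b)
  have "v \<bullet> T x = adjoint T v \<bullet> x" for x by (metis T adjoint_works inner_commute)
  then show ?case using elem.elem_flat[of P "adjoint T v"] by simp
qed (auto intro: elem.intros)

lemma linear_stretch: "linear (stretch J r)"
  by (rule linearI) (auto simp: stretch_def vec_eq_iff add_divide_distrib)

lemma stretch_axis: "stretch J r (axis j 1) = (1 / (if j \<in> J then 1 else r)) *\<^sub>R axis j 1"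
  by (auto simp: stretch_def vec_eq_iff axis_def)

lemma wid_pos: "0 < r \<Longrightarrow> 0 < wid J r j"
  by (simp add: wid_def)

lemma cmod_amp_le_1: "cmod (amp J j0 r \<xi>) \<le> 1"
  unfolding amp_def bump_at_def
  by (simp add: prod_norm[symmetric] bump_nonneg bump_le_1 prod_le_1)

lemma amp_factor:
  assumes r: "0 < r" and "j0 \<in> J"
  shows "(stretch J r \<xi> $ j - (if j = j0 then 3 / 4 else 0)) * (8 * real CARD('n))
     = (\<xi> $ j - mid j0 $ j) / wid J r (j::'n::finite)"
  using assms by (auto simp: stretch_def wid_def mid_def axis_def divide_simps)

lemma amp_eq_0:
  assumes r: "0 < r" and j0: "j0 \<in> J" and x: "\<xi> \<notin> amp_box J j0 r 1"
  shows "amp J j0 r \<xi> = 0"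
proof -
  obtain j where "\<bar>\<xi> $ j - mid j0 $ j\<bar> > wid J r j"
    using x by (auto simp: mem_amp_box not_le)
  then have "1 \<le> \<bar>(\<xi> $ j - mid j0 $ j) / wid J r j\<bar>"
    using wid_pos[OF r, of J j] by (simp add: abs_divide)
  then have "bump ((stretch J r \<xi> $ j - (if j = j0 then 3 / 4 else 0)) * (8 * real CARD('a))) = 0"
    unfolding amp_factor[OF r j0] by (rule bump_eq_0)
  then show ?thesis
    unfolding amp_def bump_at_def by (intro prod_zero bexI[of _ j]) simp_all
qed

lemma amp_ge:
  assumes r: "0 < r" and j0: "j0 \<in> J" and x: "\<xi> \<in> amp_box J j0 r (1 / 2)"
  shows "exp (- 4) ^ CARD('n) \<le> cmod (amp J j0 r (\<xi> :: real ^ 'n::finite))"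
proof -
  have "exp (- 4) \<le> bump ((stretch J r \<xi> $ j - (if j = j0 then 3 / 4 else 0)) * (8 * real CARD('n)))" for j
  proof -
    have "\<bar>(\<xi> $ j - mid j0 $ j) / wid J r j\<bar> \<le> 1 / 2"
      using x wid_pos[OF r, of J j] by (simp add: mem_amp_box abs_divide pos_divide_le_eq)
    then show ?thesis unfolding amp_factor[OF r j0] by (rule bump_ge)
  qed
  then have "(\<Prod>j\<in>(UNIV::'n set). exp (- 4))
      \<le> (\<Prod>j\<in>UNIV. bump ((stretch J r \<xi> $ j - (if j = j0 then 3 / 4 else 0)) * (8 * real CARD('n))))"
    by (intro prod_mono) auto
  also have "\<dots> = cmod (amp J j0 r \<xi>)"
    unfolding amp_def bump_at_def by (simp add: prod_norm[symmetric] bump_nonneg)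
  finally show ?thesis by simp
qed

lemma norm_amp_box:
  fixes \<xi> :: "real ^ 'n::finite"
  assumes "0 < r" "r \<le> 1" "\<xi> \<in> amp_box J j0 r 1"
  shows "5 / 8 \<le> norm \<xi>" "norm \<xi> \<le> 7 / 8" "5 / 8 \<le> \<xi> $ j0"
proof -
  have w: "wid J r j \<le> 1 / (8 * real CARD('n))" for j
    using assms by (auto simp: wid_def divide_right_mono)
  have "norm (\<xi> - mid j0) \<le> (\<Sum>j\<in>UNIV. \<bar>(\<xi> - mid j0) $ j\<bar>)"
    by (rule norm_le_l1_cart)
  also have "\<dots> \<le> (\<Sum>j\<in>(UNIV::'n set). 1 / (8 * real CARD('n)))"
    using assms(3) w by (intro sum_mono) (auto simp: mem_amp_box intro: order_trans)
  also have "\<dots> = 1 / 8" by simp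
  finally have n: "norm (\<xi> - mid j0) \<le> 1 / 8" .
  have "mid j0 = (3 / 4 :: real) *\<^sub>R axis j0 1"
    by (simp add: mid_def vec_eq_iff axis_def)
  then have m: "norm (mid j0) = 3 / 4" by (simp add: norm_axis_1)
  show "5 / 8 \<le> norm \<xi>" "norm \<xi> \<le> 7 / 8"
    using n m norm_triangle_ineq2[of "mid j0" \<xi>] norm_triangle_ineq2[of \<xi> "mid j0"]
    by (auto simp: norm_minus_commute)
  have "\<bar>(\<xi> - mid j0) $ j0\<bar> \<le> 1 / 8"
    using component_le_norm_cart[of "\<xi> - mid j0" j0] n by linarith
  then show "5 / 8 \<le> \<xi> $ j0"
    by (simp add: mid_def axis_def abs_if split: if_splits)
qed

lemma amp_box_subset_annulus:
  "0 < r \<Longrightarrow> r \<le> 1 \<Longrightarrow> amp_box J j0 r 1 \<subseteq> annulus"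
  using norm_amp_box[of r _ J j0] unfolding annulus_def by (force simp: not_less)

lemma amp_zero_near_origin:
  assumes "0 < r" "r \<le> 1" "j0 \<in> J" "norm \<xi> < 5 / 8"
  shows "amp J j0 r \<xi> = 0"
  using amp_eq_0[OF assms(1,3)] norm_amp_box(1)[OF assms(1,2)] assms(4) by force

lemma amp_elem: "amp J j0 r \<in> elem"
  using elem_compose_linear[OF linear_stretch bump_at_elem] by (simp add: amp_def[abs_def])

lemma amp_test:
  assumes "0 < r" "r \<le> 1" "j0 \<in> J"
  shows "amp J j0 r \<in> test"
  unfolding test_def using amp_elem amp_eq_0[OF assms(1,3)] norm_amp_box(2)[OF assms(1,2)]
  by (intro CollectI conjI exI[of _ "7/8"]) force+

lemma bump_at_test: "bump_at j0 \<in> test"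
proof -
  have "bump_at j0 = amp UNIV j0 1"
    by (simp add: fun_eq_iff amp_def stretch_def)
  then show ?thesis using amp_test[of 1 j0 UNIV] by simp
qed

text \<open>The amplitude is a fixed bump composed with \<open>stretch\<close>, so the chain rule
  costs \<open>1 / r\<close> off \<open>J\<close> and nothing along \<open>J\<close>. The constant
  is uniform in \<open>J\<close> and \<open>r\<close>, hence later in \<open>R\<close>.\<close>

lemma amp_derivative_bound:
  shows "\<exists>C\<ge>0. \<forall>J r j \<xi>. 0 < r \<longrightarrow>
     cmod (frechet_derivative (amp J j0 r) (at \<xi>) (axis j 1)) \<le> C / (if j \<in> J then 1 else r)"
proof -
  have "\<forall>j. \<exists>B\<ge>0. \<forall>x. norm (frechet_derivative (bump_at j0) (at x) (axis j 1)) \<le> B"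
    using test_bounded[OF test_frechet_derivative[OF bump_at_test]] by blast
  then obtain B where B: "\<And>j. 0 \<le> B j" "\<And>j x. norm (frechet_derivative (bump_at j0) (at x) (axis j 1)) \<le> B j"
    by metis
  define C where "C = (\<Sum>j\<in>UNIV. B j)"
  have C: "B j \<le> C" for j unfolding C_def using B(1) by (intro member_le_sum) auto
  have "cmod (frechet_derivative (amp J j0 r) (at \<xi>) (axis j 1)) \<le> C / (if j \<in> J then 1 else r)"
    if r: "0 < r" for J r j \<xi>
  proof -
    let ?w = "if j \<in> J then 1 else r"
    have sd: "(stretch J r has_derivative stretch J r) (at \<xi>)"
      using linear_stretch by (intro bounded_linear_imp_has_derivative) (simp add: linear_conv_bounded_linear)
    have "(amp J j0 r has_derivative (\<lambda>v. frechet_derivative (bump_at j0) (at (stretch J r \<xi>)) (stretch J r v))) (at \<xi>)"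
      using has_derivative_compose[OF sd elem_has_derivative[OF bump_at_elem]] by (simp add: amp_def[abs_def])
    then have "frechet_derivative (amp J j0 r) (at \<xi>) (axis j 1)
       = frechet_derivative (bump_at j0) (at (stretch J r \<xi>)) ((1 / ?w) *\<^sub>R axis j 1)"
      using frechet_derivative_at[of "amp J j0 r" _ \<xi>] by (metis stretch_axis)
    also have "\<dots> = (1 / ?w) *\<^sub>R frechet_derivative (bump_at j0) (at (stretch J r \<xi>)) (axis j 1)"
      using elem_has_derivative[OF bump_at_elem] has_derivative_linear linear_scale by blast
    finally show ?thesis
      using r order_trans[OF B(2) C] by (simp add: divide_right_mono del: scaleR_conv_of_real)
  qed
  moreover have "0 \<le> C" unfolding C_def using B(1) by (intro sum_nonneg)
  ultimately show ?thesis by blast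
qed

lemma measure_amp_box:
  fixes J :: "'n::finite set"
  assumes "0 < r" "0 \<le> d"
  shows "measure lborel (amp_box J j0 r d) = (d / (4 * real CARD('n))) ^ CARD('n) * r ^ (CARD('n) - card J)"
proof -
  have w: "0 \<le> d * wid J r j" for j using assms wid_pos[of r J j] by simp
  have "mid j0 \<in> amp_box J j0 r d" using w by (simp add: mem_amp_box)
  then have ne: "amp_box J j0 r d \<noteq> {}" by blast
  have "measure lborel (amp_box J j0 r d) = (\<Prod>j\<in>UNIV. 2 * (d * wid J r j))"
    using content_cbox_cart[OF ne[unfolded amp_box_def]] unfolding amp_box_def by simp
  also have "\<dots> = (\<Prod>j\<in>UNIV. d / (4 * real CARD('n)) * (if j \<in> J then 1 else r))"
    by (intro prod.cong) (auto simp: wid_def)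
  also have "\<dots> = (d / (4 * real CARD('n))) ^ CARD('n) * (\<Prod>j\<in>UNIV. if j \<in> J then 1 else r)"
    by (simp only: prod.distrib prod_constant)
  also have "(\<Prod>j\<in>UNIV. if j \<in> J then 1 else r) = (\<Prod>j\<in>UNIV - J. r)"
    by (rule prod.mono_neutral_cong_right) auto
  also have "\<dots> = r ^ (CARD('n) - card J)"
    by (simp add: card_Diff_subset)
  finally show ?thesis .
qed

lemma emeasure_amp_box_finite: "emeasure lborel (amp_box J j0 r d) < \<infinity>"
  unfolding amp_box_def by (intro emeasure_bounded_finite) simp

lemma amp_box_sets [measurable, simp]: "amp_box J j0 r d \<in> sets borel"
  unfolding amp_box_def by simp

text \<open>On the box of half the size each factor of the bump is at least
  \<open>exp (- 4)\<close>; its square and the volume of that box give the constant.\<close>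

lemma amp_mass_lower:
  fixes J :: "'n::finite set"
  assumes r: "0 < r" "r \<le> 1" and j0: "j0 \<in> J"
  shows "(exp (- 8) / (8 * real CARD('n))) ^ CARD('n) * r ^ (CARD('n) - card J)
      \<le> (LINT \<xi>|lborel. (cmod (amp J j0 r \<xi>))\<^sup>2)"
proof -
  have i: "integrable lborel (\<lambda>\<xi>. (cmod (amp J j0 r \<xi>))\<^sup>2)"
  proof (rule integrable_compact_support[of _ "7/8"])
    show "continuous_on UNIV (\<lambda>\<xi>. (cmod (amp J j0 r \<xi>))\<^sup>2)"
      by (intro continuous_intros elem_continuous amp_elem)
    show "(cmod (amp J j0 r x))\<^sup>2 = 0" if "7 / 8 < norm x" for x
      using amp_eq_0[OF r(1) j0, of x] norm_amp_box(2)[OF r, of x] that by force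
  qed
  have "(exp (- 8) / (8 * real CARD('n))) ^ CARD('n) * r ^ (CARD('n) - card J)
      = (exp (- 4) ^ CARD('n))\<^sup>2 * measure lborel (amp_box J j0 r (1 / 2))"
    using r by (subst measure_amp_box) (simp_all add: power_divide power_mult[symmetric] exp_of_nat_mult[symmetric] field_simps)
  also have "\<dots> = (LINT \<xi>|lborel. (exp (- 4) ^ CARD('n))\<^sup>2 * indicator (amp_box J j0 r (1 / 2)) \<xi>)"
    by simp
  also have "\<dots> \<le> (LINT \<xi>|lborel. (cmod (amp J j0 r \<xi>))\<^sup>2)"
  proof (rule integral_mono[OF _ i])
    show "integrable lborel (\<lambda>\<xi>. (exp (- 4) ^ CARD('n))\<^sup>2 * indicator (amp_box J j0 r (1 / 2)) \<xi> :: real)"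
      using emeasure_amp_box_finite[of J j0 r "1/2"]
        by (intro integrable_mult_right integrable_real_indicator) auto
    show "(exp (- 4) ^ CARD('n))\<^sup>2 * indicator (amp_box J j0 r (1 / 2)) \<xi> \<le> (cmod (amp J j0 r \<xi>))\<^sup>2" for \<xi>
      using amp_ge[OF r(1) j0, of \<xi>] by (auto simp: indicator_def intro!: power_mono)
  qed
  finally show ?thesis .
qed

text \<open>Restriction is expressed by a density on the whole space, so that the measurable
  functions stay those of \<open>lborel\<close>.\<close>

definition restr :: "'a::euclidean_space set \<Rightarrow> 'a measure" where
  "restr S = density lborel (\<lambda>x. ennreal (indicator S x))"

lemma mass_restr:
  assumes [measurable]: "S \<in> sets borel" "u \<in> borel_measurable borel"
  shows "mass (restr S) u = (LINT x|lborel. indicator S x * (cmod (u x))\<^sup>2)"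
  unfolding mass_def restr_def by (subst integral_density) auto

lemma sq_integrable_restr:
  assumes [measurable]: "S \<in> sets borel" and u: "sq_integrable lborel u"
  shows "sq_integrable (restr S) u"
    and "integrable lborel (\<lambda>x. indicator S x * (cmod (u x))\<^sup>2)"
proof -
  have [measurable]: "u \<in> borel_measurable borel" using u by (simp add: sq_integrable_def)
  show i: "integrable lborel (\<lambda>x. indicator S x * (cmod (u x))\<^sup>2)"
    by (rule Bochner_Integration.integrable_bound[of _ "\<lambda>x. (cmod (u x))\<^sup>2"])
       (use u in \<open>auto simp: sq_integrable_def indicator_def\<close>)
  show "sq_integrable (restr S) u"
    unfolding sq_integrable_def restr_def by (subst integrable_density) (use i in auto)
qed

lemma sq_integrable_translate:
  assumes "sq_integrable lborel k"
  shows "sq_integrable lborel (\<lambda>x. k (x - m))"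
    and "mass lborel (\<lambda>x. k (x - m)) = mass lborel k"
proof -
  have [measurable]: "k \<in> borel_measurable borel" and i: "integrable lborel (\<lambda>x. (cmod (k x))\<^sup>2)"
    using assms by (auto simp: sq_integrable_def)
  show "sq_integrable lborel (\<lambda>x. k (x - m))"
    using lborel_integrable_affine[OF i, of 1 "- m"] by (simp add: sq_integrable_def)
  show "mass lborel (\<lambda>x. k (x - m)) = mass lborel k"
    using lborel_integral_affine[OF i, of 1 "- m"] by (simp add: mass_def)
qed

section \<open>Lattice sums with random signs\<close>

definition lat :: "'n set \<Rightarrow> (real ^ 'n::finite) set" where
  "lat J = {q. (\<forall>j\<in>J. q $ j \<in> \<int>) \<and> (\<forall>j. j \<notin> J \<longrightarrow> q $ j = 0)}"

text \<open>Unit cubes in the coordinates of \<open>J\<close>, unbounded in the others. Being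
  half-open, those with corners in \<open>lat J\<close> partition the space.\<close>

definition slab :: "'n set \<Rightarrow> real ^ 'n \<Rightarrow> (real ^ 'n::finite) set" where
  "slab J q = {x. \<forall>j\<in>J. q $ j \<le> x $ j \<and> x $ j < q $ j + 1}"

lemma slab_sets [measurable, simp]: "slab J q \<in> sets borel"
  unfolding slab_def by measurable

lemma slab_disjoint:
  assumes "q \<in> lat J" "q' \<in> lat J" "x \<in> slab J q" "x \<in> slab J q'"
  shows "q = q'"
proof -
  have "q $ j = q' $ j" for j
  proof (cases "j \<in> J")
    case True
    then have "q $ j \<in> \<int>" "q' $ j \<in> \<int>"
      using assms(1,2) by (auto simp: lat_def)
    then obtain a b where "q $ j = of_int a" "q' $ j = of_int b"
      by (auto elim!: Ints_cases)
    moreover have "q $ j \<le> x $ j" "x $ j < q $ j + 1" "q' $ j \<le> x $ j" "x $ j < q' $ j + 1"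
      using assms(3,4) True by (auto simp: slab_def)
    then have "\<bar>q $ j - q' $ j\<bar> < 1" by linarith
    ultimately have "\<bar>real_of_int (a - b)\<bar> < 1" by simp
    then have "a = b" by linarith
    with \<open>q $ j = of_int a\<close> \<open>q' $ j = of_int b\<close> show ?thesis by simp
  next
    case False
    then show ?thesis using assms(1,2) by (auto simp: lat_def)
  qed
  then show ?thesis by (simp add: vec_eq_iff)
qed

lemma slab_covers: "\<exists>q\<in>lat J. x \<in> slab J q"
  by (rule bexI[of _ "\<chi> j. if j \<in> J then of_int \<lfloor>x $ j\<rfloor> else 0"]) (auto simp: slab_def lat_def)

lemma sum_indicator_disjoint_le_1:
  assumes "finite I" "\<And>m m'. m \<in> I \<Longrightarrow> m' \<in> I \<Longrightarrow> x \<in> S m \<Longrightarrow> x \<in> S m' \<Longrightarrow> m = m'"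
  shows "(\<Sum>m\<in>I. indicator (S m) x) \<le> (1::real)"
proof (cases "\<exists>m0\<in>I. x \<in> S m0")
  case True
  then obtain m0 where m0: "m0 \<in> I" "x \<in> S m0" by blast
  have "(\<Sum>m\<in>I. indicator (S m) x) = (\<Sum>m\<in>I. if m = m0 then 1 else 0 :: real)"
    by (intro sum.cong) (use m0 assms(2) in \<open>auto simp: indicator_def\<close>)
  also have "\<dots> \<le> 1" using assms(1) by simp
  finally show ?thesis .
next
  case False
  then have "(\<Sum>m\<in>I. indicator (S m) x) = (0::real)" by (intro sum.neutral) (auto simp: indicator_def)
  then show ?thesis by simp
qed

text \<open>Moving each translation from the function to the slab produces the slabs at
  \<open>q - m\<close>, which are disjoint. Thus the variances of all the translates in one slab add
  up to at most the mass of one profile, however many translates there are.\<close>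

lemma sum_mass_slab_translates:
  assumes I: "finite I" "I \<subseteq> lat J" and q: "q \<in> lat J" and k: "sq_integrable lborel k"
  shows "(\<Sum>m\<in>I. mass (restr (slab J q)) (\<lambda>x. k (x - m))) \<le> mass lborel k"
proof -
  have [measurable]: "k \<in> borel_measurable borel" and ik: "integrable lborel (\<lambda>x. (cmod (k x))\<^sup>2)"
    using k by (auto simp: sq_integrable_def)
  have i: "integrable lborel (\<lambda>x. indicator (slab J q) x * (cmod (k (x - m)))\<^sup>2)" for m
    by (intro sq_integrable_restr(2) sq_integrable_translate k) simp
  have i': "integrable lborel (\<lambda>x. indicator (slab J q) (x + m) * (cmod (k x))\<^sup>2)" for m
    using lborel_integrable_affine[OF i[of m], of 1 m] by (simp add: add.commute)
  have "mass (restr (slab J q)) (\<lambda>x. k (x - m))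
      = (LINT x|lborel. indicator (slab J q) (x + m) * (cmod (k x))\<^sup>2)" for m
    using lborel_integral_affine[OF i[of m], of 1 m] by (simp add: mass_restr add.commute)
  then have "(\<Sum>m\<in>I. mass (restr (slab J q)) (\<lambda>x. k (x - m)))
     = (LINT x|lborel. (\<Sum>m\<in>I. indicator (slab J q) (x + m) * (cmod (k x))\<^sup>2))"
    using i' by (subst Bochner_Integration.integral_sum) auto
  also have "\<dots> \<le> (LINT x|lborel. (cmod (k x))\<^sup>2)"
  proof (rule integral_mono[OF Bochner_Integration.integrable_sum[OF i'] ik])
    fix x
    have "(\<Sum>m\<in>I. indicator (slab J q) (x + m)) = (\<Sum>m\<in>I. indicator (slab J (q - m)) x :: real)"
      by (intro sum.cong) (auto simp: slab_def indicator_def algebra_simps)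
    also have "\<dots> \<le> 1"
    proof (rule sum_indicator_disjoint_le_1[OF I(1)])
      fix m m' assume m: "m \<in> I" "m' \<in> I" "x \<in> slab J (q - m)" "x \<in> slab J (q - m')"
      then have "q - m \<in> lat J" "q - m' \<in> lat J"
        using q I(2) by (auto simp: lat_def)
      from slab_disjoint[OF this m(3,4)] show "m = m'" by simp
    qed
    finally show "(\<Sum>m\<in>I. indicator (slab J q) (x + m) * (cmod (k x))\<^sup>2) \<le> (cmod (k x))\<^sup>2"
      unfolding sum_distrib_right[symmetric] by (simp add: mult_left_le_one_le sum_nonneg)
  qed
  finally show ?thesis by (simp add: mass_def)
qed

lemma mass_sum_eq_0:
  assumes "\<And>i. i \<in> I \<Longrightarrow> sq_integrable M (v i)" "\<And>i. i \<in> I \<Longrightarrow> mass M (v i) = 0"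
  shows "mass M (\<lambda>x. \<Sum>i\<in>I. c i * v i x) = 0"
  using assms
proof (induction I rule: infinite_finite_induct)
  case (insert i I)
  have "mass M (\<lambda>x. c i * v i x + (\<Sum>i\<in>I. c i * v i x))
      \<le> (sqrt (mass M (\<lambda>x. c i * v i x)) + sqrt (mass M (\<lambda>x. \<Sum>i\<in>I. c i * v i x)))\<^sup>2"
    using insert.prems by (intro mass_minkowski sq_integrable_cmult sq_integrable_sum) auto
  also have "\<dots> = 0"
    using insert by (simp add: mass_cmult)
  finally show ?case
    using insert.hyps mass_nonneg[of M "\<lambda>x. c i * v i x + (\<Sum>i\<in>I. c i * v i x)"] by simp
qed simp_all

text \<open>The threshold \<open>L\<close> separates typical from exceptional values. Above it,
  \<open>u\<^sup>2 \<le> 16 * exp (u / 2)\<close>, and half of the exponent is given up for the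
  small factor \<open>exp (- L / 2)\<close>.\<close>

lemma square_le_exp_split:
  fixes u L :: real
  assumes "0 \<le> u" "0 \<le> L"
  shows "u\<^sup>2 \<le> L\<^sup>2 + 32 * exp (- L / 2) * cosh u"
proof (cases "u \<le> L")
  case True
  then have "u\<^sup>2 \<le> L\<^sup>2" using assms by (intro power_mono) auto
  then show ?thesis by (simp add: add_increasing2)
next
  case False
  have "u / 4 \<le> exp (u / 4)"
    using exp_ge_add_one_self[of "u / 4"] by linarith
  then have "(u / 4)\<^sup>2 \<le> (exp (u / 4))\<^sup>2"
    using assms by (intro power_mono) auto
  also have "\<dots> = exp (u / 2)"
    by (simp add: exp_double[symmetric])
  also have "\<dots> \<le> exp (u - L / 2)"
    using False by simp
  also have "\<dots> = exp (- L / 2) * exp u"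
    by (simp add: exp_add[symmetric])
  also have "\<dots> \<le> exp (- L / 2) * (2 * cosh u)"
    by (intro mult_left_mono) (auto simp: cosh_field_def)
  finally have "u\<^sup>2 \<le> 32 * exp (- L / 2) * cosh u" by (simp add: power_divide)
  moreover have "0 \<le> L\<^sup>2" by simp
  ultimately show ?thesis by linarith
qed

definition lattice_sum :: "(real ^ 'n) set \<Rightarrow> (real ^ 'n) set \<Rightarrow> (real ^ 'n::finite \<Rightarrow> complex) \<Rightarrow> real ^ 'n \<Rightarrow> complex" where
  "lattice_sum I A k x = (\<Sum>m\<in>I. sgn_of A m * k (x - m))"

text \<open>A bound for this sum that is polynomial in \<open>R\<close> bounds the mass of every lattice sum in every slab
  by \<open>mass lborel (k \<theta>)\<close> up to a factor \<open>R\<^sup>\<epsilon>\<close>, uniformly in \<open>\<theta>\<close> and \<open>q\<close>.\<close>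

definition cosh_energy ::
  "'n set \<Rightarrow> 'd set \<Rightarrow> (real ^ 'n) set \<Rightarrow> (real ^ 'n) set \<Rightarrow> ('d \<Rightarrow> real ^ 'n::finite \<Rightarrow> complex) \<Rightarrow> (real ^ 'n) set \<Rightarrow> real" where
  "cosh_energy J D Q I k A = (\<Sum>\<theta>\<in>D. \<Sum>q\<in>Q. mass lborel (k \<theta>) *
     cosh (1 / sqrt (mass lborel (k \<theta>)) * sqrt (mass (restr (slab J q)) (lattice_sum I A (k \<theta>)))))"

lemma cosh_energy_nonneg [simp]: "0 \<le> cosh_energy J D Q I k A"
  unfolding cosh_energy_def by (intro sum_nonneg mult_nonneg_nonneg) auto

text \<open>The normalisation by the norm of \<open>k \<theta>\<close> makes the exponent in
  \<open>rademacher_cosh\<close> at most 1/2 for every cap and slab. The weight by the mass lets the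
  sum over the caps be bounded by the total mass, without counting caps.\<close>

lemma cosh_energy_average:
  assumes I: "finite I" "I \<subseteq> lat J" and Q: "Q \<subseteq> lat J"
    and k: "\<And>\<theta>. \<theta> \<in> D \<Longrightarrow> sq_integrable lborel (k \<theta>)"
  shows "(\<Sum>A\<in>Pow I. cosh_energy J D Q I k A)
      \<le> 2 ^ card I * (exp (1 / 2) * real (card Q) * (\<Sum>\<theta>\<in>D. mass lborel (k \<theta>)))"
proof -
  let ?\<mu> = "\<lambda>\<theta>. mass lborel (k \<theta>)"
  have *: "(\<Sum>A\<in>Pow I. cosh (1 / sqrt (?\<mu> \<theta>) * sqrt (mass (restr (slab J q)) (lattice_sum I A (k \<theta>)))))
      \<le> 2 ^ card I * exp (1 / 2)"
    if "\<theta> \<in> D" "q \<in> Q" for \<theta> q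
  proof -
    have q: "q \<in> lat J" using that Q by blast
    have "(\<Sum>A\<in>Pow I. cosh (1 / sqrt (?\<mu> \<theta>) * sqrt (mass (restr (slab J q)) (lattice_sum I A (k \<theta>)))))
      \<le> 2 ^ card I * exp ((1 / sqrt (?\<mu> \<theta>))\<^sup>2 / 2 * (\<Sum>m\<in>I. mass (restr (slab J q)) (\<lambda>x. k \<theta> (x - m))))"
      unfolding lattice_sum_def
      by (intro rademacher_cosh I sq_integrable_restr sq_integrable_translate k that) auto
    also have "\<dots> \<le> 2 ^ card I * exp (1 / 2)"
    proof -
      have "(1 / sqrt (?\<mu> \<theta>))\<^sup>2 / 2 * (\<Sum>m\<in>I. mass (restr (slab J q)) (\<lambda>x. k \<theta> (x - m)))
          \<le> (1 / sqrt (?\<mu> \<theta>))\<^sup>2 / 2 * ?\<mu> \<theta>"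
        by (intro mult_left_mono sum_mass_slab_translates I q k that) auto
      also have "\<dots> \<le> 1 / 2" by (simp add: power_divide)
      finally show ?thesis by simp
    qed
    finally show ?thesis .
  qed
  have "(\<Sum>A\<in>Pow I. cosh_energy J D Q I k A) = (\<Sum>\<theta>\<in>D. \<Sum>q\<in>Q. ?\<mu> \<theta> *
     (\<Sum>A\<in>Pow I. cosh (1 / sqrt (?\<mu> \<theta>) * sqrt (mass (restr (slab J q)) (lattice_sum I A (k \<theta>))))))"
    unfolding cosh_energy_def sum_distrib_left
    by (subst sum.swap, rule sum.cong[OF refl], rule sum.swap)
  also have "\<dots> \<le> (\<Sum>\<theta>\<in>D. \<Sum>q\<in>Q. ?\<mu> \<theta> * (2 ^ card I * exp (1 / 2)))"
    by (intro sum_mono mult_left_mono *) auto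
  also have "\<dots> = 2 ^ card I * (exp (1 / 2) * real (card Q) * (\<Sum>\<theta>\<in>D. mass lborel (k \<theta>)))"
    by (simp add: sum_distrib_left sum_distrib_right mult_ac)
  finally show ?thesis .
qed

text \<open>A deterministic bound for a given sign pattern. It holds for all subfamilies of caps and
  slabs and for every \<open>L\<close>, although only the one number \<open>cosh_energy\<close>
  refers to the signs.\<close>

lemma slab_mass_le:
  assumes I: "finite I" "I \<subseteq> lat J" and Q: "finite Q" "Q \<subseteq> lat J" "Q' \<subseteq> Q" and D: "finite D" "D' \<subseteq> D"
    and k: "\<And>\<theta>. \<theta> \<in> D \<Longrightarrow> sq_integrable lborel (k \<theta>)" and L: "0 \<le> L"
  shows "(\<Sum>\<theta>\<in>D'. \<Sum>q\<in>Q'. mass (restr (slab J q)) (lattice_sum I A (k \<theta>)))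
    \<le> L\<^sup>2 * real (card Q') * (\<Sum>\<theta>\<in>D'. mass lborel (k \<theta>)) + 32 * exp (- L / 2) * cosh_energy J D Q I k A"
proof -
  let ?\<mu> = "\<lambda>\<theta>. mass lborel (k \<theta>)"
  let ?Z = "\<lambda>\<theta> q. mass (restr (slab J q)) (lattice_sum I A (k \<theta>))"
  let ?c = "\<lambda>\<theta> q. cosh (1 / sqrt (?\<mu> \<theta>) * sqrt (?Z \<theta> q))"
  have *: "?Z \<theta> q \<le> L\<^sup>2 * ?\<mu> \<theta> + 32 * exp (- L / 2) * (?\<mu> \<theta> * ?c \<theta> q)" if "\<theta> \<in> D'" "q \<in> Q'" for \<theta> q
  proof (cases "?\<mu> \<theta> = 0")
    case False
    then have pos: "0 < ?\<mu> \<theta>" using mass_nonneg[of lborel "k \<theta>"] by linarith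
    have "?Z \<theta> q = ?\<mu> \<theta> * (1 / sqrt (?\<mu> \<theta>) * sqrt (?Z \<theta> q))\<^sup>2"
      using pos by (simp add: power_mult_distrib power_divide)
    also have "\<dots> \<le> ?\<mu> \<theta> * (L\<^sup>2 + 32 * exp (- L / 2) * ?c \<theta> q)"
      using pos by (intro mult_left_mono square_le_exp_split L) auto
    finally show ?thesis by (simp add: algebra_simps)
  next
    \<comment> \<open>Here the factor \<open>1 / sqrt 0\<close> is 0 and the hyperbolic cosine
      carries no information; instead all translates have mass 0 in the slab, and so does their
      sum.\<close>
    case True
    have kd: "sq_integrable lborel (k \<theta>)" and q: "q \<in> lat J" using that D Q k by auto
    have "mass (restr (slab J q)) (\<lambda>x. k \<theta> (x - m)) \<le> 0" if "m \<in> I" for m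
      using sum_mass_slab_translates[of "{m}" J q, OF _ _ q kd] that I True by auto
    then have "mass (restr (slab J q)) (\<lambda>x. k \<theta> (x - m)) = 0" if "m \<in> I" for m
      using that by (meson mass_nonneg order_antisym)
    then have "?Z \<theta> q = 0"
      unfolding lattice_sum_def[abs_def]
      by (intro mass_sum_eq_0 sq_integrable_restr sq_integrable_translate kd) auto
    then show ?thesis using True by simp
  qed
  have "(\<Sum>\<theta>\<in>D'. \<Sum>q\<in>Q'. ?Z \<theta> q) \<le> (\<Sum>\<theta>\<in>D'. \<Sum>q\<in>Q'. L\<^sup>2 * ?\<mu> \<theta> + 32 * exp (- L / 2) * (?\<mu> \<theta> * ?c \<theta> q))"
    by (intro sum_mono *)
  also have "\<dots> = L\<^sup>2 * real (card Q') * (\<Sum>\<theta>\<in>D'. ?\<mu> \<theta>) + 32 * exp (- L / 2) * (\<Sum>\<theta>\<in>D'. \<Sum>q\<in>Q'. ?\<mu> \<theta> * ?c \<theta> q)"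
    by (simp add: sum.distrib sum_distrib_left sum_distrib_right mult_ac)
  also have "(\<Sum>\<theta>\<in>D'. \<Sum>q\<in>Q'. ?\<mu> \<theta> * ?c \<theta> q) \<le> cosh_energy J D Q I k A"
  proof -
    have "(\<Sum>\<theta>\<in>D'. \<Sum>q\<in>Q'. ?\<mu> \<theta> * ?c \<theta> q) \<le> (\<Sum>\<theta>\<in>D'. \<Sum>q\<in>Q. ?\<mu> \<theta> * ?c \<theta> q)"
      using Q by (intro sum_mono sum_mono2) auto
    also have "\<dots> \<le> cosh_energy J D Q I k A"
      unfolding cosh_energy_def using D by (intro sum_mono2 sum_nonneg mult_nonneg_nonneg) auto
    finally show ?thesis .
  qed
  finally show ?thesis by (simp add: mult_left_mono)
qed

section \<open>Boxes, planks and lattice points\<close>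

lemma
  fixes B :: "'a::euclidean_space set"
  assumes "is_frame B \<omega>"
  shows frame_finite: "finite B" and frame_card: "card B \<le> DIM('a)"
    and frame_norm_le: "norm x \<le> (\<Sum>e\<in>B. \<bar>x \<bullet> e\<bar>)"
    and frame_unit: "e \<in> B \<Longrightarrow> norm e = 1" and frame_dir: "\<omega> \<in> B"
    and frame_orthogonal: "e \<in> B \<Longrightarrow> e \<noteq> \<omega> \<Longrightarrow> \<omega> \<bullet> e = 0"
proof -
  have B: "\<omega> \<in> B" "pairwise orthogonal B" "\<And>e. e \<in> B \<Longrightarrow> norm e = 1" "span B = UNIV"
    using assms by (auto simp: is_frame_def)
  have "0 \<notin> B" using B(3) by fastforce
  then have ind: "independent B"
    using pairwise_orthogonal_independent B(2) by blast
  show fin: "finite B" and "card B \<le> DIM('a)"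
    using independent_bound[OF ind] by auto
  have "x = (\<Sum>e\<in>B. (x \<bullet> e) *\<^sub>R e)"
    using orthonormal_basis_expand[OF B(2,3) _ fin, of x] B(4) by simp
  then have "norm x \<le> (\<Sum>e\<in>B. norm ((x \<bullet> e) *\<^sub>R e))"
    using norm_sum[of "\<lambda>e. (x \<bullet> e) *\<^sub>R e" B] by simp
  also have "\<dots> = (\<Sum>e\<in>B. \<bar>x \<bullet> e\<bar>)"
    using B(3) by (intro sum.cong) auto
  finally show "norm x \<le> (\<Sum>e\<in>B. \<bar>x \<bullet> e\<bar>)" .
  show "e \<in> B \<Longrightarrow> norm e = 1" "\<omega> \<in> B" using B by auto
  show "e \<in> B \<Longrightarrow> e \<noteq> \<omega> \<Longrightarrow> \<omega> \<bullet> e = 0"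
    using B(1,2) by (auto simp: pairwise_def orthogonal_def)
qed

lemma frame_norm_bound:
  fixes B :: "'a::euclidean_space set"
  assumes B: "is_frame B \<omega>" and d: "\<And>e. e \<in> B \<Longrightarrow> \<bar>x \<bullet> e\<bar> \<le> d" and "0 \<le> d"
  shows "norm x \<le> real DIM('a) * d"
proof -
  have "norm x \<le> (\<Sum>e\<in>B. \<bar>x \<bullet> e\<bar>)" by (rule frame_norm_le[OF B])
  also have "\<dots> \<le> real (card B) * d"
    using d by (intro sum_bounded_above) auto
  also have "\<dots> \<le> real DIM('a) * d"
    using frame_card[OF B] assms(3) by (intro mult_right_mono) auto
  finally show ?thesis .
qed

lemma mem_dilated_dual_box:
  assumes "0 < l"
  shows "x \<in> (\<lambda>y. l *\<^sub>R y) ` dual_box B \<omega> s \<longleftrightarrow>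
    \<bar>x \<bullet> \<omega>\<bar> \<le> l / 2 \<and> (\<forall>e\<in>B - {\<omega>}. \<bar>x \<bullet> e\<bar> \<le> l / (2 * s))"
proof
  assume "x \<in> (\<lambda>y. l *\<^sub>R y) ` dual_box B \<omega> s"
  then obtain y where y: "x = l *\<^sub>R y" "\<bar>y \<bullet> \<omega>\<bar> \<le> 1 / 2" "\<forall>e\<in>B - {\<omega>}. \<bar>y \<bullet> e\<bar> \<le> 1 / s / 2"
    by (auto simp: dual_box_def obox_def)
  have "\<bar>l * t\<bar> \<le> l * c" if "\<bar>t\<bar> \<le> c" for t c
    using assms that by (simp add: abs_mult mult_left_mono)
  from this[OF y(2)] this[of "y \<bullet> e" "1 / s / 2" for e] y(3)
  show "\<bar>x \<bullet> \<omega>\<bar> \<le> l / 2 \<and> (\<forall>e\<in>B - {\<omega>}. \<bar>x \<bullet> e\<bar> \<le> l / (2 * s))"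
    by (auto simp: y(1) mult.commute)
next
  assume x: "\<bar>x \<bullet> \<omega>\<bar> \<le> l / 2 \<and> (\<forall>e\<in>B - {\<omega>}. \<bar>x \<bullet> e\<bar> \<le> l / (2 * s))"
  have *: "\<bar>inverse l * t\<bar> \<le> c / l" if "\<bar>t\<bar> \<le> c" for t c
    using assms that by (simp add: abs_mult divide_inverse mult.commute mult_left_mono)
  have "inverse l *\<^sub>R x \<in> dual_box B \<omega> s"
    using x *[of "x \<bullet> \<omega>" "l / 2"] *[of "x \<bullet> e" "l / (2 * s)" for e] assms
    by (auto simp: dual_box_def obox_def mult.commute)
  then show "x \<in> (\<lambda>y. l *\<^sub>R y) ` dual_box B \<omega> s"
    using assms by (intro image_eqI[of _ _ "inverse l *\<^sub>R x"]) auto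
qed

lemma mem_V_box:
  assumes "0 < R" "0 < s"
  shows "x \<in> V_box B \<omega> s R \<longleftrightarrow> \<bar>x \<bullet> \<omega>\<bar> \<le> R * s\<^sup>2 / 2 \<and> (\<forall>e\<in>B - {\<omega>}. \<bar>x \<bullet> e\<bar> \<le> R * s / 2)"
  unfolding V_box_def using assms
  by (subst mem_dilated_dual_box) (auto simp: power2_eq_square)

lemma measure_translation_lborel:
  assumes "S \<in> sets borel"
  shows "measure lborel ((+) a ` S) = measure lborel (S :: 'a::euclidean_space set)"
proof -
  have e: "(+) a ` S = (\<lambda>x. - a + x) -` S"
    by (auto simp: image_iff intro!: bexI[of _ "- a + _"])
  have "measure lborel S = measure (distr lborel borel ((+) (- a))) S"
    by (simp add: lborel_distr_plus)
  also have "\<dots> = measure lborel ((+) a ` S)"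
    unfolding e using assms by (subst measure_distr) auto
  finally show ?thesis by simp
qed

lemma V_box_sets:
  fixes B :: "'a::euclidean_space set"
  assumes "is_frame B \<omega>" "0 < R" "0 < s"
  shows "V_box B \<omega> s R \<in> sets borel" and "bounded (V_box B \<omega> s R)"
proof -
  have [simp]: "finite (B - {\<omega>})" using frame_finite[OF assms(1)] by simp
  have "V_box B \<omega> s R = {x. \<bar>x \<bullet> \<omega>\<bar> \<le> R * s\<^sup>2 / 2 \<and> (\<forall>e\<in>B - {\<omega>}. \<bar>x \<bullet> e\<bar> \<le> R * s / 2)}"
    using mem_V_box[OF assms(2,3)] by blast
  also have "\<dots> = {x. \<bar>x \<bullet> \<omega>\<bar> \<le> R * s\<^sup>2 / 2} \<inter> (\<Inter>e\<in>B - {\<omega>}. {x. \<bar>x \<bullet> e\<bar> \<le> R * s / 2})"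
    by auto
  also have "closed \<dots>"
    by (intro closed_Int closed_INT ballI closed_Collect_le continuous_intros)
  finally show "V_box B \<omega> s R \<in> sets borel" by (rule borel_closed)
  show "bounded (V_box B \<omega> s R)"
  proof (rule boundedI)
    fix x assume "x \<in> V_box B \<omega> s R"
    then have *: "\<bar>x \<bullet> \<omega>\<bar> \<le> R * s\<^sup>2 / 2" "\<And>e. e \<in> B - {\<omega>} \<Longrightarrow> \<bar>x \<bullet> e\<bar> \<le> R * s / 2"
      using mem_V_box[OF assms(2,3)] by blast+
    have "0 \<le> R * s\<^sup>2 / 2" "0 \<le> R * s / 2" using assms by auto
    then have "\<bar>x \<bullet> e\<bar> \<le> R * s\<^sup>2 / 2 + R * s / 2" if "e \<in> B" for e
      using that * by (cases "e = \<omega>") (auto intro: order_trans add_increasing add_increasing2)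
    then show "norm x \<le> real DIM('a) * (R * s\<^sup>2 / 2 + R * s / 2)"
      using assms by (intro frame_norm_bound[OF assms(1)]) auto
  qed
qed

lemma card_int_interval_le:
  fixes x y :: real
  assumes "x \<le> y"
  shows "finite {i::int. x \<le> of_int i \<and> of_int i \<le> y}"
    and "real (card {i::int. x \<le> of_int i \<and> of_int i \<le> y}) \<le> y - x + 1"
proof -
  have e: "{i::int. x \<le> of_int i \<and> of_int i \<le> y} = {\<lceil>x\<rceil>..\<lfloor>y\<rfloor>}"
    by (auto simp: le_floor_iff ceiling_le_iff)
  show "finite {i::int. x \<le> of_int i \<and> of_int i \<le> y}" unfolding e by simp
  have "real (nat (\<lfloor>y\<rfloor> + 1 - \<lceil>x\<rceil>)) \<le> y - x + 1"
  proof (cases "0 \<le> \<lfloor>y\<rfloor> + 1 - \<lceil>x\<rceil>")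
    case True
    have "of_int \<lfloor>y\<rfloor> \<le> y" "x \<le> of_int \<lceil>x\<rceil>" by (rule of_int_floor_le, rule le_of_int_ceiling)
    then have "real_of_int (\<lfloor>y\<rfloor> + 1 - \<lceil>x\<rceil>) \<le> y - x + 1"
      unfolding of_int_diff of_int_add of_int_1 by linarith
    with True show ?thesis by (simp only: of_nat_nat)
  qed (use assms in simp)
  then show "real (card {i::int. x \<le> of_int i \<and> of_int i \<le> y}) \<le> y - x + 1"
    unfolding e by simp
qed

lemma cube_subset_ball:
  fixes x :: "real ^ 'n::finite"
  assumes "\<And>j. \<bar>x $ j\<bar> \<le> d"
  shows "norm x \<le> real CARD('n) * d"
proof -
  have "norm x \<le> (\<Sum>j\<in>UNIV. \<bar>x $ j\<bar>)" by (rule norm_le_l1_cart)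
  also have "\<dots> \<le> (\<Sum>j\<in>(UNIV::'n set). d)" by (intro sum_mono assms)
  finally show ?thesis by simp
qed

lemma measure_cube_lower:
  assumes "0 \<le> d"
  shows "measure lborel (cbox (\<chi> j. c $ j - d) (\<chi> j. c $ j + d)) = (2 * d) ^ CARD('n::finite)"
    and "x \<in> cbox (\<chi> j. c $ j - d) (\<chi> j. c $ j + d) \<longleftrightarrow> (\<forall>j. \<bar>x $ j - c $ (j::'n)\<bar> \<le> d)"
proof -
  show m: "x \<in> cbox (\<chi> j. c $ j - d) (\<chi> j. c $ j + d) \<longleftrightarrow> (\<forall>j. \<bar>x $ j - c $ j\<bar> \<le> d)" for x
    unfolding mem_box_cart by (auto simp: abs_le_iff algebra_simps)
  have "c \<in> cbox (\<chi> j. c $ j - d) (\<chi> j. c $ j + d)" using assms by (simp add: m)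
  then have "cbox (\<chi> j. c $ j - d) (\<chi> j. c $ j + d) \<noteq> {}" by blast
  from content_cbox_cart[OF this]
  show "measure lborel (cbox (\<chi> j. c $ j - d) (\<chi> j. c $ j + d)) = (2 * d) ^ CARD('n)" by simp
qed

text \<open>The box is rotated, so its volume is bounded by a covering: at most \<open>3 / s\<close>
  translates of it along \<omega> cover an axis-parallel cube with sides
  \<open>R * s / n\<close>.\<close>

lemma measure_V_box_lower:
  fixes B :: "(real ^ 'n::finite) set"
  assumes B: "is_frame B \<omega>" and R: "0 < R" and s: "0 < s" "s \<le> 1"
  shows "(R * s / real CARD('n)) ^ CARD('n) * s / 3 \<le> measure lborel ((+) a ` V_box B \<omega> s R)"
proof -
  let ?V = "V_box B \<omega> s R"
  define d where "d = R * s / (2 * real CARD('n))"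
  define h where "h = R * s\<^sup>2"
  have d0: "0 < d" and h0: "0 < h" using R s by (auto simp: d_def h_def)
  have Vs: "?V \<in> sets borel" by (rule V_box_sets[OF B R s(1)])
  have Vt: "(+) t ` ?V \<in> sets borel" for t
  proof -
    have "(+) t ` ?V = (\<lambda>x. - t + x) -` ?V \<inter> space borel"
      by (auto simp: image_iff intro!: bexI[of _ "- t + _"])
    also have "\<dots> \<in> sets borel" by (rule measurable_sets[OF _ Vs]) measurable
    finally show ?thesis .
  qed
  have Vf: "emeasure lborel ((+) t ` ?V) < \<infinity>" for t
    by (intro emeasure_bounded_finite bounded_translation V_box_sets[OF B R s(1)])
  \<comment> \<open>On the cube \<open>x \<bullet> \<omega>\<close> is at most
    \<open>R * s / 2 = h / (2 * s)\<close> in absolute value, and rounding to a multiple of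
    \<open>h\<close> moves the index by 1/2.\<close>
  define I where "I = {i::int. - (1 / (2 * s) + 1 / 2) \<le> of_int i \<and> of_int i \<le> 1 / (2 * s) + 1 / 2}"
  have "- (1 / (2 * s) + 1 / 2) \<le> 1 / (2 * s) + 1 / 2" using s by simp
  note I = card_int_interval_le[OF this, folded I_def]
  have "real (card I) \<le> 1 / s + 2" using I(2) by simp
  also have "\<dots> \<le> 3 / s" using s by (simp add: field_simps)
  finally have cI: "real (card I) \<le> 3 / s" .
  let ?C = "cbox (\<chi> j. 0 $ j - d) (\<chi> j. 0 $ j + d) :: (real ^ 'n) set"
  have sub: "?C \<subseteq> (\<Union>i\<in>I. (+) ((of_int i * h) *\<^sub>R \<omega>) ` ?V)"
  proof
    fix x :: "real ^ 'n" assume "x \<in> ?C"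
    then have "\<And>j. \<bar>x $ j\<bar> \<le> d" using measure_cube_lower(2)[of d x 0] d0 by simp
    then have "norm x \<le> real CARD('n) * d" by (rule cube_subset_ball)
    then have nx: "norm x \<le> R * s / 2" by (simp add: d_def)
    have xe: "\<bar>x \<bullet> e\<bar> \<le> R * s / 2" if "e \<in> B" for e
      using Cauchy_Schwarz_ineq2[of x e] frame_unit[OF B that] nx by simp
    define i where "i = round (x \<bullet> \<omega> / h)"
    have ri: "\<bar>of_int i - x \<bullet> \<omega> / h\<bar> \<le> 1 / 2" unfolding i_def by (rule of_int_round_abs_le)
    have "\<bar>x \<bullet> \<omega> / h\<bar> \<le> (R * s / 2) / h"
      unfolding abs_divide abs_of_pos[OF h0] using h0 by (intro divide_right_mono xe[OF frame_dir[OF B]]) auto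
    also have "\<dots> = 1 / (2 * s)" using R s by (simp add: h_def power2_eq_square)
    finally have "i \<in> I" using ri unfolding I_def mem_Collect_eq by linarith
    moreover have "x - (of_int i * h) *\<^sub>R \<omega> \<in> ?V"
      unfolding mem_V_box[OF R s(1)]
    proof (intro conjI ballI)
      have "\<omega> \<bullet> \<omega> = 1" using frame_unit[OF B frame_dir[OF B]] by (simp add: dot_square_norm)
      then have "(x - (of_int i * h) *\<^sub>R \<omega>) \<bullet> \<omega> = - h * (of_int i - x \<bullet> \<omega> / h)"
        using h0 by (simp add: inner_diff_left field_simps)
      then have "\<bar>(x - (of_int i * h) *\<^sub>R \<omega>) \<bullet> \<omega>\<bar> = h * \<bar>of_int i - x \<bullet> \<omega> / h\<bar>"
        using h0 by (simp add: abs_mult)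
      also have "\<dots> \<le> h * (1 / 2)" using h0 ri by (intro mult_left_mono) auto
      finally show "\<bar>(x - (of_int i * h) *\<^sub>R \<omega>) \<bullet> \<omega>\<bar> \<le> R * s\<^sup>2 / 2" by (simp add: h_def)
      fix e assume "e \<in> B - {\<omega>}"
      then show "\<bar>(x - (of_int i * h) *\<^sub>R \<omega>) \<bullet> e\<bar> \<le> R * s / 2"
        using xe frame_orthogonal[OF B, of e] by (simp add: inner_diff_left)
    qed
    ultimately show "x \<in> (\<Union>i\<in>I. (+) ((of_int i * h) *\<^sub>R \<omega>) ` ?V)"
      by (intro UN_I[of i]) (auto simp: image_iff intro!: bexI[of _ "x - (of_int i * h) *\<^sub>R \<omega>"])
  qed
  have "(2 * d) ^ CARD('n) = measure lborel ?C"
    using measure_cube_lower(1)[of d "0 :: real ^ 'n"] d0 by simp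
  also have "\<dots> \<le> measure lborel (\<Union>i\<in>I. (+) ((of_int i * h) *\<^sub>R \<omega>) ` ?V)"
  proof (rule measure_mono_fmeasurable[OF sub])
    show "(\<Union>i\<in>I. (+) ((of_int i * h) *\<^sub>R \<omega>) ` ?V) \<in> fmeasurable lborel"
      using I(1) Vt Vf by (intro fmeasurable.finite_UN) (auto simp: fmeasurable_def)
  qed simp
  also have "\<dots> \<le> (\<Sum>i\<in>I. measure lborel ((+) ((of_int i * h) *\<^sub>R \<omega>) ` ?V))"
    using I(1) Vt Vf by (intro measure_UNION_le) (auto simp: fmeasurable_def)
  also have "\<dots> = real (card I) * measure lborel ?V"
    by (simp add: measure_translation_lborel[OF Vs])
  also have "\<dots> \<le> 3 / s * measure lborel ?V"
    by (intro mult_right_mono cI) simp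
  finally have "(2 * d) ^ CARD('n) * s / 3 \<le> measure lborel ?V"
    using s by (simp add: field_simps)
  then show ?thesis
    unfolding measure_translation_lborel[OF Vs] by (simp add: d_def)
qed

section \<open>Frequencies near a cap against lattice slabs near a plank\<close>

definition dir_box :: "'n set \<Rightarrow> 'n \<Rightarrow> real \<Rightarrow> real \<Rightarrow> real ^ 'n \<Rightarrow> (real ^ 'n::finite) set" where
  "dir_box J j0 r d \<omega> = {\<xi> \<in> amp_box J j0 r 1. norm (\<xi> /\<^sub>R norm \<xi> - \<omega>) \<le> d}"

lemma dir_box_sets [measurable, simp]: "dir_box J j0 r d \<omega> \<in> sets borel"
proof -
  have "dir_box J j0 r d \<omega> = amp_box J j0 r 1 \<inter> {\<xi>. norm (\<xi> /\<^sub>R norm \<xi> - \<omega>) \<le> d}"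
    by (auto simp: dir_box_def)
  then show ?thesis by simp
qed

text \<open>About \<open>1 / s\<close> boxes placed along the ray through \<omega> cover the set,
  each of side of order \<open>s\<close> along \<open>J\<close> and of order \<open>r\<close> off
  \<open>J\<close>. This leaves the power \<open>card J - 1\<close> of \<open>s\<close>.\<close>

lemma measure_dir_box_le:
  fixes J :: "'n::finite set"
  assumes r: "0 < r" "r \<le> 1" and s: "0 < s" "s \<le> 1" and j0: "j0 \<in> J" and w: "norm \<omega> = 1" and H: "0 \<le> H"
  shows "measure lborel (dir_box J j0 r (H * s) \<omega>) \<le> 2 * (2 * (H + 1)) ^ CARD('n) * s ^ (card J - 1)
      * r ^ (CARD('n) - card J)"
proof -
  \<comment> \<open>Along \<open>J\<close>, \<open>H * s\<close> is the angular error and the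
    additional \<open>s\<close> is the radial error, since the centres on the ray have spacing
    \<open>s\<close>. Off \<open>J\<close> the centres are 0, as is the centre of the amplitude
    box.\<close>
  define d where "d j = (if j \<in> J then (H + 1) * s else wid J r j)" for j
  define b where "b i = cbox (\<chi> j. (if j \<in> J then real i * s * \<omega> $ j
      else 0) - d j) (\<chi> j. (if j \<in> J then real i * s * \<omega> $ j else 0) + d j)" for i :: nat
  have d0: "0 \<le> d j" for j using H s wid_pos[OF r(1), of J j] by (simp add: d_def)
  have mb: "x \<in> b i \<longleftrightarrow> (\<forall>j. \<bar>x $ j - (if j \<in> J then real i * s * \<omega> $ j else 0)\<bar> \<le> d j)" for x i
    unfolding b_def mem_box_cart by (auto simp: abs_le_iff algebra_simps)
  have vb: "measure lborel (b i) \<le> (2 * (H + 1)) ^ CARD('n) * s ^ card J * r ^ (CARD('n) - card J)" for i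
  proof -
    have "(\<chi> j. (if j \<in> J then real i * s * \<omega> $ j else 0)) \<in> b i" using d0 by (simp add: mb)
    then have ne: "b i \<noteq> {}" by blast
    have "measure lborel (b i) = (\<Prod>j\<in>UNIV. 2 * d j)"
      using content_cbox_cart[OF ne[unfolded b_def]] unfolding b_def by simp
    also have "\<dots> \<le> (\<Prod>j\<in>UNIV. 2 * (H + 1) * (if j \<in> J then s else r))"
    proof (intro prod_mono conjI)
      fix j
      have "1 \<le> real CARD('n)" by (simp add: Suc_leI)
      then have "1 \<le> 8 * real CARD('n)" by linarith
      then have "r * 1 \<le> r * (8 * real CARD('n))" using r by (intro mult_left_mono) linarith+
      then have "r / (8 * real CARD('n)) \<le> r" by (simp add: divide_le_eq)
      also have "\<dots> \<le> (H + 1) * r" using H r by (simp add: distrib_right)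
      finally show "2 * d j \<le> 2 * (H + 1) * (if j \<in> J then s else r)"
        by (auto simp: d_def wid_def algebra_simps)
    qed (use d0 in simp)
    also have "\<dots> = (2 * (H + 1)) ^ CARD('n) * (\<Prod>j\<in>UNIV. if j \<in> J then s else r)"
      by (simp only: prod.distrib prod_constant power_mult_distrib)
    also have "(\<Prod>j\<in>UNIV. if j \<in> J then s else r) = s ^ card J * r ^ (CARD('n) - card J)"
    proof -
      have "(\<Prod>j\<in>UNIV. if j \<in> J then s else r) = (\<Prod>j\<in>J. s) * (\<Prod>j\<in>- J. r)"
        by (subst prod.If_cases) auto
      then show ?thesis by (simp add: Compl_eq_Diff_UNIV card_Diff_subset)
    qed
    finally show ?thesis by (simp add: mult.assoc)
  qed
  define m where "m = nat \<lfloor>1 / s\<rfloor>"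
  have m: "real m \<le> 1 / s" using s by (simp add: m_def)
  have sub: "dir_box J j0 r (H * s) \<omega> \<subseteq> (\<Union>i\<in>{..m}. b i)"
  proof
    fix \<xi> assume x: "\<xi> \<in> dir_box J j0 r (H * s) \<omega>"
    then have xb: "\<xi> \<in> amp_box J j0 r 1" and xd: "norm (\<xi> /\<^sub>R norm \<xi> - \<omega>) \<le> H * s"
      by (auto simp: dir_box_def)
    have n: "5 / 8 \<le> norm \<xi>" "norm \<xi> \<le> 7 / 8" using norm_amp_box[OF r xb] by auto
    define i where "i = nat \<lfloor>norm \<xi> / s\<rfloor>"
    have ri: "real i \<le> norm \<xi> / s" "norm \<xi> / s < real i + 1"
      using s by (auto simp: i_def)
    have ins: "real i * s \<le> norm \<xi>" "norm \<xi> < real i * s + s"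
      using ri s by (auto simp: field_simps)
    have "norm \<xi> / s \<le> 1 / s" using n s by (intro divide_right_mono) auto
    then have "i \<le> m" unfolding i_def m_def by (intro nat_mono floor_mono)
    moreover have "\<xi> \<in> b i"
      unfolding mb
    proof
      fix j
      show "\<bar>\<xi> $ j - (if j \<in> J then real i * s * \<omega> $ j else 0)\<bar> \<le> d j"
      proof (cases "j \<in> J")
        case True
        have "\<bar>(\<xi> /\<^sub>R norm \<xi> - \<omega>) $ j\<bar> \<le> H * s"
          using component_le_norm_cart[of "\<xi> /\<^sub>R norm \<xi> - \<omega>" j] xd by linarith
        then have "norm \<xi> * \<bar>(\<xi> /\<^sub>R norm \<xi> - \<omega>) $ j\<bar> \<le> 1 * (H * s)"
          using n H s by (intro mult_mono) auto
        also have "norm \<xi> * \<bar>(\<xi> /\<^sub>R norm \<xi> - \<omega>) $ j\<bar> = \<bar>\<xi> $ j - norm \<xi> * \<omega> $ j\<bar>"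
        proof -
          have "\<xi> $ j - norm \<xi> * \<omega> $ j = norm \<xi> * (\<xi> /\<^sub>R norm \<xi> - \<omega>) $ j"
          proof -
            have "norm \<xi> \<noteq> 0" using n(1) by linarith
            then have "norm \<xi> * (inverse (norm \<xi>) * \<xi> $ j) = \<xi> $ j" by (simp add: mult.assoc[symmetric])
            then show ?thesis by (simp add: right_diff_distrib)
          qed
          then show ?thesis by (simp add: abs_mult)
        qed
        finally have 1: "\<bar>\<xi> $ j - norm \<xi> * \<omega> $ j\<bar> \<le> H * s" by simp
        have "\<bar>\<omega> $ j\<bar> \<le> 1" using component_le_norm_cart[of \<omega> j] w by simp
        then have "\<bar>norm \<xi> - real i * s\<bar> * \<bar>\<omega> $ j\<bar> \<le> s * 1"
          using ins s by (intro mult_mono) auto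
        then have 2: "\<bar>norm \<xi> * \<omega> $ j - real i * s * \<omega> $ j\<bar> \<le> s"
          by (simp add: abs_mult[symmetric] left_diff_distrib)
        have "\<bar>\<xi> $ j - real i * s * \<omega> $ j\<bar> \<le> H * s + s" using 1 2 by linarith
        then show ?thesis using True by (simp add: d_def distrib_right)
      next
        case False
        then have "\<bar>\<xi> $ j - mid j0 $ j\<bar> \<le> 1 * wid J r j" "mid j0 $ j = 0"
          using xb j0 unfolding mem_amp_box by (auto simp: mid_def axis_def)
        then show ?thesis using False by (simp add: d_def)
      qed
    qed
    ultimately show "\<xi> \<in> (\<Union>i\<in>{..m}. b i)" by blast
  qed
  have bf: "b i \<in> fmeasurable lborel" for i
    unfolding b_def by (intro fmeasurableI) (auto intro: emeasure_bounded_finite[unfolded infinity_ennreal_def])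
  have "measure lborel (dir_box J j0 r (H * s) \<omega>) \<le> measure lborel (\<Union>i\<in>{..m}. b i)"
    using bf by (intro measure_mono_fmeasurable[OF sub] fmeasurable.finite_UN) auto
  also have "\<dots> \<le> (\<Sum>i\<le>m. measure lborel (b i))"
    using fmeasurableD[OF bf] by (intro measure_UNION_le) auto
  also have "\<dots> \<le> (\<Sum>i\<le>m. (2 * (H + 1)) ^ CARD('n) * s ^ card J * r ^ (CARD('n) - card J))"
    by (intro sum_mono vb)
  also have "\<dots> = (real m + 1) * ((2 * (H + 1)) ^ CARD('n) * s ^ card J * r ^ (CARD('n) - card J))"
    by simp
  also have "\<dots> \<le> (2 / s) * ((2 * (H + 1)) ^ CARD('n) * s ^ card J * r ^ (CARD('n) - card J))"
  proof (intro mult_right_mono)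
    have "1 \<le> 1 / s" using s by simp
    then show "real m + 1 \<le> 2 / s" using m by linarith
  qed (use H s r in auto)
  also have "s ^ card J = s * s ^ (card J - 1)"
    using j0 by (metis Suc_pred' card_gt_0_iff empty_iff finite power_Suc)
  also have "(2 / s) * ((2 * (H + 1)) ^ CARD('n) * (s * s ^ (card J - 1)) * r ^ (CARD('n) - card J))
    = 2 * (2 * (H + 1)) ^ CARD('n) * s ^ (card J - 1) * r ^ (CARD('n) - card J)"
    using s by simp
  finally show ?thesis .
qed

text \<open>All coordinates of a point but \<open>j0\<close> are chosen freely within distance
  \<open>Y\<close>. As \<omega> has a component of at least 1/4 along \<open>j0\<close>, the linear
  condition then confines the last coordinate to an interval of length \<open>8 * Z\<close>.\<close>

lemma card_lattice_plank:
  fixes J :: "'n::finite set" and a \<omega> :: "real ^ 'n"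
  assumes j0: "j0 \<in> J" and Q: "Q \<subseteq> lat J" and w: "1 / 4 \<le> \<omega> $ j0" and YZ: "0 \<le> Y" "0 \<le> Z"
    and qY: "\<And>q j. q \<in> Q \<Longrightarrow> j \<in> J \<Longrightarrow> \<bar>q $ j - a $ j\<bar> \<le> Y"
    and qZ: "\<And>q. q \<in> Q \<Longrightarrow> \<bar>\<Sum>j\<in>J. \<omega> $ j * (q $ j - a $ j)\<bar> \<le> Z"
  shows "finite Q" and "real (card Q) \<le> (2 * Y + 1) ^ (card J - 1) * (8 * Z + 1)"
proof -
  define J' where "J' = J - {j0}"
  define \<pi> where "\<pi> q = restrict (\<lambda>j. \<lfloor>q $ j\<rfloor>) J'" for q :: "real ^ 'n"
  define T where "T j = {i::int. a $ j - Y \<le> of_int i \<and> of_int i \<le> a $ j + Y}" for j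
  define E where "E = PiE J' T"
  have T: "finite (T j)" "real (card (T j)) \<le> 2 * Y + 1" for j
    using card_int_interval_le[of "a $ j - Y" "a $ j + Y"] YZ unfolding T_def by auto
  have E: "finite E" unfolding E_def by (intro finite_PiE T) simp
  have "real (card E) = (\<Prod>j\<in>J'. real (card (T j)))" unfolding E_def by (simp add: card_PiE)
  also have "\<dots> \<le> (\<Prod>j\<in>J'. 2 * Y + 1)" by (intro prod_mono) (auto simp: T)
  finally have cE: "real (card E) \<le> (2 * Y + 1) ^ (card J - 1)"
    using j0 by (simp add: J'_def card_Diff_singleton)
  have fl: "of_int \<lfloor>q $ j\<rfloor> = q $ j" if "q \<in> Q" "j \<in> J" for q j
  proof -
    have "q $ j \<in> \<int>" using that Q by (auto simp: lat_def)
    then show ?thesis by simp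
  qed
  have \<pi>E: "\<pi> q \<in> E" if "q \<in> Q" for q
    unfolding E_def \<pi>_def
  proof (intro restrict_PiE_iff[THEN iffD2] ballI)
    fix j assume "j \<in> J'"
    then have "j \<in> J" by (simp add: J'_def)
    with fl[OF that this] qY[OF that this] show "\<lfloor>q $ j\<rfloor> \<in> T j"
      unfolding T_def mem_Collect_eq by linarith
  qed
  have fib: "finite {q \<in> Q. \<pi> q = g} \<and> real (card {q \<in> Q. \<pi> q = g}) \<le> 8 * Z + 1" for g
  proof -
    let ?F = "{q \<in> Q. \<pi> q = g}"
    \<comment> \<open>The value of the coordinate \<open>j0\<close> for which the linear form
      vanishes, given the others.\<close>
    define c where "c = a $ j0 - (\<Sum>j\<in>J'. \<omega> $ j * (of_int (g j) - a $ j)) / \<omega> $ j0"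
    have w0: "0 < \<omega> $ j0" using w by linarith
    let ?I = "{i::int. c - 4 * Z \<le> of_int i \<and> of_int i \<le> c + 4 * Z}"
    have I: "finite ?I" "real (card ?I) \<le> 8 * Z + 1"
      using card_int_interval_le[of "c - 4 * Z" "c + 4 * Z"] YZ by auto
    have inj: "inj_on (\<lambda>q. \<lfloor>q $ j0\<rfloor>) ?F"
    proof (rule inj_onI)
      fix q q' assume q: "q \<in> ?F" "q' \<in> ?F" "\<lfloor>q $ j0\<rfloor> = \<lfloor>q' $ j0\<rfloor>"
      have "q $ j = q' $ j" for j
      proof (cases "j \<in> J")
        case True
        have "\<lfloor>q $ j\<rfloor> = \<lfloor>q' $ j\<rfloor>"
        proof (cases "j = j0")
          case False
          then have "\<pi> q j = \<lfloor>q $ j\<rfloor>" "\<pi> q' j = \<lfloor>q' $ j\<rfloor>" using True by (auto simp: \<pi>_def J'_def)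
          then show ?thesis using q by simp
        qed (use q in simp)
        then show ?thesis using fl[of q j] fl[of q' j] q True by auto
      next
        case False
        have "q \<in> lat J" "q' \<in> lat J" using q Q by auto
        then show ?thesis using False by (simp add: lat_def)
      qed
      then show "q = q'" by (simp add: vec_eq_iff)
    qed
    have img: "(\<lambda>q. \<lfloor>q $ j0\<rfloor>) ` ?F \<subseteq> ?I"
    proof
      fix i assume "i \<in> (\<lambda>q. \<lfloor>q $ j0\<rfloor>) ` ?F"
      then obtain q where q: "q \<in> Q" "\<pi> q = g" "i = \<lfloor>q $ j0\<rfloor>" by blast
      have gj: "of_int (g j) = q $ j" if "j \<in> J'" for j
        using that q(2) fl[OF q(1), of j] by (auto simp: \<pi>_def J'_def)
      have "(\<Sum>j\<in>J. \<omega> $ j * (q $ j - a $ j)) = \<omega> $ j0 * (q $ j0 - a $ j0) + (\<Sum>j\<in>J'. \<omega> $ j * (q $ j - a $ j))"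
        unfolding J'_def using j0 by (simp add: sum.remove)
      also have "(\<Sum>j\<in>J'. \<omega> $ j * (q $ j - a $ j)) = (\<Sum>j\<in>J'. \<omega> $ j * (of_int (g j) - a $ j))"
        by (intro sum.cong) (auto simp: gj)
      also have "\<omega> $ j0 * (q $ j0 - a $ j0) + \<dots> = \<omega> $ j0 * (q $ j0 - c)"
        using w0 by (simp add: c_def field_simps)
      finally have z: "\<omega> $ j0 * \<bar>q $ j0 - c\<bar> \<le> Z"
        using qZ[OF q(1)] w0 by (simp add: abs_mult)
      have "1 / 4 * \<bar>q $ j0 - c\<bar> \<le> \<omega> $ j0 * \<bar>q $ j0 - c\<bar>"
        using w by (intro mult_right_mono) auto
      from order_trans[OF this z] have "\<bar>q $ j0 - c\<bar> \<le> 4 * Z" by simp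
      then show "i \<in> ?I" using fl[OF q(1) j0] q(3) by (auto simp: abs_le_iff)
    qed
    have "finite ?F" using inj img I(1) by (meson finite_imageD finite_subset)
    moreover have "card ?F \<le> card ?I"
      by (rule card_inj_on_le[OF inj img I(1)])
    ultimately show ?thesis using I(2) by linarith
  qed
  have Qe: "Q = (\<Union>g\<in>E. {q \<in> Q. \<pi> q = g})" using \<pi>E by auto
  show "finite Q" by (subst Qe) (use E fib in auto)
  have "card Q \<le> (\<Sum>g\<in>E. card {q \<in> Q. \<pi> q = g})"
    by (subst Qe) (rule card_UN_le[OF E])
  then have "real (card Q) \<le> (\<Sum>g\<in>E. real (card {q \<in> Q. \<pi> q = g}))"
    unfolding of_nat_sum[symmetric] by (rule of_nat_mono)
  also have "\<dots> \<le> (\<Sum>g\<in>E. 8 * Z + 1)" using fib by (intro sum_mono) auto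
  also have "\<dots> = real (card E) * (8 * Z + 1)" by simp
  also have "\<dots> \<le> (2 * Y + 1) ^ (card J - 1) * (8 * Z + 1)"
    using YZ by (intro mult_right_mono cE) auto
  finally show "real (card Q) \<le> (2 * Y + 1) ^ (card J - 1) * (8 * Z + 1)" .
qed

text \<open>Geometric core of the density bound. With sides of order \<open>R * s\<close> and one
  thickness of order \<open>R * s\<^sup>2\<close>, the plank meets about
  \<open>R ^ k * s ^ (k + 1)\<close> slabs, where \<open>k = card J\<close>; the frequencies near
  the cap fill a volume of order \<open>s ^ (k - 1) * r ^ (n - k)\<close>. The powers of
  \<open>s\<close> multiply to \<open>s ^ (2 * k)\<close>.\<close>

lemma count_times_volume:
  fixes J :: "'n::finite set" and a \<omega> :: "real ^ 'n"
  assumes j0: "j0 \<in> J" and r: "0 < r" "r \<le> s" and s: "s \<le> 1" and Rs: "1 \<le> R * s\<^sup>2"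
    and l: "1 \<le> l" and H: "1 \<le> H" and w: "norm \<omega> = 1" and Q: "Q \<subseteq> lat J"
    and q: "\<And>q. q \<in> Q \<Longrightarrow> \<exists>x\<in>slab J q. \<bar>(x - a) \<bullet> \<omega>\<bar> \<le> 2 * l * (R * s\<^sup>2) \<and> norm (x - a)
        \<le> 2 * real CARD('n) * l * (R * s)"
  shows "real (card Q) * measure lborel (dir_box J j0 r (H * s) \<omega>) \<le>
    130 * (real CARD('n))\<^sup>2 * H * (7 * real CARD('n)) ^ CARD('n) * (2 * (H + 1)) ^ CARD('n) *
    (l * R) ^ card J * s ^ (2 * card J) * r ^ (CARD('n) - card J)"
proof -
  define n where "n = real CARD('n)"
  define k where "k = card J - 1"
  have kJ: "card J = Suc k" unfolding k_def using j0 by (metis Suc_pred' card_gt_0_iff empty_iff finite)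
  have n1: "1 \<le> n" by (simp add: n_def Suc_leI)
  have s0: "0 < s" using r by linarith
  have Rpos: "0 < R" using Rs s0 by (metis less_le_trans mult_nonpos_nonneg not_le zero_le_power2 zero_less_one)
  define X where "X = l * R * s"
  define W where "W = l * (R * s\<^sup>2)"
  have W1: "1 \<le> W" unfolding W_def using l Rs by (metis mult_mono' mult_1 zero_le_one)
  have WX: "W \<le> X" unfolding W_def X_def using l Rpos s0 s by (simp add: power2_eq_square mult_left_le)
  have X1: "1 \<le> X" using W1 WX by linarith
  have bound: "real (card Q) \<le> (7 * n * X) ^ k * (65 * n\<^sup>2 * H * W)" if ne: "dir_box J j0 r (H * s) \<omega> \<noteq> {}"
  proof -
    obtain \<xi> where xb: "\<xi> \<in> amp_box J j0 r 1" and xd: "norm (\<xi> /\<^sub>R norm \<xi> - \<omega>) \<le> H * s"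
      using ne by (auto simp: dir_box_def)
    have nx: "5 / 8 \<le> norm \<xi>" "norm \<xi> \<le> 7 / 8" "5 / 8 \<le> \<xi> $ j0"
      using norm_amp_box[OF r(1) _ xb] r s by auto
    have cmp: "\<bar>\<xi> $ j / norm \<xi> - \<omega> $ j\<bar> \<le> H * s" for j
      using component_le_norm_cart[of "\<xi> /\<^sub>R norm \<xi> - \<omega>" j] xd by (simp add: divide_inverse mult.commute)
    define Y where "Y = 3 * n * X"
    have Y: "\<bar>q' $ j - a $ j\<bar> \<le> Y" if q': "q' \<in> Q" and "j \<in> J" for q' j
    proof -
      obtain x where x: "x \<in> slab J q'" "norm (x - a) \<le> 2 * n * l * (R * s)"
        using q[OF q'] by (auto simp: n_def)
      have "\<bar>x $ j - a $ j\<bar> \<le> 2 * n * X"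
        using component_le_norm_cart[of "x - a" j] x(2) by (simp add: X_def mult.assoc)
      moreover have "\<bar>q' $ j - x $ j\<bar> \<le> 1"
        using x(1) that by (auto simp: slab_def)
      moreover have "1 \<le> n * X" using n1 X1 by (metis mult_mono' mult_1 zero_le_one)
      ultimately show ?thesis unfolding Y_def by linarith
    qed
    have nX: "1 \<le> n * X" using n1 X1 by (metis mult_mono' mult_1 zero_le_one)
    have Y0: "0 \<le> Y" "2 * Y + 1 \<le> 7 * n * X" unfolding Y_def using nX by linarith+
    have n2: "n \<le> n\<^sup>2" using n1 by (simp add: power2_eq_square)
    have nH: "1 \<le> n\<^sup>2 * H" using n2 n1 H by (metis dual_order.trans mult_mono' mult_1 zero_le_one)
    have nHW: "1 \<le> n\<^sup>2 * H * W" using nH W1 by (metis mult_mono' mult_1 zero_le_one)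
    \<comment> \<open>For small caps \<omega> inherits a component along \<open>j0\<close> from the
      amplitude box, where the direction has component at least 5/8 there: 5/8 minus 3/8 is
      1/4.\<close>
    show ?thesis
    proof (cases "H * s \<le> 3 / 8")
      case True
      have wj0: "1 / 4 \<le> \<omega> $ j0"
      proof -
        have "norm \<xi> > 0" "norm \<xi> \<le> 1" using nx by linarith+
        then have "\<xi> $ j0 \<le> \<xi> $ j0 / norm \<xi>"
          using nx(3) by (simp add: field_simps mult_left_le)
        then have "5 / 8 \<le> \<xi> $ j0 / norm \<xi>" using nx(3) by linarith
        then show ?thesis using cmp[of j0] True by linarith
      qed
      \<comment> \<open>The three terms: the plank condition at a point \<open>x\<close> of the
        slab; the coordinates off \<open>J\<close>, where \<omega> is at most
        \<open>(H + 1) * s\<close> because the amplitude box has width at most \<open>s\<close>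
        there; and the passage from \<open>x\<close> to the lattice point.\<close>
      define Z where "Z = 2 * W + n * ((H + 1) * s * (2 * n * X)) + n"
      have Z: "\<bar>\<Sum>j\<in>J. \<omega> $ j * (q' $ j - a $ j)\<bar> \<le> Z" if q': "q' \<in> Q" for q'
      proof -
        obtain x where x: "x \<in> slab J q'" "\<bar>(x - a) \<bullet> \<omega>\<bar> \<le> 2 * W" "norm (x - a) \<le> 2 * n * X"
          using q[OF q'] by (auto simp: n_def W_def X_def mult.assoc)
        have w1: "\<bar>\<omega> $ j\<bar> \<le> 1" for j using component_le_norm_cart[of \<omega> j] w by simp
        have "(\<Sum>j\<in>J. \<omega> $ j * (q' $ j - a $ j)) = (\<Sum>j\<in>J. \<omega> $ j * (x $ j - a $ j))
            + (\<Sum>j\<in>J. \<omega> $ j * (q' $ j - x $ j))"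
          by (simp add: sum.distrib[symmetric] algebra_simps)
        also have "(\<Sum>j\<in>J. \<omega> $ j * (x $ j - a $ j)) = (x - a) \<bullet> \<omega> - (\<Sum>j\<in>-J. \<omega> $ j * (x $ j - a $ j))"
        proof -
          have "(x - a) \<bullet> \<omega> = (\<Sum>j\<in>UNIV. \<omega> $ j * (x $ j - a $ j))"
            by (simp add: inner_vec_def mult.commute)
          also have "\<dots> = (\<Sum>j\<in>J. \<omega> $ j * (x $ j - a $ j)) + (\<Sum>j\<in>-J. \<omega> $ j * (x $ j - a $ j))"
            by (subst sum.union_disjoint[symmetric]) auto
          finally show ?thesis by simp
        qed
        finally have e: "(\<Sum>j\<in>J. \<omega> $ j * (q' $ j - a $ j)) = (x - a) \<bullet> \<omega> - (\<Sum>j\<in>-J. \<omega> $ j * (x $ j - a $ j))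
            + (\<Sum>j\<in>J. \<omega> $ j * (q' $ j - x $ j))" .
        have b1: "\<bar>\<Sum>j\<in>-J. \<omega> $ j * (x $ j - a $ j)\<bar> \<le> n * ((H + 1) * s * (2 * n * X))"
        proof -
          have "\<bar>\<omega> $ j * (x $ j - a $ j)\<bar> \<le> (H + 1) * s * (2 * n * X)" if "j \<in> - J" for j
          proof -
            have "j \<noteq> j0" using that j0 by auto
            then have "\<bar>\<xi> $ j\<bar> \<le> 1 * wid J r j"
              using xb unfolding mem_amp_box by (auto simp: mid_def axis_def dest!: spec[of _ j])
            also have "\<dots> = r / (8 * n)" using that by (simp add: wid_def n_def)
            also have "\<dots> \<le> r / 8" using n1 r by (intro divide_left_mono) auto
            finally have "\<bar>\<xi> $ j\<bar> \<le> s / 8" using r by linarith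
            then have "\<bar>\<xi> $ j / norm \<xi>\<bar> \<le> (s / 8) / (5 / 8)"
              unfolding abs_divide abs_norm_cancel using nx s0 by (intro frac_le) auto
            also have "\<dots> = s / 5" by simp
            finally have "\<bar>\<xi> $ j / norm \<xi>\<bar> \<le> s / 5" .
            then have "\<bar>\<omega> $ j\<bar> \<le> H * s + s" using cmp[of j] s0 by linarith
            then have "\<bar>\<omega> $ j\<bar> \<le> (H + 1) * s" by (simp add: distrib_right)
            moreover have "\<bar>x $ j - a $ j\<bar> \<le> 2 * n * X"
              using component_le_norm_cart[of "x - a" j] x(3) by simp
            ultimately show ?thesis unfolding abs_mult by (intro mult_mono) auto
          qed
          then have "(\<Sum>j\<in>-J. \<bar>\<omega> $ j * (x $ j - a $ j)\<bar>) \<le> real (card (- J)) * ((H + 1) * s * (2 * n * X))"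
            by (intro sum_bounded_above) auto
          also have "\<dots> \<le> n * ((H + 1) * s * (2 * n * X))"
            using H s0 n1 X1 by (intro mult_right_mono) (auto simp: n_def intro: card_mono)
          finally show ?thesis by (rule order_trans[OF sum_abs])
        qed
        have b2: "\<bar>\<Sum>j\<in>J. \<omega> $ j * (q' $ j - x $ j)\<bar> \<le> n"
        proof -
          have "\<bar>\<omega> $ j * (q' $ j - x $ j)\<bar> \<le> 1 * 1" if "j \<in> J" for j
            unfolding abs_mult using x(1) that w1[of j] by (intro mult_mono) (auto simp: slab_def)
          then have "(\<Sum>j\<in>J. \<bar>\<omega> $ j * (q' $ j - x $ j)\<bar>) \<le> real (card J) * (1 * 1)"
            by (intro sum_bounded_above) auto
          also have "\<dots> \<le> n" by (auto simp: n_def intro: card_mono)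
          finally show ?thesis by (rule order_trans[OF sum_abs])
        qed
        show ?thesis unfolding e Z_def using x(2) b1 b2 by linarith
      qed
      have sX: "s * X = W" by (simp add: X_def W_def power2_eq_square)
      have "Z = 2 * W + 2 * n\<^sup>2 * (H + 1) * (s * X) + n"
        by (simp add: Z_def power2_eq_square)
      also have "\<dots> \<le> 7 * (n\<^sup>2 * H * W)"
      proof -
        have a1: "W \<le> n\<^sup>2 * H * W" using mult_right_mono[OF nH, of W] W1 by simp
        have a2: "n \<le> n\<^sup>2 * H * W"
        proof -
          have "n * 1 \<le> n\<^sup>2 * (H * W)"
            using n2 n1 mult_mono[OF H W1] H by (intro mult_mono) auto
          then show ?thesis by (simp add: mult.assoc)
        qed
        have a3: "n\<^sup>2 * (H + 1) * W \<le> 2 * (n\<^sup>2 * H * W)"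
        proof -
          have "n\<^sup>2 * (H + 1) * W \<le> n\<^sup>2 * (2 * H) * W"
            using H W1 by (intro mult_right_mono mult_left_mono) auto
          then show ?thesis by simp
        qed
        show ?thesis unfolding sX using a1 a2 a3 by linarith
      qed
      finally have Z7: "Z \<le> 7 * (n\<^sup>2 * H * W)" .
      have Z0: "0 \<le> Z" unfolding Z_def using W1 n1 H s0 X1 by (intro add_nonneg_nonneg mult_nonneg_nonneg) auto
      have "real (card Q) \<le> (2 * Y + 1) ^ k * (8 * Z + 1)"
        unfolding k_def by (rule card_lattice_plank(2)[OF j0 Q wj0 Y0(1) Z0 Y Z])
      also have "\<dots> \<le> (7 * n * X) ^ k * (65 * n\<^sup>2 * H * W)"
        using Y0 Z0 Z7 nHW by (intro mult_mono power_mono) (auto simp: mult.assoc)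
      finally show ?thesis .
    next
      \<comment> \<open>Now \<open>s\<close> is bounded below by \<open>3 / (8 * H)\<close>, so the
        plank is as thick as it is wide up to constants, and the coordinate axis \<open>j0\<close>
        can replace \<omega> as the normal.\<close>
      case False
      have Z: "\<bar>\<Sum>j\<in>J. (axis j0 1 :: real ^ 'n) $ j * (q' $ j - a $ j)\<bar> \<le> Y" if "q' \<in> Q" for q'
      proof -
        have "(\<Sum>j\<in>J. (axis j0 1 :: real ^ 'n) $ j * (q' $ j - a $ j))
            = (\<Sum>j\<in>J. if j = j0 then q' $ j - a $ j else 0)"
          by (intro sum.cong) (auto simp: axis_def)
        also have "\<dots> = q' $ j0 - a $ j0" using j0 by simp
        finally show ?thesis using Y[OF that j0] by simp
      qed
      have "real (card Q) \<le> (2 * Y + 1) ^ k * (8 * Y + 1)"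
        unfolding k_def by (rule card_lattice_plank(2)[OF j0 Q _ Y0(1) Y0(1) Y Z]) (simp add: axis_def)
      also have "\<dots> \<le> (7 * n * X) ^ k * (65 * n\<^sup>2 * H * W)"
      proof (intro mult_mono power_mono Y0)
        have "X * 1 \<le> X * (8 / 3 * (H * s))"
          using False X1 by (intro mult_left_mono) auto
        also have "\<dots> = 8 / 3 * H * W" by (simp add: X_def W_def power2_eq_square)
        finally have "n * X \<le> n * (8 / 3 * H * W)" using n1 by (intro mult_left_mono) auto
        also have "\<dots> \<le> n\<^sup>2 * (8 / 3 * H * W)" using n2 H W1 by (intro mult_right_mono) auto
        finally have "n * X \<le> 8 / 3 * (n\<^sup>2 * H * W)" by simp
        then have "8 * Y + 1 \<le> 65 * (n\<^sup>2 * H * W)" unfolding Y_def using nHW by simp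
        then show "8 * Y + 1 \<le> 65 * n\<^sup>2 * H * W" by (simp add: mult.assoc)
      qed (use Y0 n1 H W1 X1 in auto)
      finally show ?thesis .
    qed
  qed
  have vol: "measure lborel (dir_box J j0 r (H * s) \<omega>) \<le> 2 * (2 * (H + 1)) ^ CARD('n) * s ^ k
      * r ^ (CARD('n) - card J)"
    using measure_dir_box_le[OF r(1) _ s0 s j0 w, of H] r s H by (simp add: k_def)
  show ?thesis
  proof (cases "dir_box J j0 r (H * s) \<omega> = {}")
    case True
    then show ?thesis using H l Rpos s0 r by simp
  next
    case False
    have "real (card Q) * measure lborel (dir_box J j0 r (H * s) \<omega>) \<le>
      ((7 * n * X) ^ k * (65 * n\<^sup>2 * H * W)) * (2 * (2 * (H + 1)) ^ CARD('n) * s ^ k * r ^ (CARD('n) - card J))"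
      using bound[OF False] vol n1 X1 H W1 by (intro mult_mono) auto
    also have "\<dots> = 130 * n\<^sup>2 * H * (7 * n) ^ k * (2 * (H + 1)) ^ CARD('n)
        * ((X ^ k * W * s ^ k) * r ^ (CARD('n) - card J))"
      by (simp add: power_mult_distrib mult_ac)
    also have "X ^ k * W * s ^ k = (l * R) ^ card J * s ^ (2 * card J)"
      unfolding kJ X_def W_def by (simp add: power_mult_distrib power2_eq_square mult_2 power_add)
    also have "130 * n\<^sup>2 * H * (7 * n) ^ k * (2 * (H + 1)) ^ CARD('n) * ((l * R) ^ card J * s ^ (2 * card J)
        * r ^ (CARD('n) - card J))
      \<le> 130 * n\<^sup>2 * H * (7 * n) ^ CARD('n) * (2 * (H + 1)) ^ CARD('n) * ((l * R) ^ card J * s ^ (2 * card J)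
        * r ^ (CARD('n) - card J))"
    proof -
      have "k \<le> CARD('n)" unfolding k_def using card_mono[of UNIV J] by simp
      then have "(7 * n) ^ k \<le> (7 * n) ^ CARD('n)" using n1 by (intro power_increasing) auto
      then show ?thesis using n1 H l Rpos s0 r by (intro mult_right_mono mult_left_mono) auto
    qed
    finally show ?thesis by (simp add: n_def mult.assoc)
  qed
qed

section \<open>Spatial cutoffs, signed sums and the position of tiles\<close>

lemma smooth_continuous: "smooth f \<Longrightarrow> continuous_on S f"
proof -
  assume "smooth f"
  then have "f differentiable (at x)" for x
    unfolding smooth_def by (metis iter_deriv.simps(1))
  then show ?thesis
    by (auto intro!: continuous_at_imp_continuous_on differentiable_imp_continuous_within)
qed

text \<open>The cutoffs have sum at most 1, so the sum of their squares is at most 1 everywhere and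
  at most the largest cutoff off \<open>P\<close>, where all of them are small by rapid
  decay.\<close>

lemma tile_sum_le:
  assumes tp: "tile_partition K C r B \<omega> Z \<eta>" and u: "sq_integrable lborel u"
    and F: "finite F" "F \<subseteq> Z" and l: "1 \<le> l" and P [measurable]: "P \<in> sets borel"
    and sub: "\<And>c x. c \<in> F \<Longrightarrow> x - c \<in> (\<lambda>y. l *\<^sub>R y) ` dual_box B \<omega> r \<Longrightarrow> x \<in> P"
  shows "(\<Sum>c\<in>F. mass lborel (\<lambda>x. complex_of_real (\<eta> c x) * u x))
     \<le> (LINT x|lborel. indicator P x * (cmod (u x))\<^sup>2) + \<bar>C M\<bar> / l ^ M * mass lborel u"
proof -
  have eta: "smooth (\<eta> c)" "0 \<le> \<eta> c x" if "c \<in> F" for c x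
    using tp that F unfolding tile_partition_def by blast+
  have decay: "\<eta> c x \<le> C M / l ^ M" if "c \<in> F" "x - c \<notin> (\<lambda>y. l *\<^sub>R y) ` dual_box B \<omega> r" for c x
    using tp that F l unfolding tile_partition_def by blast
  have hs: "((\<lambda>c. \<eta> c x) has_sum 1) Z" for x
    using tp unfolding tile_partition_def by blast
  have nn: "0 \<le> \<eta> c x" if "c \<in> Z" for c x
    using tp that unfolding tile_partition_def by blast
  have sum1: "(\<Sum>c\<in>F. \<eta> c x) \<le> 1" for x
    by (rule finite_sum_le_has_sum[OF hs F(1,2)]) (use nn in auto)
  have [measurable]: "\<eta> c \<in> borel_measurable borel" if "c \<in> F" for c
    by (intro borel_measurable_continuous_onI smooth_continuous eta that)
  have [measurable]: "u \<in> borel_measurable borel" and iu: "integrable lborel (\<lambda>x. (cmod (u x))\<^sup>2)"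
    using u by (auto simp: sq_integrable_def)
  have le1: "\<eta> c x \<le> 1" if "c \<in> F" for c x
    using member_le_sum[OF that, of "\<lambda>c. \<eta> c x"] eta(2) F(1) sum1[of x] by fastforce
  have sq: "(\<Sum>c\<in>F. (\<eta> c x)\<^sup>2) \<le> indicator P x + \<bar>C M\<bar> / l ^ M" for x
  proof (cases "x \<in> P")
    case True
    have "(\<Sum>c\<in>F. (\<eta> c x)\<^sup>2) \<le> (\<Sum>c\<in>F. \<eta> c x)"
      using eta(2) le1 by (intro sum_mono) (simp add: power2_eq_square mult_left_le)
    also have "\<dots> \<le> 1" by (rule sum1)
    finally show ?thesis using True l by (simp add: add_increasing2)
  next
    case False
    have "(\<Sum>c\<in>F. (\<eta> c x)\<^sup>2) \<le> (\<Sum>c\<in>F. \<bar>C M\<bar> / l ^ M * \<eta> c x)"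
    proof (intro sum_mono)
      fix c assume c: "c \<in> F"
      have "x - c \<notin> (\<lambda>y. l *\<^sub>R y) ` dual_box B \<omega> r" using False sub c by blast
      then have "\<eta> c x \<le> C M / l ^ M" by (rule decay[OF c])
      also have "\<dots> \<le> \<bar>C M\<bar> / l ^ M" using l by (intro divide_right_mono) auto
      finally show "(\<eta> c x)\<^sup>2 \<le> \<bar>C M\<bar> / l ^ M * \<eta> c x"
        unfolding power2_eq_square by (rule mult_right_mono[OF _ eta(2)[OF c]])
    qed
    also have "\<dots> = \<bar>C M\<bar> / l ^ M * (\<Sum>c\<in>F. \<eta> c x)" by (simp add: sum_distrib_left)
    also have "\<dots> \<le> \<bar>C M\<bar> / l ^ M * 1" using l by (intro mult_left_mono sum1) auto
    finally show ?thesis using False by simp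
  qed
  have iF: "integrable lborel (\<lambda>x. (\<eta> c x)\<^sup>2 * (cmod (u x))\<^sup>2)" if "c \<in> F" for c
    by (rule Bochner_Integration.integrable_bound[OF iu])
       (use that eta(2) le1 in \<open>auto intro!: mult_left_le_one_le power_le_one\<close>)
  have iP: "integrable lborel (\<lambda>x. indicator P x * (cmod (u x))\<^sup>2)"
    by (rule sq_integrable_restr(2)[OF P u])
  have "(\<Sum>c\<in>F. mass lborel (\<lambda>x. complex_of_real (\<eta> c x) * u x))
      = (\<Sum>c\<in>F. LINT x|lborel. (\<eta> c x)\<^sup>2 * (cmod (u x))\<^sup>2)"
    unfolding mass_def by (simp add: norm_mult power_mult_distrib)
  also have "\<dots> = (LINT x|lborel. (\<Sum>c\<in>F. (\<eta> c x)\<^sup>2 * (cmod (u x))\<^sup>2))"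
    by (rule Bochner_Integration.integral_sum[symmetric]) (rule iF)
  also have "\<dots> \<le> (LINT x|lborel. indicator P x * (cmod (u x))\<^sup>2 + \<bar>C M\<bar> / l ^ M * (cmod (u x))\<^sup>2)"
  proof (rule integral_mono)
    show "(\<Sum>c\<in>F. (\<eta> c x)\<^sup>2 * (cmod (u x))\<^sup>2) \<le> indicator P x * (cmod (u x))\<^sup>2 + \<bar>C M\<bar> / l ^ M
        * (cmod (u x))\<^sup>2" for x
      unfolding sum_distrib_right[symmetric] distrib_right[symmetric] by (intro mult_right_mono sq) simp
  qed (use iF iP iu in auto)
  also have "\<dots> = (LINT x|lborel. indicator P x * (cmod (u x))\<^sup>2) + \<bar>C M\<bar> / l ^ M * mass lborel u"
    unfolding mass_def by (subst Bochner_Integration.integral_add) (use iP iu in auto)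
  finally show ?thesis .
qed

text \<open>Stated for continuous symbols of compact support, because the cap cutoffs of a given
  wave packet system need not belong to \<open>elem\<close>.\<close>

lemma inv_fourier_plancherel:
  fixes g :: "'a::euclidean_space \<Rightarrow> complex"
  assumes c: "continuous_on UNIV g" and s: "\<And>x. \<rho> < norm x \<Longrightarrow> g x = 0"
  shows "sq_integrable lborel (inv_fourier g)"
    and "mass lborel (inv_fourier g) = (LINT \<xi>|lborel. (cmod (g \<xi>))\<^sup>2) / (2 * pi) ^ DIM('a)"
proof -
  have i: "integrable lborel g" by (rule integrable_compact_support[OF c s])
  obtain B where B: "\<And>x. norm (g x) \<le> B" using bounded_compact_support[OF c s] by metis
  have [measurable]: "g \<in> borel_measurable borel" using c by (rule borel_measurable_continuous_onI)
  note p = osc_plancherel[OF i B c]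
  show "sq_integrable lborel (inv_fourier g)"
    unfolding inv_fourier_osc by (intro sq_integrable_cmult) (simp add: sq_integrable_def p(1))
  have "mass lborel (inv_fourier g) = (cmod (complex_of_real (1 / (2 * pi) ^ DIM('a))))\<^sup>2 * mass lborel (osc g)"
    unfolding inv_fourier_osc by (rule mass_cmult)
  also have "mass lborel (osc g) = (2 * pi) ^ DIM('a) * (LINT \<xi>|lborel. (cmod (g \<xi>))\<^sup>2)"
    unfolding mass_def by (rule p(2))
  finally show "mass lborel (inv_fourier g) = (LINT \<xi>|lborel. (cmod (g \<xi>))\<^sup>2) / (2 * pi) ^ DIM('a)"
    by (simp add: norm_divide norm_power norm_mult power2_eq_square)
qed

definition trig :: "(real ^ 'n) set \<Rightarrow> (real ^ 'n) set \<Rightarrow> real ^ 'n \<Rightarrow> complex" where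
  "trig I A \<xi> = (\<Sum>m\<in>I. sgn_of A m * cis (- (m \<bullet> (\<xi> :: real ^ 'n::finite))))"

lemma trig_elem: "trig I A \<in> elem"
proof -
  have "(\<lambda>\<xi>. sgn_of A m * cis (- (m \<bullet> \<xi>))) \<in> elem" for m
    using elem_mult[OF elem_const elem_cis[of "- m"]] by simp
  then show ?thesis unfolding trig_def[abs_def] by (intro elem_sum)
qed

lemma norm_trig_le: "cmod (trig I A \<xi>) \<le> real (card I)"
proof -
  have "cmod (trig I A \<xi>) \<le> (\<Sum>m\<in>I. cmod (sgn_of A m * cis (- (m \<bullet> \<xi>))))"
    unfolding trig_def by (rule norm_sum)
  then show ?thesis by (simp add: norm_mult)
qed

text \<open>Modulation in frequency is translation in space. Since \<phi> is arbitrary, the signed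
  sum passes through the cap cutoffs and the propagator alike.\<close>

lemma inv_fourier_trig:
  assumes "integrable lborel \<phi>"
  shows "inv_fourier (\<lambda>\<xi>. trig I A \<xi> * \<phi> \<xi>) = lattice_sum I A (inv_fourier \<phi>)"
proof
  fix x
  have i: "integrable lborel (\<lambda>\<xi>. sgn_of A m * (cis ((x - m) \<bullet> \<xi>) * \<phi> \<xi>))" for m
    by (intro integrable_mult_right integrable_cis_mult assms) simp
  have e: "cis (x \<bullet> \<xi>) * (trig I A \<xi> * \<phi> \<xi>) = (\<Sum>m\<in>I. sgn_of A m * (cis ((x - m) \<bullet> \<xi>) * \<phi> \<xi>))" for \<xi>
  proof -
    have *: "cis (x \<bullet> \<xi>) * (sgn_of A m * cis (- (m \<bullet> \<xi>))) = sgn_of A m * cis ((x - m) \<bullet> \<xi>)" for m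
      by (simp add: inner_diff_left cis_mult mult.left_commute)
    have "cis (x \<bullet> \<xi>) * trig I A \<xi> = (\<Sum>m\<in>I. sgn_of A m * cis ((x - m) \<bullet> \<xi>))"
      unfolding trig_def sum_distrib_left * ..
    then show ?thesis
      by (simp add: mult.assoc[symmetric] sum_distrib_right)
  qed
  have "osc (\<lambda>\<xi>. trig I A \<xi> * \<phi> \<xi>) x = (\<Sum>m\<in>I. sgn_of A m * osc \<phi> (x - m))"
    unfolding osc_def e by (subst Bochner_Integration.integral_sum) (use i in auto)
  then show "inv_fourier (\<lambda>\<xi>. trig I A \<xi> * \<phi> \<xi>) x = lattice_sum I A (inv_fourier \<phi>) x"
    unfolding inv_fourier_osc lattice_sum_def by (simp add: sum_distrib_left mult.left_commute)
qed

lemma Lp_norm_2: "Lp_norm 2 UNIV u = sqrt (mass lborel u)"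
proof -
  have "(cmod (u x)) powr 2 = (cmod (u x))\<^sup>2" for x
    by (simp add: powr_numeral)
  then show ?thesis
    by (simp add: Lp_norm_def mass_def set_lebesgue_integral_def powr_half_sqrt)
qed

lemma norm_dilated_dual_box:
  fixes B :: "(real ^ 'n::finite) set"
  assumes B: "is_frame B \<omega>" and l: "0 < l" and r: "0 < r" "r \<le> 1"
    and x: "x \<in> (\<lambda>y. l *\<^sub>R y) ` dual_box B \<omega> r"
  shows "norm x \<le> real CARD('n) * (l / (2 * r))"
proof -
  have "norm x \<le> real DIM(real ^ 'n) * (l / (2 * r))"
  proof (rule frame_norm_bound[OF B])
    fix e assume e: "e \<in> B"
    have "l / 2 \<le> l / (2 * r)" using l r by (intro divide_left_mono) auto
    then show "\<bar>x \<bullet> e\<bar> \<le> l / (2 * r)"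
      using x e unfolding mem_dilated_dual_box[OF l] by (cases "e = \<omega>") auto
  qed (use l r in auto)
  then show ?thesis by simp
qed

text \<open>No relation between the directions of the tile and of the box \<open>V\<close> enters: the dilates of a
  tile contained in \<open>V\<close> stay inside comparable dilates of \<open>V\<close>.\<close>

lemma dilated_tile_subset_plank:
  fixes B B' :: "(real ^ 'n::finite) set"
  assumes B: "is_frame B \<omega>" and R: "0 < R" and s: "0 < s" "s \<le> 1" and l: "1 \<le> l"
    and c: "(+) c ` dual_box B' \<omega>' r \<subseteq> (+) a ` V_box B \<omega> s R" and r: "0 < r"
    and x: "x - c \<in> (\<lambda>y. l *\<^sub>R y) ` dual_box B' \<omega>' r"
  shows "\<bar>(x - a) \<bullet> \<omega>\<bar> \<le> 2 * l * (R * s\<^sup>2)" "norm (x - a) \<le> 2 * real CARD('n) * l * (R * s)"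
proof -
  obtain y where y: "y \<in> dual_box B' \<omega>' r" "x - c = l *\<^sub>R y" using x by blast
  have V: "\<bar>(c + z - a) \<bullet> \<omega>\<bar> \<le> R * s\<^sup>2 / 2 \<and> (\<forall>e\<in>B - {\<omega>}. \<bar>(c + z - a) \<bullet> e\<bar> \<le> R * s / 2)"
    if "z \<in> dual_box B' \<omega>' r" for z
  proof -
    have "c + z \<in> (+) a ` V_box B \<omega> s R" using c that by blast
    then have "c + z - a \<in> V_box B \<omega> s R" by (auto simp: algebra_simps)
    then show ?thesis by (simp add: mem_V_box[OF R s(1)])
  qed
  have z0: "0 \<in> dual_box B' \<omega>' r" using r by (simp add: dual_box_def obox_def)
  have gen: "\<bar>(x - a) \<bullet> e\<bar> \<le> 2 * l * b" if b: "\<And>z. z \<in> dual_box B' \<omega>' r \<Longrightarrow> \<bar>(c + z - a) \<bullet> e\<bar> \<le> b / 2" "0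
      \<le> b" for e b
  proof -
    have c0: "\<bar>(c - a) \<bullet> e\<bar> \<le> b / 2" using b(1)[OF z0] by simp
    have "y \<bullet> e = (c + y - a) \<bullet> e - (c - a) \<bullet> e" by (simp add: inner_diff_left inner_add_left)
    then have "\<bar>y \<bullet> e\<bar> \<le> b" using c0 b(1)[OF y(1)] by linarith
    then have "l * \<bar>y \<bullet> e\<bar> \<le> l * b" using l by (intro mult_left_mono) auto
    moreover have "(x - a) \<bullet> e = (c - a) \<bullet> e + l * (y \<bullet> e)"
    proof -
      have "x - a = (c - a) + l *\<^sub>R y" using y(2) by (simp add: algebra_simps)
      then show ?thesis by (simp only: inner_add_left inner_scaleR_left)
    qed
    then have "\<bar>(x - a) \<bullet> e\<bar> \<le> b / 2 + l * \<bar>y \<bullet> e\<bar>"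
      using c0 l abs_triangle_ineq[of "(c - a) \<bullet> e" "l * (y \<bullet> e)"] by (simp add: abs_mult)
    moreover have "b \<le> l * b" using l b(2) by (metis mult_1 mult_right_mono)
    ultimately show ?thesis by linarith
  qed
  show 1: "\<bar>(x - a) \<bullet> \<omega>\<bar> \<le> 2 * l * (R * s\<^sup>2)"
    by (rule gen) (use V R in auto)
  have "norm (x - a) \<le> real DIM(real ^ 'n) * (2 * l * (R * s))"
  proof (rule frame_norm_bound[OF B])
    fix e assume e: "e \<in> B"
    show "\<bar>(x - a) \<bullet> e\<bar> \<le> 2 * l * (R * s)"
    proof (cases "e = \<omega>")
      case True
      have "R * s\<^sup>2 \<le> R * s" using R s by (simp add: power2_eq_square mult_left_le)
      then have "2 * l * (R * s\<^sup>2) \<le> 2 * l * (R * s)" by (rule mult_left_mono) (use l in auto)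
      with 1 True show ?thesis by simp
    next
      case False
      then show ?thesis using e V R s by (intro gen) auto
    qed
  qed (use l R s in auto)
  then show "norm (x - a) \<le> 2 * real CARD('n) * l * (R * s)" by (simp add: mult_ac)
qed

text \<open>It confines the relevant tiles to distance of order \<open>R\<close>, so that a finite
  set of slabs suffices. The dilated tile has diameter of order
  \<open>R powr (\<delta> + 1 / 2)\<close>, which is where \<open>\<delta> \<le> 1 / 2\<close>
  enters.\<close>

lemma plank_meets_ball_center:
  fixes S :: "('n::finite) wp_system"
  assumes fr: "is_frame (frame S (R powr (-1/2)) \<omega>) \<omega>" and R: "1 \<le> R" and d: "\<delta> \<le> 1 / 2"
    and m: "plank \<delta> S R \<omega> c \<inter> ball 0 R \<noteq> {}"
  shows "norm c \<le> (2 + real CARD('n)) * R"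
proof -
  define r where "r = R powr (-1/2)"
  have r: "0 < r" "r \<le> 1" using R powr_mono[of "-1/2" 0 R] by (auto simp: r_def)
  obtain x t where xt: "(x, t) \<in> plank \<delta> S R \<omega> c" "(x, t) \<in> ball 0 R" using m by force
  then obtain y where y: "y \<in> dual_box (frame S r \<omega>) \<omega> r" "x + t *\<^sub>R \<omega> = c + (R powr \<delta>) *\<^sub>R y" and t: "\<bar>t\<bar> \<le> R"
    by (auto simp: plank_def r_def)
  have "norm x \<le> norm (x, t)" by (simp add: norm_fst_le)
  then have nx: "norm x \<le> R" using xt(2) by simp
  have "norm \<omega> = 1" using frame_unit[OF fr frame_dir[OF fr]] .
  then have nt: "norm (t *\<^sub>R \<omega>) \<le> R" using t by simp
  have "norm ((R powr \<delta>) *\<^sub>R y) \<le> real CARD('n) * (R powr \<delta> / (2 * r))"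
    using R fr y(1) r by (intro norm_dilated_dual_box[of "frame S r \<omega>" \<omega>]) (auto simp: r_def)
  also have "R powr \<delta> / (2 * r) \<le> R"
  proof -
    have "R powr \<delta> / (2 * r) = R powr (\<delta> + 1 / 2) / 2"
      unfolding powr_add r_def using R by (simp add: powr_minus divide_simps)
    also have "\<dots> \<le> R powr 1 / 2"
      using R d by (intro divide_right_mono powr_mono) auto
    finally show ?thesis using R by simp
  qed
  finally have ny: "norm ((R powr \<delta>) *\<^sub>R y) \<le> real CARD('n) * R" by (simp add: mult_left_mono)
  have "c = x + t *\<^sub>R \<omega> - (R powr \<delta>) *\<^sub>R y" using y(2) by (simp add: algebra_simps)
  then have "norm c \<le> norm x + norm (t *\<^sub>R \<omega>) + norm ((R powr \<delta>) *\<^sub>R y)"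
    using norm_triangle_ineq4[of "x + t *\<^sub>R \<omega>" "(R powr \<delta>) *\<^sub>R y"] norm_triangle_ineq[of x "t *\<^sub>R \<omega>"] by simp
  then show ?thesis using nx nt ny by (simp add: distrib_right)
qed

section \<open>Finite parts of the lattice and summation over caps\<close>

definition lat_ball :: "'n set \<Rightarrow> real \<Rightarrow> (real ^ 'n::finite) set" where
  "lat_ball J \<rho> = {q \<in> lat J. \<forall>j\<in>J. \<bar>q $ j\<bar> \<le> \<rho>}"

lemma lat_ball_subset: "lat_ball J \<rho> \<subseteq> lat J"
  by (auto simp: lat_ball_def)

lemma slab_cover_lat_ball:
  assumes "norm x \<le> \<rho> - 1"
  shows "\<exists>q\<in>lat_ball J \<rho>. x \<in> slab J q"
proof -
  obtain q where q: "q \<in> lat J" "x \<in> slab J q" using slab_covers by blast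
  have "\<bar>q $ j\<bar> \<le> \<rho>" if "j \<in> J" for j
    using q(2) that component_le_norm_cart[of x j] assms
      by (auto simp: slab_def abs_le_iff dest!: bspec[of _ _ j])
  then show ?thesis using q by (auto simp: lat_ball_def)
qed

lemma finite_card_lat_ball:
  fixes J :: "'n::finite set"
  assumes j0: "j0 \<in> J" and p: "1 \<le> \<rho>"
  shows "finite (lat_ball J \<rho>)" and "real (card (lat_ball J \<rho>)) \<le> (9 * \<rho>) ^ CARD('n)"
proof -
  have Z: "\<bar>\<Sum>j\<in>J. (axis j0 1 :: real ^ 'n) $ j * (q $ j - 0 $ j)\<bar> \<le> \<rho>" if "q \<in> lat_ball J \<rho>" for q
  proof -
    have "(\<Sum>j\<in>J. (axis j0 1 :: real ^ 'n) $ j * (q $ j - 0 $ j)) = (\<Sum>j\<in>J. if j = j0 then q $ j else 0)"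
      by (intro sum.cong) (auto simp: axis_def)
    also have "\<dots> = q $ j0" using j0 by simp
    finally show ?thesis using that j0 by (simp add: lat_ball_def)
  qed
  have Y: "\<bar>q $ j - 0 $ j\<bar> \<le> \<rho>" if "q \<in> lat_ball J \<rho>" "j \<in> J" for q j
    using that by (simp add: lat_ball_def)
  have w: "1 / 4 \<le> (axis j0 1 :: real ^ 'n) $ j0" by (simp add: axis_def)
  have p0: "0 \<le> \<rho>" using p by simp
  note * = card_lattice_plank[OF j0 lat_ball_subset w p0 p0 Y Z]
  show "finite (lat_ball J \<rho>)" by (rule *(1))
  have "real (card (lat_ball J \<rho>)) \<le> (2 * \<rho> + 1) ^ (card J - 1) * (8 * \<rho> + 1)" by (rule *(2))
  also have "\<dots> \<le> (9 * \<rho>) ^ (card J - 1) * (9 * \<rho>) ^ 1"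
    using p by (intro mult_mono power_mono) auto
  also have "\<dots> = (9 * \<rho>) ^ (card J - 1 + 1)" by (simp only: power_add)
  also have "\<dots> \<le> (9 * \<rho>) ^ CARD('n)"
  proof (rule power_increasing)
    have "0 < card J" using j0 by (auto simp: card_gt_0_iff)
    then show "card J - 1 + 1 \<le> CARD('n)" using card_mono[of UNIV J] by simp
  qed (use p in simp)
  finally show "real (card (lat_ball J \<rho>)) \<le> (9 * \<rho>) ^ CARD('n)" .
qed

text \<open>The points with nonnegative coordinates already number
  \<open>(\<lfloor>\<rho>\<rfloor> + 1) ^ card J\<close>.\<close>

lemma card_lat_ball_lower:
  fixes J :: "'n::finite set"
  assumes p: "1 \<le> \<rho>" and f: "finite (lat_ball J \<rho>)"
  shows "\<rho> ^ card J \<le> real (card (lat_ball J \<rho>))"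
proof -
  define N where "N = \<lfloor>\<rho>\<rfloor>"
  have N: "of_int N \<le> \<rho>" "\<rho> < of_int N + 1" "1 \<le> N" using p by (auto simp: N_def le_floor_iff)
  let ?E = "PiE J (\<lambda>_. {0..N})"
  let ?g = "\<lambda>f. (\<chi> j. if j \<in> J then of_int (f j) else 0) :: real ^ 'n"
  have inj: "inj_on ?g ?E"
  proof (rule inj_onI)
    fix f g assume fg: "f \<in> ?E" "g \<in> ?E" "?g f = ?g g"
    show "f = g"
    proof (rule PiE_ext[OF fg(1,2)])
      fix j assume "j \<in> J"
      with fg(3) show "f j = g j" by (auto simp: vec_eq_iff dest!: spec[of _ j])
    qed
  qed
  have "?g ` ?E \<subseteq> lat_ball J \<rho>"
  proof
    fix q assume "q \<in> ?g ` ?E"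
    then obtain h where h: "h \<in> ?E" "q = ?g h" by blast
    have "\<bar>of_int (h j)\<bar> \<le> \<rho>" if "j \<in> J" for j
    proof -
      have "0 \<le> h j" "h j \<le> N" using h(1) that by (auto simp: PiE_iff)
      then have "0 \<le> real_of_int (h j)" "real_of_int (h j) \<le> of_int N" by simp_all
      then show ?thesis using N(1) by linarith
    qed
    then show "q \<in> lat_ball J \<rho>" unfolding h(2) lat_ball_def lat_def by auto
  qed
  then have "card ?E \<le> card (lat_ball J \<rho>)"
    using card_inj_on_le[OF inj _ f] by blast
  moreover have "\<rho> ^ card J \<le> real (card ?E)"
  proof -
    have "real (card ?E) = (of_int N + 1) ^ card J"
      using N by (simp add: card_PiE)
    then show ?thesis using N p by (simp add: power_mono)
  qed
  ultimately show ?thesis by linarith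
qed

text \<open>Almost orthogonality of the caps without counting overlaps: the values of a partition of
  unity are at most 1, so the sum of their squares is at most their sum.\<close>

lemma sum_frequency_mass_le:
  fixes \<psi> :: "'d \<Rightarrow> 'a::euclidean_space \<Rightarrow> real"
  assumes fin: "finite D" and c: "\<And>\<theta>. \<theta> \<in> D \<Longrightarrow> continuous_on UNIV (\<psi> \<theta>)"
    and nn: "\<And>\<theta> \<xi>. \<theta> \<in> D \<Longrightarrow> 0 \<le> \<psi> \<theta> \<xi>"
    and s1: "\<And>\<xi>. \<xi> \<in> T \<Longrightarrow> (\<Sum>\<theta>\<in>D. \<psi> \<theta> \<xi>) \<le> 1"
    and B: "continuous_on UNIV B" "\<And>\<xi>. cmod (B \<xi>) \<le> 1" "\<And>\<xi>. \<rho> < norm \<xi> \<Longrightarrow> B \<xi> = 0"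
    and w: "continuous_on UNIV w" "\<And>\<xi>. cmod (w \<xi>) \<le> b"
    and T [measurable]: "T \<in> sets borel" "bounded T"
    and sub: "\<And>\<theta> \<xi>. \<theta> \<in> D \<Longrightarrow> \<psi> \<theta> \<xi> \<noteq> 0 \<Longrightarrow> B \<xi> \<noteq> 0 \<Longrightarrow> \<xi> \<in> T"
  shows "(\<Sum>\<theta>\<in>D. LINT \<xi>|lborel. (cmod (complex_of_real (\<psi> \<theta> \<xi>) * (w \<xi> * B \<xi>)))\<^sup>2) \<le> b\<^sup>2 * measure lborel T"
proof -
  let ?F = "\<lambda>\<theta> \<xi>. (cmod (complex_of_real (\<psi> \<theta> \<xi>) * (w \<xi> * B \<xi>)))\<^sup>2"
  have i: "integrable lborel (?F \<theta>)" if "\<theta> \<in> D" for \<theta>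
    by (rule integrable_compact_support[of _ \<rho>]) (auto intro!: continuous_intros c that w B simp: B(3))
  have fT: "emeasure lborel T < \<infinity>" by (rule emeasure_bounded_finite[OF T(2)])
  have le: "(\<Sum>\<theta>\<in>D. ?F \<theta> \<xi>) \<le> b\<^sup>2 * indicator T \<xi>" for \<xi>
  proof (cases "\<xi> \<in> T")
    case True
    have "?F \<theta> \<xi> \<le> b\<^sup>2 * \<psi> \<theta> \<xi>" if "\<theta> \<in> D" for \<theta>
    proof -
      have "\<psi> \<theta> \<xi> \<le> 1"
        using member_le_sum[OF that, of "\<lambda>\<theta>. \<psi> \<theta> \<xi>"] nn fin s1[OF True] by fastforce
      then have p: "(\<psi> \<theta> \<xi>)\<^sup>2 \<le> \<psi> \<theta> \<xi>" using nn[OF that] by (simp add: power2_eq_square mult_left_le)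
      have "cmod (w \<xi> * B \<xi>) \<le> b * 1"
        unfolding norm_mult using order_trans[OF norm_ge_zero w(2)] by (intro mult_mono w B) auto
      then have "(cmod (w \<xi> * B \<xi>))\<^sup>2 \<le> b\<^sup>2" by (intro power_mono) auto
      then have "(\<psi> \<theta> \<xi>)\<^sup>2 * (cmod (w \<xi> * B \<xi>))\<^sup>2 \<le> \<psi> \<theta> \<xi> * b\<^sup>2"
        using p nn[OF that] by (intro mult_mono) auto
      then show ?thesis by (simp add: norm_mult power_mult_distrib mult_ac)
    qed
    then have "(\<Sum>\<theta>\<in>D. ?F \<theta> \<xi>) \<le> (\<Sum>\<theta>\<in>D. b\<^sup>2 * \<psi> \<theta> \<xi>)" by (rule sum_mono)
    also have "\<dots> = b\<^sup>2 * (\<Sum>\<theta>\<in>D. \<psi> \<theta> \<xi>)" by (simp add: sum_distrib_left)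
    also have "\<dots> \<le> b\<^sup>2 * 1" by (intro mult_left_mono s1 True) auto
    finally show ?thesis using True by simp
  next
    case False
    have "(\<Sum>\<theta>\<in>D. ?F \<theta> \<xi>) = 0"
      by (rule sum.neutral) (use sub[of _ \<xi>] False in auto)
    then show ?thesis using False by simp
  qed
  have "(\<Sum>\<theta>\<in>D. LINT \<xi>|lborel. ?F \<theta> \<xi>) = (LINT \<xi>|lborel. (\<Sum>\<theta>\<in>D. ?F \<theta> \<xi>))"
    by (rule Bochner_Integration.integral_sum[symmetric]) (rule i)
  also have "\<dots> \<le> (LINT \<xi>|lborel. b\<^sup>2 * indicator T \<xi>)"
    using fT by (intro integral_mono le Bochner_Integration.integrable_sum i integrable_mult_right integrable_real_indicator) auto
  also have "\<dots> = b\<^sup>2 * measure lborel T" by simp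
  finally show ?thesis .
qed

section \<open>The wave packets of a lattice sum\<close>

definition geo_const :: "nat \<Rightarrow> real \<Rightarrow> real" where
  "geo_const n H = 130 * (real n)\<^sup>2 * H * (7 * real n) ^ n * (2 * (H + 1)) ^ n"

locale packet_system =
  fixes S :: "('n::finite) wp_system" and A K R :: real and N :: nat and C C' :: "nat \<Rightarrow> real"
    and J :: "'n set" and j0 :: 'n
  assumes sys: "is_wp_system A N K C C' R S" and A: "0 < A" and K: "0 < K" and R: "1 \<le> R" and j0: "j0 \<in> J"
begin

definition r :: real where "r = R powr (-1/2)"

definition D :: "(real ^ 'n) set" where "D = dirs S r"

definition piece :: "real ^ 'n \<Rightarrow> real ^ 'n \<Rightarrow> complex" where
  "piece \<theta> = inv_fourier (\<lambda>\<xi>. complex_of_real (psi S \<theta> \<xi>) * amp J j0 r \<xi>)"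

lemma r: "0 < r" "r \<le> 1"
  using R powr_mono[of "-1/2" 0 R] by (auto simp: r_def)

lemma R_r: "R * r\<^sup>2 = 1"
  using R by (simp add: r_def powr_minus powr_half_sqrt power_inverse)

lemma cover: "cap_cover A N r D"
  using sys r unfolding is_wp_system_def r_def[symmetric] D_def by auto

lemma finite_D: "finite D" and norm_dir: "\<theta> \<in> D \<Longrightarrow> norm \<theta> = 1"
  using cover unfolding cap_cover_def by auto

lemma frame_s: "s \<in> {r..1} \<Longrightarrow> \<omega> \<in> dirs S s \<Longrightarrow> is_frame (frame S s \<omega>) \<omega>"
  using sys unfolding is_wp_system_def r_def by auto

lemma partition_psi: "cap_partition K C r D (frame S r) (psi S)"
  using sys unfolding is_wp_system_def Let_def r_def[symmetric] D_def by auto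

lemma partition_chi: "\<theta> \<in> D \<Longrightarrow> tile_partition K C' r (frame S r \<theta>) \<theta> (centers S \<theta>) (chi S \<theta>)"
  using sys unfolding is_wp_system_def Let_def r_def[symmetric] D_def by auto

lemma psi_continuous: "\<theta> \<in> D \<Longrightarrow> continuous_on UNIV (psi S \<theta>)"
  and psi_nonneg: "\<theta> \<in> D \<Longrightarrow> 0 \<le> psi S \<theta> \<xi>"
  using partition_psi smooth_continuous unfolding cap_partition_def by blast+

lemma psi_support: "\<theta> \<in> D \<Longrightarrow> psi S \<theta> \<xi> \<noteq> 0 \<Longrightarrow> \<xi> \<in> fat_cap K r \<theta>"
  using partition_psi closure_subset[of "{\<xi>. psi S \<theta> \<xi> \<noteq> 0}"] unfolding cap_partition_def by blast

lemma psi_sum: "\<xi> \<in> amp_box J j0 r 1 \<Longrightarrow> (\<Sum>\<theta>\<in>D. psi S \<theta> \<xi>) = 1"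
  using partition_psi amp_box_subset_annulus[OF r] unfolding cap_partition_def by blast

lemma amp_far: "7 / 8 < norm \<xi> \<Longrightarrow> amp J j0 r \<xi> = 0"
  using amp_eq_0[OF r(1) j0, of \<xi>] norm_amp_box(2)[OF r, of \<xi>] by force

lemma amp_continuous: "continuous_on UNIV (amp J j0 r)"
  by (intro elem_continuous amp_elem)

lemma amp_support: "amp J j0 r \<xi> \<noteq> 0 \<Longrightarrow> \<xi> \<in> amp_box J j0 r 1"
  using amp_eq_0[OF r(1) j0] by blast

lemma measure_amp_box_le_1: "measure lborel (amp_box J j0 r 1) \<le> 1"
proof -
  have "1 \<le> real CARD('n)" by (simp add: Suc_leI)
  then have "1 \<le> 4 * real CARD('n)" by linarith
  then have "1 / (4 * real CARD('n)) \<le> 1" by (subst divide_le_eq_1_pos) linarith+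
  then have "(1 / (4 * real CARD('n))) ^ CARD('n) * r ^ (CARD('n) - card J) \<le> 1 * 1"
    using r by (intro mult_mono power_le_one) auto
  then show ?thesis using measure_amp_box[OF r(1), of 1 J j0] by simp
qed

lemma two_pi_power: "1 \<le> (2 * pi) ^ m"
  using pi_ge_two by (intro one_le_power) linarith

lemma sum_mass_le:
  assumes D1: "D1 \<subseteq> D" and w: "continuous_on UNIV w" "\<And>\<xi>. cmod (w \<xi>) \<le> b"
    and T: "T \<in> sets borel" "T \<subseteq> amp_box J j0 r 1"
    and sub: "\<And>\<theta> \<xi>. \<theta> \<in> D1 \<Longrightarrow> psi S \<theta> \<xi> \<noteq> 0 \<Longrightarrow> amp J j0 r \<xi> \<noteq> 0 \<Longrightarrow> \<xi> \<in> T"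
  shows "(\<Sum>\<theta>\<in>D1. mass lborel (inv_fourier (\<lambda>\<xi>. complex_of_real (psi S \<theta> \<xi>) * (w \<xi> * amp J j0 r \<xi>))))
      \<le> b\<^sup>2 * measure lborel T"
proof -
  let ?g = "\<lambda>\<theta> \<xi>. complex_of_real (psi S \<theta> \<xi>) * (w \<xi> * amp J j0 r \<xi>)"
  have "(\<Sum>\<theta>\<in>D1. LINT \<xi>|lborel. (cmod (?g \<theta> \<xi>))\<^sup>2) \<le> b\<^sup>2 * measure lborel T"
  proof (rule sum_frequency_mass_le[where \<rho>="7/8", OF _ _ _ _ amp_continuous cmod_amp_le_1 amp_far w T(1) _ sub])
    show "finite D1" using D1 finite_D by (rule finite_subset)
    show "bounded T" using T(2) by (rule bounded_subset[rotated]) (simp add: amp_box_def)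
    fix \<xi> assume "\<xi> \<in> T"
    then have "(\<Sum>\<theta>\<in>D. psi S \<theta> \<xi>) = 1" using T(2) psi_sum by blast
    moreover have "(\<Sum>\<theta>\<in>D1. psi S \<theta> \<xi>) \<le> (\<Sum>\<theta>\<in>D. psi S \<theta> \<xi>)"
      using D1 finite_D psi_nonneg by (intro sum_mono2) auto
    ultimately show "(\<Sum>\<theta>\<in>D1. psi S \<theta> \<xi>) \<le> 1" by simp
  qed (use D1 psi_continuous psi_nonneg in auto)
  moreover have "mass lborel (inv_fourier (?g \<theta>)) \<le> (LINT \<xi>|lborel. (cmod (?g \<theta> \<xi>))\<^sup>2)" if "\<theta> \<in> D1" for \<theta>
  proof -
    have c: "continuous_on UNIV (?g \<theta>)"
      using that D1 by (intro continuous_intros psi_continuous w amp_continuous) auto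
    have "mass lborel (inv_fourier (?g \<theta>)) = (LINT \<xi>|lborel. (cmod (?g \<theta> \<xi>))\<^sup>2) / (2 * pi) ^ DIM(real ^ 'n)"
      by (rule inv_fourier_plancherel(2)[OF c, of "7/8"]) (simp add: amp_far)
    also have "\<dots> \<le> (LINT \<xi>|lborel. (cmod (?g \<theta> \<xi>))\<^sup>2) / 1"
      by (intro divide_left_mono two_pi_power) auto
    finally show ?thesis by simp
  qed
  ultimately show ?thesis
    by (meson order_trans sum_mono)
qed

lemma piece_sq_integrable: "\<theta> \<in> D \<Longrightarrow> sq_integrable lborel (piece \<theta>)"
  unfolding piece_def
  by (rule inv_fourier_plancherel(1)[of _ "7/8"]) (auto intro!: continuous_intros psi_continuous amp_continuous simp: amp_far)

text \<open>Before the spatial cutoff, the part of the example in a cap is the signed lattice sum of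
  the part of \<open>u\<close> in that cap, which is what \<open>cosh_energy\<close>
  controls.\<close>

lemma packet_eq:
  assumes "\<theta> \<in> D"
  shows "inv_fourier (\<lambda>\<xi>. complex_of_real (psi S \<theta> \<xi>) * (trig I A' \<xi> * amp J j0 r \<xi>))
      = lattice_sum I A' (piece \<theta>)"
proof -
  have "integrable lborel (\<lambda>\<xi>. complex_of_real (psi S \<theta> \<xi>) * amp J j0 r \<xi>)"
    using assms by (intro integrable_compact_support[of _ "7/8"]) (auto intro!: continuous_intros psi_continuous amp_continuous simp: amp_far)
  from inv_fourier_trig[OF this, of I A'] show ?thesis
    unfolding piece_def by (simp add: mult.left_commute)
qed

lemma sum_mass_piece_le: "(\<Sum>\<theta>\<in>D. mass lborel (piece \<theta>)) \<le> 1"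
proof -
  have "(\<Sum>\<theta>\<in>D. mass lborel (piece \<theta>)) \<le> 1\<^sup>2 * measure lborel (amp_box J j0 r 1)"
    using sum_mass_le[of D "\<lambda>_. 1" 1 "amp_box J j0 r 1"] amp_support by (simp add: piece_def)
  then show ?thesis using measure_amp_box_le_1 by simp
qed

lemma sum_mass_packets_le: "(\<Sum>\<theta>\<in>D. mass lborel (lattice_sum I A' (piece \<theta>))) \<le> (real (card I))\<^sup>2"
proof -
  have "(\<Sum>\<theta>\<in>D. mass lborel (lattice_sum I A' (piece \<theta>)))
      = (\<Sum>\<theta>\<in>D. mass lborel (inv_fourier (\<lambda>\<xi>. complex_of_real (psi S \<theta> \<xi>) * (trig I A' \<xi> * amp J j0 r \<xi>))))"
    by (intro sum.cong) (auto simp: packet_eq)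
  also have "\<dots> \<le> (real (card I))\<^sup>2 * measure lborel (amp_box J j0 r 1)"
    using amp_support by (intro sum_mass_le elem_continuous trig_elem norm_trig_le) auto
  also have "\<dots> \<le> (real (card I))\<^sup>2 * 1"
    by (intro mult_left_mono measure_amp_box_le_1) simp
  finally show ?thesis by simp
qed

text \<open>In the constant, \<open>K\<close> accounts for the enlarged support of the cutoff and
  \<open>A\<close> for the distance of the directions; the additional 1 makes it at least 1, as
  \<open>count_times_volume\<close> requires.\<close>

lemma sum_mass_piece_cap_le:
  assumes "r \<le> s"
  shows "(\<Sum>\<theta>\<in>{\<theta> \<in> D. cap A r \<theta> \<subseteq> cap A s \<omega>}. mass lborel (piece \<theta>))
    \<le> measure lborel (dir_box J j0 r ((1 + K + A) * s) \<omega>)"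
proof -
  have "(\<Sum>\<theta>\<in>{\<theta> \<in> D. cap A r \<theta> \<subseteq> cap A s \<omega>}. mass lborel (inv_fourier (\<lambda>\<xi>. complex_of_real (psi S \<theta> \<xi>)
      * (1 * amp J j0 r \<xi>))))
    \<le> 1\<^sup>2 * measure lborel (dir_box J j0 r ((1 + K + A) * s) \<omega>)"
  proof (rule sum_mass_le)
    show "dir_box J j0 r ((1 + K + A) * s) \<omega> \<subseteq> amp_box J j0 r 1" by (auto simp: dir_box_def)
    fix \<theta> \<xi> assume t: "\<theta> \<in> {\<theta> \<in> D. cap A r \<theta> \<subseteq> cap A s \<omega>}" and p: "psi S \<theta> \<xi> \<noteq> 0" and a: "amp J j0 r \<xi> \<noteq> 0"
    have f: "norm (\<xi> /\<^sub>R norm \<xi> - \<theta>) \<le> K * r"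
      using psi_support[OF _ p] t by (auto simp: fat_cap_def)
    \<comment> \<open>A cap contains multiples of its own direction, so the inclusion of the caps
      bounds the distance between their directions.\<close>
    have "(3 / 4) *\<^sub>R \<theta> \<in> cap A r \<theta>"
      using norm_dir t A r by (auto simp: cap_def annulus_def)
    then have "(3 / 4) *\<^sub>R \<theta> \<in> cap A s \<omega>" using t by blast
    then have "norm (\<theta> - \<omega>) \<le> A * s"
      using norm_dir t by (auto simp: cap_def)
    then have "norm (\<xi> /\<^sub>R norm \<xi> - \<omega>) \<le> K * r + A * s"
      using f norm_triangle_ineq[of "\<xi> /\<^sub>R norm \<xi> - \<theta>" "\<theta> - \<omega>"] by simp
    also have "K * r \<le> K * s" using K assms by simp
    finally have "norm (\<xi> /\<^sub>R norm \<xi> - \<omega>) \<le> (1 + K + A) * s"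
      using r assms by (simp add: algebra_simps)
    then show "\<xi> \<in> dir_box J j0 r ((1 + K + A) * s) \<omega>"
      using amp_support[OF a] by (simp add: dir_box_def)
  qed auto
  then show ?thesis by (simp add: piece_def)
qed

text \<open>The main term counts slabs near \<open>V\<close> and multiplies by the mass of
  \<open>u\<close> in the cap. The second term is the exceptional part of the sign sums, and the
  third the tails of the cutoffs outside the tiles dilated by \<open>l\<close>. The parameters
  \<open>l\<close>, \<open>L\<close> and \<open>M\<close> stay free.\<close>

theorem local_density_le:
  assumes g: "fourier g = (\<lambda>\<xi>. trig I A' \<xi> * amp J j0 r \<xi>)" and I: "finite I" "I \<subseteq> lat J"
    and s: "r \<le> s" "s \<le> 1" and w: "\<omega> \<in> dirs S s" and l: "1 \<le> l" "l \<le> sqrt R" and L: "0 \<le> L"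
    and d: "\<delta> \<le> 1 / 2" and bigR: "3 + 2 * real CARD('n) \<le> R"
  shows "(local_density A \<delta> S R g s \<omega> a)\<^sup>2 \<le> 1 / measure lborel ((+) a ` V_box (frame S s \<omega>) \<omega> s R) *
    (L\<^sup>2 * (geo_const CARD('n) (1 + K + A) * (l * R) ^ card J * s ^ (2 * card J) * r ^ (CARD('n) - card J))
     + 32 * exp (- L / 2) * cosh_energy J D (lat_ball J (R\<^sup>2)) I piece A'
     + \<bar>C' M\<bar> / l ^ M * (real (card I))\<^sup>2)"
proof -
  let ?n = "real CARD('n)"
  let ?V = "(+) a ` V_box (frame S s \<omega>) \<omega> s R"
  let ?D = "{\<theta> \<in> D. cap A r \<theta> \<subseteq> cap A s \<omega>}"
  let ?Z = "\<lambda>\<theta>. {c \<in> centers S \<theta>. plank \<delta> S R \<theta> c \<inter> ball 0 R \<noteq> {} \<and> base_box S R \<theta> c \<subseteq> ?V}"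
  let ?H = "1 + K + A"
  let ?u = "\<lambda>\<theta>. lattice_sum I A' (piece \<theta>)"
  have s0: "0 < s" using r s by linarith
  have R0: "0 < R" using R by linarith
  have fr: "is_frame (frame S s \<omega>) \<omega>" using frame_s s w by auto
  have frD: "is_frame (frame S r \<theta>) \<theta>" if "\<theta> \<in> D" for \<theta>
    using frame_s[of r \<theta>] that r by (auto simp: D_def)
  \<comment> \<open>The bound on \<open>norm x\<close> is what lets slabs from the finite set
    \<open>lat_ball J (R\<^sup>2)\<close>, over which the moment bound runs, cover the
    region.\<close>
  define P where "P = {x. \<bar>(x - a) \<bullet> \<omega>\<bar> \<le> 2 * l * (R * s\<^sup>2) \<and> norm (x - a) \<le> 2 * ?n * l * (R * s) \<and> norm x
      \<le> R\<^sup>2 - 1}"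
  have P [measurable]: "P \<in> sets borel" unfolding P_def by measurable
  define Q where "Q = {q \<in> lat_ball J (R\<^sup>2). \<exists>x\<in>slab J q. \<bar>(x - a) \<bullet> \<omega>\<bar> \<le> 2 * l * (R * s\<^sup>2) \<and> norm (x - a)
      \<le> 2 * ?n * l * (R * s)}"
  have finB: "finite (lat_ball J (R\<^sup>2))" using finite_card_lat_ball(1)[OF j0] R by (simp add: one_le_power)
  have Q: "Q \<subseteq> lat_ball J (R\<^sup>2)" "finite Q" using finite_subset[OF _ finB] by (auto simp: Q_def)
  have su: "sq_integrable lborel (?u \<theta>)" if "\<theta> \<in> D" for \<theta>
    unfolding lattice_sum_def[abs_def] by (intro sq_integrable_sum sq_integrable_translate piece_sq_integrable that)
  have PQ: "(LINT x|lborel. indicator P x * (cmod (?u \<theta> x))\<^sup>2) \<le> (\<Sum>q\<in>Q. mass (restr (slab J q)) (?u \<theta>))"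
    if "\<theta> \<in> D" for \<theta>
  proof -
    have [measurable]: "?u \<theta> \<in> borel_measurable borel" using su[OF that] by (simp add: sq_integrable_def)
    have iq: "integrable lborel (\<lambda>x. indicator (slab J q) x * (cmod (?u \<theta> x))\<^sup>2)" for q
      by (rule sq_integrable_restr(2)[OF _ su[OF that]]) simp
    have "(LINT x|lborel. indicator P x * (cmod (?u \<theta> x))\<^sup>2)
        \<le> (LINT x|lborel. (\<Sum>q\<in>Q. indicator (slab J q) x * (cmod (?u \<theta> x))\<^sup>2))"
    proof (rule integral_mono)
      fix x
      have "indicator P x \<le> (\<Sum>q\<in>Q. indicator (slab J q) x :: real)"
      proof (cases "x \<in> P")
        case True
        then obtain q where q: "q \<in> lat_ball J (R\<^sup>2)" "x \<in> slab J q"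
          using slab_cover_lat_ball[of x "R\<^sup>2" J] by (auto simp: P_def)
        then have "q \<in> Q" using True by (auto simp: Q_def P_def)
        then have "indicator (slab J q) x \<le> (\<Sum>q\<in>Q. indicator (slab J q) x :: real)"
          using Q(2) by (intro member_le_sum) auto
        then show ?thesis using q(2) True by simp
      qed (simp add: sum_nonneg)
      then show "indicator P x * (cmod (?u \<theta> x))\<^sup>2 \<le> (\<Sum>q\<in>Q. indicator (slab J q) x * (cmod (?u \<theta> x))\<^sup>2)"
        unfolding sum_distrib_right[symmetric] by (intro mult_right_mono) auto
    qed (use sq_integrable_restr(2)[OF P su[OF that]] iq in auto)
    also have "\<dots> = (\<Sum>q\<in>Q. mass (restr (slab J q)) (?u \<theta>))"
      by (subst Bochner_Integration.integral_sum) (use iq in \<open>auto simp: mass_restr\<close>)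
    finally show ?thesis .
  qed
  have tile: "(\<Sum>c\<in>?Z \<theta>. (Lp_norm 2 UNIV (packet S g \<theta> c))\<^sup>2) \<le> (\<Sum>q\<in>Q. mass (restr (slab J q)) (?u \<theta>))
      + \<bar>C' M\<bar> / l ^ M * mass lborel (?u \<theta>)"
    if th: "\<theta> \<in> D" for \<theta>
  proof (cases "finite (?Z \<theta>)")
    case True
    have pk: "(Lp_norm 2 UNIV (packet S g \<theta> c))\<^sup>2
        = mass lborel (\<lambda>x. complex_of_real (chi S \<theta> c x) * ?u \<theta> x)" for c
    proof -
      have "packet S g \<theta> c = (\<lambda>x. complex_of_real (chi S \<theta> c x) * ?u \<theta> x)"
        unfolding packet_def[abs_def] g packet_eq[OF th] ..
      then show ?thesis by (simp add: Lp_norm_2)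
    qed
    have "(\<Sum>c\<in>?Z \<theta>. mass lborel (\<lambda>x. complex_of_real (chi S \<theta> c x) * ?u \<theta> x))
      \<le> (LINT x|lborel. indicator P x * (cmod (?u \<theta> x))\<^sup>2) + \<bar>C' M\<bar> / l ^ M * mass lborel (?u \<theta>)"
    proof (rule tile_sum_le[OF partition_chi[OF th] su[OF th] True _ l(1) P])
      fix c x assume c: "c \<in> ?Z \<theta>" and x: "x - c \<in> (\<lambda>y. l *\<^sub>R y) ` dual_box (frame S r \<theta>) \<theta> r"
      have sub: "(+) c ` dual_box (frame S r \<theta>) \<theta> r \<subseteq> ?V" using c by (auto simp: base_box_def r_def)
      note pp = dilated_tile_subset_plank[OF fr R0 s0 s(2) l(1) sub r(1) x]
      have "norm c \<le> (2 + ?n) * R"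
        using c frD[OF th] by (intro plank_meets_ball_center[OF _ R d, of S \<theta>]) (auto simp: r_def)
      moreover have "norm (x - c) \<le> ?n * (l / (2 * r))"
        using l by (intro norm_dilated_dual_box[OF frD[OF th] _ r x]) auto
      \<comment> \<open>With \<open>l \<le> sqrt R\<close> even the dilated tile has diameter of
        order \<open>R\<close>, hence lies well inside the radius \<open>R\<^sup>2 - 1\<close> for
        large \<open>R\<close>.\<close>
      moreover have "l / (2 * r) \<le> R"
      proof -
        have "1 / r = sqrt R" using R0 by (simp add: r_def powr_minus powr_half_sqrt divide_simps)
        then have "l / (2 * r) = l * sqrt R / 2"
          by (metis divide_divide_eq_left' times_divide_eq_right mult.right_neutral mult.commute)
        also have "\<dots> \<le> sqrt R * sqrt R / 2" using l R0 by (intro divide_right_mono mult_right_mono) auto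
        finally show ?thesis using R0 by simp
      qed
      then have "?n * (l / (2 * r)) \<le> ?n * R" by (intro mult_left_mono) auto
      moreover have "norm x \<le> norm c + norm (x - c)"
        using norm_triangle_ineq[of c "x - c"] by simp
      ultimately have "norm x \<le> (2 + ?n) * R + ?n * R" by linarith
      also have "\<dots> = (2 + 2 * ?n) * R" by (simp add: algebra_simps)
      also have "\<dots> \<le> (R - 1) * R" using bigR R0 by (intro mult_right_mono) auto
      also have "\<dots> \<le> R\<^sup>2 - 1" using R by (simp add: power2_eq_square algebra_simps)
      finally show "x \<in> P" using pp by (simp add: P_def)
    qed auto
    then show ?thesis unfolding pk using PQ[OF th] by linarith
  next
    \<comment> \<open>A sum over an infinite index set is 0 by convention, and the right side is
      nonnegative.\<close>
    case False
    then show ?thesis using l by (simp add: sum_nonneg)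
  qed
  have "(\<Sum>\<theta>\<in>?D. \<Sum>c\<in>?Z \<theta>. (Lp_norm 2 UNIV (packet S g \<theta> c))\<^sup>2)
      \<le> (\<Sum>\<theta>\<in>?D. (\<Sum>q\<in>Q. mass (restr (slab J q)) (?u \<theta>)) + \<bar>C' M\<bar> / l ^ M * mass lborel (?u \<theta>))"
    by (intro sum_mono tile) auto
  also have "\<dots> = (\<Sum>\<theta>\<in>?D. \<Sum>q\<in>Q. mass (restr (slab J q)) (?u \<theta>)) + \<bar>C' M\<bar> / l ^ M * (\<Sum>\<theta>\<in>?D. mass lborel (?u \<theta>))"
    by (simp add: sum.distrib sum_distrib_left)
  also have "\<dots> \<le> (L\<^sup>2 * (geo_const CARD('n) ?H * (l * R) ^ card J * s ^ (2 * card J) * r ^ (CARD('n) - card J))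
     + 32 * exp (- L / 2) * cosh_energy J D (lat_ball J (R\<^sup>2)) I piece A') + \<bar>C' M\<bar> / l ^ M * (real (card I))\<^sup>2"
  proof (intro add_mono mult_left_mono)
    have "(\<Sum>\<theta>\<in>?D. mass lborel (?u \<theta>)) \<le> (\<Sum>\<theta>\<in>D. mass lborel (?u \<theta>))"
      using finite_D by (intro sum_mono2) auto
    then show "(\<Sum>\<theta>\<in>?D. mass lborel (?u \<theta>)) \<le> (real (card I))\<^sup>2"
      using sum_mass_packets_le by (rule order_trans)
    have "(\<Sum>\<theta>\<in>?D. \<Sum>q\<in>Q. mass (restr (slab J q)) (?u \<theta>)) \<le> L\<^sup>2 * real (card Q) * (\<Sum>\<theta>\<in>?D. mass lborel (piece \<theta>))
      + 32 * exp (- L / 2) * cosh_energy J D (lat_ball J (R\<^sup>2)) I piece A'"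
      by (rule slab_mass_le[OF I finB lat_ball_subset Q(1) finite_D _ piece_sq_integrable L]) auto
    also have "L\<^sup>2 * real (card Q) * (\<Sum>\<theta>\<in>?D. mass lborel (piece \<theta>))
        \<le> L\<^sup>2 * real (card Q) * measure lborel (dir_box J j0 r (?H * s) \<omega>)"
      by (intro mult_left_mono sum_mass_piece_cap_le s) auto
    also have "\<dots> = L\<^sup>2 * (real (card Q) * measure lborel (dir_box J j0 r (?H * s) \<omega>))" by simp
    also have "\<dots> \<le> L\<^sup>2 * (geo_const CARD('n) ?H * (l * R) ^ card J * s ^ (2 * card J)
        * r ^ (CARD('n) - card J))"
      unfolding geo_const_def
    proof (intro mult_left_mono count_times_volume j0 r s l)
      have "R * r\<^sup>2 \<le> R * s\<^sup>2" using R0 r s by (intro mult_left_mono power_mono) auto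
      then show "1 \<le> R * s\<^sup>2" by (simp add: R_r)
      show "norm \<omega> = 1" using frame_unit[OF fr frame_dir[OF fr]] .
      show "Q \<subseteq> lat J" using Q(1) lat_ball_subset by blast
      show "1 \<le> 1 + K + A" using A K by simp
    qed (auto simp: Q_def)
    finally show "(\<Sum>\<theta>\<in>?D. \<Sum>q\<in>Q. mass (restr (slab J q)) (?u \<theta>))
        \<le> L\<^sup>2 * (geo_const CARD('n) ?H * (l * R) ^ card J * s ^ (2 * card J) * r ^ (CARD('n) - card J))
      + 32 * exp (- L / 2) * cosh_energy J D (lat_ball J (R\<^sup>2)) I piece A'" by simp
  qed (use l in simp)
  finally have main: "(\<Sum>\<theta>\<in>?D. \<Sum>c\<in>?Z \<theta>. (Lp_norm 2 UNIV (packet S g \<theta> c))\<^sup>2) \<le> \<dots>" .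
  have "(local_density A \<delta> S R g s \<omega> a)\<^sup>2
      = 1 / measure lborel ?V * (\<Sum>\<theta>\<in>?D. \<Sum>c\<in>?Z \<theta>. (Lp_norm 2 UNIV (packet S g \<theta> c))\<^sup>2)"
    unfolding local_density_def Let_def r_def[symmetric] D_def[symmetric]
    by (rule real_sqrt_pow2) (intro mult_nonneg_nonneg sum_nonneg; simp)
  then show ?thesis
    using mult_left_mono[OF main, of "1 / measure lborel ?V"] by simp
qed

end

section \<open>Concentration of the half wave\<close>

definition wave_amp :: "'n set \<Rightarrow> 'n \<Rightarrow> real \<Rightarrow> real \<Rightarrow> real ^ 'n::finite \<Rightarrow> complex" where
  "wave_amp J j0 r t \<xi> = cis (t * norm \<xi>) * amp J j0 r \<xi>"

definition wave :: "'n set \<Rightarrow> 'n \<Rightarrow> real \<Rightarrow> real \<Rightarrow> real ^ 'n::finite \<Rightarrow> complex" where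
  "wave J j0 r t = inv_fourier (wave_amp J j0 r t)"

lemma half_wave_eq:
  fixes f :: "real ^ 'n::finite \<Rightarrow> complex"
  assumes r: "0 < r" "r \<le> 1" and j0: "j0 \<in> J"
    and f: "fourier f = (\<lambda>\<xi>. trig I A \<xi> * amp J j0 r \<xi>)"
  shows "half_wave f (x, t) = lattice_sum I A (wave J j0 r t) x"
proof -
  have far: "amp J j0 r \<xi> = 0" if "7 / 8 < norm \<xi>" for \<xi>
    using amp_eq_0[OF r(1) j0, of \<xi>] norm_amp_box(2)[OF r, of \<xi>] that by force
  have i: "integrable lborel (wave_amp J j0 r t)"
    unfolding wave_amp_def[abs_def]
    by (rule integrable_compact_support[of _ "7/8"])
       (auto intro!: continuous_intros elem_continuous[OF amp_elem] simp: far)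
  have "half_wave f (x, t) = inv_fourier (\<lambda>\<xi>. trig I A \<xi> * wave_amp J j0 r t \<xi>) x"
    unfolding half_wave_def inv_fourier_def f wave_amp_def by (simp add: cis_mult[symmetric] mult_ac)
  then show ?thesis
    unfolding inv_fourier_trig[OF i] wave_def .
qed

lemma frechet_derivative_zero_on_open:
  assumes "open S" "x \<in> S" "\<And>y. y \<in> S \<Longrightarrow> f y = 0"
  shows "frechet_derivative f (at x) = (\<lambda>_. 0)" "(f has_derivative (\<lambda>_. 0)) (at x)"
proof -
  have "((\<lambda>_. 0) has_derivative (\<lambda>_. 0)) (at x)" by simp
  then show h: "(f has_derivative (\<lambda>_. 0)) (at x)"
    by (rule has_derivative_transform_within_open[OF _ assms(1,2)]) (use assms(3) in auto)
  show "frechet_derivative f (at x) = (\<lambda>_. 0)"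
    using frechet_derivative_at[OF h] by simp
qed

text \<open>The second term contains the group velocity: \<open>sgn \<xi>\<close> is the gradient of
  \<open>norm\<close> away from 0.\<close>

definition wave_amp_deriv :: "'n set \<Rightarrow> 'n \<Rightarrow> real \<Rightarrow> real \<Rightarrow> real ^ 'n \<Rightarrow> real ^ 'n::finite \<Rightarrow> complex" where
  "wave_amp_deriv J j0 r t \<xi> v = cis (t * norm \<xi>) * frechet_derivative (amp J j0 r) (at \<xi>) v +
     \<i> * complex_of_real (t * (v \<bullet> sgn \<xi>)) * cis (t * norm \<xi>) * amp J j0 r \<xi>"

text \<open>The phase is not differentiable at the origin, but the amplitude vanishes on the ball of
  radius 5/8. The statements are proved on this ball and on the complement of 0, which together are
  the whole space.\<close>

lemma
  assumes r: "0 < r" "r \<le> 1" and j0: "j0 \<in> J"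
  shows wave_amp_has_derivative: "(wave_amp J j0 r t has_derivative wave_amp_deriv J j0 r t \<xi>) (at \<xi>)"
    and wave_amp_deriv_continuous: "continuous_on UNIV (\<lambda>\<xi>. wave_amp_deriv J j0 r t \<xi> v)"
    and wave_amp_deriv_outside: "\<xi> \<notin> amp_box J j0 r 1 \<Longrightarrow> wave_amp_deriv J j0 r t \<xi> v = 0"
proof -
  have d0: "wave_amp_deriv J j0 r t \<xi> = (\<lambda>_. 0)" if "norm \<xi> < 5 / 8" for \<xi>
  proof -
    have "frechet_derivative (amp J j0 r) (at \<xi>) = (\<lambda>_. 0)"
      by (rule frechet_derivative_zero_on_open(1)[of "ball 0 (5/8)"])
         (use that amp_zero_near_origin[OF r j0] in auto)
    then show ?thesis
      using amp_zero_near_origin[OF r j0 that] by (simp add: wave_amp_deriv_def fun_eq_iff)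
  qed
  show "(wave_amp J j0 r t has_derivative wave_amp_deriv J j0 r t \<xi>) (at \<xi>)"
  proof (cases "norm \<xi> < 5 / 8")
    case True
    have "(wave_amp J j0 r t has_derivative (\<lambda>_. 0)) (at \<xi>)"
      by (rule frechet_derivative_zero_on_open(2)[of "ball 0 (5/8)"])
         (use True amp_zero_near_origin[OF r j0] in \<open>auto simp: wave_amp_def\<close>)
    then show ?thesis using d0[OF True] by simp
  next
    case False
    then have "\<xi> \<noteq> 0" by auto
    from has_derivative_compose[OF has_derivative_norm[OF this] cis_has_derivative[of t]]
    have "((\<lambda>\<xi>. cis (t * norm \<xi>)) has_derivative (\<lambda>v. \<i> * complex_of_real (t * (v \<bullet> sgn \<xi>))
        * cis (t * norm \<xi>))) (at \<xi>)"
      by simp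
    from has_derivative_mult[OF this elem_has_derivative[OF amp_elem[of J j0 r]]]
    show ?thesis
      unfolding wave_amp_def[abs_def] wave_amp_deriv_def[abs_def] .
  qed
  have "continuous_on (ball 0 (5/8) \<union> - {0}) (\<lambda>\<xi>. wave_amp_deriv J j0 r t \<xi> v)"
  proof (rule continuous_on_open_Un)
    show "continuous_on (ball 0 (5/8)) (\<lambda>\<xi>. wave_amp_deriv J j0 r t \<xi> v)"
      by (rule continuous_on_cong[THEN iffD1, OF refl _ continuous_on_const[of _ 0]]) (simp add: d0)
    have "continuous_on (- {0}) (\<lambda>\<xi>. frechet_derivative (amp J j0 r) (at \<xi>) v)"
      by (rule continuous_on_subset[OF elem_continuous[OF elem_frechet_derivative[OF amp_elem]]]) simp
    moreover have "continuous_on (- {0}) (amp J j0 r)"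
      by (rule continuous_on_subset[OF elem_continuous[OF amp_elem]]) simp
    ultimately show "continuous_on (- {0}) (\<lambda>\<xi>. wave_amp_deriv J j0 r t \<xi> v)"
      unfolding wave_amp_deriv_def sgn_div_norm by (intro continuous_intros) auto
  qed auto
  moreover have "ball 0 (5/8) \<union> - {0} = (UNIV :: (real ^ 'a) set)" by auto
  ultimately show "continuous_on UNIV (\<lambda>\<xi>. wave_amp_deriv J j0 r t \<xi> v)" by simp
  show "wave_amp_deriv J j0 r t \<xi> v = 0" if x: "\<xi> \<notin> amp_box J j0 r 1"
  proof -
    have "frechet_derivative (amp J j0 r) (at \<xi>) = (\<lambda>_. 0)"
    proof (rule frechet_derivative_zero_on_open(1)[of "- amp_box J j0 r 1"])
      show "open (- amp_box J j0 r 1)" unfolding amp_box_def by (intro open_Compl closed_cbox)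
    qed (use x amp_eq_0[OF r(1) j0] in auto)
    then show ?thesis using amp_eq_0[OF r(1) j0 x] by (simp add: wave_amp_deriv_def)
  qed
qed

text \<open>Off \<open>J\<close> a frequency in the box has coordinate at most \<open>r / 8\<close>
  and norm at least 5/8, so the velocity in that direction is at most \<open>r\<close>; the
  derivative of the bump contributes the inverse width.\<close>

lemma wave_amp_deriv_bound:
  fixes J :: "'n::finite set"
  assumes r: "0 < r" "r \<le> 1" and j0: "j0 \<in> J"
    and C: "\<And>\<xi>. cmod (frechet_derivative (amp J j0 r) (at \<xi>) (axis j 1)) \<le> C / (if j \<in> J then 1 else r)"
  shows "cmod (wave_amp_deriv J j0 r t \<xi> (axis j 1)) \<le>
    (\<bar>t\<bar> * (if j \<in> J then 1 else r) + C / (if j \<in> J then 1 else r)) * indicator (amp_box J j0 r 1) \<xi>"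
proof (cases "\<xi> \<in> amp_box J j0 r 1")
  case True
  let ?w = "if j \<in> J then 1 else r"
  have n: "5 / 8 \<le> norm \<xi>" using norm_amp_box(1)[OF r True] .
  have "\<bar>axis j 1 \<bullet> sgn \<xi>\<bar> \<le> ?w"
  proof (cases "j \<in> J")
    case True
    have "\<bar>sgn \<xi> $ j\<bar> \<le> norm (sgn \<xi>)" by (rule component_le_norm_cart)
    also have "\<dots> \<le> 1" by (simp add: norm_sgn)
    finally show ?thesis using True by (simp add: inner_axis')
  next
    case False
    then have "j \<noteq> j0" using j0 by auto
    then have "\<bar>\<xi> $ j\<bar> \<le> 1 * wid J r j"
      using True unfolding mem_amp_box by (auto simp: mid_def axis_def dest!: spec[of _ j])
    also have "\<dots> = r / (8 * real CARD('n))" using False by (simp add: wid_def)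
    also have "\<dots> \<le> r / 8" using r by (intro divide_left_mono) (auto simp: Suc_leI)
    finally have "\<bar>\<xi> $ j\<bar> / norm \<xi> \<le> (r / 8) / (5 / 8)"
      using n r by (intro frac_le) auto
    also have "\<dots> \<le> r" using r by simp
    finally show ?thesis using False
      by (simp add: inner_axis' sgn_div_norm abs_mult divide_inverse mult.commute)
  qed
  then have 1: "\<bar>t * (axis j 1 \<bullet> sgn \<xi>)\<bar> \<le> \<bar>t\<bar> * ?w"
    unfolding abs_mult by (rule mult_left_mono) simp
  have "cmod (wave_amp_deriv J j0 r t \<xi> (axis j 1)) \<le> cmod (frechet_derivative (amp J j0 r) (at \<xi>) (axis j 1))
      + \<bar>t * (axis j 1 \<bullet> sgn \<xi>)\<bar> * cmod (amp J j0 r \<xi>)"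
    unfolding wave_amp_deriv_def by (rule order_trans[OF norm_triangle_ineq]) (simp add: norm_mult del: of_real_mult)
  also have "\<dots> \<le> C / ?w + \<bar>t\<bar> * ?w * 1"
    using 1 r by (intro add_mono C mult_mono cmod_amp_le_1) auto
  finally show ?thesis using True by (simp only: indicator_simps) simp
next
  case False
  then show ?thesis using wave_amp_deriv_outside[OF r j0 False] by simp
qed

lemma
  fixes J :: "'n::finite set"
  assumes r: "0 < r" "r \<le> 1" and j0: "j0 \<in> J"
  shows wave_sq_integrable: "sq_integrable lborel (wave J j0 r t)"
    and mass_wave: "mass lborel (wave J j0 r t)
        = (LINT \<xi>|lborel. (cmod (amp J j0 r \<xi>))\<^sup>2) / (2 * pi) ^ CARD('n)"
    and norm_wave_le_1: "cmod (wave J j0 r t x) \<le> 1"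
proof -
  have far: "amp J j0 r \<xi> = 0" if "7 / 8 < norm \<xi>" for \<xi>
    using amp_eq_0[OF r(1) j0, of \<xi>] norm_amp_box(2)[OF r, of \<xi>] that by force
  have c: "continuous_on UNIV (wave_amp J j0 r t)"
    unfolding wave_amp_def[abs_def] by (intro continuous_intros elem_continuous amp_elem)
  have f: "wave_amp J j0 r t \<xi> = 0" if "7 / 8 < norm \<xi>" for \<xi>
    using far[OF that] by (simp add: wave_amp_def)
  have p: "sq_integrable lborel (inv_fourier (wave_amp J j0 r t))"
    "mass lborel (inv_fourier (wave_amp J j0 r t))
        = (LINT \<xi>|lborel. (cmod (wave_amp J j0 r t \<xi>))\<^sup>2) / (2 * pi) ^ DIM(real ^ 'n)"
    by (rule inv_fourier_plancherel[OF c f], assumption)+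
  show "sq_integrable lborel (wave J j0 r t)" unfolding wave_def by (rule p(1))
  show "mass lborel (wave J j0 r t) = (LINT \<xi>|lborel. (cmod (amp J j0 r \<xi>))\<^sup>2) / (2 * pi) ^ CARD('n)"
    using p(2) by (simp add: wave_def wave_amp_def norm_mult)
  have "cmod (osc (wave_amp J j0 r t) x) \<le> (LINT \<xi>|lborel. cmod (wave_amp J j0 r t \<xi>))"
    by (rule norm_osc_le)
  also have "\<dots> \<le> (LINT \<xi>|lborel. indicator (amp_box J j0 r 1) \<xi>)"
  proof (rule integral_mono)
    show "integrable lborel (\<lambda>\<xi>. cmod (wave_amp J j0 r t \<xi>))"
      using integrable_compact_support[OF c f] by (rule integrable_norm)
    show "integrable lborel (indicator (amp_box J j0 r 1) :: _ \<Rightarrow> real)"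
      using emeasure_amp_box_finite[of J j0 r 1] by (intro integrable_real_indicator) auto
    show "cmod (wave_amp J j0 r t \<xi>) \<le> indicator (amp_box J j0 r 1) \<xi>" for \<xi>
      using cmod_amp_le_1[of J j0 r \<xi>] amp_eq_0[OF r(1) j0, of \<xi>]
      by (auto simp: wave_amp_def norm_mult indicator_def)
  qed
  also have "\<dots> = measure lborel (amp_box J j0 r 1)" by simp
  also have "\<dots> \<le> 1"
  proof -
    have "1 \<le> real CARD('n)" by (simp add: Suc_leI)
    then have "1 \<le> 4 * real CARD('n)" by linarith
    then have "1 / (4 * real CARD('n)) \<le> 1" by (subst divide_le_eq_1_pos) linarith+
    then have "(1 / (4 * real CARD('n))) ^ CARD('n) * r ^ (CARD('n) - card J) \<le> 1 * 1"
      using r by (intro mult_mono power_le_one) auto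
    then show ?thesis using measure_amp_box[OF r(1), of 1 J j0] by simp
  qed
  finally have o: "cmod (osc (wave_amp J j0 r t) x) \<le> 1" .
  have "1 \<le> (2 * pi) ^ CARD('n)" using pi_ge_two by (intro one_le_power) linarith
  then have "cmod (osc (wave_amp J j0 r t) x) / (2 * pi) ^ CARD('n) \<le> 1 / 1"
    using o by (intro frac_le) auto
  then show "cmod (wave J j0 r t x) \<le> 1"
    unfolding wave_def inv_fourier_osc by (simp add: norm_mult norm_divide norm_power)
qed

text \<open>Chebyshev's inequality: the second moments of the wave are the masses of the derivatives of its
  amplitude, and these grow with the group velocity, which is small off \<open>J\<close>.\<close>

lemma wave_concentration:
  fixes J :: "'n::finite set"
  assumes r: "0 < r" "r \<le> 1" and j0: "j0 \<in> J"
    and C: "\<And>j \<xi>. cmod (frechet_derivative (amp J j0 r) (at \<xi>) (axis j 1)) \<le> C / (if j \<in> J then 1 else r)" "0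
        \<le> C"
    and d: "\<And>j. 0 < d j" "\<And>j. \<bar>t\<bar> * (if j \<in> J then 1 else r) + C / (if j \<in> J then 1 else r) \<le> \<eta> * d j"
    and eta: "\<eta>\<^sup>2 * (2 * exp 8) ^ CARD('n) * real CARD('n) \<le> 1 / 2"
  shows "mass lborel (wave J j0 r t) / 2 \<le>
    (LINT x|lborel. indicator {x. \<forall>j. \<bar>x $ j\<bar> \<le> d j} x * (cmod (wave J j0 r t x))\<^sup>2)"
proof -
  let ?W = "wave J j0 r t"
  define \<mu> where "\<mu> = (LINT \<xi>|lborel. (cmod (amp J j0 r \<xi>))\<^sup>2)"
  have \<mu>: "0 \<le> \<mu>" by (simp add: \<mu>_def)
  have sqW: "sq_integrable lborel ?W" by (rule wave_sq_integrable[OF r j0])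
  then have iW: "integrable lborel (\<lambda>x. (cmod (?W x))\<^sup>2)" and [measurable]: "?W \<in> borel_measurable borel"
    by (auto simp: sq_integrable_def)
  have far: "wave_amp J j0 r t \<xi> = 0" if "7 / 8 < norm \<xi>" for \<xi>
    using amp_eq_0[OF r(1) j0, of \<xi>] norm_amp_box(2)[OF r, of \<xi>] that by (force simp: wave_amp_def)
  \<comment> \<open>The derivatives are bounded by the volume of the support; this converts that
    volume into the mass of the amplitude, so that the tails become a fixed fraction of the
    mass.\<close>
  have box: "measure lborel (amp_box J j0 r 1) \<le> (2 * exp 8) ^ CARD('n) * \<mu>"
  proof -
    have "measure lborel (amp_box J j0 r 1) = (1 / (4 * real CARD('n))) ^ CARD('n) * r ^ (CARD('n) - card J)"
      using measure_amp_box[OF r(1), of 1 J j0] by simp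
    also have "\<dots> = (2 * exp 8) ^ CARD('n) * ((exp (- 8) / (8 * real CARD('n))) ^ CARD('n)
        * r ^ (CARD('n) - card J))"
    proof -
      have "1 / (4 * real CARD('n)) = (2 * exp 8) * (exp (- 8) / (8 * real CARD('n)))"
        by (simp add: exp_minus field_simps)
      then show ?thesis by (simp only: power_mult_distrib mult.assoc)
    qed
    also have "\<dots> \<le> (2 * exp 8) ^ CARD('n) * \<mu>"
      unfolding \<mu>_def by (intro mult_left_mono amp_mass_lower[OF r j0]) auto
    finally show ?thesis .
  qed
  have mom: "integrable lborel (\<lambda>x. (x $ j)\<^sup>2 * (cmod (?W x))\<^sup>2)"
    "(LINT x|lborel. (x $ j)\<^sup>2 * (cmod (?W x))\<^sup>2)
        \<le> (\<eta> * d j)\<^sup>2 * ((2 * exp 8) ^ CARD('n) * \<mu>) / (2 * pi) ^ CARD('n)" for j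
  proof -
    let ?g = "\<lambda>\<xi>. wave_amp_deriv J j0 r t \<xi> (axis j 1)"
    have gc: "continuous_on UNIV ?g" by (rule wave_amp_deriv_continuous[OF r j0])
    have gf: "?g \<xi> = 0" if "7 / 8 < norm \<xi>" for \<xi>
      using wave_amp_deriv_outside[OF r j0, of \<xi> t] norm_amp_box(2)[OF r, of \<xi>] that by force
    have "osc ?g x = - \<i> * complex_of_real (x \<bullet> axis j 1) * osc (wave_amp J j0 r t) x" for x
      by (rule osc_derivative[OF wave_amp_has_derivative[OF r j0] gc far])
    then have e: "(cmod (inv_fourier ?g x))\<^sup>2 = (x $ j)\<^sup>2 * (cmod (?W x))\<^sup>2" for x
      unfolding wave_def inv_fourier_osc
        by (simp add: norm_mult norm_divide norm_power power_mult_distrib power_divide inner_axis mult_ac)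
    have p: "sq_integrable lborel (inv_fourier ?g)"
      "mass lborel (inv_fourier ?g) = (LINT \<xi>|lborel. (cmod (?g \<xi>))\<^sup>2) / (2 * pi) ^ DIM(real ^ 'n)"
      by (rule inv_fourier_plancherel[OF gc gf], assumption)+
    show "integrable lborel (\<lambda>x. (x $ j)\<^sup>2 * (cmod (?W x))\<^sup>2)"
      using p(1) unfolding sq_integrable_def e by simp
    have "(LINT x|lborel. (x $ j)\<^sup>2 * (cmod (?W x))\<^sup>2) = (LINT \<xi>|lborel. (cmod (?g \<xi>))\<^sup>2) / (2 * pi) ^ CARD('n)"
      using p(2) unfolding mass_def e by simp
    also have "\<dots> \<le> (LINT \<xi>|lborel. (\<eta> * d j)\<^sup>2 * indicator (amp_box J j0 r 1) \<xi>) / (2 * pi) ^ CARD('n)"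
    proof (intro divide_right_mono integral_mono)
      show "integrable lborel (\<lambda>\<xi>. (cmod (?g \<xi>))\<^sup>2)"
        by (rule integrable_compact_support[of _ "7/8"]) (auto intro!: continuous_intros gc simp: gf)
      show "integrable lborel (\<lambda>\<xi>. (\<eta> * d j)\<^sup>2 * indicator (amp_box J j0 r 1) \<xi> :: real)"
        using emeasure_amp_box_finite[of J j0 r 1]
          by (intro integrable_mult_right integrable_real_indicator) auto
      show "(cmod (?g \<xi>))\<^sup>2 \<le> (\<eta> * d j)\<^sup>2 * indicator (amp_box J j0 r 1) \<xi>" for \<xi>
      proof -
        have "cmod (?g \<xi>) \<le> (\<bar>t\<bar> * (if j \<in> J then 1 else r) + C / (if j \<in> J then 1 else r))
            * indicator (amp_box J j0 r 1) \<xi>"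
          by (rule wave_amp_deriv_bound[OF r j0 C(1)])
        also have "\<dots> \<le> \<eta> * d j * indicator (amp_box J j0 r 1) \<xi>"
          by (intro mult_right_mono d) auto
        finally have "(cmod (?g \<xi>))\<^sup>2 \<le> (\<eta> * d j * indicator (amp_box J j0 r 1) \<xi>)\<^sup>2"
          by (intro power_mono) auto
        then show ?thesis
          by (cases "\<xi> \<in> amp_box J j0 r 1") (simp_all add: power_mult_distrib)
      qed
    qed simp
    also have "(LINT \<xi>|lborel. (\<eta> * d j)\<^sup>2 * indicator (amp_box J j0 r 1) \<xi>)
        = (\<eta> * d j)\<^sup>2 * measure lborel (amp_box J j0 r 1)"
      by simp
    also have "(\<eta> * d j)\<^sup>2 * measure lborel (amp_box J j0 r 1) / (2 * pi) ^ CARD('n)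
        \<le> (\<eta> * d j)\<^sup>2 * ((2 * exp 8) ^ CARD('n) * \<mu>) / (2 * pi) ^ CARD('n)"
      by (intro divide_right_mono mult_left_mono box) auto
    finally show "(LINT x|lborel. (x $ j)\<^sup>2 * (cmod (?W x))\<^sup>2)
        \<le> (\<eta> * d j)\<^sup>2 * ((2 * exp 8) ^ CARD('n) * \<mu>) / (2 * pi) ^ CARD('n)" .
  qed
  let ?B = "{x :: real ^ 'n. \<forall>j. \<bar>x $ j\<bar> \<le> d j}"
  have Bs [measurable]: "?B \<in> sets borel" by measurable
  have iB: "integrable lborel (\<lambda>x. indicator ?B x * (cmod (?W x))\<^sup>2)"
    by (rule sq_integrable_restr(2)[OF Bs sqW])
  \<comment> \<open>Outside the box some \<open>(x $ j)\<^sup>2 / (d j)\<^sup>2\<close> is at least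
    1.\<close>
  have "mass lborel ?W \<le> (LINT x|lborel. indicator ?B x * (cmod (?W x))\<^sup>2
      + (\<Sum>j\<in>UNIV. (x $ j)\<^sup>2 * (cmod (?W x))\<^sup>2 / (d j)\<^sup>2))"
    unfolding mass_def
  proof (rule integral_mono[OF iW])
    show "integrable lborel (\<lambda>x. indicator ?B x * (cmod (?W x))\<^sup>2
        + (\<Sum>j\<in>UNIV. (x $ j)\<^sup>2 * (cmod (?W x))\<^sup>2 / (d j)\<^sup>2))"
      by (intro Bochner_Integration.integrable_add Bochner_Integration.integrable_sum integrable_divide iB mom)
    fix x :: "real ^ 'n"
    show "(cmod (?W x))\<^sup>2 \<le> indicator ?B x * (cmod (?W x))\<^sup>2 + (\<Sum>j\<in>UNIV. (x $ j)\<^sup>2 * (cmod (?W x))\<^sup>2 / (d j)\<^sup>2)"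
    proof (cases "x \<in> ?B")
      case True
      then show ?thesis by (simp add: sum_nonneg)
    next
      case False
      then obtain j where j: "d j < \<bar>x $ j\<bar>" by (auto simp: not_le)
      then have "(d j)\<^sup>2 \<le> (x $ j)\<^sup>2" using d(1)[of j] abs_le_square_iff[of "d j" "x $ j"] by simp
      then have "1 \<le> (x $ j)\<^sup>2 / (d j)\<^sup>2" using d(1)[of j] by simp
      then have "1 * (cmod (?W x))\<^sup>2 \<le> (x $ j)\<^sup>2 / (d j)\<^sup>2 * (cmod (?W x))\<^sup>2" by (rule mult_right_mono) simp
      also have "\<dots> \<le> (\<Sum>j\<in>UNIV. (x $ j)\<^sup>2 * (cmod (?W x))\<^sup>2 / (d j)\<^sup>2)"
        using member_le_sum[of j UNIV "\<lambda>j. (x $ j)\<^sup>2 * (cmod (?W x))\<^sup>2 / (d j)\<^sup>2"] by simp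
      finally show ?thesis using False by simp
    qed
  qed
  also have "\<dots> = (LINT x|lborel. indicator ?B x * (cmod (?W x))\<^sup>2)
      + (\<Sum>j\<in>UNIV. (LINT x|lborel. (x $ j)\<^sup>2 * (cmod (?W x))\<^sup>2) / (d j)\<^sup>2)"
    by (subst Bochner_Integration.integral_add[OF iB]) (use mom in \<open>auto simp: Bochner_Integration.integral_sum\<close>)
  also have "(\<Sum>j\<in>UNIV. (LINT x|lborel. (x $ j)\<^sup>2 * (cmod (?W x))\<^sup>2) / (d j)\<^sup>2)
      \<le> (\<Sum>j\<in>(UNIV::'n set). \<eta>\<^sup>2 * (2 * exp 8) ^ CARD('n) * mass lborel ?W)"
  proof (rule sum_mono)
    fix j :: 'n
    have "(LINT x|lborel. (x $ j)\<^sup>2 * (cmod (?W x))\<^sup>2) / (d j)\<^sup>2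
        \<le> ((\<eta> * d j)\<^sup>2 * ((2 * exp 8) ^ CARD('n) * \<mu>) / (2 * pi) ^ CARD('n)) / (d j)\<^sup>2"
      by (intro divide_right_mono mom) simp
    also have "\<dots> = \<eta>\<^sup>2 * (2 * exp 8) ^ CARD('n) * mass lborel ?W"
      unfolding mass_wave[OF r j0] \<mu>_def[symmetric] using d(1)[of j] by (simp add: power_mult_distrib)
    finally show "(LINT x|lborel. (x $ j)\<^sup>2 * (cmod (?W x))\<^sup>2) / (d j)\<^sup>2 \<le> \<eta>\<^sup>2 * (2 * exp 8) ^ CARD('n)
        * mass lborel ?W" .
  qed
  also have "(\<Sum>j\<in>(UNIV::'n set). \<eta>\<^sup>2 * (2 * exp 8) ^ CARD('n) * mass lborel ?W)
      = (\<eta>\<^sup>2 * (2 * exp 8) ^ CARD('n) * real CARD('n)) * mass lborel ?W"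
    by simp
  also have "\<dots> \<le> 1 / 2 * mass lborel ?W"
    by (intro mult_right_mono eta) simp
  finally show ?thesis by simp
qed

section \<open>Energy in a spacetime box\<close>

lemma sq_integrable_restr_bounded:
  assumes S [measurable]: "S \<in> sets borel" "bounded S" and u [measurable]: "u \<in> borel_measurable borel"
    and b: "\<And>x. cmod (u x) \<le> b"
  shows "sq_integrable (restr S) u"
    and "integrable lborel (\<lambda>x. indicator S x * (cmod (u x))\<^sup>2)"
    and "mass (restr S) u \<le> b\<^sup>2 * measure lborel S"
proof -
  have fS: "emeasure lborel S < \<infinity>" by (rule emeasure_bounded_finite[OF S(2)])
  have iS: "integrable lborel (\<lambda>x. b\<^sup>2 * indicator S x :: real)"
    using fS by (intro integrable_mult_right integrable_real_indicator) auto
  have le: "indicator S x * (cmod (u x))\<^sup>2 \<le> b\<^sup>2 * indicator S x" for x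
    using power_mono[OF b, of x 2] by (simp add: indicator_def)
  show i: "integrable lborel (\<lambda>x. indicator S x * (cmod (u x))\<^sup>2)"
    by (rule Bochner_Integration.integrable_bound[OF iS])
       (use le in \<open>auto intro!: order_trans[OF _ abs_ge_self]\<close>)
  show "sq_integrable (restr S) u"
    unfolding sq_integrable_def restr_def by (subst integrable_density) (use i in auto)
  have "mass (restr S) u \<le> (LINT x|lborel. b\<^sup>2 * indicator S x)"
    unfolding mass_restr[OF S(1) u] by (rule integral_mono[OF i iS le])
  then show "mass (restr S) u \<le> b\<^sup>2 * measure lborel S" by simp
qed

definition spacetime_box :: "('n \<Rightarrow> real) \<Rightarrow> real \<Rightarrow> ((real ^ 'n::finite) \<times> real) set" where
  "spacetime_box d T = {p. \<bar>snd p\<bar> \<le> T \<and> (\<forall>j. \<bar>fst p $ j\<bar> \<le> d j)}"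

lemma
  assumes d: "\<And>j. 0 \<le> d j" and T: "0 \<le> T"
  shows spacetime_box_sets: "spacetime_box d T \<in> sets borel" "bounded (spacetime_box d T)"
    and measure_spacetime_box: "measure lborel (spacetime_box d T) = (\<Prod>j\<in>UNIV. 2 * d j) * (2 * T)"
proof -
  have e: "spacetime_box d T = cbox (\<chi> j. - d j) (\<chi> j. d j) \<times> cbox (- T) T"
    by (auto simp: spacetime_box_def mem_box_cart abs_le_iff minus_le_iff)
  then have e': "spacetime_box d T = cbox (\<chi> j. - d j, - T) (\<chi> j. d j, T)"
    by (simp only: cbox_Pair_eq)
  show "spacetime_box d T \<in> sets borel" "bounded (spacetime_box d T)"
    unfolding e' by (simp, rule bounded_cbox)
  have "0 \<in> cbox (\<chi> j. - d j) (\<chi> j. d j)" using d by (simp add: mem_box_cart)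
  then have ne: "cbox (\<chi> j. - d j) (\<chi> j. d j) \<noteq> {}" by blast
  show "measure lborel (spacetime_box d T) = (\<Prod>j\<in>UNIV. 2 * d j) * (2 * T)"
    unfolding e' content_Pair content_cbox_cart[OF ne] using T by simp
qed

lemma measurable_wave:
  fixes J :: "'n::finite set"
  shows "(\<lambda>p. wave J j0 r (snd p) (fst p - m)) \<in> borel_measurable borel"
proof -
  have [measurable]: "amp J j0 r \<in> borel_measurable borel"
    by (intro borel_measurable_continuous_onI elem_continuous amp_elem)
  have "(\<lambda>p. wave J j0 r (snd p) (fst p - m)) \<in> borel_measurable (borel \<Otimes>\<^sub>M borel)"
    unfolding wave_def inv_fourier_def wave_amp_def by measurable
  then show ?thesis by (simp add: borel_prod)
qed

text \<open>Integration over the time interval of length \<open>2 * T\<close>, with mass at least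
  \<open>\<mu> / 2\<close> at each time. The sides \<open>D\<close> leave room for the translation,
  so the same box serves all translates.\<close>

lemma wave_translate_mass_lower:
  fixes J :: "'n::finite set"
  assumes r: "0 < r" "r \<le> 1" and j0: "j0 \<in> J" and T: "0 \<le> T"
    and D: "\<And>j. 0 \<le> d j" "\<And>j. d j + \<bar>m $ j\<bar> \<le> D j"
    and conc: "\<And>t. \<bar>t\<bar> \<le> T \<Longrightarrow> \<mu> / 2 \<le> (LINT x|lborel. indicator {x. \<forall>j. \<bar>x $ j\<bar>
        \<le> d j} x * (cmod (wave J j0 r t x))\<^sup>2)"
  shows "T * \<mu> \<le> mass (restr (spacetime_box D T)) (\<lambda>p. wave J j0 r (snd p) (fst p - m))"
proof -
  let ?Y = "spacetime_box D T"
  let ?v = "\<lambda>p. wave J j0 r (snd p) (fst p - m)"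
  have D0: "0 \<le> D j" for j using D(1)[of j] D(2)[of j] abs_ge_zero[of "m $ j"] by linarith
  note Y = spacetime_box_sets[of D T, OF D0 T]
  have i: "integrable lborel (\<lambda>p. indicator ?Y p * (cmod (?v p))\<^sup>2)"
    by (rule sq_integrable_restr_bounded(2)[OF Y measurable_wave, where b=1]) (rule norm_wave_le_1[OF r j0])
  then have i': "integrable (lborel \<Otimes>\<^sub>M lborel) (\<lambda>(x, t). indicator ?Y (x, t)
      * (cmod (wave J j0 r t (x - m)))\<^sup>2)"
    unfolding lborel_prod by (simp add: case_prod_beta')
  let ?in = "\<lambda>t. LINT x|lborel. indicator ?Y (x, t) * (cmod (wave J j0 r t (x - m)))\<^sup>2"
  have "mass (restr ?Y) ?v = (LINT p|lborel. indicator ?Y p * (cmod (?v p))\<^sup>2)"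
    by (rule mass_restr[OF Y(1) measurable_wave])
  also have "\<dots> = integral\<^sup>L (lborel \<Otimes>\<^sub>M lborel) (\<lambda>(x, t). indicator ?Y (x, t)
      * (cmod (wave J j0 r t (x - m)))\<^sup>2)"
    unfolding lborel_prod by (simp add: case_prod_beta')
  also have "\<dots> = (LINT t|lborel. ?in t)"
    by (rule lborel_pair.integral_snd[OF i', symmetric])
  finally have e: "mass (restr ?Y) ?v = (LINT t|lborel. ?in t)" .
  have "T * \<mu> = (LINT t|lborel. \<mu> / 2 * indicator {- T..T} t)" using T by simp
  also have "\<dots> \<le> (LINT t|lborel. ?in t)"
  proof (rule integral_mono)
    show "integrable lborel (\<lambda>t. \<mu> / 2 * indicator {- T..T} t :: real)"
      using T by (intro integrable_mult_right integrable_real_indicator) (auto simp: emeasure_lborel_Icc_eq)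
    show "integrable lborel ?in" by (rule lborel_pair.integrable_snd[OF i'])
    fix t
    show "\<mu> / 2 * indicator {- T..T} t \<le> ?in t"
    proof (cases "\<bar>t\<bar> \<le> T")
      case True
      let ?B = "{x :: real ^ 'n. \<forall>j. \<bar>x $ j\<bar> \<le> d j}"
      let ?B' = "{x :: real ^ 'n. \<forall>j. \<bar>x $ j\<bar> \<le> D j}"
      have [measurable]: "?B \<in> sets borel" "?B' \<in> sets borel" by measurable
      note sq = wave_sq_integrable[OF r j0, of t]
      have i1: "integrable lborel (\<lambda>x. indicator ?B' x * (cmod (wave J j0 r t (x - m)))\<^sup>2)"
        by (intro sq_integrable_restr(2) sq_integrable_translate sq) simp
      have i2: "integrable lborel (\<lambda>x. indicator ?B' (x + m) * (cmod (wave J j0 r t x))\<^sup>2)"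
        using lborel_integrable_affine[OF i1, of 1 m] by (simp add: add.commute)
      have "\<mu> / 2 \<le> (LINT x|lborel. indicator ?B x * (cmod (wave J j0 r t x))\<^sup>2)" by (rule conc[OF True])
      also have "\<dots> \<le> (LINT x|lborel. indicator ?B' (x + m) * (cmod (wave J j0 r t x))\<^sup>2)"
      proof (rule integral_mono[OF _ i2])
        show "integrable lborel (\<lambda>x. indicator ?B x * (cmod (wave J j0 r t x))\<^sup>2)"
          by (intro sq_integrable_restr(2) sq) simp
        fix x :: "real ^ 'n"
        have "x + m \<in> ?B'" if "x \<in> ?B"
        proof -
          have "\<bar>(x + m) $ j\<bar> \<le> D j" for j
            using that D(2)[of j] abs_triangle_ineq[of "x $ j" "m $ j"] by (auto dest!: spec[of _ j])
          then show ?thesis by blast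
        qed
        then show "indicator ?B x * (cmod (wave J j0 r t x))\<^sup>2
            \<le> indicator ?B' (x + m) * (cmod (wave J j0 r t x))\<^sup>2"
          by (intro mult_right_mono) (auto simp: indicator_def)
      qed
      also have "\<dots> = (LINT x|lborel. indicator ?B' x * (cmod (wave J j0 r t (x - m)))\<^sup>2)"
        using lborel_integral_affine[OF i1, of 1 m] by (simp add: add.commute)
      also have "\<dots> = ?in t"
        using True by (intro Bochner_Integration.integral_cong) (auto simp: spacetime_box_def indicator_def)
      finally show ?thesis by (simp add: indicator_def abs_le_iff mult_nonneg_nonneg split: if_splits)
    next
      case False
      then have "t \<notin> {- T..T}" by auto
      then show ?thesis by simp
    qed
  qed
  finally show ?thesis unfolding e .
qed

lemma norm_lattice_sum_le:
  assumes "\<And>x. cmod (k x) \<le> 1"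
  shows "cmod (lattice_sum I A k x) \<le> real (card I)"
proof -
  have "cmod (lattice_sum I A k x) \<le> (\<Sum>m\<in>I. cmod (sgn_of A m * k (x - m)))"
    unfolding lattice_sum_def by (rule norm_sum)
  also have "\<dots> \<le> (\<Sum>m\<in>I. 1)" by (intro sum_mono) (simp add: norm_mult assms)
  finally show ?thesis by simp
qed

text \<open>The number \<open>exp 8\<close> comes from the lower bound \<open>exp (- 4)\<close> for \<open>bump\<close>, which enters squared.\<close>

definition focus_eta :: "nat \<Rightarrow> real" where
  "focus_eta n = 1 / sqrt (2 * real n * (2 * exp 8) ^ n)"

text \<open>The spacetime box has half-sides \<open>2 * focus_rho n * R\<close> along
  \<open>J\<close>. With this value they are \<open>R / (4 * n)\<close>, which places the spatial
  box within \<open>R / 4\<close> of the origin.\<close>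

definition focus_rho :: "nat \<Rightarrow> real" where
  "focus_rho n = 1 / (8 * real n)"

text \<open>For times up to \<open>focus_tau n * R\<close> the transport along \<open>J\<close> uses
  half of the allowance \<open>focus_eta n * focus_rho n * R\<close> in the Chebyshev bound; the
  other half is left for the initial width.\<close>

definition focus_tau :: "nat \<Rightarrow> real" where
  "focus_tau n = focus_rho n * focus_eta n / 2"

text \<open>Off \<open>J\<close>, transport and initial width are of the order
  \<open>sqrt R\<close>, with coefficients \<open>focus_tau n\<close> and \<open>E\<close>; division
  by \<open>focus_eta n\<close> gives the side that the Chebyshev bound demands.\<close>

definition focus_width :: "nat \<Rightarrow> real \<Rightarrow> real" where
  "focus_width n E = (focus_tau n + E) / focus_eta n"

text \<open>\<open>E\<close> is the derivative bound of the amplitude. The three conditions on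
  \<open>R\<close> say, in order, that \<open>E\<close> fits into its half of the allowance along
  \<open>J\<close>, that the lattice cube has side at least 1, and that the thin sides of the
  spacetime box fit into the ball.\<close>

locale focusing_system = packet_system S A K R N C C' J j0
  for S :: "('n::finite) wp_system" and A K R N C C' J j0 +
  fixes E :: real
  assumes E: "0 \<le> E" "\<And>j \<xi>. cmod (frechet_derivative (amp J j0 (R powr (-1/2))) (at \<xi>) (axis j 1))
      \<le> E / (if j \<in> J then 1 else R powr (-1/2))"
    and large: "2 * E \<le> focus_rho CARD('n) * focus_eta CARD('n) * R" "1 \<le> focus_rho CARD('n) * R"
      "4 * real CARD('n) * focus_width CARD('n) E \<le> sqrt R"
begin

text \<open>The factor 2 along \<open>J\<close> is for the spread of the wave and the position of
  the translate, each at most \<open>focus_rho CARD('n) * R\<close>. Off \<open>J\<close> the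
  lattice points have coordinate 0.\<close>

definition "width j = (if j \<in> J then 2 * focus_rho CARD('n) * R else focus_width CARD('n) E * sqrt R)"

definition "Y = spacetime_box width (focus_tau CARD('n) * R)"

definition "I = lat_ball J (focus_rho CARD('n) * R)"

definition "\<mu> = mass lborel (wave J j0 r 0)"

lemma n_pos: "1 \<le> real CARD('n)"
  by (simp add: Suc_leI)

lemma eta: "0 < focus_eta CARD('n)" "focus_eta CARD('n) \<le> 1" "(focus_eta CARD('n))\<^sup>2 * (2 * exp 8) ^ CARD('n)
    * real CARD('n) \<le> 1 / 2"
proof -
  let ?c = "2 * real CARD('n) * (2 * exp 8) ^ CARD('n)"
  have "1 \<le> (2 * exp (8::real)) ^ CARD('n)"
    by (intro one_le_power) (use exp_ge_add_one_self[of 8] in linarith)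
  moreover have "1 \<le> 2 * real CARD('n)" using n_pos by linarith
  ultimately have c: "1 * 1 \<le> ?c" by (intro mult_mono) linarith+
  show "0 < focus_eta CARD('n)" using c by (simp add: focus_eta_def)
  show "focus_eta CARD('n) \<le> 1" using c real_sqrt_ge_1_iff[of ?c] by (simp add: focus_eta_def)
  have "(focus_eta CARD('n))\<^sup>2 * ?c = 1" using c by (simp add: focus_eta_def power_divide)
  then show "(focus_eta CARD('n))\<^sup>2 * (2 * exp 8) ^ CARD('n) * real CARD('n) \<le> 1 / 2" by (simp add: mult_ac)
qed

lemma rho: "0 < focus_rho CARD('n)" "focus_rho CARD('n) \<le> 1 / 8"
  and tau: "0 < focus_tau CARD('n)" "focus_tau CARD('n) \<le> 1 / 16" and width0: "0 < focus_width CARD('n) E"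
proof -
  show r1: "0 < focus_rho CARD('n)" "focus_rho CARD('n) \<le> 1 / 8" using n_pos
    by (auto simp: focus_rho_def divide_simps)
  show t: "0 < focus_tau CARD('n)" using eta r1 by (simp add: focus_tau_def)
  have "focus_rho CARD('n) * focus_eta CARD('n) \<le> 1 / 8 * 1" using eta r1 by (intro mult_mono) auto
  then show "focus_tau CARD('n) \<le> 1 / 16" unfolding focus_tau_def by linarith
  show "0 < focus_width CARD('n) E" using t E eta by (simp add: focus_width_def)
qed

lemma R_pos: "0 < R" using R by linarith

lemma inverse_r: "1 / r = sqrt R" and R_times_r: "R * r = sqrt R"
proof -
  show i: "1 / r = sqrt R" using R_pos by (simp add: r_def powr_minus powr_half_sqrt divide_simps)
  have "R * r = R * r\<^sup>2 / r" using r by (simp add: power2_eq_square)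
  then show "R * r = sqrt R" using R_r i by simp
qed

lemma width_pos: "0 < width j"
  using R_pos rho width0 by (simp add: width_def)

lemma concentration:
  assumes "\<bar>t\<bar> \<le> focus_tau CARD('n) * R"
  shows "\<mu> / 2 \<le> (LINT x|lborel. indicator {x. \<forall>j. \<bar>x $ j\<bar>
      \<le> (if j \<in> J then focus_rho CARD('n) * R else focus_width CARD('n) E * sqrt R)} x
      * (cmod (wave J j0 r t x))\<^sup>2)"
proof -
  have "\<mu> = mass lborel (wave J j0 r t)"
    unfolding \<mu>_def mass_wave[OF r j0] ..
  moreover have "mass lborel (wave J j0 r t) / 2 \<le> (LINT x|lborel. indicator {x. \<forall>j. \<bar>x $ j\<bar>
      \<le> (if j \<in> J then focus_rho CARD('n) * R else focus_width CARD('n) E * sqrt R)} x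
      * (cmod (wave J j0 r t x))\<^sup>2)"
  proof (rule wave_concentration[OF r j0 E(2)[folded r_def] E(1) _ _ eta(3)])
    fix j
    show "0 < (if j \<in> J then focus_rho CARD('n) * R else focus_width CARD('n) E * sqrt R)"
      using R_pos rho width0 by simp
    show "\<bar>t\<bar> * (if j \<in> J then 1 else r) + E / (if j \<in> J then 1 else r)
        \<le> focus_eta CARD('n) * (if j \<in> J then focus_rho CARD('n) * R else focus_width CARD('n) E * sqrt R)"
    proof (cases "j \<in> J")
      case True
      have "\<bar>t\<bar> + E \<le> focus_tau CARD('n) * R + focus_rho CARD('n) * focus_eta CARD('n) * R / 2"
        using assms large(1) by linarith
      also have "\<dots> = focus_eta CARD('n) * (focus_rho CARD('n) * R)" by (simp add: focus_tau_def)
      finally show ?thesis using True by simp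
    next
      case False
      have "\<bar>t\<bar> * r + E / r \<le> focus_tau CARD('n) * R * r + E / r" using assms r
        by (intro add_right_mono mult_right_mono) auto
      also have "\<dots> = (focus_tau CARD('n) + E) * sqrt R"
        using inverse_r by (simp add: mult.assoc R_times_r distrib_right divide_inverse)
      also have "\<dots> = focus_eta CARD('n) * (focus_width CARD('n) E * sqrt R)"
        using eta by (simp add: focus_width_def)
      finally show ?thesis using False by simp
    qed
  qed
  ultimately show ?thesis by simp
qed

lemma Y_sets: "Y \<in> sets borel" "bounded Y"
  unfolding Y_def using width_pos tau R_pos by (intro spacetime_box_sets; simp add: less_imp_le)+

lemma measure_Y: "measure lborel Y = (2 * (2 * focus_rho CARD('n) * R)) ^ card J
    * (2 * (focus_width CARD('n) E * sqrt R)) ^ (CARD('n) - card J) * (2 * (focus_tau CARD('n) * R))"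
proof -
  have "measure lborel Y = (\<Prod>j\<in>UNIV. 2 * width j) * (2 * (focus_tau CARD('n) * R))"
    unfolding Y_def using width_pos tau R_pos by (intro measure_spacetime_box) (auto simp: less_imp_le)
  also have "(\<Prod>j\<in>UNIV. 2 * width j) = (\<Prod>j\<in>UNIV. if j \<in> J then 2 * (2 * focus_rho CARD('n) * R) else 2
      * (focus_width CARD('n) E * sqrt R))"
    by (intro prod.cong) (auto simp: width_def)
  also have "\<dots> = (\<Prod>j\<in>J. 2 * (2 * focus_rho CARD('n) * R)) * (\<Prod>j\<in>-J. 2 * (focus_width CARD('n) E * sqrt R))"
    by (subst prod.If_cases) auto
  finally show ?thesis by (simp add: Compl_eq_Diff_UNIV card_Diff_subset)
qed

lemma Y_subset_ball: "Y \<subseteq> ball 0 R"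
proof
  fix p assume p: "p \<in> Y"
  obtain x t where xt: "p = (x, t)" by (cases p)
  have t: "\<bar>t\<bar> \<le> focus_tau CARD('n) * R" and x: "\<bar>x $ j\<bar> \<le> width j" for j
    using p by (auto simp: Y_def spacetime_box_def xt)
  have "width j \<le> R / (4 * real CARD('n))" for j
  proof (cases "j \<in> J")
    case True
    then show ?thesis by (simp add: width_def focus_rho_def)
  next
    case False
    have "4 * real CARD('n) * focus_width CARD('n) E * sqrt R \<le> sqrt R * sqrt R"
      using large(3) R_pos by (intro mult_right_mono) auto
    then have "4 * real CARD('n) * (focus_width CARD('n) E * sqrt R) \<le> R" using R_pos by (simp add: mult.assoc)
    then show ?thesis using False by (simp add: width_def pos_le_divide_eq mult.commute)
  qed
  then have "\<bar>x $ j\<bar> \<le> R / (4 * real CARD('n))" for j using x[of j] order_trans by blast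
  then have "norm x \<le> real CARD('n) * (R / (4 * real CARD('n)))" by (rule cube_subset_ball)
  then have "norm x \<le> R / 4" by simp
  moreover have "focus_tau CARD('n) * R \<le> 1 / 16 * R" using tau R_pos by (intro mult_right_mono) auto
  ultimately have "norm x + \<bar>t\<bar> < R" using t R_pos by linarith
  moreover have "norm p \<le> norm x + norm t" unfolding xt by (rule norm_Pair_le)
  ultimately show "p \<in> ball 0 R" by simp
qed

lemma I_facts: "finite I" "I \<subseteq> lat J" "(focus_rho CARD('n) * R) ^ card J \<le> real (card I)" "real (card I)
    \<le> (9 * R) ^ CARD('n)"
proof -
  show f: "finite I" unfolding I_def by (rule finite_card_lat_ball(1)[OF j0 large(2)])
  show "I \<subseteq> lat J" unfolding I_def by (rule lat_ball_subset)
  show "(focus_rho CARD('n) * R) ^ card J \<le> real (card I)"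
    using card_lat_ball_lower[OF large(2) f[unfolded I_def]] by (simp add: I_def)
  have "real (card I) \<le> (9 * (focus_rho CARD('n) * R)) ^ CARD('n)"
    unfolding I_def by (rule finite_card_lat_ball(2)[OF j0 large(2)])
  also have "\<dots> \<le> (9 * R) ^ CARD('n)"
    using rho R_pos by (intro power_mono) (auto intro: mult_left_le_one_le)
  finally show "real (card I) \<le> (9 * R) ^ CARD('n)" .
qed

lemma card_I_pos: "1 \<le> real (card I)"
  using I_facts(3) one_le_power[OF large(2), of "card J"] by linarith

lemma mu_lower: "(exp (- 8) / (16 * pi * real CARD('n))) ^ CARD('n) * r ^ (CARD('n) - card J) \<le> \<mu>"
proof -
  have "(exp (- 8) / (16 * pi * real CARD('n))) ^ CARD('n) * r ^ (CARD('n) - card J)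
     = ((exp (- 8) / (8 * real CARD('n))) ^ CARD('n) * r ^ (CARD('n) - card J)) / (2 * pi) ^ CARD('n)"
  proof -
    have "exp (- 8) / (16 * pi * real CARD('n)) = exp (- 8) / (8 * real CARD('n)) / (2 * pi)" by simp
    then show ?thesis by (simp only: power_divide[of _ "2 * pi"]) simp
  qed
  also have "\<dots> \<le> \<mu>"
    unfolding \<mu>_def mass_wave[OF r j0] by (intro divide_right_mono amp_mass_lower[OF r j0]) auto
  finally show ?thesis .
qed

lemma mu_pos: "0 < \<mu>"
proof -
  have "0 < (exp (- 8) / (16 * pi * real CARD('n))) ^ CARD('n) * r ^ (CARD('n) - card J)"
    using n_pos r by (intro mult_pos_pos zero_less_power) auto
  then show ?thesis using mu_lower by linarith
qed

definition "energy A' = mass (restr Y) (\<lambda>p. lattice_sum I A' (wave J j0 r (snd p)) (fst p))"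

text \<open>Three averages over the signs are compared: the energy in the box from below, the total
  mass and the moment from above. The first is within the factor
  \<open>focus_tau CARD('n) * R\<close> of the second because every translate stays in the box for
  that long.\<close>

theorem exists_focusing_signs:
  obtains A' where "focus_tau CARD('n) * R * (real (card I) * \<mu>) / 2 \<le> energy A'"
    "mass lborel (lattice_sum I A' (wave J j0 r 0)) \<le> 4 / (focus_tau CARD('n) * R) * energy A'"
    "cosh_energy J D (lat_ball J (R\<^sup>2)) I piece A' \<le> 8 * (9 * R\<^sup>2) ^ CARD('n)
        * (measure lborel Y * real (card I) / (focus_tau CARD('n) * R * \<mu>))"
proof -
  let ?T = "focus_tau CARD('n) * R"
  let ?v = "\<lambda>m p. wave J j0 r (snd p) (fst p - m)"
  let ?Q = "lat_ball J (R\<^sup>2)"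
  have T: "0 < ?T" using tau R_pos by simp
  note sqY = sq_integrable_restr_bounded(1)[OF Y_sets measurable_wave norm_wave_le_1[OF r j0]]
  have eG: "(\<Sum>A\<in>Pow I. energy A) = 2 ^ card I * (\<Sum>m\<in>I. mass (restr Y) (?v m))"
    unfolding energy_def lattice_sum_def by (rule rademacher_mass[OF I_facts(1) sqY])
  have "(\<Sum>m\<in>I. ?T * \<mu>) \<le> (\<Sum>m\<in>I. mass (restr Y) (?v m))"
  proof (rule sum_mono)
    fix m assume m: "m \<in> I"
    show "?T * \<mu> \<le> mass (restr Y) (?v m)"
      unfolding Y_def
    proof (rule wave_translate_mass_lower[OF r j0 _ _ _ concentration])
      fix j
      show "0 \<le> (if j \<in> J then focus_rho CARD('n) * R else focus_width CARD('n) E * sqrt R)"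
        using rho R_pos width0 by simp
      show "(if j \<in> J then focus_rho CARD('n) * R else focus_width CARD('n) E * sqrt R) + \<bar>m $ j\<bar> \<le> width j"
      proof (cases "j \<in> J")
        case True
        then have "\<bar>m $ j\<bar> \<le> focus_rho CARD('n) * R" using m by (simp add: I_def lat_ball_def)
        then show ?thesis using True unfolding width_def by (simp only: if_True)
      next
        case False
        then have "m $ j = 0" using m I_facts(2) by (auto simp: lat_def)
        then show ?thesis using False by (simp add: width_def)
      qed
    qed (use T in auto)
  qed
  then have G: "2 ^ card I * (?T * (real (card I) * \<mu>)) \<le> (\<Sum>A\<in>Pow I. energy A)"
    unfolding eG by (simp add: mult_ac)
  have sq0: "sq_integrable lborel (\<lambda>x. wave J j0 r 0 (x - m))" for m
    by (rule sq_integrable_translate(1)[OF wave_sq_integrable[OF r j0]])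
  have "(\<Sum>A\<in>Pow I. mass lborel (lattice_sum I A (wave J j0 r 0)))
      = 2 ^ card I * (\<Sum>m\<in>I. mass lborel (\<lambda>x. wave J j0 r 0 (x - m)))"
    unfolding lattice_sum_def[abs_def] by (rule rademacher_mass[OF I_facts(1) sq0])
  also have "(\<Sum>m\<in>I. mass lborel (\<lambda>x. wave J j0 r 0 (x - m))) = real (card I) * \<mu>"
    by (simp add: sq_integrable_translate(2)[OF wave_sq_integrable[OF r j0]] \<mu>_def)
  finally have Nm: "(\<Sum>A\<in>Pow I. mass lborel (lattice_sum I A (wave J j0 r 0)))
      \<le> 2 ^ card I * (real (card I) * \<mu>)"
    by simp
  have R2: "1 \<le> R\<^sup>2" using R by (simp add: one_le_power)
  have "(\<Sum>A\<in>Pow I. cosh_energy J D ?Q I piece A)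
      \<le> 2 ^ card I * (exp (1 / 2) * real (card ?Q) * (\<Sum>\<theta>\<in>D. mass lborel (piece \<theta>)))"
    by (rule cosh_energy_average[OF I_facts(1,2) lat_ball_subset piece_sq_integrable])
  also have "\<dots> \<le> 2 ^ card I * (2 * (9 * R\<^sup>2) ^ CARD('n) * 1)"
  proof (intro mult_left_mono mult_mono finite_card_lat_ball(2)[OF j0 R2] sum_mass_piece_le)
    have "exp (1/2 :: real) \<le> 2"
    proof -
      have "(exp (1/2 :: real))\<^sup>2 = exp 1" by (simp add: exp_double[symmetric])
      also have "\<dots> \<le> 2\<^sup>2" using exp_le by simp
      finally show ?thesis by (rule power2_le_imp_le) simp
    qed
    then show "exp (1/2 :: real) \<le> 2" .
  qed (auto intro: sum_nonneg)
  finally have Ps: "(\<Sum>A\<in>Pow I. cosh_energy J D ?Q I piece A) \<le> 2 ^ card I * (2 * (9 * R\<^sup>2) ^ CARD('n))"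
    by simp
  have pos: "0 < ?T * (real (card I) * \<mu>)" "0 < real (card I) * \<mu>" "0 < 2 * (9 * R\<^sup>2) ^ CARD('n)"
    using T card_I_pos mu_pos R_pos by auto
  obtain A' where A': "A' \<subseteq> I" "?T * (real (card I) * \<mu>) / 2 \<le> energy A'"
    "mass lborel (lattice_sum I A' (wave J j0 r 0)) \<le> 4 * (real (card I) * \<mu>) / (?T * (real (card I) * \<mu>))
        * energy A'"
    "cosh_energy J D ?Q I piece A' \<le> 4 * (2 * (9 * R\<^sup>2) ^ CARD('n)) / (?T * (real (card I) * \<mu>)) * energy A'"
    using exists_good_signs[OF I_facts(1) G Nm Ps pos mass_nonneg cosh_energy_nonneg] by blast
  have e4: "4 * (real (card I) * \<mu>) / (?T * (real (card I) * \<mu>)) = 4 / ?T"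
    using card_I_pos mu_pos by simp
  \<comment> \<open>A crude upper bound turns the comparison of the moment with the energy into one
    free of the signs. The lost powers of \<open>R\<close> are harmless, since an exponential factor
    will beat them.\<close>
  have "energy A' \<le> (real (card I))\<^sup>2 * measure lborel Y"
    unfolding energy_def
  proof (rule sq_integrable_restr_bounded(3)[OF Y_sets])
    show "(\<lambda>p. lattice_sum I A' (wave J j0 r (snd p)) (fst p)) \<in> borel_measurable borel"
      unfolding lattice_sum_def by (intro borel_measurable_sum borel_measurable_times measurable_wave) simp
    show "cmod (lattice_sum I A' (wave J j0 r (snd p)) (fst p)) \<le> real (card I)" for p
      by (rule norm_lattice_sum_le[OF norm_wave_le_1[OF r j0]])
  qed
  then have "cosh_energy J D ?Q I piece A' \<le> 4 * (2 * (9 * R\<^sup>2) ^ CARD('n)) / (?T * (real (card I) * \<mu>))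
      * ((real (card I))\<^sup>2 * measure lborel Y)"
    using pos by (intro order_trans[OF A'(4)] mult_left_mono) auto
  also have "\<dots> = 8 * (9 * R\<^sup>2) ^ CARD('n) * (measure lborel Y * real (card I) / (focus_tau CARD('n) * R * \<mu>))"
  proof -
    have "4 * (2 * b) / (t * (i * u)) * (i\<^sup>2 * y) = 8 * b * (y * i / (t * u))" if "i \<noteq> 0" for b t i u y :: real
      using that by (simp add: power2_eq_square)
    then show ?thesis using card_I_pos by simp
  qed
  finally show ?thesis
    using A' e4 by (intro that[of A']) auto
qed

end

section \<open>The bounds for the example\<close>

text \<open>Hoelder's inequality on \<open>Y\<close> in a pointwise form with a height
  \<open>T\<close>, at which values below \<open>T\<close> contribute at most half of the mass on
  \<open>Y\<close>. The other half is carried by values above \<open>T\<close>.\<close>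

lemma Lp_norm_lower:
  fixes F :: "'a::euclidean_space \<Rightarrow> complex"
  assumes Y: "Y \<in> sets borel" "bounded Y" "Y \<subseteq> B" and B: "B \<in> sets borel" "bounded B"
    and F [measurable]: "F \<in> borel_measurable borel" and b: "\<And>x. cmod (F x) \<le> b"
    and p: "2 < p" and G: "0 < mass (restr Y) F" and mY: "0 < measure lborel Y"
  shows "(mass (restr Y) F / 2 * (mass (restr Y) F / (2 * measure lborel Y)) powr (p / 2 - 1)) powr (1 / p)
      \<le> Lp_norm p B F"
proof -
  note [measurable] = Y(1) B(1)
  define G where "G = mass (restr Y) F"
  define T where "T = sqrt (G / (2 * measure lborel Y))"
  have T: "0 < T" using assms by (simp add: T_def G_def)
  have T2: "T\<^sup>2 = G / (2 * measure lborel Y)" using T by (simp add: T_def)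
  have b0: "0 \<le> b" using order_trans[OF norm_ge_zero b] .
  have iB: "integrable lborel (\<lambda>x. indicator S x * cmod (F x) powr p)" if S: "S \<in> sets borel" "bounded S" for S
  proof (rule Bochner_Integration.integrable_bound)
    show "integrable lborel (\<lambda>x. b powr p * indicator S x :: real)"
      using S emeasure_bounded_finite[OF S(2)] by (intro integrable_mult_right integrable_real_indicator) auto
    show "AE x in lborel. norm (indicator S x * cmod (F x) powr p) \<le> norm (b powr p * indicator S x)"
      using p b by (auto simp: indicator_def intro!: powr_mono2)
  qed (use S in measurable)
  have iY: "integrable lborel (\<lambda>x. indicator Y x * (cmod (F x))\<^sup>2)"
    by (rule sq_integrable_restr_bounded(2)[OF Y(1,2) F b])
  have i1: "integrable lborel (\<lambda>x. T\<^sup>2 * indicator Y x :: real)"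
    using emeasure_bounded_finite[OF Y(2)] by (intro integrable_mult_right integrable_real_indicator) auto
  have pt: "u\<^sup>2 \<le> T\<^sup>2 + T powr (2 - p) * u powr p" if "0 \<le> u" for u
  proof (cases "u \<le> T")
    case True
    then have "u\<^sup>2 \<le> T\<^sup>2" using that by (intro power_mono) auto
    then show ?thesis by (simp add: add_increasing2)
  next
    case False
    then have u: "0 < u" "T \<le> u" using T by auto
    have "u\<^sup>2 = u powr (2 - p) * u powr p" using u by (simp add: powr_add[symmetric] powr_numeral)
    also have "\<dots> \<le> T powr (2 - p) * u powr p"
      using p T u by (intro mult_right_mono powr_mono2') auto
    finally show ?thesis by (simp add: add_increasing)
  qed
  have "G = (LINT x|lborel. indicator Y x * (cmod (F x))\<^sup>2)"
    unfolding G_def by (rule mass_restr[OF Y(1) F])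
  also have "\<dots> \<le> (LINT x|lborel. T\<^sup>2 * indicator Y x + T powr (2 - p) * (indicator Y x * cmod (F x) powr p))"
  proof (rule integral_mono[OF iY])
    show "integrable lborel (\<lambda>x. T\<^sup>2 * indicator Y x + T powr (2 - p) * (indicator Y x * cmod (F x) powr p))"
      by (intro Bochner_Integration.integrable_add i1 integrable_mult_right iB Y)
    show "indicator Y x * (cmod (F x))\<^sup>2 \<le> T\<^sup>2 * indicator Y x + T powr (2 - p)
        * (indicator Y x * cmod (F x) powr p)" for x
      using pt[of "cmod (F x)"] by (auto simp: indicator_def)
  qed
  also have "\<dots> = T\<^sup>2 * measure lborel Y + T powr (2 - p) * (LINT x|lborel. indicator Y x * cmod (F x) powr p)"
    by (subst Bochner_Integration.integral_add) (use i1 iB Y in \<open>auto intro!: integrable_mult_right\<close>)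
  also have "T\<^sup>2 * measure lborel Y = G / 2" unfolding T2 using mY by simp
  also have "(LINT x|lborel. indicator Y x * cmod (F x) powr p)
      \<le> (LINT x|lborel. indicator B x * cmod (F x) powr p)"
    using Y(3) by (intro integral_mono iB Y B) (auto simp: indicator_def)
  finally have "G / 2 \<le> T powr (2 - p) * (LINT x|lborel. indicator B x * cmod (F x) powr p)"
    using T by (simp add: mult_left_mono)
  then have "T powr (p - 2) * (G / 2) \<le> T powr (p - 2)
      * (T powr (2 - p) * (LINT x|lborel. indicator B x * cmod (F x) powr p))"
    by (rule mult_left_mono) simp
  also have "\<dots> = (LINT x|lborel. indicator B x * cmod (F x) powr p)"
    using T by (simp add: mult.assoc[symmetric] powr_add[symmetric])
  finally have "T powr (p - 2) * (G / 2) \<le> (LINT x|lborel. indicator B x * cmod (F x) powr p)" .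
  moreover have "T powr (p - 2) = (G / (2 * measure lborel Y)) powr (p / 2 - 1)"
  proof -
    have "T powr (p - 2) = (T powr 2) powr (p / 2 - 1)" by (simp add: powr_powr right_diff_distrib)
    also have "T powr 2 = G / (2 * measure lborel Y)" using T T2 by (simp add: powr_numeral)
    finally show ?thesis .
  qed
  ultimately have "G / 2 * (G / (2 * measure lborel Y)) powr (p / 2 - 1)
      \<le> (LINT x|lborel. indicator B x * cmod (F x) powr p)"
    by (simp add: mult.commute)
  then have "(G / 2 * (G / (2 * measure lborel Y)) powr (p / 2 - 1)) powr (1 / p)
      \<le> (LINT x|lborel. indicator B x * cmod (F x) powr p) powr (1 / p)"
    using assms(9,10) p by (intro powr_mono2) (auto simp: G_def intro!: mult_nonneg_nonneg)
  then show ?thesis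
    by (simp add: Lp_norm_def set_lebesgue_integral_def G_def)
qed

text \<open>A real supremum is informative only for nonempty bounded sets. Carrying both bounds
  makes the lemma applicable to each of the three nested suprema of
  \<open>wp_density\<close>.\<close>

lemma SUP_bounds:
  fixes f :: "'a \<Rightarrow> real"
  assumes "A \<noteq> {}" "\<And>x. x \<in> A \<Longrightarrow> 0 \<le> f x \<and> f x \<le> b"
  shows "0 \<le> (SUP x\<in>A. f x) \<and> (SUP x\<in>A. f x) \<le> b"
proof
  obtain a where a: "a \<in> A" using assms(1) by blast
  have "bdd_above (f ` A)" using assms(2) by (auto simp: bdd_above_def)
  then have "f a \<le> (SUP x\<in>A. f x)" using a by (intro cSUP_upper)
  then show "0 \<le> (SUP x\<in>A. f x)" using assms(2)[OF a] by linarith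
  show "(SUP x\<in>A. f x) \<le> b" using assms by (intro cSUP_least) auto
qed

definition error_const :: "nat \<Rightarrow> real \<Rightarrow> real" where
  "error_const n c = 512 * 81 ^ n * (16 * pi * real n * exp 8) ^ n + \<bar>c\<bar> * 81 ^ n"

text \<open>The factor \<open>3 * n ^ n\<close> comes from the volume of \<open>V\<close>, and
  \<open>144 * n\<^sup>2 / \<epsilon>\<^sup>2\<close> from bounding the square of the threshold
  \<open>12 * n * ln R\<close> by a power of \<open>R\<close>.\<close>

definition density_const :: "nat \<Rightarrow> real \<Rightarrow> real \<Rightarrow> real \<Rightarrow> real" where
  "density_const n H \<epsilon> c = 3 * real n ^ n * (144 * (real n)\<^sup>2 / \<epsilon>\<^sup>2 * geo_const n H + error_const n c)"

context focusing_system
begin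

text \<open>The exponent \<open>5 * n\<close> collects \<open>2 * n\<close> from the number of slabs
  and \<open>n\<close> each from the spatial volume of \<open>Y\<close>, from the number of
  translates and from \<open>1 / \<mu>\<close>.\<close>

lemma cosh_energy_poly:
  assumes "cosh_energy J D (lat_ball J (R\<^sup>2)) I piece A' \<le> 8 * (9 * R\<^sup>2) ^ CARD('n)
      * (measure lborel Y * real (card I) / (focus_tau CARD('n) * R * \<mu>))"
  shows "cosh_energy J D (lat_ball J (R\<^sup>2)) I piece A'
      \<le> 16 * 81 ^ CARD('n) * (16 * pi * real CARD('n) * exp 8) ^ CARD('n) * R ^ (5 * CARD('n))"
proof -
  let ?n = "CARD('n)"
  let ?c = "(16 * pi * real ?n * exp 8) ^ ?n"
  have kn: "card J \<le> ?n" using card_mono[of UNIV J] by simp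
  have w: "2 * (2 * focus_rho ?n * R) \<le> R" "2 * (focus_width ?n E * sqrt R) \<le> R"
  proof -
    have "focus_rho ?n * R \<le> 1 / 8 * R" using rho R_pos by (intro mult_right_mono) auto
    then show "2 * (2 * focus_rho ?n * R) \<le> R" using R_pos by linarith
    have "2 * focus_width ?n E \<le> 4 * real ?n * focus_width ?n E"
    proof (rule mult_right_mono)
      show "2 \<le> 4 * real ?n" using n_pos by linarith
    qed (use width0 in simp)
    then have "2 * focus_width ?n E * sqrt R \<le> sqrt R * sqrt R"
      using large(3) R_pos by (intro mult_right_mono) auto
    then show "2 * (focus_width ?n E * sqrt R) \<le> R" using R_pos by (simp add: mult.assoc)
  qed
  have mY: "measure lborel Y \<le> R ^ ?n * (2 * (focus_tau ?n * R))"
  proof -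
    have "measure lborel Y \<le> R ^ card J * R ^ (?n - card J) * (2 * (focus_tau ?n * R))"
      unfolding measure_Y using w rho tau width0 R_pos
      by (intro mult_mono power_mono mult_nonneg_nonneg) auto
    then show ?thesis using kn by (simp add: power_add[symmetric])
  qed
  have mu: "1 / \<mu> \<le> ?c * R ^ ?n"
  proof -
    have "1 / (?c * R ^ ?n) \<le> (exp (- 8) / (16 * pi * real ?n)) ^ ?n * r ^ (?n - card J)"
    proof -
      have "1 / R ^ ?n \<le> r ^ (?n - card J)"
      proof -
        have "1 / R = r\<^sup>2" using R_r R_pos by (simp add: field_simps)
        then have "1 / R ^ ?n = r ^ (2 * ?n)" by (simp add: power_mult power_one_over[symmetric])
        also have "\<dots> \<le> r ^ (?n - card J)" using r by (intro power_decreasing) auto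
        finally show ?thesis .
      qed
      moreover have "1 / ?c = (exp (- 8) / (16 * pi * real ?n)) ^ ?n"
        by (simp add: power_one_over[symmetric] exp_minus field_simps)
      ultimately have "1 / ?c * (1 / R ^ ?n) \<le> (exp (- 8) / (16 * pi * real ?n)) ^ ?n * r ^ (?n - card J)"
        by (simp only:) (intro mult_left_mono; simp)
      then show ?thesis by simp
    qed
    also have "\<dots> \<le> \<mu>" by (rule mu_lower)
    finally have "1 / (?c * R ^ ?n) \<le> \<mu>" .
    moreover have "0 < ?c * R ^ ?n" using n_pos R_pos by (intro mult_pos_pos zero_less_power) auto
    ultimately show ?thesis using mu_pos by (simp add: field_simps)
  qed
  have tp: "0 < focus_tau ?n * R" using tau R_pos by simp
  have "measure lborel Y * real (card I) / (focus_tau ?n * R * \<mu>) = measure lborel Y / (focus_tau ?n * R)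
      * real (card I) * (1 / \<mu>)"
    by simp
  also have "\<dots> \<le> (R ^ ?n * 2) * (9 * R) ^ ?n * (?c * R ^ ?n)"
  proof (intro mult_mono mu I_facts(4))
    show "measure lborel Y / (focus_tau ?n * R) \<le> R ^ ?n * 2"
      using mY tp by (simp add: pos_divide_le_eq mult_ac)
  qed (use tp mu_pos R_pos n_pos in auto)
  finally have "8 * (9 * R\<^sup>2) ^ ?n * (measure lborel Y * real (card I) / (focus_tau ?n * R * \<mu>))
     \<le> 8 * (9 * R\<^sup>2) ^ ?n * ((R ^ ?n * 2) * (9 * R) ^ ?n * (?c * R ^ ?n))"
    using R_pos by (intro mult_left_mono) auto
  also have "\<dots> = 16 * 81 ^ ?n * ?c * R ^ (5 * ?n)"
  proof -
    have "(81::real) ^ ?n = 9 ^ ?n * 9 ^ ?n" by (simp add: power_mult_distrib[symmetric])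
    moreover have "R ^ (5 * ?n) = (R\<^sup>2) ^ ?n * R ^ ?n * R ^ ?n * R ^ ?n"
      by (simp add: power_mult[symmetric] power_add[symmetric])
    ultimately show ?thesis by (simp add: power_mult_distrib mult_ac)
  qed
  finally show ?thesis using assms by linarith
qed

text \<open>After division by the volume of \<open>V\<close> the remaining power of \<open>s\<close>
  has exponent \<open>2 * card J - n - 1\<close>, which is at most 0 by the first assumption, so
  \<open>s = r\<close> is the worst case and the bound no longer depends on the scale.\<close>

theorem local_density_power_bound:
  assumes k: "2 * card J \<le> CARD('n) + 1"
    and g: "fourier g = (\<lambda>\<xi>. trig I A' \<xi> * amp J j0 r \<xi>)"
    and Psi: "cosh_energy J D (lat_ball J (R\<^sup>2)) I piece A' \<le> 8 * (9 * R\<^sup>2) ^ CARD('n)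
        * (measure lborel Y * real (card I) / (focus_tau CARD('n) * R * \<mu>))"
    and s: "r \<le> s" "s \<le> 1" and w: "\<omega> \<in> dirs S s" and d: "\<delta> \<le> 1 / 2"
    and bigR: "3 + 2 * real CARD('n) \<le> R"
    and e: "0 < \<epsilon>" "\<epsilon> \<le> 1 / 2" and M: "3 * real CARD('n) \<le> \<epsilon> * real M"
  shows "(local_density A \<delta> S R g s \<omega> a)\<^sup>2 \<le> density_const CARD('n) (1 + K + A) \<epsilon> (C' M) *
    R powr (\<epsilon> * (real CARD('n) + 2)) * (R ^ card J * r ^ (card J - 1) / R ^ CARD('n))"
proof -
  let ?n = "CARD('n)"
  let ?k = "card J"
  let ?geo = "geo_const ?n (1 + K + A)"
  let ?c = "(16 * pi * real ?n * exp 8) ^ ?n"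
  let ?V = "measure lborel ((+) a ` V_box (frame S s \<omega>) \<omega> s R)"
  \<comment> \<open>A dilation of size \<open>R powr \<epsilon>\<close> lets rapid decay of order
    \<open>M\<close> gain \<open>R ^ (3 * n)\<close>, against at most \<open>R ^ (2 * n)\<close>
    from the number of translates squared, up to constants.\<close>
  define l where "l = R powr \<epsilon>"
  \<comment> \<open>The coefficient gives \<open>exp (- L / 2) = 1 / R ^ (6 * n)\<close>, one power
    \<open>R ^ n\<close> better than the bound for the moment.\<close>
  define L where "L = 12 * real ?n * ln R"
  define X where "X = R ^ ?k * r ^ (?k - 1) / R ^ ?n"
  have "0 < ?k" using j0 by (auto simp: card_gt_0_iff)
  then have k1: "1 \<le> ?k" by simp
  have kn: "?k \<le> ?n" using card_mono[of UNIV J] by simp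
  have s0: "0 < s" using r s by linarith
  have l: "1 \<le> l" "l \<le> sqrt R"
  proof -
    show "1 \<le> l" unfolding l_def using R e by (simp add: ge_one_powr_ge_zero)
    have "R powr \<epsilon> \<le> R powr (1 / 2)" using R e by (intro powr_mono) auto
    then show "l \<le> sqrt R" using R_pos by (simp add: l_def powr_half_sqrt)
  qed
  have lnR: "0 \<le> ln R" using R by simp
  have L: "0 \<le> L" using lnR by (simp add: L_def)
  have geo0: "0 \<le> ?geo" using A K by (simp add: geo_const_def)
  have bound: "(local_density A \<delta> S R g s \<omega> a)\<^sup>2 \<le> 1 / ?V *
    (L\<^sup>2 * (?geo * (l * R) ^ ?k * s ^ (2 * ?k) * r ^ (?n - ?k))
     + 32 * exp (- L / 2) * cosh_energy J D (lat_ball J (R\<^sup>2)) I piece A'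
     + \<bar>C' M\<bar> / l ^ M * (real (card I))\<^sup>2)"
    by (rule local_density_le[OF g I_facts(1,2) s w l L d bigR])
  have fr: "is_frame (frame S s \<omega>) \<omega>" using frame_s s w by auto
  have V: "(R * s / real ?n) ^ ?n * s / 3 \<le> ?V"
    by (rule measure_V_box_lower[OF fr R_pos s0 s(2)])
  have Vl: "R ^ ?n * s ^ (?n + 1) / (3 * real ?n ^ ?n) \<le> ?V"
    using V by (simp add: power_divide power_mult_distrib mult_ac)
  have Vp: "0 < R ^ ?n * s ^ (?n + 1) / (3 * real ?n ^ ?n)" using R_pos s0 n_pos by auto
  have iV: "1 / ?V \<le> 3 * real ?n ^ ?n / (R ^ ?n * s ^ (?n + 1))"
  proof -
    have "1 / ?V \<le> 1 / (R ^ ?n * s ^ (?n + 1) / (3 * real ?n ^ ?n))"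
      by (rule divide_left_mono[OF Vl _ mult_pos_pos[OF less_le_trans[OF Vp Vl] Vp]]) simp
    then show ?thesis by simp
  qed
  have expL: "exp (- L / 2) = 1 / R ^ (6 * ?n)"
  proof -
    have "- L / 2 = - (real (6 * ?n) * ln R)" by (simp add: L_def)
    then have "exp (- L / 2) = 1 / exp (real (6 * ?n) * ln R)" by (simp only: exp_minus inverse_eq_divide)
    also have "exp (real (6 * ?n) * ln R) = R ^ (6 * ?n)" unfolding exp_of_nat_mult using R_pos by simp
    finally show ?thesis .
  qed
  have err1: "32 * exp (- L / 2) * cosh_energy J D (lat_ball J (R\<^sup>2)) I piece A' \<le> 512 * 81 ^ ?n * ?c / R ^ ?n"
  proof -
    have "32 * exp (- L / 2) * cosh_energy J D (lat_ball J (R\<^sup>2)) I piece A'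
        \<le> 32 * exp (- L / 2) * (16 * 81 ^ ?n * ?c * R ^ (5 * ?n))"
      by (intro mult_left_mono cosh_energy_poly Psi) auto
    also have "\<dots> = 512 * 81 ^ ?n * ?c * (R ^ (5 * ?n) / R ^ (6 * ?n))"
      unfolding expL by simp
    also have "R ^ (5 * ?n) / R ^ (6 * ?n) = 1 / R ^ ?n"
    proof -
      have "R ^ (6 * ?n) = R ^ (5 * ?n) * R ^ ?n" by (simp add: power_add[symmetric])
      then show ?thesis using R_pos by simp
    qed
    finally show ?thesis by simp
  qed
  have err2: "\<bar>C' M\<bar> / l ^ M * (real (card I))\<^sup>2 \<le> \<bar>C' M\<bar> * 81 ^ ?n / R ^ ?n"
  proof -
    have "R ^ (3 * ?n) \<le> l ^ M"
    proof -
      have "R ^ (3 * ?n) = R powr (real (3 * ?n))" using R_pos by (simp add: powr_realpow del: of_nat_mult)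
      also have "\<dots> \<le> R powr (\<epsilon> * real M)" using R M by (intro powr_mono) auto
      also have "\<dots> = l ^ M" unfolding l_def using R_pos by (simp add: powr_power mult.commute)
      finally show ?thesis .
    qed
    moreover have "(real (card I))\<^sup>2 \<le> 81 ^ ?n * R ^ (2 * ?n)"
    proof -
      have "(real (card I))\<^sup>2 \<le> ((9 * R) ^ ?n)\<^sup>2" using I_facts(4) by (intro power_mono) auto
      also have "\<dots> = (9\<^sup>2) ^ ?n * (R ^ (2 * ?n))"
        by (simp only: power_mult_distrib power_mult[symmetric] mult.commute)
      finally show ?thesis by simp
    qed
    ultimately have "\<bar>C' M\<bar> / l ^ M * (real (card I))\<^sup>2 \<le> \<bar>C' M\<bar> / R ^ (3 * ?n) * (81 ^ ?n * R ^ (2 * ?n))"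
      using R_pos by (intro mult_mono frac_le) auto
    also have "\<dots> = \<bar>C' M\<bar> * 81 ^ ?n * (R ^ (2 * ?n) / R ^ (3 * ?n))" by simp
    also have "R ^ (2 * ?n) / R ^ (3 * ?n) = 1 / R ^ ?n"
    proof -
      have "R ^ (3 * ?n) = R ^ (2 * ?n) * R ^ ?n" by (simp add: power_add[symmetric])
      then show ?thesis using R_pos by simp
    qed
    finally show ?thesis by simp
  qed
  \<comment> \<open>Both error terms are of size \<open>1 / R ^ n\<close>; this absorbs them into
    the main term.\<close>
  have RX: "1 / R ^ ?n \<le> X"
  proof -
    have "1 \<le> R ^ ?k * r ^ (?k - 1)"
    proof -
      have "?k = Suc (?k - 1)" using k1 by simp
      then have Rk: "R ^ ?k = R * R ^ (?k - 1)" by (metis power_Suc)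
      have "R ^ ?k * r ^ (?k - 1) = R * (R * r) ^ (?k - 1)"
        unfolding Rk power_mult_distrib by (simp only: mult.assoc)
      also have "1 * 1 \<le> R * (R * r) ^ (?k - 1)"
        unfolding R_times_r using R by (intro mult_mono one_le_power) auto
      finally show ?thesis by simp
    qed
    then show ?thesis unfolding X_def using R_pos by (intro divide_right_mono) auto
  qed
  have X0: "0 < X" unfolding X_def using R_pos r by simp
  have Rs: "1 \<le> R ^ ?n * s ^ (?n + 1)"
  proof -
    have "1 \<le> R * s" using R_r r s mult_mono[of "R * r" "R * s" r 1] R_pos
      by (simp add: power2_eq_square mult.assoc mult_left_mono)
    have "1 \<le> R * s\<^sup>2"
    proof -
      have "R * r\<^sup>2 \<le> R * s\<^sup>2" using R_pos r s by (intro mult_left_mono power_mono) auto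
      then show ?thesis by (simp add: R_r)
    qed
    have n1: "?n = ?n - 1 + 1" "?n + 1 = ?n - 1 + 2" by (simp_all add: Suc_leI)
    have "R ^ ?n = R ^ (?n - 1) * R" "s ^ (?n + 1) = s ^ (?n - 1) * s\<^sup>2"
      by (subst n1(1), simp only: power_add power_one_right, subst n1(2), simp only: power_add)
    then have "R ^ ?n * s ^ (?n + 1) = (R * s) ^ (?n - 1) * (R * s\<^sup>2)"
      by (simp only: power_mult_distrib mult_ac)
    moreover have "1 * 1 \<le> (R * s) ^ (?n - 1) * (R * s\<^sup>2)"
      using \<open>1 \<le> R * s\<close> \<open>1 \<le> R * s\<^sup>2\<close> by (intro mult_mono one_le_power) auto
    ultimately show ?thesis by simp
  qed
  have main: "(l * R) ^ ?k * s ^ (2 * ?k) * r ^ (?n - ?k) / (R ^ ?n * s ^ (?n + 1)) \<le> l ^ ?k * X"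
  proof -
    \<comment> \<open>The subtraction is exact by the assumption on \<open>card J\<close>. What
      remains of the scale is \<open>1 / s ^ e\<close>.\<close>
    define e where "e = ?n + 1 - 2 * ?k"
    have e1: "?n + 1 = 2 * ?k + e" using k by (simp add: e_def)
    have "s ^ (2 * ?k) / s ^ (?n + 1) = 1 / s ^ e" unfolding e1 using s0 by (simp add: power_add)
    also have "\<dots> \<le> 1 / r ^ e" using r s by (intro divide_left_mono power_mono mult_pos_pos zero_less_power s0) auto
    finally have se: "s ^ (2 * ?k) / s ^ (?n + 1) \<le> 1 / r ^ e" .
    have "(l * R) ^ ?k * s ^ (2 * ?k) * r ^ (?n - ?k) / (R ^ ?n * s ^ (?n + 1))
       = (l ^ ?k * R ^ ?k * r ^ (?n - ?k) / R ^ ?n) * (s ^ (2 * ?k) / s ^ (?n + 1))"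
      by (simp add: power_mult_distrib)
    also have "\<dots> \<le> (l ^ ?k * R ^ ?k * r ^ (?n - ?k) / R ^ ?n) * (1 / r ^ e)"
      using l R_pos r by (intro mult_left_mono se) auto
    also have "\<dots> = l ^ ?k * (R ^ ?k * (r ^ (?n - ?k) / r ^ e) / R ^ ?n)" by (simp add: mult_ac)
    also have "r ^ (?n - ?k) / r ^ e = r ^ (?k - 1)"
    proof -
      have "?n - ?k = (?k - 1) + e" using k k1 kn by (simp add: e_def)
      then show ?thesis using r by (simp add: power_add)
    qed
    finally show ?thesis by (simp add: X_def)
  qed
  have "(local_density A \<delta> S R g s \<omega> a)\<^sup>2 \<le> 3 * real ?n ^ ?n / (R ^ ?n * s ^ (?n + 1)) *
    (L\<^sup>2 * (?geo * (l * R) ^ ?k * s ^ (2 * ?k) * r ^ (?n - ?k))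
     + 512 * 81 ^ ?n * ?c / R ^ ?n + \<bar>C' M\<bar> * 81 ^ ?n / R ^ ?n)"
    using geo0 l R_pos s0 r
    by (intro order_trans[OF bound] mult_mono iV add_mono err1 err2 order_refl) (auto intro!: add_nonneg_nonneg mult_nonneg_nonneg)
  also have "\<dots> = 3 * real ?n ^ ?n * (L\<^sup>2 * ?geo * ((l * R) ^ ?k * s ^ (2 * ?k)
      * r ^ (?n - ?k) / (R ^ ?n * s ^ (?n + 1)))
     + error_const ?n (C' M) * (1 / R ^ ?n) * (1 / (R ^ ?n * s ^ (?n + 1))))"
    by (simp add: error_const_def add_divide_distrib algebra_simps)
  also have "\<dots> \<le> 3 * real ?n ^ ?n * ((12 * real ?n / \<epsilon>)\<^sup>2 * R powr (2 * \<epsilon>) * ?geo * (R powr (\<epsilon> * real ?n) * X)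
      + error_const ?n (C' M) * X * 1)"
  proof (intro mult_left_mono add_mono)
    have "L \<le> 12 * real ?n / \<epsilon> * R powr \<epsilon>"
      using mult_left_mono[OF ln_powr_bound[OF R e(1)], of "12 * real ?n"] by (simp add: L_def)
    then have "L\<^sup>2 \<le> (12 * real ?n / \<epsilon> * R powr \<epsilon>)\<^sup>2" using L by (intro power_mono)
    also have "\<dots> = (12 * real ?n / \<epsilon>)\<^sup>2 * R powr (2 * \<epsilon>)"
    proof -
      have "(R powr \<epsilon>)\<^sup>2 = R powr (2 * \<epsilon>)" using R_pos by (simp add: powr_power mult.commute)
      then show ?thesis by (simp only: power_mult_distrib)
    qed
    finally have L2: "L\<^sup>2 \<le> (12 * real ?n / \<epsilon>)\<^sup>2 * R powr (2 * \<epsilon>)" .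
    have "l ^ ?k = R powr (\<epsilon> * real ?k)" unfolding l_def using R_pos by (simp add: powr_power mult.commute)
    also have "\<dots> \<le> R powr (\<epsilon> * real ?n)" using R e kn by (intro powr_mono mult_left_mono) auto
    finally have lk: "l ^ ?k \<le> R powr (\<epsilon> * real ?n)" .
    have "(l * R) ^ ?k * s ^ (2 * ?k) * r ^ (?n - ?k) / (R ^ ?n * s ^ (?n + 1)) \<le> R powr (\<epsilon> * real ?n) * X"
      by (rule order_trans[OF main]) (use lk X0 in \<open>simp add: mult_right_mono\<close>)
    then show "L\<^sup>2 * ?geo * ((l * R) ^ ?k * s ^ (2 * ?k) * r ^ (?n - ?k) / (R ^ ?n * s ^ (?n + 1)))
       \<le> (12 * real ?n / \<epsilon>)\<^sup>2 * R powr (2 * \<epsilon>) * ?geo * (R powr (\<epsilon> * real ?n) * X)"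
      using L2 geo0 l R_pos s0 r by (intro mult_mono) auto
    have ec: "0 \<le> error_const ?n (C' M)" by (simp add: error_const_def)
    show "error_const ?n (C' M) * (1 / R ^ ?n) * (1 / (R ^ ?n * s ^ (?n + 1))) \<le> error_const ?n (C' M) * X * 1"
      using ec RX X0 Rs R_pos s0 by (intro mult_mono) auto
  qed simp
  also have "\<dots> \<le> 3 * real ?n ^ ?n * ((12 * real ?n / \<epsilon>)\<^sup>2 * ?geo * (R powr (\<epsilon> * (real ?n + 2)) * X)
      + error_const ?n (C' M) * (R powr (\<epsilon> * (real ?n + 2)) * X))"
  proof (intro mult_left_mono add_mono)
    have split: "R powr (\<epsilon> * (real ?n + 2)) = R powr (2 * \<epsilon>) * R powr (\<epsilon> * real ?n)"
      by (simp add: powr_add[symmetric] algebra_simps)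
    show "(12 * real ?n / \<epsilon>)\<^sup>2 * R powr (2 * \<epsilon>) * ?geo * (R powr (\<epsilon> * real ?n) * X)
      \<le> (12 * real ?n / \<epsilon>)\<^sup>2 * ?geo * (R powr (\<epsilon> * (real ?n + 2)) * X)"
      unfolding split by (simp only: mult_ac order_refl)
    have "1 \<le> R powr (\<epsilon> * (real ?n + 2))" using R e by (intro ge_one_powr_ge_zero) auto
    then have "1 * X \<le> R powr (\<epsilon> * (real ?n + 2)) * X" using X0 by (intro mult_right_mono) auto
    then show "error_const ?n (C' M) * X * 1 \<le> error_const ?n (C' M) * (R powr (\<epsilon> * (real ?n + 2)) * X)"
      by (simp add: mult_left_mono error_const_def)
  qed simp
  also have "\<dots> = density_const ?n (1 + K + A) \<epsilon> (C' M) * R powr (\<epsilon> * (real ?n + 2)) * X"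
    by (simp add: density_const_def power_divide power_mult_distrib algebra_simps)
  finally show ?thesis by (simp add: X_def)
qed

end

section \<open>Comparison of the two bounds\<close>

lemma geo_const_pos: "1 \<le> n \<Longrightarrow> 1 \<le> H \<Longrightarrow> 0 < geo_const n H"
  by (simp add: geo_const_def)

lemma density_const_pos:
  assumes "1 \<le> n" "1 \<le> H" "0 < \<epsilon>"
  shows "0 < density_const n H \<epsilon> c"
proof -
  have "0 \<le> error_const n c" by (simp add: error_const_def)
  then have "0 < 144 * (real n)\<^sup>2 / \<epsilon>\<^sup>2 * geo_const n H + error_const n c"
    using assms geo_const_pos[OF assms(1,2)] by (intro add_pos_nonneg) auto
  then show ?thesis using assms by (simp add: density_const_def)
qed

text \<open>Chosen to cancel in the \<open>p\<close>-th power: \<tau>/8 against the factor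
  \<open>4 / \<tau>\<close> of the mass bound leaves the 1/2 of \<open>Lp_norm_lower\<close>, and
  the quotient exchanges the density constant \<open>c7\<close> for the height constant
  \<open>c6\<close>.\<close>

definition final_const :: "real \<Rightarrow> real \<Rightarrow> real \<Rightarrow> real \<Rightarrow> real" where
  "final_const \<tau> c6 c7 p = (\<tau> / 8 * (c6 / c7) powr (p / 2 - 1)) powr (1 / p)"

text \<open>After taking \<open>p\<close>-th powers both sides are linear in the energy
  \<open>G\<close>. The mass bound contributes \<open>R\<close> to the power -1, the density and the
  height contribute their exponents times \<open>q = p / 2 - 1\<close>, and \<open>ex\<close> is the
  resulting inequality between exponents of \<open>R\<close>.\<close>

lemma exponent_bookkeeping:
  fixes n k :: nat
  assumes R: "1 \<le> R" and p: "2 < p" and kn: "k \<le> n" and G: "0 < G" and N: "0 \<le> N" and W: "0 \<le> W"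
    and pos: "0 < \<tau>" "0 < c6" "0 < c7"
    and h1: "c6 / R ^ (n - k) \<le> g" and h2: "N \<le> 4 / (\<tau> * R) * G"
    and h3: "W\<^sup>2 \<le> c7 * R powr e1 * R powr ((real k + 1) / 2 - real n)"
    and ex: "(p / 2 - 1) * (2 * real n - real k - 1) / 2 + p * e + (p / 2 - 1) * e1 \<le> 1"
  shows "final_const \<tau> c6 c7 p * R powr ((real n - 1) * (1 / 2 - 1 / p) + e) * sqrt N powr (2 / p)
      * W powr (1 - 2 / p)
     \<le> (G / 2 * g powr (p / 2 - 1)) powr (1 / p)"
proof -
  define q where "q = p / 2 - 1"
  define x where "x = (real k + 1) / 2 - real n"
  have q: "0 < q" using p by (simp add: q_def)
  have R0: "0 < R" using R by simp
  let ?E = "(real n - 1) * (1 / 2 - 1 / p) + e"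
  have N1: "sqrt N powr (2 / p) = N powr (1 / p)"
    using N by (simp add: powr_half_sqrt[symmetric] powr_powr)
  have W1: "W powr (1 - 2 / p) \<le> (c7 * R powr e1 * R powr x) powr (q / p)"
  proof -
    have "W powr (1 - 2 / p) = (W powr 2) powr (q / p)"
    proof -
      have "1 - 2 / p = 2 * (q / p)" using p by (simp add: q_def field_simps)
      then show ?thesis by (simp only: powr_powr)
    qed
    also have "W powr 2 = W\<^sup>2" using W by (simp add: powr_numeral)
    also have "(W\<^sup>2) powr (q / p) \<le> (c7 * R powr e1 * R powr x) powr (q / p)"
      using h3 q p by (intro powr_mono2) (auto simp: x_def)
    finally show ?thesis .
  qed
  have RE: "R powr ?E = (R powr (p * ?E)) powr (1 / p)"
    using p by (simp add: powr_powr)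
  have Wq: "(c7 * R powr e1 * R powr x) powr (q / p) = ((c7 * R powr e1 * R powr x) powr q) powr (1 / p)"
    by (simp add: powr_powr)
  have "final_const \<tau> c6 c7 p * R powr ?E * sqrt N powr (2 / p) * W powr (1 - 2 / p)
     \<le> final_const \<tau> c6 c7 p * R powr ?E * sqrt N powr (2 / p) * (c7 * R powr e1 * R powr x) powr (q / p)"
    by (intro mult_left_mono W1) (simp add: final_const_def)
  also have "\<dots> = (\<tau> / 8 * (c6 / c7) powr q * R powr (p * ?E) * N
      * (c7 * R powr e1 * R powr x) powr q) powr (1 / p)"
  proof -
    have pm: "(a * b * N * d) powr (1 / p) = a powr (1 / p) * b powr (1 / p) * N powr (1 / p) * d powr (1 / p)"
      if "0 \<le> a" "0 \<le> b" "0 \<le> d" for a b d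
      using that N by (simp add: powr_mult)
    then show ?thesis
      unfolding N1 RE Wq final_const_def q_def[symmetric] by (intro pm[symmetric]) (use pos in auto)
  qed
  also have "\<dots> \<le> (G / 2 * g powr q) powr (1 / p)"
  proof (rule powr_mono2)
    have g: "c6 powr q * R powr (- (real n - real k) * q) \<le> g powr q"
    proof -
      have "R ^ (n - k) = R powr (real n - real k)"
        using R0 kn by (simp add: powr_realpow[symmetric] of_nat_diff)
      then have "c6 / R ^ (n - k) = c6 * R powr (- (real n - real k))"
        by (simp only: powr_minus divide_inverse)
      then have "(c6 * R powr (- (real n - real k))) powr q \<le> g powr q"
        using h1 pos q by (intro powr_mono2) auto
      then show ?thesis using pos by (simp add: powr_mult powr_powr)
    qed
    have exps: "p * ?E + (e1 + x) * q - 1 \<le> - (real n - real k) * q"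
    proof -
      have "p * ?E = (real n - 1) * q + p * e" using p by (simp add: q_def field_simps)
      moreover have "q * (2 * real n - real k - 1) / 2 + p * e + q * e1 \<le> 1" using ex by (simp add: q_def)
      moreover have "(real n - 1) * q + x * q + (real n - real k) * q = q * (2 * real n - real k - 1) / 2"
        by (simp add: x_def field_simps)
      ultimately show ?thesis unfolding distrib_right mult.commute[of q e1] by linarith
    qed
    have "\<tau> / 8 * (c6 / c7) powr q * R powr (p * ?E) * N * (c7 * R powr e1 * R powr x) powr q
       \<le> \<tau> / 8 * (c6 / c7) powr q * R powr (p * ?E) * (4 / (\<tau> * R) * G) * (c7 * R powr e1 * R powr x) powr q"
      using pos by (intro mult_right_mono mult_left_mono h2) auto
    also have "\<dots> = G / 2 * (c6 powr q * (R powr (p * ?E) * (R powr e1 * R powr x) powr q / R))"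
      using pos R0 by (simp add: powr_mult powr_divide)
    also have "R powr (p * ?E) * (R powr e1 * R powr x) powr q / R = R powr (p * ?E + (e1 + x) * q - 1)"
      using R0 by (simp add: powr_add[symmetric] powr_powr powr_diff)
    also have "G / 2 * (c6 powr q * R powr (p * ?E + (e1 + x) * q - 1))
        \<le> G / 2 * (c6 powr q * R powr (- (real n - real k) * q))"
      using R G exps by (intro mult_left_mono powr_mono) auto
    also have "\<dots> \<le> G / 2 * g powr q" using G by (intro mult_left_mono g) auto
    finally show "\<tau> / 8 * (c6 / c7) powr q * R powr (p * ?E) * N * (c7 * R powr e1 * R powr x) powr q
        \<le> G / 2 * g powr q" .
  qed (use pos N p in auto)
  finally show ?thesis by (simp add: q_def)
qed

definition focus_const :: "nat \<Rightarrow> nat \<Rightarrow> real \<Rightarrow> real" where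
  "focus_const n k E = (exp (- 8) / (16 * pi * real n)) ^ n / (8 * 4 ^ k * (2 * focus_width n E) ^ (n - k))"

context focusing_system
begin

text \<open>Along \<open>J\<close> the number of translates and the sides of \<open>Y\<close> cancel
  up to constants, as does the duration. Each direction off \<open>J\<close> contributes
  \<open>r\<close> from the mass of the amplitude and \<open>1 / sqrt R\<close> from the side of
  \<open>Y\<close>, together \<open>1 / R\<close>.\<close>

lemma focusing_ratio:
  assumes G: "focus_tau CARD('n) * R * (real (card I) * \<mu>) / 2 \<le> G"
  shows "focus_const CARD('n) (card J) E / R ^ (CARD('n) - card J) \<le> G / (2 * measure lborel Y)"
proof -
  let ?n = "CARD('n)"
  let ?k = "card J"
  let ?w = "focus_width ?n E"
  let ?c = "(exp (- 8) / (16 * pi * real ?n)) ^ ?n"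
  have rR: "r / sqrt R = 1 / R"
    unfolding inverse_r[symmetric] using R_r r R_pos by (simp add: field_simps power2_eq_square)
  have c0: "0 \<le> ?c" by simp
  have "focus_tau ?n * R * ((focus_rho ?n * R) ^ ?k * (?c * r ^ (?n - ?k))) / 2
      \<le> focus_tau ?n * R * (real (card I) * \<mu>) / 2"
    using tau R_pos rho r c0 I_facts(3) mu_lower by (intro divide_right_mono mult_left_mono mult_mono) auto
  also have "\<dots> \<le> G" by (rule G)
  finally have g: "focus_tau ?n * R * ((focus_rho ?n * R) ^ ?k * (?c * r ^ (?n - ?k))) / 2 \<le> G" .
  have Yp: "0 < measure lborel Y"
    unfolding measure_Y using rho R_pos width0 tau by (intro mult_pos_pos zero_less_power) auto
  have "focus_const ?n ?k E / R ^ (?n - ?k)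
      = ?c * (r / sqrt R) ^ (?n - ?k) / (8 * 4 ^ ?k * (2 * ?w) ^ (?n - ?k))"
    unfolding rR by (simp add: focus_const_def power_divide)
  also have "\<dots> = (focus_tau ?n * R * ((focus_rho ?n * R) ^ ?k * (?c * r ^ (?n - ?k))) / 2) / (2
      * measure lborel Y)"
  proof -
    have y: "measure lborel Y = 4 ^ ?k * (focus_rho ?n * R) ^ ?k * ((2 * ?w) ^ (?n - ?k) * sqrt R ^ (?n - ?k))
        * (2 * (focus_tau ?n * R))"
    proof -
      have "2 * (2 * focus_rho ?n * R) = 4 * (focus_rho ?n * R)" "2 * (?w * sqrt R) = (2 * ?w) * sqrt R"
        by simp_all
      then show ?thesis unfolding measure_Y by (simp only: power_mult_distrib)
    qed
    have alg: "c * (a / b) / (8 * f * h) = (t * (u * (c * a)) / 2) / (2 * (f * u * (h * b) * (2 * t)))"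
      if "u \<noteq> 0" "t \<noteq> 0" for a b c f h t u :: real
      using that by simp
    show ?thesis unfolding y power_divide
      by (rule alg) (use rho tau R_pos in auto)
  qed
  also have "\<dots> \<le> G / (2 * measure lborel Y)"
    using Yp by (intro divide_right_mono g) auto
  finally show ?thesis .
qed

text \<open>The function is obtained before \<open>p\<close>, \<open>e\<close>, \<epsilon> and
  \<open>M\<close> are quantified, as the statement asks for one function at each \<open>R\<close>
  for all \<open>p\<close>. This is possible because the sign pattern was selected without reference
  to them.\<close>

theorem focusing_example:
  assumes k: "2 * card J \<le> CARD('n) + 1" and d: "\<delta> \<le> 1 / 2" and bigR: "3 + 2 * real CARD('n) \<le> R"
  obtains f where "schwartz f" "f \<noteq> (\<lambda>x. 0)" "closure {\<xi>. fourier f \<xi> \<noteq> 0} \<subseteq> annulus"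
    "\<And>p e \<epsilon> M. 2 < p \<Longrightarrow> 0 < \<epsilon> \<Longrightarrow> \<epsilon> \<le> 1 / 2 \<Longrightarrow> 3 * real CARD('n) \<le> \<epsilon> * real M \<Longrightarrow>
      (p / 2 - 1) * (2 * real CARD('n) - real (card J) - 1) / 2 + p * e + (p / 2 - 1)
        * (\<epsilon> * (real CARD('n) + 2)) \<le> 1 \<Longrightarrow>
      final_const (focus_tau CARD('n)) (focus_const CARD('n) (card J) E) (density_const CARD('n) (1 + K
        + A) \<epsilon> (C' M)) p *
        R powr ((real CARD('n) - 1) * (1 / 2 - 1 / p) + e) * Lp_norm 2 UNIV f powr (2 / p)
          * wp_density A \<delta> S R f powr (1 - 2 / p)
      \<le> Lp_norm p (ball 0 R) (half_wave f)"
proof -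
  let ?n = "CARD('n)"
  let ?k = "card J"
  obtain A' where A': "focus_tau ?n * R * (real (card I) * \<mu>) / 2 \<le> energy A'"
    "mass lborel (lattice_sum I A' (wave J j0 r 0)) \<le> 4 / (focus_tau ?n * R) * energy A'"
    "cosh_energy J D (lat_ball J (R\<^sup>2)) I piece A'
        \<le> 8 * (9 * R\<^sup>2) ^ ?n * (measure lborel Y * real (card I) / (focus_tau ?n * R * \<mu>))"
    by (rule exists_focusing_signs)
  define h where "h = (\<lambda>\<xi>. trig I A' \<xi> * amp J j0 r \<xi>)"
  define f where "f = inv_fourier h"
  have h: "h \<in> test" unfolding h_def by (intro test_mult trig_elem amp_test r j0)
  have ff: "fourier f = h" unfolding f_def by (rule fourier_inv_fourier[OF h])
  have hw: "half_wave f = (\<lambda>p. lattice_sum I A' (wave J j0 r (snd p)) (fst p))"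
    using half_wave_eq[OF r j0 ff[unfolded h_def]] by (simp add: fun_eq_iff split_paired_all)
  have e: "energy A' = mass (restr Y) (half_wave f)" unfolding energy_def hw ..
  have wm: "half_wave f \<in> borel_measurable borel"
    unfolding hw lattice_sum_def by (intro borel_measurable_sum borel_measurable_times measurable_wave) simp
  have wb: "cmod (half_wave f p) \<le> real (card I)" for p
    unfolding hw by (rule norm_lattice_sum_le[OF norm_wave_le_1[OF r j0]])
  have G: "0 < energy A'"
  proof -
    have "0 < focus_tau ?n * R * (real (card I) * \<mu>) / 2"
      using tau R_pos card_I_pos mu_pos by (intro divide_pos_pos mult_pos_pos) auto
    then show ?thesis using A'(1) by linarith
  qed
  have f_lat: "f = lattice_sum I A' (wave J j0 r 0)"
  proof -
    have "integrable lborel (amp J j0 r)" by (rule test_integrable[OF amp_test[OF r j0]])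
    moreover have "wave J j0 r 0 = inv_fourier (amp J j0 r)"
      by (simp add: wave_def wave_amp_def[abs_def])
    ultimately show ?thesis unfolding f_def h_def by (simp add: inv_fourier_trig)
  qed
  have k1n: "?k \<le> ?n" using card_mono[of UNIV J] by simp
  have k1: "1 \<le> ?k"
  proof -
    have "0 < ?k" using j0 by (auto simp: card_gt_0_iff)
    then show ?thesis by simp
  qed
  have X: "R ^ ?k * r ^ (?k - 1) / R ^ ?n = R powr ((real ?k + 1) / 2 - real ?n)"
  proof -
    have "r ^ (?k - 1) = R powr (- (real ?k - 1) / 2)"
    proof -
      have "r ^ (?k - 1) = R powr ((-1/2) * real (?k - 1))"
        unfolding r_def using R_pos by (subst powr_power) auto
      also have "(-1/2) * real (?k - 1) = - (real ?k - 1) / 2"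
        using k1 by (simp add: of_nat_diff field_simps)
      finally show ?thesis .
    qed
    then have "R ^ ?k * r ^ (?k - 1) / R ^ ?n
        = R powr (real ?k) * R powr (- (real ?k - 1) / 2) / R powr (real ?n)"
      using R_pos by (simp add: powr_realpow)
    also have "\<dots> = R powr (real ?k + (- (real ?k - 1) / 2) - real ?n)"
      by (simp only: powr_add powr_diff)
    also have "real ?k + (- (real ?k - 1) / 2) - real ?n = (real ?k + 1) / 2 - real ?n"
      by (simp add: field_simps)
    finally show ?thesis .
  qed
  show thesis
  proof (rule that)
    show "schwartz f" unfolding f_def by (rule schwartz_inv_fourier[OF h])
    \<comment> \<open>Otherwise the half wave, and with it the positive energy in the box, would
      vanish.\<close>
    show "f \<noteq> (\<lambda>x. 0)"
    proof
      assume "f = (\<lambda>x. 0)"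
      then have "fourier f = (\<lambda>\<xi>. 0)" by (simp add: fourier_def fun_eq_iff)
      then have "half_wave f = (\<lambda>p. 0)" by (simp add: half_wave_def fun_eq_iff)
      then have "energy A' = 0" unfolding e by simp
      then show False using G by simp
    qed
    have "{\<xi>. fourier f \<xi> \<noteq> 0} \<subseteq> amp_box J j0 r 1" unfolding ff h_def using amp_support by auto
    moreover have "closed (amp_box J j0 r 1)" unfolding amp_box_def by (rule closed_cbox)
    ultimately have "closure {\<xi>. fourier f \<xi> \<noteq> 0} \<subseteq> amp_box J j0 r 1" by (rule closure_minimal)
    then show "closure {\<xi>. fourier f \<xi> \<noteq> 0} \<subseteq> annulus" using amp_box_subset_annulus[OF r] by blast
  next
    fix p e' \<epsilon> :: real and M :: nat
    assume p: "2 < p" and eps: "0 < \<epsilon>" "\<epsilon> \<le> 1 / 2" and M: "3 * real ?n \<le> \<epsilon> * real M"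
      and ex: "(p / 2 - 1) * (2 * real ?n - real ?k - 1) / 2 + p * e' + (p / 2 - 1) * (\<epsilon> * (real ?n + 2)) \<le> 1"
    define c7 where "c7 = density_const ?n (1 + K + A) \<epsilon> (C' M)"
    have c7: "0 < c7" unfolding c7_def using A K eps by (intro density_const_pos) (auto simp: Suc_leI)
    define W2 where "W2 = c7 * R powr (\<epsilon> * (real ?n + 2)) * R powr ((real ?k + 1) / 2 - real ?n)"
    have W2: "0 \<le> W2" unfolding W2_def using c7 by simp
    have ld: "0 \<le> local_density A \<delta> S R f s \<omega> a \<and> local_density A \<delta> S R f s \<omega> a \<le> sqrt W2"
      if "s \<in> {r..1}" "\<omega> \<in> dirs S s" for s \<omega> a
    proof
      show "0 \<le> local_density A \<delta> S R f s \<omega> a"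
        unfolding local_density_def Let_def by (intro real_sqrt_ge_zero mult_nonneg_nonneg sum_nonneg) auto
      have "(local_density A \<delta> S R f s \<omega> a)\<^sup>2 \<le> W2"
        unfolding W2_def c7_def X[symmetric]
        using that by (intro local_density_power_bound[OF k ff[unfolded h_def] A'(3) _ _ _ d bigR eps M]) auto
      then show "local_density A \<delta> S R f s \<omega> a \<le> sqrt W2" by (rule real_le_rsqrt)
    qed
    have W: "0 \<le> wp_density A \<delta> S R f \<and> wp_density A \<delta> S R f \<le> sqrt W2"
      unfolding wp_density_def r_def[symmetric]
    proof (rule SUP_bounds)
      show "{r..1} \<noteq> {}" using r by simp
      fix s assume s: "s \<in> {r..1}"
      show "0 \<le> (SUP \<omega>\<in>dirs S s. SUP a. local_density A \<delta> S R f s \<omega> a)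
          \<and> (SUP \<omega>\<in>dirs S s. SUP a. local_density A \<delta> S R f s \<omega> a) \<le> sqrt W2"
      proof (rule SUP_bounds)
        have "cap_cover A N s (dirs S s)" using sys s unfolding is_wp_system_def r_def by auto
        moreover have "axis j0 1 \<in> (sphere 0 1 :: (real ^ 'n) set)" by (simp add: norm_axis_1)
        ultimately show "dirs S s \<noteq> {}" unfolding cap_cover_def by blast
        fix \<omega> assume w: "\<omega> \<in> dirs S s"
        show "0 \<le> (SUP a. local_density A \<delta> S R f s \<omega> a) \<and> (SUP a. local_density A \<delta> S R f s \<omega> a) \<le> sqrt W2"
          by (rule SUP_bounds) (use ld[OF s w] in auto)
      qed
    qed
    have "(wp_density A \<delta> S R f)\<^sup>2 \<le> (sqrt W2)\<^sup>2" using W by (intro power_mono) auto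
    then have Wsq: "(wp_density A \<delta> S R f)\<^sup>2 \<le> W2" using W2 by simp
    have Yp: "0 < measure lborel Y"
      unfolding measure_Y using rho R_pos width0 tau by (intro mult_pos_pos zero_less_power) auto
    have fc: "0 < focus_const ?n ?k E"
      unfolding focus_const_def using width0 n_pos by (intro divide_pos_pos mult_pos_pos zero_less_power) auto
    have "final_const (focus_tau ?n) (focus_const ?n ?k E) c7 p * R powr ((real ?n - 1) * (1 / 2 - 1 / p)
        + e') *
        sqrt (mass lborel f) powr (2 / p) * wp_density A \<delta> S R f powr (1 - 2 / p)
      \<le> (energy A' / 2 * (energy A' / (2 * measure lborel Y)) powr (p / 2 - 1)) powr (1 / p)"
      using A'(2) W
      by (intro exponent_bookkeeping[OF R p k1n G _ _ tau(1) fc c7 focusing_ratio[OF A'(1)] _ Wsq[unfolded W2_def] ex])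
         (auto simp: f_lat)
    also have "\<dots> \<le> Lp_norm p (ball 0 R) (half_wave f)"
      unfolding e using G Yp
      by (intro Lp_norm_lower[OF Y_sets Y_subset_ball _ _ wm wb p]) (auto simp: e)
    finally show "final_const (focus_tau ?n) (focus_const ?n ?k E) (density_const ?n (1 + K + A) \<epsilon> (C' M)) p *
        R powr ((real ?n - 1) * (1 / 2 - 1 / p) + e') * Lp_norm 2 UNIV f powr (2 / p)
          * wp_density A \<delta> S R f powr (1 - 2 / p)
      \<le> Lp_norm p (ball 0 R) (half_wave f)"
      by (simp add: Lp_norm_2 c7_def)
  qed
qed

end

theorem theorem2p4:
  assumes "CARD('n::finite) \<ge> 3"
  shows "\<exists>(c :: real \<Rightarrow> real) \<delta>\<^sub>0. 0 < \<delta>\<^sub>0 \<and>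
    (\<forall>p. 2 < p \<and> p < p_plus CARD('n) \<longrightarrow> 0 < c p) \<and>
    (\<forall>A \<delta> (S :: real \<Rightarrow> 'n wp_system). wp_family A S \<and> 0 < \<delta> \<and> \<delta> < \<delta>\<^sub>0 \<longrightarrow>
      (\<exists>R\<^sub>0\<ge>1. \<exists>f :: real \<Rightarrow> real ^ 'n \<Rightarrow> complex.
        (\<forall>R\<ge>R\<^sub>0. schwartz (f R) \<and> f R \<noteq> (\<lambda>x. 0) \<and>
           closure {\<xi>. fourier (f R) \<xi> \<noteq> 0} \<subseteq> annulus) \<and>
        (\<forall>p. 2 < p \<and> p < p_plus CARD('n) \<longrightarrow>
          (\<exists>C>0. \<forall>R\<ge>R\<^sub>0.
            Lp_norm p (ball 0 R) (half_wave (f R)) \<ge>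
              C * R powr ((real CARD('n) - 1) * (1 / 2 - 1 / p) + c p) *
              Lp_norm 2 UNIV (f R) powr (2 / p) *
              wp_density A \<delta> (S R) R (f R) powr (1 - 2 / p)))))"
proof -
  let ?n = "CARD('n)"
  define k where "k = (?n + 1) div 2"
  have k: "1 \<le> k" "k \<le> ?n" "2 * k \<le> ?n + 1" "?n \<le> 2 * k" using assms by (auto simp: k_def)
  obtain J :: "'n set" where J: "card J = k"
    using obtain_subset_with_card_n[of k "UNIV :: 'n set"] k(2) by auto
  then obtain j0 where j0: "j0 \<in> J" using k(1) by fastforce
  obtain E where E: "0 \<le> E" "\<And>J r (j :: 'n) \<xi>. 0 < r
      \<Longrightarrow> cmod (frechet_derivative (amp J j0 r) (at \<xi>) (axis j 1)) \<le> E / (if j \<in> J then 1 else r)"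
    using amp_derivative_bound[of j0] by blast
  \<comment> \<open>What is left of the exponent 1, the time factor in the mass comparison, after
    the loss that grows with \<open>p\<close>.\<close>
  define gap where "gap p = 1 - (p / 2 - 1) * (2 * real ?n - real k - 1) / 2" for p
  have gap: "0 < gap p" if "2 < p" "p < p_plus ?n" for p
  proof -
    have n3: "3 \<le> real ?n" using assms by simp
    have "(p / 2 - 1) * (2 * real ?n - real k - 1) / 2 \<le> (p / 2 - 1) * (3 * real ?n - 2) / 4"
    proof -
      \<comment> \<open>This uses \<open>n \<le> 2 * k\<close>, with equality for even
        \<open>n\<close>; the threshold \<open>p_plus n\<close> is where the bound obtained from it
        reaches 1.\<close>
      have "2 * (2 * real ?n - real k - 1) \<le> 3 * real ?n - 2"
        using of_nat_mono[OF k(4), where 'a=real] by simp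
      then have "(p / 2 - 1) * (2 * (2 * real ?n - real k - 1)) \<le> (p / 2 - 1) * (3 * real ?n - 2)"
        using that by (intro mult_left_mono) auto
      then show ?thesis unfolding mult.left_commute[of _ 2] by linarith
    qed
    also have "(p / 2 - 1) * (3 * real ?n - 2) / 4 < 1"
      using that n3 by (simp add: p_plus_def field_simps)
    finally show ?thesis by (simp add: gap_def)
  qed
  \<comment> \<open>Half of the gap becomes the gain, and the other half pays for the powers
    \<open>R powr \<epsilon>\<close> in the density. The minimum with 1/2 keeps the dilation of
    tiles below \<open>sqrt R\<close>, and \<open>M\<close> is the decay order that this \<epsilon>
    demands.\<close>
  define c where "c p = gap p / (2 * p)" for p
  define eps where "eps p = min (1 / 2) (gap p / (2 * (p / 2 - 1) * (real ?n + 2)))" for p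
  define M where "M p = nat \<lceil>3 * real ?n / eps p\<rceil>" for p
  have cp: "0 < c p" and eps: "0 < eps p" "eps p \<le> 1 / 2" and M: "3 * real ?n \<le> eps p * real (M p)"
    and ex: "(p / 2 - 1) * (2 * real ?n - real k - 1) / 2 + p * c p + (p / 2 - 1) * (eps p * (real ?n + 2)) \<le> 1"
    if p: "2 < p" "p < p_plus ?n" for p
  proof -
    show "0 < c p" using gap[OF p] p by (simp add: c_def)
    show e: "0 < eps p" using gap[OF p] p by (simp add: eps_def)
    show "eps p \<le> 1 / 2" unfolding eps_def by (rule min.cobounded1)
    have "3 * real ?n / eps p \<le> real (M p)" unfolding M_def by (rule real_nat_ceiling_ge)
    then show "3 * real ?n \<le> eps p * real (M p)" using e by (simp add: pos_divide_le_eq mult.commute)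
    have pp: "0 < 2 * (p / 2 - 1) * (real ?n + 2)" using p by (intro mult_pos_pos) auto
    have "eps p \<le> gap p / (2 * (p / 2 - 1) * (real ?n + 2))" by (simp add: eps_def)
    then have "eps p * (2 * (p / 2 - 1) * (real ?n + 2)) \<le> gap p"
      by (simp only: pos_le_divide_eq[OF pp])
    moreover have "eps p * (2 * (p / 2 - 1) * (real ?n + 2)) = 2 * ((p / 2 - 1) * (eps p * (real ?n + 2)))"
      by (simp only: mult_ac)
    ultimately have "(p / 2 - 1) * (eps p * (real ?n + 2)) \<le> gap p / 2" by linarith
    moreover have "p * c p = gap p / 2" using p by (simp add: c_def)
    ultimately show "(p / 2 - 1) * (2 * real ?n - real k - 1) / 2 + p * c p + (p / 2 - 1)
        * (eps p * (real ?n + 2)) \<le> 1"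
      by (simp add: gap_def)
  qed
  \<comment> \<open>A sum of nonnegative thresholds, so that each condition follows separately. It
    depends on the dimension and \<open>E\<close> only, hence works for every
    \<open>p\<close>.\<close>
  define R0 where "R0 = 3 + 2 * real ?n + 2 * E / (focus_rho ?n * focus_eta ?n) + 1 / focus_rho ?n
      + (4 * real ?n * focus_width ?n E)\<^sup>2"
  have rho: "0 < focus_rho ?n" by (simp add: focus_rho_def)
  have eta: "0 < focus_eta ?n" by (simp add: focus_eta_def)
  have nn: "0 \<le> 2 * E / (focus_rho ?n * focus_eta ?n)" "0 \<le> 1 / focus_rho ?n" "0
      \<le> (4 * real ?n * focus_width ?n E)\<^sup>2"
    using E(1) rho eta by auto
  have R0: "1 \<le> R0" unfolding R0_def using nn by linarith
  show ?thesis
  proof (rule exI[of _ c], rule exI[of _ "1/2"], intro conjI allI impI)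
    fix p assume "2 < p \<and> p < p_plus ?n"
    then show "0 < c p" using cp by blast
  next
    fix A \<delta> :: real and S :: "real \<Rightarrow> 'n wp_system"
    assume as: "wp_family A S \<and> 0 < \<delta> \<and> \<delta> < 1 / 2"
    then obtain N K C C' where A: "0 < A" and K: "0 < K" and sys: "\<And>R. 1 \<le> R \<Longrightarrow> is_wp_system A N K C C' R (S R)"
      unfolding wp_family_def by blast
    define const where "const p = final_const (focus_tau ?n) (focus_const ?n k E) (density_const ?n (1 + K
        + A) (eps p) (C' (M p))) p" for p
    let ?good = "\<lambda>R f. schwartz f \<and> f \<noteq> (\<lambda>x. 0) \<and> closure {\<xi>. fourier f \<xi> \<noteq> 0} \<subseteq> annulus \<and>
      (\<forall>p. 2 < p \<and> p < p_plus ?n \<longrightarrow>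
         const p * R powr ((real ?n - 1) * (1 / 2 - 1 / p) + c p) * Lp_norm 2 UNIV f powr (2 / p) *
           wp_density A \<delta> (S R) R f powr (1 - 2 / p) \<le> Lp_norm p (ball 0 R) (half_wave f))"
    have "\<exists>f. ?good R f" if Rbig: "R0 \<le> R" for R
    proof -
      have R1: "1 \<le> R" using Rbig R0 by linarith
      interpret focusing_system "S R" A K R N C C' J j0 E
      proof
        show "is_wp_system A N K C C' R (S R)" by (rule sys[OF R1])
        show "cmod (frechet_derivative (amp J j0 (R powr (-1/2))) (at \<xi>) (axis j 1))
            \<le> E / (if j \<in> J then 1 else R powr (-1/2))" for j \<xi>
          using R1 by (intro E(2)) simp
        have "2 * E / (focus_rho ?n * focus_eta ?n) \<le> R" using Rbig nn unfolding R0_def by linarith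
        then show "2 * E \<le> focus_rho ?n * focus_eta ?n * R"
          using rho eta by (simp add: pos_divide_le_eq mult.commute)
        have "1 / focus_rho ?n \<le> R" using Rbig nn unfolding R0_def by linarith
        then show "1 \<le> focus_rho ?n * R" using rho by (simp add: pos_divide_le_eq mult.commute)
        have "(4 * real ?n * focus_width ?n E)\<^sup>2 \<le> R" using Rbig nn unfolding R0_def by linarith
        then show "4 * real ?n * focus_width ?n E \<le> sqrt R" by (rule real_le_rsqrt)
      qed (use A K R1 j0 E(1) in auto)
      have k': "2 * card J \<le> ?n + 1" using k(3) J by simp
      have d: "\<delta> \<le> 1 / 2" using as by simp
      have big: "3 + 2 * real ?n \<le> R" using Rbig nn unfolding R0_def by linarith
      show ?thesis
      proof (rule focusing_example[OF k' d big], intro exI conjI allI impI)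
        fix f p assume p: "2 < p \<and> p < p_plus ?n"
        assume main: "\<And>p e \<epsilon> M. 2 < p \<Longrightarrow> 0 < \<epsilon> \<Longrightarrow> \<epsilon> \<le> 1 / 2 \<Longrightarrow> 3 * real ?n \<le> \<epsilon> * real M \<Longrightarrow>
          (p / 2 - 1) * (2 * real ?n - real (card J) - 1) / 2 + p * e + (p / 2 - 1) * (\<epsilon> * (real ?n + 2)) \<le> 1 \<Longrightarrow>
          final_const (focus_tau ?n) (focus_const ?n (card J) E) (density_const ?n (1 + K + A) \<epsilon> (C' M)) p *
            R powr ((real ?n - 1) * (1 / 2 - 1 / p) + e) * Lp_norm 2 UNIV f powr (2 / p)
              * wp_density A \<delta> (S R) R f powr (1 - 2 / p)
          \<le> Lp_norm p (ball 0 R) (half_wave f)"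
        show "const p * R powr ((real ?n - 1) * (1 / 2 - 1 / p) + c p) * Lp_norm 2 UNIV f powr (2 / p) *
           wp_density A \<delta> (S R) R f powr (1 - 2 / p) \<le> Lp_norm p (ball 0 R) (half_wave f)"
          unfolding const_def J[symmetric]
          using p by (intro main eps M ex[unfolded J[symmetric]]) auto
      qed
    qed
    then have "\<forall>R. \<exists>f. R0 \<le> R \<longrightarrow> ?good R f" by blast
    then have "\<exists>f. \<forall>R. R0 \<le> R \<longrightarrow> ?good R (f R)" by (rule choice)
    then obtain f where f: "\<And>R. R0 \<le> R \<Longrightarrow> ?good R (f R)" by blast
    have cpos: "0 < const p" if p: "2 < p" "p < p_plus ?n" for p
    proof -
      have "0 < focus_tau ?n" using rho eta by (simp add: focus_tau_def)
      moreover have "0 < focus_const ?n k E"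
      proof -
        have "0 < focus_width ?n E" using \<open>0 < focus_tau ?n\<close> E(1) eta by (simp add: focus_width_def)
        then show ?thesis by (simp add: focus_const_def)
      qed
      moreover have "0 < density_const ?n (1 + K + A) (eps p) (C' (M p))"
        using A K eps[OF p] by (intro density_const_pos) (auto simp: Suc_leI)
      ultimately show ?thesis by (simp add: const_def final_const_def)
    qed
    show "\<exists>R\<^sub>0\<ge>1. \<exists>f. (\<forall>R\<ge>R\<^sub>0. schwartz (f R) \<and> f R \<noteq> (\<lambda>x. 0) \<and> closure {\<xi>. fourier (f R) \<xi> \<noteq> 0} \<subseteq> annulus) \<and>
        (\<forall>p. 2 < p \<and> p < p_plus ?n \<longrightarrow> (\<exists>C>0. \<forall>R\<ge>R\<^sub>0. Lp_norm p (ball 0 R) (half_wave (f R)) \<ge>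
              C * R powr ((real ?n - 1) * (1 / 2 - 1 / p) + c p) * Lp_norm 2 UNIV (f R) powr (2 / p) *
              wp_density A \<delta> (S R) R (f R) powr (1 - 2 / p)))"
    proof (rule exI[of _ R0], intro conjI R0, rule exI[of _ f], intro conjI allI impI)
      fix p assume p: "2 < p \<and> p < p_plus ?n"
      show "\<exists>C>0. \<forall>R\<ge>R0. Lp_norm p (ball 0 R) (half_wave (f R)) \<ge>
              C * R powr ((real ?n - 1) * (1 / 2 - 1 / p) + c p) * Lp_norm 2 UNIV (f R) powr (2 / p) *
              wp_density A \<delta> (S R) R (f R) powr (1 - 2 / p)"
        using f p cpos by (intro exI[of _ "const p"]) blast
    qed (use f in blast)+
  qed simp
qed

end
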